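(* Let $X$ be a separable operator space generating a TRO $T$. If $X$ is rectangular hyperrigid (in $T$), then every irreducible representation of $T$ is a boundary representation for $X$.
   Context: Hilbert spaces are complex and nonzero. A ternary ring of operators (TRO) is a norm closed subspace $T\subset B(H_0,K_0)$ with $xy^*z\in T$ for all $x,y,z\in T$. A triple morphism is a linear map $\theta$ between TROs with $\theta(xy^*z)=\theta(x)\theta(y)^*\theta(z)$; a representation of $T$ is a triple morphism $\theta:T\to B(H,K)$ for Hilbert spaces $H,K$; it is faithful if injective (equivalently completely isometric). It is irreducible if, whenever $p\in B(H)$, $q\in B(K)$ are projections with $q\theta(t)=\theta(t)p$ for all $t\in T$, either $p=0,q=0$ or $p=1,q=1$. A linear map $\phi$ into $B(H,K)$ is nondegenerate if, whenever $p\in B(H)$, $q\in B(K)$ are projections with $q\phi(x)=\phi(x)p=0$ for all $x$ in the domain, one has $p=0$ and $q=0$. A rectangular operator state on an operator space is a nondegenerate completely contractive linear map into some $B(H,K)$ with completely bounded norm $1$. If $X$ generates $T$, a rectangular operator state $\phi$ on $X$ has the unique extension property if any rectangular operator state of $T$ whose restriction to $X$ is $\phi$ is automatically a triple morphism. It is a boundary representation for $X$ if it has the unique extension property and its unique extension to $T$ is irreducible. A representation $\pi$ of $T$ is called a boundary representation for $X$ if $\pi|_X$ is a boundary representation for $X$. A generating set $G$ of a TRO $T$ (finite or countable, or a generating separable operator space $G=X$) is rectangular hyperrigid if for every faithful nondegenerate representation $\pi:T\to B(H,K)$, identifying $T$ with $\pi(T)\subset B(H,K)$, and every sequence of completely contractive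 maps $\phi_n:B(H,K)\to B(H,K)$ with $\|\phi_n\|_{cb}=1$, $n=1,2,\dots$: if $\lim_n\|\phi_n(g)-g\|=0$ for all $g\in G$, then $\lim_n\|\phi_n(t)-t\|=0$ for all $t\in T$. *)

theory Defs
  imports Complex_Main "HOL-Library.FuncSet" "HOL-Library.Countable_Set"
    "HOL-Library.Extended_Real" "HOL-Algebra.Module"
begin

section \<open>Complex Hilbert spaces\<close>

definition complex_field :: "complex ring"
  where "complex_field = \<lparr>carrier = UNIV, monoid.mult = (*), one = 1, zero = 0, add = (+)\<rparr>"

text \<open>
  Hilbert spaces are explicit carriers rather than types, because rectangular hyperrigidity
  quantifies over Hilbert spaces inside a hypothesis. The fields \<open>mult\<close> and \<open>one\<close> that a
  \<^typ>\<open>('r, 'a) module\<close> inherits from the ring record are irrelevant.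
\<close>

record 'a inner_space = "(complex, 'a) module" +
  cinner :: "'a \<Rightarrow> 'a \<Rightarrow> complex"

definition hnorm :: "'a inner_space \<Rightarrow> 'a \<Rightarrow> real"
  where "hnorm H x = sqrt (Re (cinner H x x))"

text \<open>The inner product is linear in its first argument. Hilbert spaces are nonzero throughout.\<close>

locale complex_hilbert_space = Module.module complex_field H
  for H :: "'a inner_space" (structure) +
  assumes cinner_add_left:
      "\<lbrakk>x \<in> carrier H; y \<in> carrier H; z \<in> carrier H\<rbrakk>
        \<Longrightarrow> cinner H (x \<oplus> y) z = cinner H x z + cinner H y z"
    and cinner_smult_left:
      "\<lbrakk>x \<in> carrier H; y \<in> carrier H\<rbrakk> \<Longrightarrow> cinner H (c \<odot> x) y = c * cinner H x y"
    and cinner_commute: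
      "\<lbrakk>x \<in> carrier H; y \<in> carrier H\<rbrakk> \<Longrightarrow> cinner H x y = cnj (cinner H y x)"
    and cinner_pos:
      "\<lbrakk>x \<in> carrier H; x \<noteq> \<zero>\<rbrakk> \<Longrightarrow> Re (cinner H x x) > 0"
    and complete:
      "\<lbrakk>\<And>n::nat. s n \<in> carrier H;
        \<forall>e>0. \<exists>N. \<forall>m\<ge>N. \<forall>n\<ge>N. hnorm H (s m \<ominus> s n) < e\<rbrakk>
        \<Longrightarrow> \<exists>x\<in>carrier H. (\<lambda>n. hnorm H (s n \<ominus> x)) \<longlonglongrightarrow> 0"
    and nonzero: "\<exists>x\<in>carrier H. x \<noteq> \<zero>"


section \<open>Bounded operators\<close>

definition clinear_on ::
    "'x set \<Rightarrow> (complex, 'x, 'm) module_scheme \<Rightarrow> (complex, 'y, 'n) module_scheme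
      \<Rightarrow> ('x \<Rightarrow> 'y) \<Rightarrow> bool"
  where "clinear_on X M N f \<longleftrightarrow>
    f \<in> X \<rightarrow> carrier N \<and>
    (\<forall>x\<in>X. \<forall>y\<in>X. f (x \<oplus>\<^bsub>M\<^esub> y) = f x \<oplus>\<^bsub>N\<^esub> f y) \<and>
    (\<forall>c. \<forall>x\<in>X. f (c \<odot>\<^bsub>M\<^esub> x) = c \<odot>\<^bsub>N\<^esub> f x)"

text \<open>
  The space \<open>B(H, K)\<close>. Operators are extensional functions on \<^term>\<open>carrier H\<close>, so that equality
  of operators is equality of functions.
\<close>

definition bop :: "'a inner_space \<Rightarrow> 'b inner_space \<Rightarrow> (complex, 'a \<Rightarrow> 'b) module"
  where "bop H K =
    \<lparr>carrier = {a \<in> extensional (carrier H). clinear_on (carrier H) H K a \<and>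
                  (\<exists>C. \<forall>x\<in>carrier H. hnorm K (a x) \<le> C * hnorm H x)},
     monoid.mult = undefined,
     one = undefined,
     zero = (\<lambda>x\<in>carrier H. \<zero>\<^bsub>K\<^esub>),
     add = (\<lambda>a b. \<lambda>x\<in>carrier H. a x \<oplus>\<^bsub>K\<^esub> b x),
     smult = (\<lambda>c a. \<lambda>x\<in>carrier H. c \<odot>\<^bsub>K\<^esub> a x)\<rparr>"

definition opnorm :: "'a inner_space \<Rightarrow> 'b inner_space \<Rightarrow> ('a \<Rightarrow> 'b) \<Rightarrow> real"
  where "opnorm H K a = (SUP x\<in>{x \<in> carrier H. hnorm H x \<le> 1}. hnorm K (a x))"

definition adj :: "'a inner_space \<Rightarrow> 'b inner_space \<Rightarrow> ('a \<Rightarrow> 'b) \<Rightarrow> ('b \<Rightarrow> 'a)"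
  where "adj H K a = (THE b. b \<in> carrier (bop K H) \<and>
    (\<forall>x\<in>carrier H. \<forall>y\<in>carrier K. cinner K (a x) y = cinner H x (b y)))"

definition idop :: "'a inner_space \<Rightarrow> 'a \<Rightarrow> 'a"
  where "idop H = (\<lambda>x\<in>carrier H. x)"

definition projections :: "'a inner_space \<Rightarrow> ('a \<Rightarrow> 'a) set"
  where "projections H =
    {p \<in> carrier (bop H H). compose (carrier H) p p = p \<and> adj H H p = p}"

text \<open>The ternary product \<open>x y\<^sup>* z\<close> in \<open>B(H, K)\<close>.\<close>

definition tprod ::
    "'a inner_space \<Rightarrow> 'b inner_space \<Rightarrow> ('a \<Rightarrow> 'b) \<Rightarrow> ('a \<Rightarrow> 'b) \<Rightarrow> ('a \<Rightarrow> 'b) \<Rightarrow> ('a \<Rightarrow> 'b)"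
  where "tprod H K x y z = compose (carrier H) x (compose (carrier H) (adj H K y) z)"


section \<open>Operator spaces and ternary rings of operators\<close>

text \<open>Norm closedness is not required of an operator space.\<close>

definition operator_space :: "'a inner_space \<Rightarrow> 'b inner_space \<Rightarrow> ('a \<Rightarrow> 'b) set \<Rightarrow> bool"
  where "operator_space H K X \<longleftrightarrow> submodule X complex_field (bop H K)"

definition norm_closed :: "'a inner_space \<Rightarrow> 'b inner_space \<Rightarrow> ('a \<Rightarrow> 'b) set \<Rightarrow> bool"
  where "norm_closed H K S \<longleftrightarrow>
    (\<forall>s. \<forall>t\<in>carrier (bop H K). (\<forall>n::nat. s n \<in> S) \<and>
      (\<lambda>n. opnorm H K (s n \<ominus>\<^bsub>bop H K\<^esub> t)) \<longlonglongrightarrow> 0 \<longrightarrow> t \<in> S)"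

definition norm_separable :: "'a inner_space \<Rightarrow> 'b inner_space \<Rightarrow> ('a \<Rightarrow> 'b) set \<Rightarrow> bool"
  where "norm_separable H K S \<longleftrightarrow>
    (\<exists>D. countable D \<and> D \<subseteq> S \<and>
      (\<forall>x\<in>S. \<forall>e>0. \<exists>d\<in>D. opnorm H K (x \<ominus>\<^bsub>bop H K\<^esub> d) < e))"

definition tro :: "'a inner_space \<Rightarrow> 'b inner_space \<Rightarrow> ('a \<Rightarrow> 'b) set \<Rightarrow> bool"
  where "tro H K T \<longleftrightarrow> operator_space H K T \<and> norm_closed H K T \<and>
    (\<forall>x\<in>T. \<forall>y\<in>T. \<forall>z\<in>T. tprod H K x y z \<in> T)"

definition generates ::
    "'a inner_space \<Rightarrow> 'b inner_space \<Rightarrow> ('a \<Rightarrow> 'b) set \<Rightarrow> ('a \<Rightarrow> 'b) set \<Rightarrow> bool"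
  where "generates H K G T \<longleftrightarrow> G \<subseteq> carrier (bop H K) \<and> T = \<Inter>{S. tro H K S \<and> G \<subseteq> S}"


section \<open>Completely bounded norms\<close>

text \<open>
  Norm of the \<open>n \<times> n\<close> operator matrix \<^term>\<open>A\<close>, as an operator from the \<open>n\<close>-fold direct sum of
  \<^term>\<open>H\<close> to the \<open>n\<close>-fold direct sum of \<^term>\<open>K\<close>. Only the entries \<^term>\<open>A i j\<close> with
  \<open>i, j < n\<close> matter.
\<close>

definition mat_norm ::
    "'a inner_space \<Rightarrow> 'b inner_space \<Rightarrow> nat \<Rightarrow> (nat \<Rightarrow> nat \<Rightarrow> 'a \<Rightarrow> 'b) \<Rightarrow> real"
  where "mat_norm H K n A =
    (SUP v\<in>{v. (\<forall>j<n. v j \<in> carrier H) \<and> (\<Sum>j<n. (hnorm H (v j))\<^sup>2) \<le> 1}.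
      sqrt (\<Sum>i<n. (hnorm K (\<Oplus>\<^bsub>K\<^esub>j\<in>{..<n}. A i j (v j)))\<^sup>2))"

text \<open>
  The completely bounded norm of a map \<^term>\<open>f\<close> from a subset \<^term>\<open>X\<close> of \<open>B(H, K)\<close> to
  \<open>B(H', K')\<close>; it is infinite if \<^term>\<open>f\<close> is not completely bounded.
\<close>

definition cb_norm ::
    "'a inner_space \<Rightarrow> 'b inner_space \<Rightarrow> ('a \<Rightarrow> 'b) set \<Rightarrow>
     'c inner_space \<Rightarrow> 'd inner_space \<Rightarrow> (('a \<Rightarrow> 'b) \<Rightarrow> ('c \<Rightarrow> 'd)) \<Rightarrow> ereal"
  where "cb_norm H K X H' K' f =
    (SUP (n, A)\<in>{(n, A). (\<forall>i<n. \<forall>j<n. A i j \<in> X) \<and> mat_norm H K n A \<le> 1}.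
      ereal (mat_norm H' K' n (\<lambda>i j. f (A i j))))"

definition completely_contractive ::
    "'a inner_space \<Rightarrow> 'b inner_space \<Rightarrow> ('a \<Rightarrow> 'b) set \<Rightarrow>
     'c inner_space \<Rightarrow> 'd inner_space \<Rightarrow> (('a \<Rightarrow> 'b) \<Rightarrow> ('c \<Rightarrow> 'd)) \<Rightarrow> bool"
  where "completely_contractive H K X H' K' f \<longleftrightarrow>
    clinear_on X (bop H K) (bop H' K') f \<and> cb_norm H K X H' K' f \<le> 1"


section \<open>Representations and rectangular operator states\<close>

text \<open>
  In the following, \<^term>\<open>f\<close> or \<^term>\<open>\<pi>\<close> maps a subset of \<open>B(H, K)\<close> to \<open>B(H', K')\<close>, and only its
  values on that subset matter.
\<close>

definition triple_morphism ::
    "'a inner_space \<Rightarrow> 'b inner_space \<Rightarrow> ('a \<Rightarrow> 'b) set \<Rightarrow>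
     'c inner_space \<Rightarrow> 'd inner_space \<Rightarrow> (('a \<Rightarrow> 'b) \<Rightarrow> ('c \<Rightarrow> 'd)) \<Rightarrow> bool"
  where "triple_morphism H K T H' K' f \<longleftrightarrow>
    clinear_on T (bop H K) (bop H' K') f \<and>
    (\<forall>x\<in>T. \<forall>y\<in>T. \<forall>z\<in>T. f (tprod H K x y z) = tprod H' K' (f x) (f y) (f z))"

definition representation ::
    "'a inner_space \<Rightarrow> 'b inner_space \<Rightarrow> ('a \<Rightarrow> 'b) set \<Rightarrow>
     'c inner_space \<Rightarrow> 'd inner_space \<Rightarrow> (('a \<Rightarrow> 'b) \<Rightarrow> ('c \<Rightarrow> 'd)) \<Rightarrow> bool"
  where "representation H K T H' K' \<pi> \<longleftrightarrow>
    complex_hilbert_space H' \<and> complex_hilbert_space K' \<and> triple_morphism H K T H' K' \<pi>"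

definition irreducible_representation ::
    "'a inner_space \<Rightarrow> 'b inner_space \<Rightarrow> ('a \<Rightarrow> 'b) set \<Rightarrow>
     'c inner_space \<Rightarrow> 'd inner_space \<Rightarrow> (('a \<Rightarrow> 'b) \<Rightarrow> ('c \<Rightarrow> 'd)) \<Rightarrow> bool"
  where "irreducible_representation H K T H' K' \<pi> \<longleftrightarrow>
    representation H K T H' K' \<pi> \<and>
    (\<forall>p\<in>projections H'. \<forall>q\<in>projections K'.
      (\<forall>t\<in>T. compose (carrier H') q (\<pi> t) = compose (carrier H') (\<pi> t) p) \<longrightarrow>
      (p = \<zero>\<^bsub>bop H' H'\<^esub> \<and> q = \<zero>\<^bsub>bop K' K'\<^esub>) \<or> (p = idop H' \<and> q = idop K'))"

definition nondegenerate ::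
    "('a \<Rightarrow> 'b) set \<Rightarrow> 'c inner_space \<Rightarrow> 'd inner_space \<Rightarrow> (('a \<Rightarrow> 'b) \<Rightarrow> ('c \<Rightarrow> 'd)) \<Rightarrow> bool"
  where "nondegenerate X H' K' f \<longleftrightarrow>
    (\<forall>p\<in>projections H'. \<forall>q\<in>projections K'.
      (\<forall>x\<in>X. compose (carrier H') q (f x) = \<zero>\<^bsub>bop H' K'\<^esub> \<and>
              compose (carrier H') (f x) p = \<zero>\<^bsub>bop H' K'\<^esub>) \<longrightarrow>
      p = \<zero>\<^bsub>bop H' H'\<^esub> \<and> q = \<zero>\<^bsub>bop K' K'\<^esub>)"

definition rect_operator_state ::
    "'a inner_space \<Rightarrow> 'b inner_space \<Rightarrow> ('a \<Rightarrow> 'b) set \<Rightarrow>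
     'c inner_space \<Rightarrow> 'd inner_space \<Rightarrow> (('a \<Rightarrow> 'b) \<Rightarrow> ('c \<Rightarrow> 'd)) \<Rightarrow> bool"
  where "rect_operator_state H K X H' K' f \<longleftrightarrow>
    complex_hilbert_space H' \<and> complex_hilbert_space K' \<and>
    nondegenerate X H' K' f \<and> completely_contractive H K X H' K' f \<and> cb_norm H K X H' K' f = 1"


section \<open>Boundary representations and rectangular hyperrigidity\<close>

definition state_extension ::
    "'a inner_space \<Rightarrow> 'b inner_space \<Rightarrow> ('a \<Rightarrow> 'b) set \<Rightarrow> ('a \<Rightarrow> 'b) set \<Rightarrow>
     'c inner_space \<Rightarrow> 'd inner_space \<Rightarrow>
     (('a \<Rightarrow> 'b) \<Rightarrow> ('c \<Rightarrow> 'd)) \<Rightarrow> (('a \<Rightarrow> 'b) \<Rightarrow> ('c \<Rightarrow> 'd)) \<Rightarrow> bool"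
  where "state_extension H K T X H' K' f g \<longleftrightarrow>
    rect_operator_state H K T H' K' g \<and> (\<forall>x\<in>X. g x = f x)"

definition unique_extension_property ::
    "'a inner_space \<Rightarrow> 'b inner_space \<Rightarrow> ('a \<Rightarrow> 'b) set \<Rightarrow> ('a \<Rightarrow> 'b) set \<Rightarrow>
     'c inner_space \<Rightarrow> 'd inner_space \<Rightarrow> (('a \<Rightarrow> 'b) \<Rightarrow> ('c \<Rightarrow> 'd)) \<Rightarrow> bool"
  where "unique_extension_property H K T X H' K' f \<longleftrightarrow>
    rect_operator_state H K X H' K' f \<and>
    (\<forall>g. state_extension H K T X H' K' f g \<longrightarrow> triple_morphism H K T H' K' g)"

definition boundary_map ::
    "'a inner_space \<Rightarrow> 'b inner_space \<Rightarrow> ('a \<Rightarrow> 'b) set \<Rightarrow> ('a \<Rightarrow> 'b) set \<Rightarrow>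
     'c inner_space \<Rightarrow> 'd inner_space \<Rightarrow> (('a \<Rightarrow> 'b) \<Rightarrow> ('c \<Rightarrow> 'd)) \<Rightarrow> bool"
  where "boundary_map H K T X H' K' f \<longleftrightarrow>
    unique_extension_property H K T X H' K' f \<and>
    (\<exists>g. state_extension H K T X H' K' f g \<and>
         (\<forall>g'. state_extension H K T X H' K' f g' \<longrightarrow> (\<forall>t\<in>T. g' t = g t)) \<and>
         irreducible_representation H K T H' K' g)"

definition boundary_representation ::
    "'a inner_space \<Rightarrow> 'b inner_space \<Rightarrow> ('a \<Rightarrow> 'b) set \<Rightarrow> ('a \<Rightarrow> 'b) set \<Rightarrow>
     'c inner_space \<Rightarrow> 'd inner_space \<Rightarrow> (('a \<Rightarrow> 'b) \<Rightarrow> ('c \<Rightarrow> 'd)) \<Rightarrow> bool"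
  where "boundary_representation H K T X H' K' \<pi> \<longleftrightarrow>
    representation H K T H' K' \<pi> \<and> boundary_map H K T X H' K' (restrict \<pi> X)"

text \<open>
  HOL cannot quantify over types inside a definition, so \<^term>\<open>H'\<close> and \<^term>\<open>K'\<close> below range over
  all Hilbert spaces carried by the types \<^typ>\<open>'a\<close> and \<^typ>\<open>'b\<close> of the ambient spaces. Since the
  ambient spaces are nonzero, these types have at least the cardinality of the continuum, hence carry
  a copy of every separable Hilbert space, and of the ambient spaces and their finite direct sums.
\<close>

definition rect_hyperrigid ::
    "'a inner_space \<Rightarrow> 'b inner_space \<Rightarrow> ('a \<Rightarrow> 'b) set \<Rightarrow> ('a \<Rightarrow> 'b) set \<Rightarrow> bool"
  where "rect_hyperrigid H K T G \<longleftrightarrow>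
    generates H K G T \<and> (countable G \<or> operator_space H K G \<and> norm_separable H K G) \<and>
    (\<forall>(H' :: 'a inner_space) (K' :: 'b inner_space) \<pi>
       (\<phi> :: nat \<Rightarrow> ('a \<Rightarrow> 'b) \<Rightarrow> ('a \<Rightarrow> 'b)).
      representation H K T H' K' \<pi> \<and> inj_on \<pi> T \<and> nondegenerate T H' K' \<pi> \<and>
      (\<forall>n. completely_contractive H' K' (carrier (bop H' K')) H' K' (\<phi> n) \<and>
           cb_norm H' K' (carrier (bop H' K')) H' K' (\<phi> n) = 1) \<and>
      (\<forall>g\<in>G. (\<lambda>n. opnorm H' K' (\<phi> n (\<pi> g) \<ominus>\<^bsub>bop H' K'\<^esub> \<pi> g)) \<longlonglongrightarrow> 0) \<longrightarrow>
      (\<forall>t\<in>T. (\<lambda>n. opnorm H' K' (\<phi> n (\<pi> t) \<ominus>\<^bsub>bop H' K'\<^esub> \<pi> t)) \<longlonglongrightarrow> 0))"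

end

theory Submission
  imports Defs "HOL-Analysis.Analysis" "HOL-Library.Function_Algebras"
begin

text \<open>
  The point is that a completely contractive \<open>F\<close> on \<open>B(H\<^sub>0, K\<^sub>0)\<close> that agrees with \<open>\<pi>\<close> on \<open>X\<close> agrees
  with \<open>\<pi>\<close> on \<open>T\<close>. To see this, apply hyperrigidity to the faithful nondegenerate representation
  \<open>\<sigma> = id \<oplus> \<pi>\<close> of \<open>T\<close>, where \<open>id\<close> is cut down to its nondegenerate part, and to the constant
  sequence \<open>\<Phi> a = c a \<oplus> F (c a)\<close>, where \<open>c\<close> compresses an operator to the first summand: \<open>\<Phi>\<close>
  fixes \<open>\<sigma> x\<close> for \<open>x \<in> X\<close>, hence fixes \<open>\<sigma> t\<close> for \<open>t \<in> T\<close>. Since \<open>X\<close> is separable, so are the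
  spaces of the irreducible \<open>\<pi>\<close>, and \<open>\<sigma>\<close> can be carried by the types of \<open>H\<^sub>0\<close> and \<open>K\<^sub>0\<close>.

  A rectangular operator state on \<open>T\<close> that extends the restriction of \<open>\<pi>\<close> to \<open>X\<close> extends further to
  \<open>B(H\<^sub>0, K\<^sub>0)\<close> by Wittstock's theorem, so it is \<open>\<pi>\<close>. If \<open>\<pi>\<close> had completely bounded norm at most
  \<open>s < 1\<close> on \<open>X\<close>, then extending \<open>\<pi> / s\<close> in the same way would give \<open>\<parallel>\<pi> t\<parallel> \<le> s \<parallel>t\<parallel>\<close> on \<open>T\<close>, which
  is impossible for a nonzero triple morphism.
\<close>

section \<open>Hilbert spaces\<close>

text \<open>Hyperrigidity speaks only of maps defined on all of \<open>B(H, K)\<close>, while the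
  states in question live on \<open>T\<close>; this is why an extension theorem is needed at all.
  The summand \<open>id\<close> does two jobs: it makes \<open>\<sigma>\<close> faithful whatever
  \<open>\<pi>\<close> kills, and it lets \<open>\<Phi>\<close> recover \<open>t\<close> from
  \<open>\<sigma> t\<close>, so that the other summand can be recomputed as \<open>F t\<close>.

  Functional calculus is replaced by linear equations such as \<open>y + x x\<^sup>* y = x\<close>,
  solved inside the norm closed space \<open>T\<close> by contraction: a solution in
  \<open>T\<close> can be pushed through \<open>\<pi>\<close>. Norms are handled through real parts
  of sesquilinear sums, bounded by half a sum of squares. Such bounds are additive over block sums,
  so that neither the gauge in the extension theorem nor the map \<open>\<Phi>\<close> requires a
  maximum of norms to be computed. Functionals are real throughout, and complex linearity is
  recovered at the end by moving scalars between the factors.\<close>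

lemma complex_field_simps [simp]:
  "carrier complex_field = UNIV" "x \<otimes>\<^bsub>complex_field\<^esub> y = x * y" "\<one>\<^bsub>complex_field\<^esub> = 1"
  "\<zero>\<^bsub>complex_field\<^esub> = 0" "x \<oplus>\<^bsub>complex_field\<^esub> y = x + y"
  by (simp_all add: complex_field_def)

lemma cring_complex_field: "cring complex_field"
proof (intro cringI abelian_groupI comm_monoidI)
  show "\<exists>y\<in>carrier complex_field. y \<oplus>\<^bsub>complex_field\<^esub> x = \<zero>\<^bsub>complex_field\<^esub>" for x
    by (simp, rule exI[of _ "- x"]) simp
qed (simp_all add: algebra_simps)

text \<open>Hilbert spaces, the spaces \<open>bop H K\<close> and \<open>hpow n H\<close>, and the
  direct sum \<open>S\<close> are all instances, so the vector space calculus over the complex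
  numbers is set up once, without an inner product.\<close>

locale complex_module = Module.module complex_field M for M (structure)
begin

lemmas csmult_add_left = smult_l_distr[simplified]
lemmas csmult_assoc = smult_assoc1[simplified]
lemmas csmult_one [simp] = smult_one[simplified]
lemmas csmult_zero [simp] = smult_l_null[simplified]

lemma csmult_minus_one: "x \<in> carrier M \<Longrightarrow> (-1) \<odot> x = \<ominus> x"
  using csmult_add_left[where a = "-1" and b = 1 and x = x] minus_equality[of "(-1) \<odot> x" x] by simp

lemma diff_eq_0_iff: "x \<in> carrier M \<Longrightarrow> y \<in> carrier M \<Longrightarrow> x \<ominus> y = \<zero> \<longleftrightarrow> x = y"
  by (metis minus_eq add.inv_closed add.inv_equality r_neg minus_minus)

end

sublocale complex_hilbert_space \<subseteq> complex_module H
  by unfold_locales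

section \<open>Inner product calculus and the Cauchy-Schwarz inequality\<close>

context complex_hilbert_space
begin

lemma cinner_zero_left [simp]:
  assumes "y \<in> carrier H" shows "cinner H \<zero> y = 0"
  using cinner_add_left[of \<zero> \<zero> y] assms by simp

lemma cinner_uminus_left [simp]:
  assumes "x \<in> carrier H" "y \<in> carrier H" shows "cinner H (\<ominus> x) y = - cinner H x y"
  using cinner_add_left[of x "\<ominus> x" y] assms by (simp add: r_neg add_eq_0_iff)

lemma cinner_add_right:
  assumes "x \<in> carrier H" "y \<in> carrier H" "z \<in> carrier H"
  shows "cinner H x (y \<oplus> z) = cinner H x y + cinner H x z"
  using assms cinner_commute[of x "y \<oplus> z"] cinner_commute[of x y] cinner_commute[of x z]
  by (simp add: cinner_add_left)

lemma cinner_smult_right: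
  assumes "x \<in> carrier H" "y \<in> carrier H"
  shows "cinner H x (c \<odot> y) = cnj c * cinner H x y"
  using assms cinner_commute[of x "c \<odot> y"] cinner_commute[of x y] by (simp add: cinner_smult_left)

lemma cinner_zero_right [simp]:
  assumes "y \<in> carrier H" shows "cinner H y \<zero> = 0"
  using assms cinner_commute[of y \<zero>] by simp

lemma cinner_uminus_right [simp]:
  assumes "x \<in> carrier H" "y \<in> carrier H" shows "cinner H y (\<ominus> x) = - cinner H y x"
  using assms cinner_commute[of y "\<ominus> x"] cinner_commute[of y x] by simp

lemma cinner_diff_left:
  assumes "x \<in> carrier H" "y \<in> carrier H" "z \<in> carrier H"
  shows "cinner H (x \<ominus> y) z = cinner H x z - cinner H y z"
  using assms by (simp add: minus_eq cinner_add_left)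

lemma cinner_diff_right:
  assumes "x \<in> carrier H" "y \<in> carrier H" "z \<in> carrier H"
  shows "cinner H z (x \<ominus> y) = cinner H z x - cinner H z y"
  using assms by (simp add: minus_eq cinner_add_right)

lemmas cinner_simps = cinner_add_left cinner_add_right cinner_smult_left cinner_smult_right
  cinner_diff_left cinner_diff_right

lemma cinner_finsum_left:
  assumes "finite I" "\<And>i. i \<in> I \<Longrightarrow> f i \<in> carrier H" "y \<in> carrier H"
  shows "cinner H (\<Oplus>i\<in>I. f i) y = (\<Sum>i\<in>I. cinner H (f i) y)"
  using assms(1,2)
proof (induction I rule: finite_induct)
  case (insert a I)
  then show ?case using assms(3) by (simp add: Pi_def cinner_add_left)
qed (use assms in simp)

lemma cinner_finsum_right:
  assumes "finite I" "\<And>i. i \<in> I \<Longrightarrow> f i \<in> carrier H" "y \<in> carrier H"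
  shows "cinner H y (\<Oplus>i\<in>I. f i) = (\<Sum>i\<in>I. cinner H y (f i))"
proof -
  have "cinner H y (\<Oplus>i\<in>I. f i) = cnj (cinner H (\<Oplus>i\<in>I. f i) y)"
    using assms by (intro cinner_commute) (auto intro: finsum_closed)
  also have "\<dots> = (\<Sum>i\<in>I. cinner H y (f i))"
    using assms by (subst cinner_finsum_left) (auto simp: cnj_sum intro!: sum.cong cinner_commute[symmetric])
  finally show ?thesis .
qed

lemma cinner_same_Im [simp]: "x \<in> carrier H \<Longrightarrow> Im (cinner H x x) = 0"
  using cinner_commute[of x x] by (metis Im_complex_of_real complex_cnj_cancel_iff Reals_cnj_iff complex_is_Real_iff)

lemma cinner_same_nonneg [simp]: "x \<in> carrier H \<Longrightarrow> Re (cinner H x x) \<ge> 0"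
  using cinner_pos[of x] by (cases "x = \<zero>") auto

lemma hnorm_square: "x \<in> carrier H \<Longrightarrow> (hnorm H x)\<^sup>2 = Re (cinner H x x)"
  by (simp add: hnorm_def)

lemma cinner_same: "x \<in> carrier H \<Longrightarrow> cinner H x x = complex_of_real ((hnorm H x)\<^sup>2)"
  by (simp add: hnorm_square complex_eq_iff)

lemma hnorm_nonneg [simp]: "x \<in> carrier H \<Longrightarrow> hnorm H x \<ge> 0"
  by (simp add: hnorm_def)

lemma hnorm_zero [simp]: "hnorm H \<zero> = 0"
  by (simp add: hnorm_def)

lemma hnorm_eq_0_iff [simp]: "x \<in> carrier H \<Longrightarrow> hnorm H x = 0 \<longleftrightarrow> x = \<zero>"
  using cinner_pos[of x] by (cases "x = \<zero>") (auto simp: hnorm_def)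

text \<open>Real parts are enough because only \<open>z = x \<ominus> y\<close> is tested. Most
  vector identities below are proved through this rule: expanding both inner products leaves an
  identity of numbers.\<close>

lemma cinner_eqI:
  assumes "x \<in> carrier H" "y \<in> carrier H"
    and "\<And>z. z \<in> carrier H \<Longrightarrow> Re (cinner H x z) = Re (cinner H y z)"
  shows "x = y"
proof -
  have "Re (cinner H (x \<ominus> y) (x \<ominus> y)) = 0"
    using assms(1,2) assms(3)[of "x \<ominus> y"] by (simp add: cinner_diff_left)
  then show ?thesis
    using assms(1,2) diff_eq_0_iff cinner_pos[of "x \<ominus> y"] by force
qed

lemma hnorm_smult [simp]: "x \<in> carrier H \<Longrightarrow> hnorm H (c \<odot> x) = cmod c * hnorm H x"
  by (simp add: hnorm_def cinner_simps real_sqrt_mult mult.assoc[symmetric] complex_norm_square[symmetric]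
      del: mult.assoc)
     (simp add: cmod_def power2_eq_square real_sqrt_mult[symmetric] algebra_simps)

lemma hnorm_uminus [simp]: "x \<in> carrier H \<Longrightarrow> hnorm H (\<ominus> x) = hnorm H x"
  by (simp add: hnorm_def)

lemma Re_cinner_le:
  assumes "x \<in> carrier H" "y \<in> carrier H"
  shows "Re (cinner H x y) \<le> ((hnorm H x)\<^sup>2 + (hnorm H y)\<^sup>2) / 2"
proof -
  have "Re (cinner H y x) = Re (cinner H x y)"
    using assms cinner_commute[of y x] by simp
  moreover have "0 \<le> Re (cinner H (x \<ominus> y) (x \<ominus> y))"
    using assms by (intro cinner_same_nonneg) auto
  ultimately show ?thesis
    using assms by (simp add: hnorm_square cinner_simps)
qed

lemma Re_cinner_sym: "x \<in> carrier H \<Longrightarrow> y \<in> carrier H \<Longrightarrow> Re (cinner H y x) = Re (cinner H x y)"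
  using cinner_commute[of y x] by simp

text \<open>Cauchy-Schwarz follows from the additive bound \<open>Re_cinner_le\<close>: both vectors
  are scaled to norm 1, and the first is rotated so that the inner product becomes its own
  modulus.\<close>

lemma cmod_cinner_le:
  assumes "x \<in> carrier H" "y \<in> carrier H"
  shows "cmod (cinner H x y) \<le> hnorm H x * hnorm H y"
proof (cases "x = \<zero> \<or> y = \<zero>")
  case False
  \<comment> \<open>The conjugate phase of the inner product; the value 1 in the zero case keeps
    \<open>cmod c = 1\<close>, since \<open>sgn 0 = 0\<close>.\<close>
  define c where "c = (if cinner H x y = 0 then 1 else cnj (sgn (cinner H x y)))"
  define s t where "s = hnorm H x" and "t = hnorm H y"
  have st: "s > 0" "t > 0"
    using False assms hnorm_nonneg[of x] hnorm_nonneg[of y] hnorm_eq_0_iff[of x] hnorm_eq_0_iff[of y]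
    unfolding s_def t_def by (metis order_le_less)+
  have c: "cmod c = 1"
    by (auto simp: c_def norm_sgn)
  have "cnj (sgn w) * w = complex_of_real (cmod w)" for w
    by (cases "w = 0") (simp_all add: sgn_eq complex_norm_square[symmetric] mult.commute[of "cnj w"] field_simps
        flip: power2_eq_square)
  then have c2: "c * cinner H x y = complex_of_real (cmod (cinner H x y))"
    by (simp add: c_def)
  let ?x = "(c * complex_of_real (1 / s)) \<odot> x" and ?y = "complex_of_real (1 / t) \<odot> y"
  have "cinner H ?x ?y = complex_of_real (1 / s * (1 / t)) * (c * cinner H x y)"
    using assms by (simp add: cinner_simps)
  then have "Re (cinner H ?x ?y) = cmod (cinner H x y) / (s * t)"
    unfolding c2 by simp
  moreover have "Re (cinner H ?x ?y) \<le> 1"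
    using Re_cinner_le[of ?x ?y] assms st c by (simp add: s_def[symmetric] t_def[symmetric] norm_mult norm_divide)
  ultimately show ?thesis
    using st by (simp add: s_def[symmetric] t_def[symmetric] divide_le_eq)
qed (use assms in auto)

lemma Re_cinner_le_mult:
  assumes "x \<in> carrier H" "y \<in> carrier H"
  shows "\<bar>Re (cinner H x y)\<bar> \<le> hnorm H x * hnorm H y"
  using cmod_cinner_le[OF assms] abs_Re_le_cmod[of "cinner H x y"] by linarith

lemma hnorm_triangle:
  assumes "x \<in> carrier H" "y \<in> carrier H"
  shows "hnorm H (x \<oplus> y) \<le> hnorm H x + hnorm H y"
proof (rule power2_le_imp_le)
  show "(hnorm H (x \<oplus> y))\<^sup>2 \<le> (hnorm H x + hnorm H y)\<^sup>2"
    using assms Re_cinner_le_mult[OF assms] Re_cinner_sym[OF assms]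
    by (simp add: power2_sum hnorm_square cinner_simps)
qed (use assms in simp)

lemma hnorm_diff_triangle:
  assumes "x \<in> carrier H" "y \<in> carrier H" "z \<in> carrier H"
  shows "hnorm H (x \<ominus> z) \<le> hnorm H (x \<ominus> y) + hnorm H (y \<ominus> z)"
proof -
  have "x \<ominus> z = (x \<ominus> y) \<oplus> (y \<ominus> z)"
    using assms by (intro cinner_eqI) (auto simp: cinner_simps)
  then show ?thesis using hnorm_triangle[of "x \<ominus> y" "y \<ominus> z"] assms by simp
qed

lemma hnorm_minus_commute:
  assumes "x \<in> carrier H" "y \<in> carrier H"
  shows "hnorm H (x \<ominus> y) = hnorm H (y \<ominus> x)"
  using assms by (simp add: hnorm_def cinner_simps algebra_simps)

lemma hnorm_le_if_cinner_le:
  assumes "x \<in> carrier H" "0 \<le> C" "\<And>y. y \<in> carrier H \<Longrightarrow> Re (cinner H x y) \<le> C * hnorm H y"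
  shows "hnorm H x \<le> C"
proof (cases "hnorm H x = 0")
  case False
  then show ?thesis
    using assms(3)[OF assms(1)] assms(1) hnorm_nonneg[OF assms(1)]
    by (simp add: hnorm_square[symmetric] power2_eq_square order.order_iff_strict)
qed (use assms in simp)

lemma tendsto_cinner:
  assumes "\<And>n. s n \<in> carrier H" "x \<in> carrier H" "y \<in> carrier H"
    and "(\<lambda>n. hnorm H (s n \<ominus> x)) \<longlonglongrightarrow> 0"
  shows "(\<lambda>n. cinner H (s n) y) \<longlonglongrightarrow> cinner H x y"
proof -
  have "(\<lambda>n. cinner H (s n) y - cinner H x y) \<longlonglongrightarrow> 0"
  proof (rule Lim_null_comparison)
    show "\<forall>\<^sub>F n in sequentially. norm (cinner H (s n) y - cinner H x y) \<le> hnorm H (s n \<ominus> x) * hnorm H y"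
      using assms cmod_cinner_le[of "s _ \<ominus> x" y] by (auto simp: cinner_diff_left[symmetric])
    show "(\<lambda>n. hnorm H (s n \<ominus> x) * hnorm H y) \<longlonglongrightarrow> 0"
      using assms(4) tendsto_mult_left_zero by blast
  qed
  then show ?thesis using LIM_zero_iff by blast
qed

text \<open>The Riesz vector is the minimiser of
  \<open>J x = \<parallel>x\<parallel>\<^sup>2 - 2 g x\<close>. The real form of the statement
  covers the real functionals that Hahn-Banach produces, on the whole space, as well as orthogonal
  projections onto closed subspaces.\<close>

lemma riesz_real_subspace:
  assumes M: "M \<subseteq> carrier H" "\<zero> \<in> M" "\<And>x y. x \<in> M \<Longrightarrow> y \<in> M \<Longrightarrow> x \<oplus> y \<in> M"
      "\<And>r x. x \<in> M \<Longrightarrow> complex_of_real r \<odot> x \<in> M"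
    and closed: "\<And>s x. (\<And>n::nat. s n \<in> M) \<Longrightarrow> x \<in> carrier H \<Longrightarrow> (\<lambda>n. hnorm H (s n \<ominus> x)) \<longlonglongrightarrow> 0 \<Longrightarrow> x \<in> M"
    and g: "\<And>x y. x \<in> M \<Longrightarrow> y \<in> M \<Longrightarrow> g (x \<oplus> y) = g x + g y"
      "\<And>r x. x \<in> M \<Longrightarrow> g (complex_of_real r \<odot> x) = r * g x"
      "\<And>x. x \<in> M \<Longrightarrow> g x \<le> C * hnorm H x"
  shows "\<exists>z\<in>M. \<forall>x\<in>M. Re (cinner H z x) = g x"
proof -
  define J where "J x = (hnorm H x)\<^sup>2 - 2 * g x" for x
  have MH: "x \<in> carrier H" if "x \<in> M" for x using M(1) that by auto
  have "J x \<ge> - C\<^sup>2" if "x \<in> M" for x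
    using g(3)[OF that] sum_squares_ge_zero[of "hnorm H x - C" 0]
    by (simp add: J_def power2_eq_square algebra_simps)
  then have bdd: "bdd_below (J ` M)" by (auto intro!: bdd_belowI)
  define d where "d = Inf (J ` M)"
  have dle: "d \<le> J x" if "x \<in> M" for x
    using bdd that by (auto simp: d_def intro: cInf_lower)
  have "\<exists>x\<in>M. J x < d + 1 / (real n + 1)" for n :: nat
    using cInf_lessD[of "J ` M" "d + 1 / (real n + 1)"] M(2) by (auto simp: d_def)
  then obtain s where s: "\<And>n::nat. s n \<in> M" "\<And>n. J (s n) < d + 1 / (real n + 1)"
    by metis
  \<comment> \<open>Parallelogram law: the midpoint of \<open>x\<close> and \<open>y\<close> lies in
    \<open>M\<close>, so \<open>J\<close> is at least \<open>d\<close> there. Near-minimisers are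
    therefore close to each other.\<close>
  have J2: "(hnorm H (x \<ominus> y))\<^sup>2 \<le> 2 * (J x + J y) - 4 * d" if "x \<in> M" "y \<in> M" for x y
  proof -
    have m: "complex_of_real (1/2) \<odot> (x \<oplus> y) \<in> M" by (intro M that)
    have "J (complex_of_real (1/2) \<odot> (x \<oplus> y)) = (J x + J y) / 2 - (hnorm H (x \<ominus> y))\<^sup>2 / 4"
      using that MH g M unfolding J_def
      by (simp only: hnorm_square smult_closed a_closed minus_closed complex_field_simps UNIV_I g cinner_simps)
         (simp add: field_simps)
    then show ?thesis using dle[OF m] by linarith
  qed
  have "\<exists>x\<in>carrier H. (\<lambda>n. hnorm H (s n \<ominus> x)) \<longlonglongrightarrow> 0"
  proof (rule complete)
    show "s n \<in> carrier H" for n using s MH by auto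
    show "\<forall>e>0. \<exists>N. \<forall>m\<ge>N. \<forall>n\<ge>N. hnorm H (s m \<ominus> s n) < e"
    proof (intro allI impI)
      fix e :: real assume "e > 0"
      then obtain N :: nat where N: "real N > 4 / e\<^sup>2" using reals_Archimedean2 by blast
      have "hnorm H (s m \<ominus> s n) < e" if "m \<ge> N" "n \<ge> N" for m n
      proof (rule power2_less_imp_less)
        have Np: "real N > 0" using N \<open>e > 0\<close> by (smt (verit) divide_pos_pos zero_less_power)
        have "1 / (real m + 1) \<le> 1 / real N" "1 / (real n + 1) \<le> 1 / real N"
          using that Np by (auto intro!: divide_left_mono mult_pos_pos)
        then have "(hnorm H (s m \<ominus> s n))\<^sup>2 < 4 / real N"
          using J2[OF s(1) s(1), of m n] s(2)[of m] s(2)[of n] by (simp add: divide_inverse)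
        also have "4 / real N < e\<^sup>2" using N Np \<open>e > 0\<close> by (simp add: field_simps)
        finally show "(hnorm H (s m \<ominus> s n))\<^sup>2 < e\<^sup>2" .
      qed (use \<open>e > 0\<close> in simp)
      then show "\<exists>N. \<forall>m\<ge>N. \<forall>n\<ge>N. hnorm H (s m \<ominus> s n) < e" by blast
    qed
  qed
  then obtain z where z: "z \<in> carrier H" "(\<lambda>n. hnorm H (s n \<ominus> z)) \<longlonglongrightarrow> 0" by blast
  have zM: "z \<in> M" using closed[OF s(1) z] .
  have "Re (cinner H z x) = g x" if x: "x \<in> M" for x
  proof -
    \<comment> \<open>Minimality of \<open>z\<close> in the direction \<open>x\<close>. The
      inequality is obtained along \<open>s n\<close>, where \<open>J (s n)\<close> exceeds the
      infimum by less than \<open>1 / (n + 1)\<close>, and only then passed to the limit, so that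
      \<open>J z\<close> itself is never evaluated.\<close>
    have ineq: "2 * t * (Re (cinner H z x) - g x) + t\<^sup>2 * (hnorm H x)\<^sup>2 \<ge> 0" for t
    proof (rule LIMSEQ_le_const)
      have l1: "(\<lambda>n. Re (cinner H (s n) x)) \<longlonglongrightarrow> Re (cinner H z x)"
        using tendsto_cinner[of s z x] s MH x z by (auto intro!: tendsto_Re)
      have l2: "(\<lambda>n. 1 / (real n + 1)) \<longlonglongrightarrow> 0"
        using lim_inverse_n' LIMSEQ_Suc[of "\<lambda>n. 1 / real n" 0] by (simp add: add.commute)
      show "(\<lambda>n. 2 * t * (Re (cinner H (s n) x) - g x) + t\<^sup>2 * (hnorm H x)\<^sup>2 + 1 / (real n + 1))
          \<longlonglongrightarrow> 2 * t * (Re (cinner H z x) - g x) + t\<^sup>2 * (hnorm H x)\<^sup>2"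
        by (rule tendsto_eq_intros l1 l2 refl | simp)+
      have "0 \<le> 2 * t * (Re (cinner H (s n) x) - g x) + t\<^sup>2 * (hnorm H x)\<^sup>2 + 1 / (real n + 1)" for n
      proof -
        have "J (s n \<oplus> complex_of_real t \<odot> x) =
            J (s n) + 2 * t * (Re (cinner H (s n) x) - g x) + t\<^sup>2 * (hnorm H x)\<^sup>2"
          using s(1)[of n] x MH Re_cinner_sym[of "s n" x] M unfolding J_def
          by (simp add: hnorm_square g cinner_simps del: hnorm_smult)
             (simp add: power2_eq_square algebra_simps)
        then show ?thesis using s(2)[of n] dle[of "s n \<oplus> complex_of_real t \<odot> x"] M(3,4) s(1) x by (smt (verit))
      qed
      then show "\<exists>N. \<forall>n\<ge>N. 0 \<le> 2 * t * (Re (cinner H (s n) x) - g x) + t\<^sup>2 * (hnorm H x)\<^sup>2 + 1 / (real n + 1)"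
        by blast
    qed
    define u where "u = Re (cinner H z x) - g x"
    define v where "v = (hnorm H x)\<^sup>2"
    have "v \<ge> 0" by (simp add: v_def)
    \<comment> \<open>The quadratic in \<open>t\<close> has the minimiser \<open>- u / v\<close>;
      writing \<open>1 + v\<close> avoids a division by zero for \<open>x = 0\<close> and still
      makes the value negative unless \<open>u = 0\<close>.\<close>
    have "2 * (- u / (1 + v)) * u + (- u / (1 + v))\<^sup>2 * v \<ge> 0"
      using ineq[of "- u / (1 + v)"] by (simp add: u_def v_def)
    then have "(2 * (- u / (1 + v)) * u + (- u / (1 + v))\<^sup>2 * v) * (1 + v)\<^sup>2 \<ge> 0"
      by (rule mult_nonneg_nonneg) simp
    also have "(2 * (- u / (1 + v)) * u + (- u / (1 + v))\<^sup>2 * v) * (1 + v)\<^sup>2 = - u\<^sup>2 * (2 + v)"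
      using \<open>v \<ge> 0\<close> by (simp add: divide_simps) (simp add: power2_eq_square algebra_simps)
    finally have "u\<^sup>2 * (2 + v) \<le> 0" by simp
    then have "u\<^sup>2 \<le> 0" using \<open>v \<ge> 0\<close> by (simp add: mult_le_0_iff)
    then show ?thesis by (simp add: u_def)
  qed
  then show ?thesis using zM by blast
qed

end

section \<open>Bounded operators between two Hilbert spaces\<close>

locale hilbert_pair = H: complex_hilbert_space H + K: complex_hilbert_space K
  for H :: "'a inner_space" and K :: "'b inner_space"
begin

lemma bop_iff:
  "a \<in> carrier (bop H K) \<longleftrightarrow> a \<in> extensional (carrier H) \<and> (\<forall>x\<in>carrier H. a x \<in> carrier K) \<and>
    (\<forall>x\<in>carrier H. \<forall>y\<in>carrier H. a (x \<oplus>\<^bsub>H\<^esub> y) = a x \<oplus>\<^bsub>K\<^esub> a y) \<and>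
    (\<forall>c. \<forall>x\<in>carrier H. a (c \<odot>\<^bsub>H\<^esub> x) = c \<odot>\<^bsub>K\<^esub> a x) \<and>
    (\<exists>C. \<forall>x\<in>carrier H. hnorm K (a x) \<le> C * hnorm H x)"
  by (auto simp: bop_def clinear_on_def)

lemma bop_closed [simp]: "a \<in> carrier (bop H K) \<Longrightarrow> x \<in> carrier H \<Longrightarrow> a x \<in> carrier K"
  unfolding bop_iff by blast

lemma bop_add [simp]: "a \<in> carrier (bop H K) \<Longrightarrow> x \<in> carrier H \<Longrightarrow> y \<in> carrier H
    \<Longrightarrow> a (x \<oplus>\<^bsub>H\<^esub> y) = a x \<oplus>\<^bsub>K\<^esub> a y"
  unfolding bop_iff by blast

lemma bop_smult [simp]: "a \<in> carrier (bop H K) \<Longrightarrow> x \<in> carrier H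
    \<Longrightarrow> a (c \<odot>\<^bsub>H\<^esub> x) = c \<odot>\<^bsub>K\<^esub> a x"
  unfolding bop_iff by blast

lemma bop_zero [simp]: "a \<in> carrier (bop H K) \<Longrightarrow> a \<zero>\<^bsub>H\<^esub> = \<zero>\<^bsub>K\<^esub>"
  using bop_smult[of a "\<zero>\<^bsub>H\<^esub>" 0] H.smult_r_null[of 0] K.smult_l_null[of "a \<zero>\<^bsub>H\<^esub>"] by simp

lemma bop_uminus [simp]: "a \<in> carrier (bop H K) \<Longrightarrow> x \<in> carrier H \<Longrightarrow> a (\<ominus>\<^bsub>H\<^esub> x) = \<ominus>\<^bsub>K\<^esub> a x"
  using bop_add[of a "\<ominus>\<^bsub>H\<^esub> x" x] K.minus_equality[of "a (\<ominus>\<^bsub>H\<^esub> x)" "a x"]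
  by (simp add: H.l_neg)

lemma bop_diff [simp]: "a \<in> carrier (bop H K) \<Longrightarrow> x \<in> carrier H \<Longrightarrow> y \<in> carrier H
    \<Longrightarrow> a (x \<ominus>\<^bsub>H\<^esub> y) = a x \<ominus>\<^bsub>K\<^esub> a y"
  by (simp add: H.minus_eq K.minus_eq)

lemma bop_finsum:
  assumes "a \<in> carrier (bop H K)" "finite I" "\<And>i. i \<in> I \<Longrightarrow> f i \<in> carrier H"
  shows "a (\<Oplus>\<^bsub>H\<^esub>i\<in>I. f i) = (\<Oplus>\<^bsub>K\<^esub>i\<in>I. a (f i))"
  using assms(2,3)
proof (induction I rule: finite_induct)
  case (insert i I)
  then show ?case using assms(1) by (simp add: Pi_def H.finsum_insert K.finsum_insert)
qed (use assms(1) in simp)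

lemma bop_ext:
  assumes "a \<in> carrier (bop H K)" "b \<in> carrier (bop H K)" "\<And>x. x \<in> carrier H \<Longrightarrow> a x = b x"
  shows "a = b"
proof (rule extensionalityI)
  show "a \<in> extensional (carrier H)" "b \<in> extensional (carrier H)"
    using assms(1,2) unfolding bop_iff by blast+
qed (rule assms(3))

lemma bop_eqI:
  assumes "a \<in> carrier (bop H K)" "b \<in> carrier (bop H K)"
    "\<And>x y. x \<in> carrier H \<Longrightarrow> y \<in> carrier K \<Longrightarrow> Re (cinner K (a x) y) = Re (cinner K (b x) y)"
  shows "a = b"
  using assms by (intro bop_ext K.cinner_eqI) auto

lemma bopI:
  assumes "a \<in> extensional (carrier H)" "\<And>x. x \<in> carrier H \<Longrightarrow> a x \<in> carrier K"
    "\<And>x y. x \<in> carrier H \<Longrightarrow> y \<in> carrier H \<Longrightarrow> a (x \<oplus>\<^bsub>H\<^esub> y) = a x \<oplus>\<^bsub>K\<^esub> a y"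
    "\<And>c x. x \<in> carrier H \<Longrightarrow> a (c \<odot>\<^bsub>H\<^esub> x) = c \<odot>\<^bsub>K\<^esub> a x"
    "\<And>x. x \<in> carrier H \<Longrightarrow> hnorm K (a x) \<le> C * hnorm H x"
  shows "a \<in> carrier (bop H K)"
  unfolding bop_iff using assms by blast

lemma bop_bound:
  assumes "a \<in> carrier (bop H K)"
  obtains C where "C > 0" "\<And>x. x \<in> carrier H \<Longrightarrow> hnorm K (a x) \<le> C * hnorm H x"
proof -
  obtain C where C: "\<And>x. x \<in> carrier H \<Longrightarrow> hnorm K (a x) \<le> C * hnorm H x"
    using assms unfolding bop_iff by blast
  have "hnorm K (a x) \<le> (\<bar>C\<bar> + 1) * hnorm H x" if "x \<in> carrier H" for x
    using C[OF that] mult_right_mono[of C "\<bar>C\<bar> + 1" "hnorm H x"] H.hnorm_nonneg[OF that] by linarith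
  then show thesis by (intro that[of "\<bar>C\<bar> + 1"]) auto
qed

lemma bop_zero_eq: "\<zero>\<^bsub>bop H K\<^esub> = (\<lambda>x\<in>carrier H. \<zero>\<^bsub>K\<^esub>)"
  by (simp add: bop_def)
lemma bop_add_eq: "a \<oplus>\<^bsub>bop H K\<^esub> b = (\<lambda>x\<in>carrier H. a x \<oplus>\<^bsub>K\<^esub> b x)"
  by (simp add: bop_def)
lemma bop_smult_eq: "c \<odot>\<^bsub>bop H K\<^esub> a = (\<lambda>x\<in>carrier H. c \<odot>\<^bsub>K\<^esub> a x)"
  by (simp add: bop_def)

lemma bop_zero_closed: "\<zero>\<^bsub>bop H K\<^esub> \<in> carrier (bop H K)"
  by (rule bopI[where C = 0]) (simp_all add: bop_zero_eq)

lemma bop_add_closed: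
  assumes "a \<in> carrier (bop H K)" "b \<in> carrier (bop H K)"
  shows "a \<oplus>\<^bsub>bop H K\<^esub> b \<in> carrier (bop H K)"
proof -
  obtain C where "C > 0" and C: "\<And>x. x \<in> carrier H \<Longrightarrow> hnorm K (a x) \<le> C * hnorm H x"
    by (rule bop_bound[OF assms(1)]) blast
  obtain D where "D > 0" and D: "\<And>x. x \<in> carrier H \<Longrightarrow> hnorm K (b x) \<le> D * hnorm H x"
    by (rule bop_bound[OF assms(2)]) blast
  show ?thesis
  proof (rule bopI[where C = "C + D"])
    fix x assume x: "x \<in> carrier H"
    show "hnorm K ((a \<oplus>\<^bsub>bop H K\<^esub> b) x) \<le> (C + D) * hnorm H x"
      using K.hnorm_triangle[of "a x" "b x"] C[OF x] D[OF x] x assms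
      by (simp add: bop_add_eq algebra_simps)
  qed (use assms in \<open>simp_all add: bop_add_eq K.smult_r_distr K.a_ac\<close>)
qed

lemma bop_smult_closed:
  assumes "a \<in> carrier (bop H K)"
  shows "c \<odot>\<^bsub>bop H K\<^esub> a \<in> carrier (bop H K)"
proof -
  obtain C where "C > 0" and C: "\<And>x. x \<in> carrier H \<Longrightarrow> hnorm K (a x) \<le> C * hnorm H x"
    by (rule bop_bound[OF assms]) blast
  show ?thesis
  proof (rule bopI[where C = "cmod c * C"])
    fix x assume x: "x \<in> carrier H"
    show "hnorm K ((c \<odot>\<^bsub>bop H K\<^esub> a) x) \<le> cmod c * C * hnorm H x"
      using C[OF x] x assms by (simp add: bop_smult_eq mult_left_mono mult.assoc)
  qed (use assms in \<open>simp_all add: bop_smult_eq K.smult_r_distr mult.commute flip: K.csmult_assoc\<close>)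
qed

lemma module_bop: "Module.module complex_field (bop H K)"
proof (intro moduleI abelian_groupI cring_complex_field)
  fix a assume a: "a \<in> carrier (bop H K)"
  note m = bop_smult_closed[OF a, of "-1"]
  show "\<exists>b\<in>carrier (bop H K). b \<oplus>\<^bsub>bop H K\<^esub> a = \<zero>\<^bsub>bop H K\<^esub>"
  proof (intro bexI[OF bop_ext m] bop_add_closed bop_zero_closed m a)
    fix x assume x: "x \<in> carrier H"
    show "((-1) \<odot>\<^bsub>bop H K\<^esub> a \<oplus>\<^bsub>bop H K\<^esub> a) x = \<zero>\<^bsub>bop H K\<^esub> x"
      using x a by (intro K.cinner_eqI) (simp_all add: bop_add_eq bop_smult_eq bop_zero_eq K.cinner_simps)
  qed
next
  fix a b c :: "'a \<Rightarrow> 'b" and r s :: complex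
  assume "a \<in> carrier (bop H K)" "b \<in> carrier (bop H K)" "c \<in> carrier (bop H K)"
  then show "a \<oplus>\<^bsub>bop H K\<^esub> b \<oplus>\<^bsub>bop H K\<^esub> c = a \<oplus>\<^bsub>bop H K\<^esub> (b \<oplus>\<^bsub>bop H K\<^esub> c)"
    by (intro bop_ext bop_add_closed) (simp_all add: bop_add_eq K.a_assoc)
qed (intro bop_ext bop_add_closed bop_smult_closed bop_zero_closed;
    (assumption | simp add: bop_add_eq bop_smult_eq bop_zero_eq K.a_ac K.smult_r_distr K.csmult_add_left K.csmult_assoc))+

sublocale B: complex_module "bop H K"
  unfolding complex_module_def by (rule module_bop)

lemma zero_apply [simp]: "x \<in> carrier H \<Longrightarrow> \<zero>\<^bsub>bop H K\<^esub> x = \<zero>\<^bsub>K\<^esub>"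
  by (simp add: bop_zero_eq)
lemma add_apply [simp]: "x \<in> carrier H \<Longrightarrow> (a \<oplus>\<^bsub>bop H K\<^esub> b) x = a x \<oplus>\<^bsub>K\<^esub> b x"
  by (simp add: bop_add_eq)
lemma smult_apply [simp]: "x \<in> carrier H \<Longrightarrow> (c \<odot>\<^bsub>bop H K\<^esub> a) x = c \<odot>\<^bsub>K\<^esub> a x"
  by (simp add: bop_smult_eq)

lemma uminus_apply [simp]:
  assumes "a \<in> carrier (bop H K)" "x \<in> carrier H"
  shows "(\<ominus>\<^bsub>bop H K\<^esub> a) x = \<ominus>\<^bsub>K\<^esub> a x"
proof -
  have "(\<ominus>\<^bsub>bop H K\<^esub> a) x \<oplus>\<^bsub>K\<^esub> a x = \<zero>\<^bsub>K\<^esub>"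
    using add_apply[OF assms(2), of "\<ominus>\<^bsub>bop H K\<^esub> a" a] B.l_neg[OF assms(1)] assms by simp
  then show ?thesis using assms K.minus_equality by fastforce
qed

lemma diff_apply [simp]: "a \<in> carrier (bop H K) \<Longrightarrow> b \<in> carrier (bop H K) \<Longrightarrow> x \<in> carrier H \<Longrightarrow>
    (a \<ominus>\<^bsub>bop H K\<^esub> b) x = a x \<ominus>\<^bsub>K\<^esub> b x"
  by (simp add: B.minus_eq K.minus_eq)

lemma opnorm_bdd: "a \<in> carrier (bop H K) \<Longrightarrow>
    bdd_above ((\<lambda>x. hnorm K (a x)) ` {x \<in> carrier H. hnorm H x \<le> 1})"
proof -
  assume "a \<in> carrier (bop H K)"
  then obtain C where "C > 0" "\<And>x. x \<in> carrier H \<Longrightarrow> hnorm K (a x) \<le> C * hnorm H x"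
    by (rule bop_bound) blast
  then have "hnorm K (a x) \<le> C" if "x \<in> carrier H" "hnorm H x \<le> 1" for x
    using that mult_left_le[of "hnorm H x" C] by (meson less_imp_le order_trans)
  then show ?thesis
    by (intro bdd_aboveI[of _ C]) blast
qed

lemma opnorm_nonneg [simp]: assumes "a \<in> carrier (bop H K)" shows "opnorm H K a \<ge> 0"
  using cSUP_upper[OF _ opnorm_bdd[OF assms], of "\<zero>\<^bsub>H\<^esub>"] assms by (simp add: opnorm_def)

lemma hnorm_le_opnorm:
  assumes "a \<in> carrier (bop H K)" "x \<in> carrier H"
  shows "hnorm K (a x) \<le> opnorm H K a * hnorm H x"
proof (cases "hnorm H x = 0")
  case False
  then have pos: "hnorm H x > 0" using assms H.hnorm_nonneg[of x] by linarith
  let ?y = "complex_of_real (1 / hnorm H x) \<odot>\<^bsub>H\<^esub> x"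
  have "hnorm K (a ?y) \<le> opnorm H K a"
    unfolding opnorm_def using pos assms
    by (intro cSUP_upper opnorm_bdd) (auto simp: norm_divide)
  then show ?thesis using pos assms by (simp add: norm_divide field_simps)
qed (use assms in auto)

lemma opnorm_le:
  assumes "0 \<le> C" "\<And>x. x \<in> carrier H \<Longrightarrow> hnorm K (a x) \<le> C * hnorm H x"
  shows "opnorm H K a \<le> C"
  unfolding opnorm_def
proof (rule cSUP_least)
  show "{x \<in> carrier H. hnorm H x \<le> 1} \<noteq> {}" using H.zero_closed by force
  fix x assume x: "x \<in> {x \<in> carrier H. hnorm H x \<le> 1}"
  then show "hnorm K (a x) \<le> C"
    using assms(2)[of x] mult_left_le[of "hnorm H x" C] assms(1) by simp
qed

lemma opnorm_eq_0:
  assumes "a \<in> carrier (bop H K)" "opnorm H K a = 0" shows "a = \<zero>\<^bsub>bop H K\<^esub>"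
  using hnorm_le_opnorm[OF assms(1)] assms
  by (intro bop_ext) (auto intro!: antisym simp flip: K.hnorm_eq_0_iff)

lemma opnorm_zero [simp]: "opnorm H K \<zero>\<^bsub>bop H K\<^esub> = 0"
  using opnorm_le[of 0 "\<zero>\<^bsub>bop H K\<^esub>"] opnorm_nonneg[OF B.zero_closed] by auto

lemma opnorm_triangle:
  assumes "a \<in> carrier (bop H K)" "b \<in> carrier (bop H K)"
  shows "opnorm H K (a \<oplus>\<^bsub>bop H K\<^esub> b) \<le> opnorm H K a + opnorm H K b"
proof (rule opnorm_le)
  fix x assume "x \<in> carrier H"
  then show "hnorm K ((a \<oplus>\<^bsub>bop H K\<^esub> b) x) \<le> (opnorm H K a + opnorm H K b) * hnorm H x"
    using assms K.hnorm_triangle[of "a x" "b x"] hnorm_le_opnorm[of a x] hnorm_le_opnorm[of b x]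
    by (simp add: algebra_simps)
qed (use assms in simp)

lemma opnorm_smult:
  assumes "a \<in> carrier (bop H K)"
  shows "opnorm H K (c \<odot>\<^bsub>bop H K\<^esub> a) = cmod c * opnorm H K a"
proof -
  have le: "opnorm H K (c \<odot>\<^bsub>bop H K\<^esub> a) \<le> cmod c * opnorm H K a" if "a \<in> carrier (bop H K)" for c a
    using that hnorm_le_opnorm[OF that]
    by (intro opnorm_le) (auto simp: mult.assoc mult_left_mono)
  show ?thesis
  proof (cases "c = 0")
    case False
    have "opnorm H K a = opnorm H K (inverse c \<odot>\<^bsub>bop H K\<^esub> (c \<odot>\<^bsub>bop H K\<^esub> a))"
      using False assms by (simp flip: B.csmult_assoc)
    also have "\<dots> \<le> cmod (inverse c) * opnorm H K (c \<odot>\<^bsub>bop H K\<^esub> a)"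
      using assms by (intro le) auto
    finally have "cmod c * opnorm H K a \<le> opnorm H K (c \<odot>\<^bsub>bop H K\<^esub> a)"
      using False by (simp add: norm_inverse norm_divide field_simps)
    then show ?thesis using le[OF assms, of c] by linarith
  qed (use assms in simp)
qed

lemma opnorm_minus_commute:
  assumes "a \<in> carrier (bop H K)" "b \<in> carrier (bop H K)"
  shows "opnorm H K (a \<ominus>\<^bsub>bop H K\<^esub> b) = opnorm H K (b \<ominus>\<^bsub>bop H K\<^esub> a)"
  unfolding opnorm_def using assms by (intro SUP_cong) (auto intro: K.hnorm_minus_commute)

lemma opnorm_diff_triangle:
  assumes "a \<in> carrier (bop H K)" "b \<in> carrier (bop H K)" "c \<in> carrier (bop H K)"
  shows "opnorm H K (a \<ominus>\<^bsub>bop H K\<^esub> c) \<le> opnorm H K (a \<ominus>\<^bsub>bop H K\<^esub> b) + opnorm H K (b \<ominus>\<^bsub>bop H K\<^esub> c)"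
proof -
  have "a \<ominus>\<^bsub>bop H K\<^esub> c = (a \<ominus>\<^bsub>bop H K\<^esub> b) \<oplus>\<^bsub>bop H K\<^esub> (b \<ominus>\<^bsub>bop H K\<^esub> c)"
    using assms by (intro bop_eqI) (auto simp: K.cinner_simps)
  then show ?thesis using opnorm_triangle assms by simp
qed

text \<open>The form \<open>G\<close> gives only the real part of the inner product. Riesz produces
  the image vectors, and \<open>bal\<close>, which moves a complex scalar from one argument to the
  other, is what makes the resulting operator complex linear.\<close>

lemma bop_of_form:
  assumes add1: "\<And>x x' y. x \<in> carrier H \<Longrightarrow> x' \<in> carrier H \<Longrightarrow> y \<in> carrier K \<Longrightarrow> G (x \<oplus>\<^bsub>H\<^esub> x') y = G x y + G x' y"
    and add2: "\<And>x y y'. x \<in> carrier H \<Longrightarrow> y \<in> carrier K \<Longrightarrow> y' \<in> carrier K \<Longrightarrow> G x (y \<oplus>\<^bsub>K\<^esub> y') = G x y + G x y'"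
    and real: "\<And>r x y. x \<in> carrier H \<Longrightarrow> y \<in> carrier K \<Longrightarrow> G x (complex_of_real r \<odot>\<^bsub>K\<^esub> y) = r * G x y"
    and bal: "\<And>c x y. x \<in> carrier H \<Longrightarrow> y \<in> carrier K \<Longrightarrow> G (c \<odot>\<^bsub>H\<^esub> x) y = G x (cnj c \<odot>\<^bsub>K\<^esub> y)"
    and bound: "\<And>x y. x \<in> carrier H \<Longrightarrow> y \<in> carrier K \<Longrightarrow> G x y \<le> C * hnorm H x * hnorm K y"
    and C: "0 \<le> C"
  shows "\<exists>a\<in>carrier (bop H K). \<forall>x\<in>carrier H. \<forall>y\<in>carrier K. Re (cinner K (a x) y) = G x y"
proof -
  have "\<exists>z\<in>carrier K. \<forall>y\<in>carrier K. Re (cinner K z y) = G x y" if x: "x \<in> carrier H" for x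
    by (rule K.riesz_real_subspace[where C = "C * hnorm H x"]) (use x add2 real bound in auto)
  then obtain a where a: "\<And>x. x \<in> carrier H \<Longrightarrow> a x \<in> carrier K"
    "\<And>x y. x \<in> carrier H \<Longrightarrow> y \<in> carrier K \<Longrightarrow> Re (cinner K (a x) y) = G x y"
    by metis
  have "restrict a (carrier H) \<in> carrier (bop H K)"
  proof (rule bopI[where C = C])
    fix x assume x: "x \<in> carrier H"
    show "hnorm K (restrict a (carrier H) x) \<le> C * hnorm H x"
      using a x bound[OF x] C by (auto intro!: K.hnorm_le_if_cinner_le)
    fix c
    show "restrict a (carrier H) (c \<odot>\<^bsub>H\<^esub> x) = c \<odot>\<^bsub>K\<^esub> restrict a (carrier H) x"
    proof (rule K.cinner_eqI)
      fix y assume y: "y \<in> carrier K"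
      have "Re (cinner K (c \<odot>\<^bsub>K\<^esub> a x) y) = Re (cinner K (a x) (cnj c \<odot>\<^bsub>K\<^esub> y))"
        using a x y by (simp add: K.cinner_simps)
      then show "Re (cinner K (restrict a (carrier H) (c \<odot>\<^bsub>H\<^esub> x)) y) =
          Re (cinner K (c \<odot>\<^bsub>K\<^esub> restrict a (carrier H) x) y)"
        using a x y bal by simp
    qed (use a x in auto)
    fix x' assume x': "x' \<in> carrier H"
    show "restrict a (carrier H) (x \<oplus>\<^bsub>H\<^esub> x') = restrict a (carrier H) x \<oplus>\<^bsub>K\<^esub> restrict a (carrier H) x'"
      using a x x' add1 by (intro K.cinner_eqI) (auto simp: K.cinner_simps)
  qed (use a in auto)
  then show ?thesis using a by (intro bexI[of _ "restrict a (carrier H)"]) auto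
qed

text \<open>The imaginary part of \<open>z\<close> is the real part of \<open>- \<i> * z\<close>, so
  the identity of real parts is tested at \<open>- \<i> \<odot> x\<close>.\<close>

lemma Re_cinner_imp_cinner:
  assumes "a \<in> carrier (bop H K)" "b \<in> carrier (bop K H)" "x \<in> carrier H" "y \<in> carrier K"
    and Re: "\<And>x y. x \<in> carrier H \<Longrightarrow> y \<in> carrier K \<Longrightarrow> Re (cinner K (a x) y) = Re (cinner H x (b y))"
  shows "cinner K (a x) y = cinner H x (b y)"
proof -
  interpret F: complex_hilbert_space K by (rule K.complex_hilbert_space_axioms)
  have b: "b y \<in> carrier H" using assms(2,4) by (auto simp: bop_def clinear_on_def)
  have "Re (cinner K (a (- \<i> \<odot>\<^bsub>H\<^esub> x)) y) = Re (cinner H (- \<i> \<odot>\<^bsub>H\<^esub> x) (b y))"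
    using assms by (intro Re) auto
  then show ?thesis
    using Re[OF assms(3,4)] assms(1,3,4) b by (simp add: H.cinner_simps K.cinner_simps complex_eq_iff)
qed

end

lemma hilbert_pairI: "complex_hilbert_space H \<Longrightarrow> complex_hilbert_space K \<Longrightarrow> hilbert_pair H K"
  by (simp add: hilbert_pair_def)

section \<open>Adjoints and the completeness of \<open>B(H, K)\<close>\<close>

context hilbert_pair
begin

lemma hilbert_pair_flip: "hilbert_pair K H"
  by (simp add: hilbert_pair_def H.complex_hilbert_space_axioms K.complex_hilbert_space_axioms)

lemma adj_exists:
  assumes a: "a \<in> carrier (bop H K)"
  shows "\<exists>b\<in>carrier (bop K H). \<forall>x\<in>carrier H. \<forall>y\<in>carrier K. cinner K (a x) y = cinner H x (b y)"
proof -
  interpret F: hilbert_pair K H by (rule hilbert_pair_flip)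
  obtain C where C: "C > 0" "\<And>x. x \<in> carrier H \<Longrightarrow> hnorm K (a x) \<le> C * hnorm H x"
    by (rule bop_bound[OF a]) blast
  have "\<exists>b\<in>carrier (bop K H). \<forall>y\<in>carrier K. \<forall>x\<in>carrier H. Re (cinner H (b y) x) = Re (cinner K y (a x))"
  proof (rule F.bop_of_form[where C = C])
    fix y x assume "y \<in> carrier K" "x \<in> carrier H"
    then show "Re (cinner K y (a x)) \<le> C * hnorm K y * hnorm H x"
      using K.Re_cinner_le_mult[of y "a x"] a mult_left_mono[OF C(2)[of x], of "hnorm K y"]
      by (simp add: algebra_simps)
  qed (use a C in \<open>auto simp: K.cinner_simps\<close>)
  then obtain b where b: "b\<in>carrier (bop K H)"
    "\<And>y x. y \<in> carrier K \<Longrightarrow> x \<in> carrier H \<Longrightarrow> Re (cinner H (b y) x) = Re (cinner K y (a x))" by blast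
  have "cinner K (a x) y = cinner H x (b y)" if "x \<in> carrier H" "y \<in> carrier K" for x y
  proof (intro Re_cinner_imp_cinner a b(1) that)
    fix x y assume xy: "x \<in> carrier H" "y \<in> carrier K"
    then show "Re (cinner K (a x) y) = Re (cinner H x (b y))"
      using b(2)[OF xy(2,1)] K.Re_cinner_sym[of "a x" y] H.Re_cinner_sym[of x "b y"] a F.bop_closed[OF b(1)] by simp
  qed
  then show ?thesis using b by blast
qed

lemma adj_eqI:
  assumes a: "a \<in> carrier (bop H K)" and b: "b \<in> carrier (bop K H)"
    and eq: "\<And>x y. x \<in> carrier H \<Longrightarrow> y \<in> carrier K \<Longrightarrow> cinner K (a x) y = cinner H x (b y)"
  shows "adj H K a = b"
  unfolding adj_def
proof (rule the_equality)
  interpret F: hilbert_pair K H by (rule hilbert_pair_flip)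
  fix c assume c: "c \<in> carrier (bop K H) \<and> (\<forall>x\<in>carrier H. \<forall>y\<in>carrier K. cinner K (a x) y = cinner H x (c y))"
  show "c = b"
  proof (rule F.bop_eqI)
    fix y x assume "y \<in> carrier K" "x \<in> carrier H"
    then show "Re (cinner H (c y) x) = Re (cinner H (b y) x)"
      using c eq b by (metis F.bop_closed H.Re_cinner_sym)
  qed (use c b in auto)
qed (use assms in auto)

lemma
  assumes "a \<in> carrier (bop H K)"
  shows adj_closed [simp]: "adj H K a \<in> carrier (bop K H)"
    and cinner_adj_right: "x \<in> carrier H \<Longrightarrow> y \<in> carrier K \<Longrightarrow> cinner H x (adj H K a y) = cinner K (a x) y"
proof -
  obtain b where "b \<in> carrier (bop K H)"
      "\<And>x y. x \<in> carrier H \<Longrightarrow> y \<in> carrier K \<Longrightarrow> cinner K (a x) y = cinner H x (b y)"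
    using adj_exists[OF assms] by blast
  with adj_eqI[OF assms this] show "adj H K a \<in> carrier (bop K H)"
     "x \<in> carrier H \<Longrightarrow> y \<in> carrier K \<Longrightarrow> cinner H x (adj H K a y) = cinner K (a x) y" by auto
qed

lemma adj_apply_closed [simp]:
  "a \<in> carrier (bop H K) \<Longrightarrow> y \<in> carrier K \<Longrightarrow> adj H K a y \<in> carrier H"
  using hilbert_pair.bop_closed[OF hilbert_pair_flip adj_closed] by blast

lemma cinner_adj_left:
  assumes "a \<in> carrier (bop H K)" "x \<in> carrier H" "y \<in> carrier K"
  shows "cinner H (adj H K a y) x = cinner K y (a x)"
  using assms cinner_adj_right[OF assms] H.cinner_commute[of "adj H K a y" x] K.cinner_commute[of y "a x"] by simp

lemma cinner_bop_adj_same: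
  assumes "a \<in> carrier (bop H K)" "u \<in> carrier K"
  shows "cinner K (a (adj H K a u)) u = complex_of_real ((hnorm H (adj H K a u))\<^sup>2)"
    "cinner K u (a (adj H K a u)) = complex_of_real ((hnorm H (adj H K a u))\<^sup>2)"
  using assms H.cinner_same[of "adj H K a u"] cinner_adj_right[of a "adj H K a u" u]
    cinner_adj_left[of a "adj H K a u" u] by simp_all

text \<open>Needed because the estimate behind the contractivity of triple morphisms concerns
  \<open>a a\<^sup>*\<close>, hence the vectors \<open>adj H K a y\<close> and not
  \<open>a x\<close>.\<close>

lemma opnorm_le_adj:
  assumes a: "a \<in> carrier (bop H K)" and C: "0 \<le> C"
    "\<And>y. y \<in> carrier K \<Longrightarrow> hnorm H (adj H K a y) \<le> C * hnorm K y"
  shows "opnorm H K a \<le> C"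
proof (rule opnorm_le)
  fix x assume x: "x \<in> carrier H"
  show "hnorm K (a x) \<le> C * hnorm H x"
  proof (rule K.hnorm_le_if_cinner_le)
    fix y assume y: "y \<in> carrier K"
    have "Re (cinner K (a x) y) \<le> hnorm H x * hnorm H (adj H K a y)"
      using H.Re_cinner_le_mult[of x "adj H K a y"] a x y by (simp add: cinner_adj_right)
    also have "\<dots> \<le> hnorm H x * (C * hnorm K y)" using C(2)[OF y] x by (intro mult_left_mono) auto
    finally show "Re (cinner K (a x) y) \<le> C * hnorm H x * hnorm K y" by (simp add: mult_ac)
  qed (use a x C in auto)
qed (rule C)

lemma hnorm_adj_le:
  assumes a: "a \<in> carrier (bop H K)" and y: "y \<in> carrier K"
  shows "hnorm H (adj H K a y) \<le> opnorm H K a * hnorm K y"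
proof (rule H.hnorm_le_if_cinner_le)
  fix x assume x: "x \<in> carrier H"
  have "Re (cinner H (adj H K a y) x) \<le> hnorm K y * hnorm K (a x)"
    using K.Re_cinner_le_mult[of y "a x"] a x y by (simp add: cinner_adj_left)
  also have "\<dots> \<le> hnorm K y * (opnorm H K a * hnorm H x)"
    using hnorm_le_opnorm[OF a x] y by (intro mult_left_mono) auto
  finally show "Re (cinner H (adj H K a y) x) \<le> opnorm H K a * hnorm K y * hnorm H x" by (simp add: mult_ac)
qed (use a y in auto)

text \<open>The limit operator is assembled from the pointwise limits, which exist because
  \<open>K\<close> is complete; linearity and norm estimates are inherited weakly, through
  \<open>tendsto_cinner\<close>.\<close>

lemma bop_complete:
  assumes s: "\<And>n::nat. s n \<in> carrier (bop H K)"
    and cauchy: "\<And>e. e > 0 \<Longrightarrow> \<exists>N. \<forall>m\<ge>N. \<forall>n\<ge>N. opnorm H K (s m \<ominus>\<^bsub>bop H K\<^esub> s n) < e"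
  shows "\<exists>a\<in>carrier (bop H K). (\<lambda>n. opnorm H K (s n \<ominus>\<^bsub>bop H K\<^esub> a)) \<longlonglongrightarrow> 0"
proof -
  have pt: "hnorm K (s m x \<ominus>\<^bsub>K\<^esub> s n x) \<le> opnorm H K (s m \<ominus>\<^bsub>bop H K\<^esub> s n) * hnorm H x"
    if "x \<in> carrier H" for m n x
    using hnorm_le_opnorm[of "s m \<ominus>\<^bsub>bop H K\<^esub> s n" x] s that by simp
  have "\<exists>z\<in>carrier K. (\<lambda>n. hnorm K (s n x \<ominus>\<^bsub>K\<^esub> z)) \<longlonglongrightarrow> 0" if x: "x \<in> carrier H" for x
  proof (rule K.complete)
    show "\<forall>e>0. \<exists>N. \<forall>m\<ge>N. \<forall>n\<ge>N. hnorm K (s m x \<ominus>\<^bsub>K\<^esub> s n x) < e"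
    proof (intro allI impI)
      fix e :: real assume "e > 0"
      have hx: "hnorm H x \<ge> 0" using x by simp
      then have "e / (hnorm H x + 1) > 0" using \<open>e > 0\<close> by auto
      then obtain N where N: "\<And>m n. m \<ge> N \<Longrightarrow> n \<ge> N \<Longrightarrow> opnorm H K (s m \<ominus>\<^bsub>bop H K\<^esub> s n) < e / (hnorm H x + 1)"
        using cauchy by blast
      have "hnorm K (s m x \<ominus>\<^bsub>K\<^esub> s n x) < e" if "m \<ge> N" "n \<ge> N" for m n
      proof -
        have "hnorm K (s m x \<ominus>\<^bsub>K\<^esub> s n x) \<le> e / (hnorm H x + 1) * hnorm H x"
          using pt[OF x, of m n] N[OF that] mult_right_mono[OF less_imp_le hx] by fastforce
        also have "\<dots> < e" using \<open>e > 0\<close> hx by (simp add: field_simps)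
        finally show ?thesis .
      qed
      then show "\<exists>N. \<forall>m\<ge>N. \<forall>n\<ge>N. hnorm K (s m x \<ominus>\<^bsub>K\<^esub> s n x) < e" by blast
    qed
  qed (use s x in auto)
  then obtain a where a: "\<And>x. x \<in> carrier H \<Longrightarrow> a x \<in> carrier K"
    "\<And>x. x \<in> carrier H \<Longrightarrow> (\<lambda>n. hnorm K (s n x \<ominus>\<^bsub>K\<^esub> a x)) \<longlonglongrightarrow> 0" by metis
  have lim: "(\<lambda>n. cinner K (s n x) y) \<longlonglongrightarrow> cinner K (a x) y" if "x \<in> carrier H" "y \<in> carrier K" for x y
    using K.tendsto_cinner[of "\<lambda>n. s n x" "a x" y] s a that by auto
  \<comment> \<open>Letting \<open>m\<close> tend to infinity in the Cauchy estimate, after pairing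
    with \<open>y\<close>, turns it into an estimate for the distance to the limit. The same fact
    bounds the limit operator and shows convergence in norm.\<close>
  have tail: "hnorm K (s n x \<ominus>\<^bsub>K\<^esub> a x) \<le> e * hnorm H x"
    if "e > 0" and eN: "\<And>m n. m \<ge> N \<Longrightarrow> n \<ge> N \<Longrightarrow> opnorm H K (s m \<ominus>\<^bsub>bop H K\<^esub> s n) < e" and "n \<ge> N" "x \<in> carrier H" for e N n x
  proof (rule K.hnorm_le_if_cinner_le)
    fix y assume y: "y \<in> carrier K"
    show "Re (cinner K (s n x \<ominus>\<^bsub>K\<^esub> a x) y) \<le> e * hnorm H x * hnorm K y"
    proof (rule LIMSEQ_le_const2)
      show "(\<lambda>m. Re (cinner K (s n x) y - cinner K (s m x) y)) \<longlonglongrightarrow> Re (cinner K (s n x \<ominus>\<^bsub>K\<^esub> a x) y)"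
        using lim[OF that(4) y] s that a y by (auto simp: K.cinner_diff_left intro!: tendsto_intros)
      have "Re (cinner K (s n x) y - cinner K (s m x) y) \<le> e * hnorm H x * hnorm K y" if m: "m \<ge> N" for m
      proof -
        have "Re (cinner K (s n x) y - cinner K (s m x) y) \<le> hnorm K (s n x \<ominus>\<^bsub>K\<^esub> s m x) * hnorm K y"
          using K.Re_cinner_le_mult[of "s n x \<ominus>\<^bsub>K\<^esub> s m x" y] s \<open>x \<in> carrier H\<close> y by (simp add: K.cinner_diff_left)
        also have "\<dots> \<le> e * hnorm H x * hnorm K y"
          using y \<open>x \<in> carrier H\<close> less_imp_le[OF eN[OF \<open>n \<ge> N\<close> m]]
          by (intro mult_right_mono order_trans[OF pt[OF \<open>x \<in> carrier H\<close>]]) simp_all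
        finally show ?thesis .
      qed
      then show "\<exists>N. \<forall>m\<ge>N. Re (cinner K (s n x) y - cinner K (s m x) y) \<le> e * hnorm H x * hnorm K y" by blast
    qed
  qed (use that s a in auto)
  obtain N1 where N1: "\<And>m n. m \<ge> N1 \<Longrightarrow> n \<ge> N1 \<Longrightarrow> opnorm H K (s m \<ominus>\<^bsub>bop H K\<^esub> s n) < 1"
    using cauchy[of 1] by auto
  have aB: "restrict a (carrier H) \<in> carrier (bop H K)"
  proof (rule bopI[where C = "opnorm H K (s N1) + 1"])
    fix x assume x: "x \<in> carrier H"
    have "hnorm K (a x) \<le> hnorm K (s N1 x) + hnorm K (s N1 x \<ominus>\<^bsub>K\<^esub> a x)"
    proof -
      have "a x = s N1 x \<oplus>\<^bsub>K\<^esub> \<ominus>\<^bsub>K\<^esub> (s N1 x \<ominus>\<^bsub>K\<^esub> a x)"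
        using a s x by (intro K.cinner_eqI) (auto simp: K.cinner_simps)
      then show ?thesis
        using K.hnorm_triangle[of "s N1 x" "\<ominus>\<^bsub>K\<^esub> (s N1 x \<ominus>\<^bsub>K\<^esub> a x)"] a s x by simp
    qed
    also have "\<dots> \<le> opnorm H K (s N1) * hnorm H x + 1 * hnorm H x"
      using tail[of 1 N1 N1 x] N1 x s by (intro add_mono hnorm_le_opnorm) auto
    finally show "hnorm K (restrict a (carrier H) x) \<le> (opnorm H K (s N1) + 1) * hnorm H x"
      using x by (simp add: algebra_simps)
    fix c
    show "restrict a (carrier H) (c \<odot>\<^bsub>H\<^esub> x) = c \<odot>\<^bsub>K\<^esub> restrict a (carrier H) x"
    proof (rule K.cinner_eqI)
      fix y assume y: "y \<in> carrier K"
      have "(\<lambda>n. c * cinner K (s n x) y) \<longlonglongrightarrow> cinner K (a (c \<odot>\<^bsub>H\<^esub> x)) y"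
        using lim[of "c \<odot>\<^bsub>H\<^esub> x" y] x y s by (simp add: K.cinner_simps)
      moreover have "(\<lambda>n. c * cinner K (s n x) y) \<longlonglongrightarrow> c * cinner K (a x) y"
        using lim[OF x y] by (intro tendsto_intros)
      ultimately show "Re (cinner K (restrict a (carrier H) (c \<odot>\<^bsub>H\<^esub> x)) y) =
          Re (cinner K (c \<odot>\<^bsub>K\<^esub> restrict a (carrier H) x) y)"
        using LIMSEQ_unique x y a by (fastforce simp: K.cinner_simps)
    qed (use a x in auto)
    fix x' assume x': "x' \<in> carrier H"
    show "restrict a (carrier H) (x \<oplus>\<^bsub>H\<^esub> x') = restrict a (carrier H) x \<oplus>\<^bsub>K\<^esub> restrict a (carrier H) x'"
    proof (rule K.cinner_eqI)
      fix y assume y: "y \<in> carrier K"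
      have "(\<lambda>n. cinner K (s n x) y + cinner K (s n x') y) \<longlonglongrightarrow> cinner K (a (x \<oplus>\<^bsub>H\<^esub> x')) y"
        using lim[of "x \<oplus>\<^bsub>H\<^esub> x'" y] x x' y s by (simp add: K.cinner_simps)
      moreover have "(\<lambda>n. cinner K (s n x) y + cinner K (s n x') y) \<longlonglongrightarrow> cinner K (a x) y + cinner K (a x') y"
        using lim[OF x y] lim[OF x' y] by (intro tendsto_intros)
      ultimately show "Re (cinner K (restrict a (carrier H) (x \<oplus>\<^bsub>H\<^esub> x')) y) =
          Re (cinner K (restrict a (carrier H) x \<oplus>\<^bsub>K\<^esub> restrict a (carrier H) x') y)"
        using LIMSEQ_unique x x' y a by (fastforce simp: K.cinner_simps)
    qed (use a x x' in auto)
  qed (use a in auto)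
  have "(\<lambda>n. opnorm H K (s n \<ominus>\<^bsub>bop H K\<^esub> restrict a (carrier H))) \<longlonglongrightarrow> 0"
  proof (rule LIMSEQ_I)
    fix e :: real assume e: "e > 0"
    then obtain N where N: "\<And>m n. m \<ge> N \<Longrightarrow> n \<ge> N \<Longrightarrow> opnorm H K (s m \<ominus>\<^bsub>bop H K\<^esub> s n) < e / 2"
      using cauchy[of "e / 2"] by auto
    have "opnorm H K (s n \<ominus>\<^bsub>bop H K\<^esub> restrict a (carrier H)) \<le> e / 2" if "n \<ge> N" for n
      using tail[of "e / 2" N n] e N that s aB by (intro opnorm_le) auto
    moreover have "opnorm H K (s n \<ominus>\<^bsub>bop H K\<^esub> restrict a (carrier H)) \<ge> 0" for n
      using s aB by simp
    ultimately have "norm (opnorm H K (s n \<ominus>\<^bsub>bop H K\<^esub> restrict a (carrier H)) - 0) < e" if "n \<ge> N" for n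
      using that e by (smt (verit) field_sum_of_halves real_norm_def)
    then show "\<exists>N. \<forall>n\<ge>N. norm (opnorm H K (s n \<ominus>\<^bsub>bop H K\<^esub> restrict a (carrier H)) - 0) < e" by blast
  qed
  then show ?thesis using aB by blast
qed

end

section \<open>Triple morphisms\<close>

lemma bop_compose:
  assumes "hilbert_pair H K" "hilbert_pair K L" "a \<in> carrier (bop K L)" "b \<in> carrier (bop H K)"
  shows "compose (carrier H) a b \<in> carrier (bop H L)"
proof -
  interpret HK: hilbert_pair H K by fact
  interpret KL: hilbert_pair K L by fact
  interpret HL: hilbert_pair H L
    by (rule hilbert_pairI[OF HK.H.complex_hilbert_space_axioms KL.K.complex_hilbert_space_axioms])
  show ?thesis
  proof (rule HL.bopI[where C = "opnorm K L a * opnorm H K b"])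
    fix x assume x: "x \<in> carrier H"
    show "hnorm L (compose (carrier H) a b x) \<le> opnorm K L a * opnorm H K b * hnorm H x"
      using KL.hnorm_le_opnorm[OF assms(3), of "b x"]
        mult_left_mono[OF HK.hnorm_le_opnorm[OF assms(4) x] KL.opnorm_nonneg[OF assms(3)]] x assms
      by (simp add: compose_eq mult.assoc)
  qed (use assms in \<open>auto simp: compose_eq\<close>)
qed

context hilbert_pair
begin

lemma operator_spaceD:
  assumes "operator_space H K X"
  shows "a \<in> X \<Longrightarrow> a \<in> carrier (bop H K)" "\<zero>\<^bsub>bop H K\<^esub> \<in> X"
    "a \<in> X \<Longrightarrow> b \<in> X \<Longrightarrow> a \<oplus>\<^bsub>bop H K\<^esub> b \<in> X" "a \<in> X \<Longrightarrow> c \<odot>\<^bsub>bop H K\<^esub> a \<in> X"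
    "a \<in> X \<Longrightarrow> b \<in> X \<Longrightarrow> a \<ominus>\<^bsub>bop H K\<^esub> b \<in> X"
proof -
  interpret X: submodule X complex_field "bop H K"
    using assms by (simp add: operator_space_def)
  show 1: "a \<in> X \<Longrightarrow> a \<in> carrier (bop H K)" for a using X.subset by auto
  show "\<zero>\<^bsub>bop H K\<^esub> \<in> X" using X.one_closed by simp
  show 2: "a \<in> X \<Longrightarrow> b \<in> X \<Longrightarrow> a \<oplus>\<^bsub>bop H K\<^esub> b \<in> X" for a b using X.m_closed by simp
  show 3: "a \<in> X \<Longrightarrow> c \<odot>\<^bsub>bop H K\<^esub> a \<in> X" for a c by simp
  show "a \<in> X \<Longrightarrow> b \<in> X \<Longrightarrow> a \<ominus>\<^bsub>bop H K\<^esub> b \<in> X"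
    using 1 2 3[of b "-1"] by (simp add: B.minus_eq B.csmult_minus_one)
qed

lemma operator_spaceI:
  assumes "X \<subseteq> carrier (bop H K)" "\<zero>\<^bsub>bop H K\<^esub> \<in> X" "\<And>a b. a \<in> X \<Longrightarrow> b \<in> X \<Longrightarrow> a \<oplus>\<^bsub>bop H K\<^esub> b \<in> X"
    "\<And>c a. a \<in> X \<Longrightarrow> c \<odot>\<^bsub>bop H K\<^esub> a \<in> X"
  shows "operator_space H K X"
proof -
  have "\<ominus>\<^bsub>bop H K\<^esub> a \<in> X" if "a \<in> X" for a
    using assms(4)[of a "-1"] that assms(1) by (auto simp: B.csmult_minus_one)
  then show ?thesis
    using assms unfolding operator_space_def submodule_def submodule_axioms_def
    by (auto intro!: subgroup.intro simp flip: a_inv_def)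
qed

lemma tprod_closed [simp]:
  assumes "a \<in> carrier (bop H K)" "b \<in> carrier (bop H K)" "c \<in> carrier (bop H K)"
  shows "tprod H K a b c \<in> carrier (bop H K)"
proof -
  note HH = hilbert_pairI[OF H.complex_hilbert_space_axioms H.complex_hilbert_space_axioms]
  show ?thesis unfolding tprod_def
    by (rule bop_compose[OF HH hilbert_pair_axioms assms(1)])
      (rule bop_compose[OF hilbert_pair_axioms hilbert_pair_flip _ assms(3)], simp add: assms)
qed

lemma tprod_apply [simp]:
  "x \<in> carrier H \<Longrightarrow> tprod H K a b c x = a (adj H K b (c x))"
  by (simp add: tprod_def compose_eq)

lemma norm_closedD:
  assumes "norm_closed H K S" "\<And>n::nat. s n \<in> S" "t \<in> carrier (bop H K)"
    "(\<lambda>n. opnorm H K (s n \<ominus>\<^bsub>bop H K\<^esub> t)) \<longlonglongrightarrow> 0"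
  shows "t \<in> S"
  using assms unfolding norm_closed_def by blast

text \<open>The contraction principle in \<open>T\<close>, which is complete as a norm closed
  subspace of the complete space \<open>B(H, K)\<close>. What matters is that the fixed point lies
  in \<open>T\<close>, where a triple morphism can be applied to it.\<close>

lemma tro_fixed_point:
  assumes T: "tro H K T" and z: "z \<in> T" and F: "\<And>u. u \<in> T \<Longrightarrow> F u \<in> T"
    and k: "0 \<le> k" "k < 1"
    and lip: "\<And>u v. u \<in> T \<Longrightarrow> v \<in> T \<Longrightarrow>
      opnorm H K (F u \<ominus>\<^bsub>bop H K\<^esub> F v) \<le> k * opnorm H K (u \<ominus>\<^bsub>bop H K\<^esub> v)"
  shows "\<exists>y\<in>T. F y = y"
proof -
  have os: "operator_space H K T" and cl: "norm_closed H K T" using T by (auto simp: tro_def)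
  note T_closed [simp] = operator_spaceD(1)[OF os]
  define y where "y n = (F ^^ n) z" for n
  have yT [simp]: "y n \<in> T" for n unfolding y_def by (induction n) (auto simp: z F)
  have y_Suc: "y (Suc n) = F (y n)" for n by (simp add: y_def)
  define d where "d = opnorm H K (y 1 \<ominus>\<^bsub>bop H K\<^esub> y 0)"
  have d: "d \<ge> 0" by (simp add: d_def)
  have step: "opnorm H K (y (Suc n) \<ominus>\<^bsub>bop H K\<^esub> y n) \<le> k ^ n * d" for n
  proof (induction n)
    case (Suc n)
    have "opnorm H K (y (Suc (Suc n)) \<ominus>\<^bsub>bop H K\<^esub> y (Suc n)) \<le> k * opnorm H K (y (Suc n) \<ominus>\<^bsub>bop H K\<^esub> y n)"
      unfolding y_Suc[of "Suc n"] y_Suc[of n] by (intro lip F yT)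
    also have "\<dots> \<le> k * (k ^ n * d)" using Suc k by (intro mult_left_mono) auto
    finally show ?case by (simp add: mult_ac)
  qed (simp add: d_def)
  \<comment> \<open>The partial sum of the geometric series is kept exact, factor
    \<open>1 - k ^ m\<close> included, so that the induction on \<open>m\<close> closes.\<close>
  have dist: "opnorm H K (y (n + m) \<ominus>\<^bsub>bop H K\<^esub> y n) \<le> k ^ n * d / (1 - k) * (1 - k ^ m)" for n m
  proof (induction m)
    case 0
    then show ?case by (simp add: B.minus_eq B.r_neg)
  next
    case (Suc m)
    have "opnorm H K (y (n + Suc m) \<ominus>\<^bsub>bop H K\<^esub> y n) \<le>
        opnorm H K (y (Suc (n + m)) \<ominus>\<^bsub>bop H K\<^esub> y (n + m)) + opnorm H K (y (n + m) \<ominus>\<^bsub>bop H K\<^esub> y n)"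
      using opnorm_diff_triangle[of "y (Suc (n + m))" "y (n + m)" "y n"] by simp
    also have "\<dots> \<le> k ^ (n + m) * d + k ^ n * d / (1 - k) * (1 - k ^ m)"
      by (intro add_mono step Suc)
    also have "\<dots> = k ^ n * d / (1 - k) * (1 - k ^ Suc m)"
      using k by (simp add: field_simps power_add)
    finally show ?case .
  qed
  have dist': "opnorm H K (y (n + m) \<ominus>\<^bsub>bop H K\<^esub> y n) \<le> k ^ n * (d / (1 - k))" for n m
  proof -
    have "k ^ n * (d / (1 - k)) * (1 - k ^ m) \<le> k ^ n * (d / (1 - k))"
      using k d by (intro mult_left_le) auto
    then show ?thesis using dist[of n m] by simp
  qed
  have lim0: "(\<lambda>n. k ^ n * (d / (1 - k))) \<longlonglongrightarrow> 0"
    using k by (intro tendsto_mult_left_zero LIMSEQ_power_zero) auto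
  have "\<exists>a\<in>carrier (bop H K). (\<lambda>n. opnorm H K (y n \<ominus>\<^bsub>bop H K\<^esub> a)) \<longlonglongrightarrow> 0"
  proof (rule bop_complete)
    fix e :: real assume "e > 0"
    then have "\<forall>\<^sub>F n in sequentially. k ^ n * (d / (1 - k)) < e" using lim0 by (auto dest: order_tendstoD)
    then obtain N where N: "\<And>n. n \<ge> N \<Longrightarrow> k ^ n * (d / (1 - k)) < e" by (auto simp: eventually_sequentially)
    have lt: "opnorm H K (y m \<ominus>\<^bsub>bop H K\<^esub> y n) < e" if "n \<ge> N" "m \<ge> n" for m n
      using dist'[of n "m - n"] N[OF that(1)] that(2) by simp
    have "opnorm H K (y m \<ominus>\<^bsub>bop H K\<^esub> y n) < e" if "n \<ge> N" "m \<ge> N" for m n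
      using lt[of n m] lt[of m n] that opnorm_minus_commute[of "y m" "y n"] by (cases "m \<ge> n") auto
    then show "\<exists>N. \<forall>m\<ge>N. \<forall>n\<ge>N. opnorm H K (y m \<ominus>\<^bsub>bop H K\<^esub> y n) < e" by blast
  qed simp
  then obtain a where a: "a \<in> carrier (bop H K)" "(\<lambda>n. opnorm H K (y n \<ominus>\<^bsub>bop H K\<^esub> a)) \<longlonglongrightarrow> 0" by blast
  have aT [simp]: "a \<in> T" by (rule norm_closedD[OF cl yT a])
  have "opnorm H K (F a \<ominus>\<^bsub>bop H K\<^esub> a) \<le> k * opnorm H K (y n \<ominus>\<^bsub>bop H K\<^esub> a) + opnorm H K (y (Suc n) \<ominus>\<^bsub>bop H K\<^esub> a)" for n
    using opnorm_diff_triangle[of "F a" "F (y n)" a] lip[of a "y n"] F[of a] F[of "y n"] a(1)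
      opnorm_minus_commute[of a "y n"] by (simp add: y_Suc)
  then have "opnorm H K (F a \<ominus>\<^bsub>bop H K\<^esub> a) \<le> 0"
    by (intro LIMSEQ_le_const[of "\<lambda>n. k * opnorm H K (y n \<ominus>\<^bsub>bop H K\<^esub> a) + opnorm H K (y (Suc n) \<ominus>\<^bsub>bop H K\<^esub> a)"])
      (auto intro!: tendsto_eq_intros a(2) LIMSEQ_Suc[OF a(2)])
  then have "F a \<ominus>\<^bsub>bop H K\<^esub> a = \<zero>\<^bsub>bop H K\<^esub>"
    using F a(1) by (intro opnorm_eq_0 antisym) auto
  then have "F a = a"
    using F[OF aT] a(1) B.diff_eq_0_iff by simp
  then show ?thesis using aT by blast
qed

end

section \<open>Norm estimates for triple morphisms\<close>

locale tro_morphism = D: hilbert_pair H0 K0 + C: hilbert_pair H K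
  for H0 :: "'a inner_space" and K0 :: "'b inner_space" and H :: "'c inner_space" and K :: "'d inner_space" +
  fixes T :: "('a \<Rightarrow> 'b) set" and \<pi> :: "('a \<Rightarrow> 'b) \<Rightarrow> ('c \<Rightarrow> 'd)"
  assumes tro: "tro H0 K0 T" and triple: "triple_morphism H0 K0 T H K \<pi>"
begin

lemma operator_space_T: "operator_space H0 K0 T" using tro by (simp add: tro_def)
lemma norm_closed_T: "norm_closed H0 K0 T" using tro by (simp add: tro_def)

lemmas T_closed [simp] = D.operator_spaceD[OF operator_space_T]

lemma tprod_T [simp]: "x \<in> T \<Longrightarrow> y \<in> T \<Longrightarrow> z \<in> T \<Longrightarrow> tprod H0 K0 x y z \<in> T"
  using tro by (simp add: tro_def)

lemma \<pi>_closed [simp]: "x \<in> T \<Longrightarrow> \<pi> x \<in> carrier (bop H K)"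
  and \<pi>_add [simp]: "x \<in> T \<Longrightarrow> y \<in> T \<Longrightarrow> \<pi> (x \<oplus>\<^bsub>bop H0 K0\<^esub> y) = \<pi> x \<oplus>\<^bsub>bop H K\<^esub> \<pi> y"
  and \<pi>_smult [simp]: "x \<in> T \<Longrightarrow> \<pi> (c \<odot>\<^bsub>bop H0 K0\<^esub> x) = c \<odot>\<^bsub>bop H K\<^esub> \<pi> x"
  and \<pi>_tprod [simp]: "x \<in> T \<Longrightarrow> y \<in> T \<Longrightarrow> z \<in> T \<Longrightarrow> \<pi> (tprod H0 K0 x y z) = tprod H K (\<pi> x) (\<pi> y) (\<pi> z)"
  using triple by (auto simp: triple_morphism_def clinear_on_def)

lemma \<pi>_diff [simp]:
  assumes "x \<in> T" "y \<in> T" shows "\<pi> (x \<ominus>\<^bsub>bop H0 K0\<^esub> y) = \<pi> x \<ominus>\<^bsub>bop H K\<^esub> \<pi> y"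
proof -
  have "\<pi> (x \<oplus>\<^bsub>bop H0 K0\<^esub> (-1) \<odot>\<^bsub>bop H0 K0\<^esub> y) = \<pi> x \<oplus>\<^bsub>bop H K\<^esub> (-1) \<odot>\<^bsub>bop H K\<^esub> \<pi> y"
    using assms by (simp del: D.B.csmult_minus_one)
  then show ?thesis using assms by (simp add: D.B.minus_eq C.B.minus_eq D.B.csmult_minus_one C.B.csmult_minus_one)
qed

lemma \<pi>_zero [simp]: "\<pi> \<zero>\<^bsub>bop H0 K0\<^esub> = \<zero>\<^bsub>bop H K\<^esub>"
  using \<pi>_smult[of "\<zero>\<^bsub>bop H0 K0\<^esub>" 0] D.B.csmult_zero[of "\<zero>\<^bsub>bop H0 K0\<^esub>"] by (simp del: \<pi>_smult)

text \<open>
  If the norm \<open>\<lambda>\<close> of \<open>a = \<pi> x\<close> exceeded that of \<open>x\<close>, then with \<open>s = 1 / \<lambda>\<^sup>2\<close> the equation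
  \<open>y = x + s x x\<^sup>* y\<close> would have a solution in \<open>T\<close>. Applying \<open>\<pi>\<close> inverts \<open>1 - s a a\<^sup>*\<close>,
  although \<open>\<lambda>\<^sup>2\<close> is an approximate eigenvalue of \<open>a a\<^sup>*\<close>.
\<close>

lemma contractive:
  assumes x: "x \<in> T"
  shows "opnorm H K (\<pi> x) \<le> opnorm H0 K0 x"
proof (rule ccontr)
  assume neg: "\<not> ?thesis"
  define l where "l = opnorm H K (\<pi> x)"
  define s where "s = 1 / l\<^sup>2"
  have n0: "opnorm H0 K0 x \<ge> 0" using x by simp
  have l: "opnorm H0 K0 x < l" "l > 0" using neg n0 by (auto simp: l_def)
  have s: "s > 0" "s * l\<^sup>2 = 1" using l by (auto simp: s_def)
  define F where "F y = x \<oplus>\<^bsub>bop H0 K0\<^esub> complex_of_real s \<odot>\<^bsub>bop H0 K0\<^esub> tprod H0 K0 x x y" for y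
  have "\<exists>y\<in>T. F y = y"
  proof (rule D.tro_fixed_point[OF tro x])
    show "0 \<le> s * (opnorm H0 K0 x)\<^sup>2" using s by simp
    have "(opnorm H0 K0 x)\<^sup>2 < l\<^sup>2" using l n0 by (intro power_strict_mono) auto
    then show "s * (opnorm H0 K0 x)\<^sup>2 < 1" using s by (metis mult_strict_left_mono)
    fix u v assume uv: "u \<in> T" "v \<in> T"
    show "opnorm H0 K0 (F u \<ominus>\<^bsub>bop H0 K0\<^esub> F v) \<le> s * (opnorm H0 K0 x)\<^sup>2 * opnorm H0 K0 (u \<ominus>\<^bsub>bop H0 K0\<^esub> v)"
    proof (rule D.opnorm_le)
      fix w assume w: "w \<in> carrier H0"
      let ?d = "u w \<ominus>\<^bsub>K0\<^esub> v w"
      have "(F u \<ominus>\<^bsub>bop H0 K0\<^esub> F v) w = complex_of_real s \<odot>\<^bsub>K0\<^esub> x (adj H0 K0 x ?d)"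
        using x uv w by (intro D.K.cinner_eqI)
          (simp_all add: F_def D.K.cinner_simps right_diff_distrib hilbert_pair.bop_diff[OF D.hilbert_pair_flip])
      also have "hnorm K0 \<dots> \<le> s * (opnorm H0 K0 x * (opnorm H0 K0 x * hnorm K0 ?d))"
        using s x uv w n0 D.hnorm_le_opnorm[of x "adj H0 K0 x ?d"]
          mult_left_mono[OF D.hnorm_adj_le[of x ?d] n0]
        by (simp add: mult_left_mono)
      also have "\<dots> \<le> s * (opnorm H0 K0 x * (opnorm H0 K0 x * (opnorm H0 K0 (u \<ominus>\<^bsub>bop H0 K0\<^esub> v) * hnorm H0 w)))"
        using D.hnorm_le_opnorm[of "u \<ominus>\<^bsub>bop H0 K0\<^esub> v" w] uv w s n0 by (intro mult_left_mono) auto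
      finally show "hnorm K0 ((F u \<ominus>\<^bsub>bop H0 K0\<^esub> F v) w) \<le>
          s * (opnorm H0 K0 x)\<^sup>2 * opnorm H0 K0 (u \<ominus>\<^bsub>bop H0 K0\<^esub> v) * hnorm H0 w"
        by (simp add: power2_eq_square mult_ac)
    qed (use s uv in simp)
  qed (use x in \<open>simp add: F_def\<close>)
  then obtain y where y: "y \<in> T" "F y = y" by blast
  define a b where "a = \<pi> x" and "b = \<pi> y"
  have ab [simp]: "a \<in> carrier (bop H K)" "b \<in> carrier (bop H K)" using x y by (auto simp: a_def b_def)
  have "\<pi> y = \<pi> (F y)" by (simp add: y(2))
  then have "b = a \<oplus>\<^bsub>bop H K\<^esub> complex_of_real s \<odot>\<^bsub>bop H K\<^esub> tprod H K a a b"
    using x y(1) by (simp add: F_def a_def b_def)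
  then have b_eq: "b v = a v \<oplus>\<^bsub>K\<^esub> complex_of_real s \<odot>\<^bsub>K\<^esub> a (adj H K a (b v))" if "v \<in> carrier H" for v
    using that ab by (metis C.add_apply C.smult_apply C.tprod_apply)
  \<comment> \<open>\<open>D\<close> bounds the norm of \<open>1 + s a b\<^sup>*\<close>, which the
    identity below shows to be a left inverse of \<open>1 - s a a\<^sup>*\<close>.\<close>
  define D where "D = 1 + s * (l * opnorm H K b)"
  have D: "D \<ge> 1" using s l by (simp add: D_def)
  \<comment> \<open>Two estimates for \<open>u' = u - s a a\<^sup>* u\<close> are combined:
    invertibility bounds its norm below by \<open>\<parallel>u\<parallel> / D\<close>, and expanding
    the square with \<open>s l\<^sup>2 = 1\<close> bounds
    \<open>\<parallel>u'\<parallel>\<^sup>2\<close> above by \<open>\<parallel>u\<parallel>\<^sup>2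
    - s \<parallel>a\<^sup>* u\<parallel>\<^sup>2\<close>. Together they keep
    \<open>\<parallel>a\<^sup>* u\<parallel>\<close> below \<open>l \<parallel>u\<parallel>\<close>
    by a fixed factor.\<close>
  have main: "(hnorm H (adj H K a u))\<^sup>2 \<le> l\<^sup>2 * (1 - 1 / D\<^sup>2) * (hnorm K u)\<^sup>2" if u [simp]: "u \<in> carrier K" for u
  proof -
    define u' where "u' = u \<ominus>\<^bsub>K\<^esub> complex_of_real s \<odot>\<^bsub>K\<^esub> a (adj H K a u)"
    have u' [simp]: "u' \<in> carrier K" by (simp add: u'_def)
    \<comment> \<open>This rests on \<open>b\<^sup>* u' = a\<^sup>* u\<close>, the adjoint of the
      equation for \<open>b\<close>.\<close>
    have "u = u' \<oplus>\<^bsub>K\<^esub> complex_of_real s \<odot>\<^bsub>K\<^esub> a (adj H K b u')"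
    proof (rule C.K.cinner_eqI)
      fix z assume z [simp]: "z \<in> carrier K"
      let ?v = "adj H K a z"
      have "cinner K (a (adj H K b u')) z = cinner K u' (b ?v)"
        by (simp add: C.cinner_adj_left flip: C.cinner_adj_right)
      also have "\<dots> = cinner K u (b ?v) - s * cinner K (a (adj H K a u)) (b ?v)"
        by (simp add: u'_def C.K.cinner_simps)
      also have "cinner K (a (adj H K a u)) (b ?v) = cinner K u (a (adj H K a (b ?v)))"
        by (simp add: C.cinner_adj_left flip: C.cinner_adj_right)
      also have "cinner K u (b ?v) - s * cinner K u (a (adj H K a (b ?v))) = cinner K u (a ?v)"
        by (subst b_eq) (simp_all add: C.K.cinner_simps)
      also have "\<dots> = cinner K (a (adj H K a u)) z"
        by (simp add: C.cinner_adj_left flip: C.cinner_adj_right)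
      finally show "Re (cinner K u z) = Re (cinner K (u' \<oplus>\<^bsub>K\<^esub> complex_of_real s \<odot>\<^bsub>K\<^esub> a (adj H K b u')) z)"
        by (simp add: C.K.cinner_simps) (simp add: u'_def C.K.cinner_simps)
    qed simp_all
    then have "hnorm K u \<le> hnorm K u' + hnorm K (complex_of_real s \<odot>\<^bsub>K\<^esub> a (adj H K b u'))"
      using C.K.hnorm_triangle[of u' "complex_of_real s \<odot>\<^bsub>K\<^esub> a (adj H K b u')"] by simp
    also have "hnorm K (complex_of_real s \<odot>\<^bsub>K\<^esub> a (adj H K b u')) = s * hnorm K (a (adj H K b u'))"
      using s by simp
    also have "\<dots> \<le> s * (l * hnorm H (adj H K b u'))"
      using s C.hnorm_le_opnorm[of a "adj H K b u'"] unfolding l_def a_def[symmetric]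
      by (intro mult_left_mono) auto
    also have "\<dots> \<le> s * (l * (opnorm H K b * hnorm K u'))"
      using s l by (intro mult_left_mono C.hnorm_adj_le) auto
    finally have "hnorm K u \<le> D * hnorm K u'" by (simp add: D_def algebra_simps)
    then have "(hnorm K u)\<^sup>2 \<le> (D * hnorm K u')\<^sup>2" by (intro power_mono) auto
    then have 1: "(hnorm K u)\<^sup>2 \<le> D\<^sup>2 * (hnorm K u')\<^sup>2" by (simp add: power_mult_distrib)
    have "hnorm K (a (adj H K a u)) \<le> l * hnorm H (adj H K a u)"
      using C.hnorm_le_opnorm[of a "adj H K a u"] unfolding l_def a_def[symmetric] by simp
    then have "(hnorm K (a (adj H K a u)))\<^sup>2 \<le> (l * hnorm H (adj H K a u))\<^sup>2"
      by (intro power_mono) auto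
    then have "s\<^sup>2 * (hnorm K (a (adj H K a u)))\<^sup>2 \<le> s\<^sup>2 * (l * hnorm H (adj H K a u))\<^sup>2"
      by (intro mult_left_mono) auto
    also have "\<dots> = s * (hnorm H (adj H K a u))\<^sup>2" using s by (simp add: power2_eq_square mult_ac)
    finally have 2: "s\<^sup>2 * (hnorm K (a (adj H K a u)))\<^sup>2 \<le> s * (hnorm H (adj H K a u))\<^sup>2" .
    have "cinner K (a (adj H K a u)) u = complex_of_real ((hnorm H (adj H K a u))\<^sup>2)"
      by (simp add: C.cinner_bop_adj_same)
    moreover have "cinner K u (a (adj H K a u)) = complex_of_real ((hnorm H (adj H K a u))\<^sup>2)"
      by (simp add: C.cinner_bop_adj_same)
    ultimately have "(hnorm K u')\<^sup>2 = (hnorm K u)\<^sup>2 - 2 * s * (hnorm H (adj H K a u))\<^sup>2 + s\<^sup>2 * (hnorm K (a (adj H K a u)))\<^sup>2"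
      by (simp add: C.K.hnorm_square u'_def C.K.cinner_simps)
        (simp add: power2_eq_square[of s] algebra_simps)
    then have "(hnorm K u')\<^sup>2 \<le> (hnorm K u)\<^sup>2 - s * (hnorm H (adj H K a u))\<^sup>2" using 2 by linarith
    then have "(hnorm K u)\<^sup>2 \<le> D\<^sup>2 * ((hnorm K u)\<^sup>2 - s * (hnorm H (adj H K a u))\<^sup>2)"
      using 1 mult_left_mono[of _ _ "D\<^sup>2"] by (meson order_trans zero_le_power2)
    then have "s * (hnorm H (adj H K a u))\<^sup>2 \<le> (1 - 1 / D\<^sup>2) * (hnorm K u)\<^sup>2"
      using D by (simp add: field_simps)
    then have "l\<^sup>2 * (s * (hnorm H (adj H K a u))\<^sup>2) \<le> l\<^sup>2 * ((1 - 1 / D\<^sup>2) * (hnorm K u)\<^sup>2)"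
      by (intro mult_left_mono) auto
    moreover have "l\<^sup>2 * (s * (hnorm H (adj H K a u))\<^sup>2) = (hnorm H (adj H K a u))\<^sup>2"
      using s by (simp add: mult.assoc[symmetric] mult.commute)
    ultimately show ?thesis by (simp add: mult.assoc)
  qed
  define m where "m = l * sqrt (1 - 1 / D\<^sup>2)"
  have D2: "0 \<le> 1 - 1 / D\<^sup>2" "1 - 1 / D\<^sup>2 < 1" using D by auto
  have m: "0 \<le> m" "m\<^sup>2 = l\<^sup>2 * (1 - 1 / D\<^sup>2)" using D2 l by (auto simp: m_def power_mult_distrib)
  have "l \<le> m"
    unfolding l_def a_def[symmetric]
  proof (rule C.opnorm_le_adj)
    fix u assume "u \<in> carrier K"
    then have "(hnorm H (adj H K a u))\<^sup>2 \<le> (m * hnorm K u)\<^sup>2"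
      unfolding power_mult_distrib m(2) by (rule main)
    then show "hnorm H (adj H K a u) \<le> m * hnorm K u"
      by (rule power2_le_imp_le) (use m(1) \<open>u \<in> carrier K\<close> in simp)
  qed (use m(1) in auto)
  then have "l\<^sup>2 \<le> m\<^sup>2" using l by (intro power_mono) auto
  then have "l\<^sup>2 * 1 \<le> l\<^sup>2 * (1 - 1 / D\<^sup>2)" using m(2) by simp
  then show False using D2(2) l by (metis mult_le_cancel_left_pos not_le zero_less_power)
qed

text \<open>With \<open>\<parallel>\<pi> x\<parallel> = 1\<close>, solve
  \<open>y + x x\<^sup>* y = x\<close> in \<open>T\<close>. Whatever the norm of \<open>x\<close>
  is, \<open>\<parallel>y\<parallel> \<le> 1 / 2\<close>, because
  \<open>\<lambda> / (1 + \<lambda>\<^sup>2)\<close> never exceeds \<open>1 / 2\<close>; but the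
  same equation for the images forces \<open>\<parallel>\<pi> y\<parallel> \<ge> 1 / 2\<close>. So
  \<open>r\<close> cannot be below 1.\<close>

lemma norm_ge_1:
  assumes x0: "x0 \<in> T" "\<pi> x0 \<noteq> \<zero>\<^bsub>bop H K\<^esub>"
    and r: "\<And>t. t \<in> T \<Longrightarrow> opnorm H K (\<pi> t) \<le> r * opnorm H0 K0 t"
  shows "1 \<le> r"
proof -
  define n where "n = opnorm H K (\<pi> x0)"
  have n: "n > 0" using x0 C.opnorm_nonneg[of "\<pi> x0"] C.opnorm_eq_0[of "\<pi> x0"] by (auto simp: n_def order.order_iff_strict)
  define x where "x = complex_of_real (1 / n) \<odot>\<^bsub>bop H0 K0\<^esub> x0"
  have x [simp]: "x \<in> T" using x0 by (simp add: x_def)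
  have nx: "opnorm H K (\<pi> x) = 1"
    using x0 n by (simp add: x_def C.opnorm_smult norm_divide n_def)
  define c where "c = (opnorm H0 K0 x)\<^sup>2"
  have c: "c \<ge> 0" by (simp add: c_def)
  \<comment> \<open>The operator \<open>c - x x\<^sup>*\<close> is positive and at most
    \<open>c\<close>; expanding the square, this comes down to \<open>\<parallel>x x\<^sup>*
    w\<parallel>\<^sup>2 \<le> c \<parallel>x\<^sup>* w\<parallel>\<^sup>2\<close>.\<close>
  have shift: "hnorm K0 (complex_of_real c \<odot>\<^bsub>K0\<^esub> w \<ominus>\<^bsub>K0\<^esub> x (adj H0 K0 x w)) \<le> c * hnorm K0 w"
    if w [simp]: "w \<in> carrier K0" for w
  proof (rule power2_le_imp_le)
    have "hnorm K0 (x (adj H0 K0 x w)) \<le> opnorm H0 K0 x * hnorm H0 (adj H0 K0 x w)"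
      by (intro D.hnorm_le_opnorm) auto
    then have "(hnorm K0 (x (adj H0 K0 x w)))\<^sup>2 \<le> (opnorm H0 K0 x * hnorm H0 (adj H0 K0 x w))\<^sup>2"
      by (intro power_mono) auto
    then have 2: "(hnorm K0 (x (adj H0 K0 x w)))\<^sup>2 \<le> c * (hnorm H0 (adj H0 K0 x w))\<^sup>2"
      by (simp add: c_def power_mult_distrib)
    have "cinner K0 (x (adj H0 K0 x w)) w = complex_of_real ((hnorm H0 (adj H0 K0 x w))\<^sup>2)"
      by (simp add: D.cinner_bop_adj_same)
    moreover have "cinner K0 w (x (adj H0 K0 x w)) = complex_of_real ((hnorm H0 (adj H0 K0 x w))\<^sup>2)"
      by (simp add: D.cinner_bop_adj_same)
    ultimately have "(hnorm K0 (complex_of_real c \<odot>\<^bsub>K0\<^esub> w \<ominus>\<^bsub>K0\<^esub> x (adj H0 K0 x w)))\<^sup>2 =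
        c\<^sup>2 * (hnorm K0 w)\<^sup>2 - 2 * c * (hnorm H0 (adj H0 K0 x w))\<^sup>2 + (hnorm K0 (x (adj H0 K0 x w)))\<^sup>2"
      by (simp add: D.K.hnorm_square D.K.cinner_simps) (simp add: power2_eq_square[of c] algebra_simps)
    also have "\<dots> \<le> c\<^sup>2 * (hnorm K0 w)\<^sup>2" using 2 mult_nonneg_nonneg[OF c zero_le_power2, of "hnorm H0 (adj H0 K0 x w)"] by linarith
    finally show "(hnorm K0 (complex_of_real c \<odot>\<^bsub>K0\<^esub> w \<ominus>\<^bsub>K0\<^esub> x (adj H0 K0 x w)))\<^sup>2 \<le> (c * hnorm K0 w)\<^sup>2"
      by (simp add: power_mult_distrib)
  qed (use c in simp)
  \<comment> \<open>The equation is relaxed by adding \<open>c y\<close> on both sides and dividing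
    by \<open>1 + c\<close>, which turns it into a contraction with factor
    \<open>c / (1 + c)\<close> however large \<open>x\<close> is.\<close>
  define F where "F y = complex_of_real (1 / (1 + c)) \<odot>\<^bsub>bop H0 K0\<^esub>
      (x \<oplus>\<^bsub>bop H0 K0\<^esub> (complex_of_real c \<odot>\<^bsub>bop H0 K0\<^esub> y \<ominus>\<^bsub>bop H0 K0\<^esub> tprod H0 K0 x x y))" for y
  have "\<exists>y\<in>T. F y = y"
  proof (rule D.tro_fixed_point[OF tro x])
    show "0 \<le> c / (1 + c)" "c / (1 + c) < 1" using c by (auto simp: divide_less_eq)
    fix u v assume uv: "u \<in> T" "v \<in> T"
    show "opnorm H0 K0 (F u \<ominus>\<^bsub>bop H0 K0\<^esub> F v) \<le> c / (1 + c) * opnorm H0 K0 (u \<ominus>\<^bsub>bop H0 K0\<^esub> v)"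
    proof (rule D.opnorm_le)
      fix w assume w: "w \<in> carrier H0"
      let ?d = "u w \<ominus>\<^bsub>K0\<^esub> v w"
      have "(F u \<ominus>\<^bsub>bop H0 K0\<^esub> F v) w =
          complex_of_real (1 / (1 + c)) \<odot>\<^bsub>K0\<^esub> (complex_of_real c \<odot>\<^bsub>K0\<^esub> ?d \<ominus>\<^bsub>K0\<^esub> x (adj H0 K0 x ?d))"
        using uv w by (intro D.K.cinner_eqI)
          (simp_all add: F_def D.K.cinner_simps hilbert_pair.bop_diff[OF D.hilbert_pair_flip] algebra_simps)
      also have "hnorm K0 \<dots> \<le> (1 / (1 + c)) * (c * hnorm K0 ?d)"
        using shift[of ?d] uv w c by (simp add: norm_divide divide_right_mono del: of_real_add)
      also have "\<dots> \<le> 1 / (1 + c) * (c * (opnorm H0 K0 (u \<ominus>\<^bsub>bop H0 K0\<^esub> v) * hnorm H0 w))"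
        using D.hnorm_le_opnorm[of "u \<ominus>\<^bsub>bop H0 K0\<^esub> v" w] uv w c by (intro mult_left_mono) auto
      finally show "hnorm K0 ((F u \<ominus>\<^bsub>bop H0 K0\<^esub> F v) w) \<le>
          c / (1 + c) * opnorm H0 K0 (u \<ominus>\<^bsub>bop H0 K0\<^esub> v) * hnorm H0 w"
        by (simp add: mult_ac)
    qed (use c uv in simp)
  qed (simp add: F_def)
  then obtain y where y [simp]: "y \<in> T" and "F y = y" by blast
  have c1: "1 + complex_of_real c \<noteq> 0"
    using c by (auto simp: complex_eq_iff)
  have "x = complex_of_real (1 + c) \<odot>\<^bsub>bop H0 K0\<^esub> F y \<ominus>\<^bsub>bop H0 K0\<^esub> complex_of_real c \<odot>\<^bsub>bop H0 K0\<^esub> y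
      \<oplus>\<^bsub>bop H0 K0\<^esub> tprod H0 K0 x x y"
    unfolding F_def using c1 by (intro D.bop_eqI) (simp_all add: D.K.cinner_simps flip: of_real_mult)
  also have "\<dots> = y \<oplus>\<^bsub>bop H0 K0\<^esub> tprod H0 K0 x x y"
    unfolding \<open>F y = y\<close> by (intro D.bop_eqI) (simp_all add: D.K.cinner_simps algebra_simps)
  finally have eq: "x = y \<oplus>\<^bsub>bop H0 K0\<^esub> tprod H0 K0 x x y" .
  \<comment> \<open>Pairing the equation at \<open>v\<close> with \<open>y v\<close> gives \<open>Re
    \<langle>v, x\<^sup>* y v\<rangle> = \<parallel>y v\<parallel>\<^sup>2 + \<parallel>x\<^sup>* y
    v\<parallel>\<^sup>2\<close>, and the left side is at most
    \<open>\<parallel>v\<parallel>\<^sup>2 / 4 + \<parallel>x\<^sup>* y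
    v\<parallel>\<^sup>2\<close>.\<close>
  have "opnorm H0 K0 y \<le> 1/2"
  proof (rule D.opnorm_le)
    fix v assume v [simp]: "v \<in> carrier H0"
    have "cinner K0 (x v) (y v) = cinner K0 (y v) (y v) + cinner K0 (x (adj H0 K0 x (y v))) (y v)"
      by (subst eq) (simp add: D.K.cinner_simps)
    also have "cinner K0 (x (adj H0 K0 x (y v))) (y v) = cinner H0 (adj H0 K0 x (y v)) (adj H0 K0 x (y v))"
      by (simp add: D.cinner_adj_right)
    finally have "Re (cinner H0 v (adj H0 K0 x (y v))) = (hnorm K0 (y v))\<^sup>2 + (hnorm H0 (adj H0 K0 x (y v)))\<^sup>2"
      by (simp add: D.cinner_adj_right D.H.hnorm_square D.K.hnorm_square)
    moreover have "Re (cinner H0 v (adj H0 K0 x (y v))) \<le> hnorm H0 v * hnorm H0 (adj H0 K0 x (y v))"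
      using D.H.Re_cinner_le_mult[of v "adj H0 K0 x (y v)"] by simp
    moreover have "0 \<le> (hnorm H0 v / 2 - hnorm H0 (adj H0 K0 x (y v)))\<^sup>2" by simp
    ultimately have "(hnorm K0 (y v))\<^sup>2 \<le> (1 / 2 * hnorm H0 v)\<^sup>2"
      by (simp add: power2_eq_square algebra_simps)
    then show "hnorm K0 (y v) \<le> 1 / 2 * hnorm H0 v" by (rule power2_le_imp_le) simp
  qed simp
  moreover have "1 \<le> 2 * opnorm H K (\<pi> y)"
  proof -
    have "\<pi> (y \<oplus>\<^bsub>bop H0 K0\<^esub> tprod H0 K0 x x y) = \<pi> y \<oplus>\<^bsub>bop H K\<^esub> tprod H K (\<pi> x) (\<pi> x) (\<pi> y)"
      by simp
    then have "1 = opnorm H K (\<pi> y \<oplus>\<^bsub>bop H K\<^esub> tprod H K (\<pi> x) (\<pi> x) (\<pi> y))"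
      using nx eq by metis
    also have "\<dots> \<le> opnorm H K (\<pi> y) + opnorm H K (tprod H K (\<pi> x) (\<pi> x) (\<pi> y))"
      by (intro C.opnorm_triangle) auto
    also have "opnorm H K (tprod H K (\<pi> x) (\<pi> x) (\<pi> y)) \<le> opnorm H K (\<pi> y)"
    proof (rule C.opnorm_le)
      fix v assume v [simp]: "v \<in> carrier H"
      show "hnorm K (tprod H K (\<pi> x) (\<pi> x) (\<pi> y) v) \<le> opnorm H K (\<pi> y) * hnorm H v"
        using C.hnorm_le_opnorm[of "\<pi> x" "adj H K (\<pi> x) (\<pi> y v)"] C.hnorm_adj_le[of "\<pi> x" "\<pi> y v"]
          C.hnorm_le_opnorm[of "\<pi> y" v] nx by simp
    qed simp
    finally show ?thesis by simp
  qed
  moreover have "opnorm H0 K0 y \<ge> 0" by simp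
  ultimately show ?thesis
    using r[OF y] mult_strict_right_mono[of r 1 "opnorm H0 K0 y"] mult_right_mono[of r 1 "opnorm H0 K0 y"]
    by linarith
qed

end

section \<open>Matrices of operators\<close>

text \<open>Additivity is asked for on a subset \<open>S\<close> because \<open>\<pi>\<close> is
  known to be additive on \<open>T\<close> and not on the whole operator space.\<close>

lemma additive_finsum:
  assumes M: "abelian_monoid M" and N: "abelian_monoid N" and S: "S \<subseteq> carrier M" "\<zero>\<^bsub>M\<^esub> \<in> S"
    "\<And>x y. x \<in> S \<Longrightarrow> y \<in> S \<Longrightarrow> x \<oplus>\<^bsub>M\<^esub> y \<in> S"
    and h: "\<And>x. x \<in> S \<Longrightarrow> h x \<in> carrier N" "h \<zero>\<^bsub>M\<^esub> = \<zero>\<^bsub>N\<^esub>"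
    "\<And>x y. x \<in> S \<Longrightarrow> y \<in> S \<Longrightarrow> h (x \<oplus>\<^bsub>M\<^esub> y) = h x \<oplus>\<^bsub>N\<^esub> h y"
    and I: "finite I" and f: "\<And>i. i \<in> I \<Longrightarrow> f i \<in> S"
  shows "finsum M f I \<in> S \<and> h (finsum M f I) = finsum N (\<lambda>i. h (f i)) I"
  using I f
proof (induction I rule: finite_induct)
  case empty
  then show ?case using M N S h by (simp add: abelian_monoid.finsum_empty)
next
  case (insert i I)
  have "f \<in> I \<rightarrow> carrier M" "f i \<in> carrier M" "(\<lambda>i. h (f i)) \<in> I \<rightarrow> carrier N" "h (f i) \<in> carrier N"
    using insert.prems S h by auto
  then show ?case
    using insert M N S h by (simp add: abelian_monoid.finsum_insert)
qed

context complex_module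
begin

lemma diff_conv_smult: "x \<in> carrier M \<Longrightarrow> y \<in> carrier M \<Longrightarrow> x \<ominus> y = x \<oplus> (-1) \<odot> y"
  by (simp add: minus_eq csmult_minus_one)

end

lemma (in complex_hilbert_space) hnorm_finsum:
  assumes "finite I" "\<And>i. i \<in> I \<Longrightarrow> f i \<in> carrier H"
  shows "hnorm H (\<Oplus>i\<in>I. f i) \<le> (\<Sum>i\<in>I. hnorm H (f i))"
  using assms
proof (induction I rule: finite_induct)
  case (insert i I)
  have "hnorm H (f i \<oplus> finsum H f I) \<le> hnorm H (f i) + hnorm H (finsum H f I)"
    using insert by (intro hnorm_triangle) (auto intro: finsum_closed)
  then show ?case using insert by (simp add: Pi_def)
qed simp

section \<open>Finite sums and \<open>n\<close>-fold direct sums\<close>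

context complex_hilbert_space
begin

lemma finsum_lessThan_closed [simp]:
  "(\<And>i::nat. i < n \<Longrightarrow> f i \<in> carrier H) \<Longrightarrow> (\<Oplus>i\<in>{..<n}. f i) \<in> carrier H"
  by (auto intro: finsum_closed)

lemma cinner_finsum_lessThan:
  "(\<And>i::nat. i < n \<Longrightarrow> f i \<in> carrier H) \<Longrightarrow> y \<in> carrier H \<Longrightarrow>
    cinner H (\<Oplus>i\<in>{..<n}. f i) y = (\<Sum>i<n. cinner H (f i) y)"
  by (auto intro: cinner_finsum_left)

end

text \<open>Vectors are extensional functions, so that \<open>hpow n H\<close> satisfies the Hilbert
  space locale and an operator matrix becomes an element of
  \<open>bop (hpow n H) (hpow n K)\<close>, to which every result about TROs applies.\<close>

definition hpow :: "nat \<Rightarrow> 'a inner_space \<Rightarrow> (nat \<Rightarrow> 'a) inner_space"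
  where "hpow n H =
    \<lparr>carrier = PiE {..<n} (\<lambda>_. carrier H), monoid.mult = undefined, one = undefined,
     zero = (\<lambda>i\<in>{..<n}. \<zero>\<^bsub>H\<^esub>), add = (\<lambda>v w. \<lambda>i\<in>{..<n}. v i \<oplus>\<^bsub>H\<^esub> w i),
     module.smult = (\<lambda>c v. \<lambda>i\<in>{..<n}. c \<odot>\<^bsub>H\<^esub> v i), cinner = (\<lambda>v w. \<Sum>i<n. cinner H (v i) (w i))\<rparr>"

lemma hpow_simps:
  "carrier (hpow n H) = PiE {..<n} (\<lambda>_. carrier H)"
  "\<zero>\<^bsub>hpow n H\<^esub> = (\<lambda>i\<in>{..<n}. \<zero>\<^bsub>H\<^esub>)"
  "v \<oplus>\<^bsub>hpow n H\<^esub> w = (\<lambda>i\<in>{..<n}. v i \<oplus>\<^bsub>H\<^esub> w i)"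
  "c \<odot>\<^bsub>hpow n H\<^esub> v = (\<lambda>i\<in>{..<n}. c \<odot>\<^bsub>H\<^esub> v i)"
  "cinner (hpow n H) v w = (\<Sum>i<n. cinner H (v i) (w i))"
  by (simp_all add: hpow_def)

context complex_hilbert_space
begin

lemma hpow_component: "v \<in> carrier (hpow n H) \<Longrightarrow> i < n \<Longrightarrow> v i \<in> carrier H"
  by (simp add: hpow_simps PiE_def Pi_def)

lemma hpow_memI:
  "v \<in> extensional {..<n} \<Longrightarrow> (\<And>i. i < n \<Longrightarrow> v i \<in> carrier H) \<Longrightarrow> v \<in> carrier (hpow n H)"
  by (simp add: hpow_simps PiE_def Pi_def)

lemma hpow_eqI:
  "v \<in> carrier (hpow n H) \<Longrightarrow> w \<in> carrier (hpow n H) \<Longrightarrow> (\<And>i. i < n \<Longrightarrow> v i = w i) \<Longrightarrow> v = w"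
  unfolding hpow_simps by (rule PiE_ext) auto

lemma hpow_closed:
  "\<zero>\<^bsub>hpow n H\<^esub> \<in> carrier (hpow n H)"
  "v \<in> carrier (hpow n H) \<Longrightarrow> w \<in> carrier (hpow n H) \<Longrightarrow> v \<oplus>\<^bsub>hpow n H\<^esub> w \<in> carrier (hpow n H)"
  "v \<in> carrier (hpow n H) \<Longrightarrow> c \<odot>\<^bsub>hpow n H\<^esub> v \<in> carrier (hpow n H)"
  by (rule hpow_memI; simp add: hpow_simps(2-4) hpow_component[of _ n])+

lemma hpow_apply:
  "i < n \<Longrightarrow> \<zero>\<^bsub>hpow n H\<^esub> i = \<zero>"
  "i < n \<Longrightarrow> (v \<oplus>\<^bsub>hpow n H\<^esub> w) i = v i \<oplus> w i"
  "i < n \<Longrightarrow> (c \<odot>\<^bsub>hpow n H\<^esub> v) i = c \<odot> v i"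
  by (simp_all add: hpow_simps)

lemma module_hpow: "Module.module complex_field (hpow n H)"
proof (intro moduleI abelian_groupI cring_complex_field)
  note [simp] = hpow_component[of _ n]
  fix v assume v: "v \<in> carrier (hpow n H)"
  note m = hpow_closed(3)[OF v, of "-1"]
  show "\<exists>w\<in>carrier (hpow n H). w \<oplus>\<^bsub>hpow n H\<^esub> v = \<zero>\<^bsub>hpow n H\<^esub>"
  proof (intro bexI[OF hpow_eqI m] hpow_closed m v)
    show "((-1) \<odot>\<^bsub>hpow n H\<^esub> v \<oplus>\<^bsub>hpow n H\<^esub> v) i = \<zero>\<^bsub>hpow n H\<^esub> i" if "i < n" for i
      using v that by (simp add: hpow_apply csmult_minus_one l_neg)
  qed (intro hpow_closed m v)+
next
  fix u v w assume "u \<in> carrier (hpow n H)" "v \<in> carrier (hpow n H)" "w \<in> carrier (hpow n H)"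
  then show "u \<oplus>\<^bsub>hpow n H\<^esub> v \<oplus>\<^bsub>hpow n H\<^esub> w = u \<oplus>\<^bsub>hpow n H\<^esub> (v \<oplus>\<^bsub>hpow n H\<^esub> w)"
    by (intro hpow_eqI[of _ n] hpow_closed) (simp_all add: hpow_component hpow_apply a_assoc)
qed (intro hpow_eqI[of _ n] hpow_closed;
    (assumption | simp add: hpow_component[of _ n] hpow_apply a_ac smult_r_distr csmult_add_left csmult_assoc))+

lemma hnorm_hpow: "v \<in> carrier (hpow n H) \<Longrightarrow> hnorm (hpow n H) v = sqrt (\<Sum>i<n. (hnorm H (v i))\<^sup>2)"
  by (simp add: hnorm_def[of "hpow n H"] hpow_simps(5) hnorm_square hpow_component)

lemma hnorm_hpow_square:
  "v \<in> carrier (hpow n H) \<Longrightarrow> (hnorm (hpow n H) v)\<^sup>2 = (\<Sum>i<n. (hnorm H (v i))\<^sup>2)"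
  by (simp add: hnorm_hpow sum_nonneg)

lemma hnorm_component_le:
  assumes "v \<in> carrier (hpow n H)" "i < n" shows "hnorm H (v i) \<le> hnorm (hpow n H) v"
proof (rule power2_le_imp_le)
  show "(hnorm H (v i))\<^sup>2 \<le> (hnorm (hpow n H) v)\<^sup>2"
    unfolding hnorm_hpow_square[OF assms(1)]
    by (rule member_le_sum[of i "{..<n}" "\<lambda>i. (hnorm H (v i))\<^sup>2"]) (use assms in auto)
qed (use assms in \<open>simp add: hnorm_hpow sum_nonneg\<close>)

lemma complex_hilbert_space_hpow:
  assumes "0 < n" shows "complex_hilbert_space (hpow n H)"
proof -
  note [simp] = hpow_component[of _ n]
  interpret P: complex_module "hpow n H"
    unfolding complex_module_def by (rule module_hpow)
  have diff: "(v \<ominus>\<^bsub>hpow n H\<^esub> w) i = v i \<ominus> w i"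
    if "v \<in> carrier (hpow n H)" "w \<in> carrier (hpow n H)" "i < n" for v w i
    using that by (simp add: P.diff_conv_smult diff_conv_smult hpow_apply)
  show ?thesis
  proof
    fix x y z and c :: complex
    assume v: "x \<in> carrier (hpow n H)" "y \<in> carrier (hpow n H)"
    show "cinner (hpow n H) (c \<odot>\<^bsub>hpow n H\<^esub> x) y = c * cinner (hpow n H) x y"
      unfolding hpow_simps(5) sum_distrib_left
      by (rule sum.cong) (use v in \<open>auto simp: hpow_apply cinner_simps\<close>)
    show "cinner (hpow n H) x y = cnj (cinner (hpow n H) y x)"
      unfolding hpow_simps(5) cnj_sum
      by (rule sum.cong) (use v in \<open>auto intro: cinner_commute\<close>)
    assume z: "z \<in> carrier (hpow n H)"
    show "cinner (hpow n H) (x \<oplus>\<^bsub>hpow n H\<^esub> y) z = cinner (hpow n H) x z + cinner (hpow n H) y z"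
      unfolding hpow_simps(5) sum.distrib[symmetric]
      by (rule sum.cong) (use v z in \<open>auto simp: hpow_apply cinner_simps\<close>)
  next
    fix x assume x: "x \<in> carrier (hpow n H)" "x \<noteq> \<zero>\<^bsub>hpow n H\<^esub>"
    have "\<exists>i<n. x i \<noteq> \<zero>"
    proof (rule ccontr)
      assume "\<not> ?thesis"
      then have "x = \<zero>\<^bsub>hpow n H\<^esub>" by (intro hpow_eqI[OF x(1)] P.zero_closed) (auto simp: hpow_apply)
      then show False using x by simp
    qed
    then obtain i where i: "i < n" "x i \<noteq> \<zero>" by blast
    have "0 < Re (cinner H (x i) (x i))" using i x by (intro cinner_pos) auto
    also have "\<dots> \<le> (\<Sum>i<n. Re (cinner H (x i) (x i)))"
      by (rule member_le_sum[of i "{..<n}" "\<lambda>i. Re (cinner H (x i) (x i))"]) (use i x in auto)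
    finally show "0 < Re (cinner (hpow n H) x x)" by (simp add: hpow_simps(5))
  next
    fix s :: "nat \<Rightarrow> nat \<Rightarrow> 'a"
    assume s: "\<And>m. s m \<in> carrier (hpow n H)"
      "\<forall>e>0. \<exists>N. \<forall>m\<ge>N. \<forall>k\<ge>N. hnorm (hpow n H) (s m \<ominus>\<^bsub>hpow n H\<^esub> s k) < e"
    have "\<exists>x\<in>carrier H. (\<lambda>m. hnorm H (s m i \<ominus> x)) \<longlonglongrightarrow> 0" if i: "i < n" for i
    proof (rule complete)
      have "hnorm H (s m i \<ominus> s k i) \<le> hnorm (hpow n H) (s m \<ominus>\<^bsub>hpow n H\<^esub> s k)" for m k
        using hnorm_component_le[of "s m \<ominus>\<^bsub>hpow n H\<^esub> s k" n i] s i by (simp add: diff)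
      then show "\<forall>e>0. \<exists>N. \<forall>m\<ge>N. \<forall>k\<ge>N. hnorm H (s m i \<ominus> s k i) < e"
        using s(2) by (meson order_le_less_trans)
    qed (use s i in auto)
    then obtain x where x: "\<And>i. i < n \<Longrightarrow> x i \<in> carrier H"
      "\<And>i. i < n \<Longrightarrow> (\<lambda>m. hnorm H (s m i \<ominus> x i)) \<longlonglongrightarrow> 0" by metis
    have xP: "restrict x {..<n} \<in> carrier (hpow n H)" using x by (intro hpow_memI) auto
    have "(\<lambda>m. sqrt (\<Sum>i<n. (hnorm H (s m i \<ominus> x i))\<^sup>2)) \<longlonglongrightarrow> sqrt (\<Sum>i<n. 0\<^sup>2)"
      using x(2) by (intro tendsto_intros) auto
    then have "(\<lambda>m. hnorm (hpow n H) (s m \<ominus>\<^bsub>hpow n H\<^esub> restrict x {..<n})) \<longlonglongrightarrow> 0"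
      using s(1) xP by (simp add: hnorm_hpow diff)
    then show "\<exists>x\<in>carrier (hpow n H). (\<lambda>m. hnorm (hpow n H) (s m \<ominus>\<^bsub>hpow n H\<^esub> x)) \<longlonglongrightarrow> 0"
      using xP by blast
  next
    obtain x where x: "x \<in> carrier H" "x \<noteq> \<zero>" using nonzero by blast
    then show "\<exists>x\<in>carrier (hpow n H). x \<noteq> \<zero>\<^bsub>hpow n H\<^esub>"
      using assms by (intro bexI[of _ "\<lambda>i\<in>{..<n}. x"] hpow_memI) (auto simp: hpow_simps(2) fun_eq_iff intro!: exI[of _ 0])
  qed
qed

end

section \<open>Operator matrices as operators between direct sums\<close>

definition mop :: "'a inner_space \<Rightarrow> 'b inner_space \<Rightarrow> nat \<Rightarrow> (nat \<Rightarrow> nat \<Rightarrow> 'a \<Rightarrow> 'b) \<Rightarrow> (nat \<Rightarrow> 'a) \<Rightarrow> (nat \<Rightarrow> 'b)"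
  where "mop H K n A = (\<lambda>v\<in>carrier (hpow n H). \<lambda>i\<in>{..<n}. \<Oplus>\<^bsub>K\<^esub>j\<in>{..<n}. A i j (v j))"

definition entry :: "'a inner_space \<Rightarrow> nat \<Rightarrow> ((nat \<Rightarrow> 'a) \<Rightarrow> (nat \<Rightarrow> 'b)) \<Rightarrow> nat \<Rightarrow> nat \<Rightarrow> 'a \<Rightarrow> 'b"
  where "entry H n t i j = (\<lambda>x\<in>carrier H. t (\<lambda>k\<in>{..<n}. if k = j then x else \<zero>\<^bsub>H\<^esub>) i)"

text \<open>The size 0 is excluded because Hilbert spaces are nonzero; empty matrices are treated
  separately where all sizes are quantified.\<close>

locale hilbert_pair_power = hilbert_pair H K for H :: "'a inner_space" and K :: "'b inner_space" +
  fixes n :: nat assumes n_pos: "0 < n"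
begin

sublocale P: hilbert_pair "hpow n H" "hpow n K"
  by (intro hilbert_pairI H.complex_hilbert_space_hpow K.complex_hilbert_space_hpow n_pos)

lemmas component_closed [simp] = H.hpow_component[of _ n] K.hpow_component[of _ n]

abbreviation mats :: "('a \<Rightarrow> 'b) set \<Rightarrow> (nat \<Rightarrow> nat \<Rightarrow> 'a \<Rightarrow> 'b) set"
  where "mats X \<equiv> {A. \<forall>i<n. \<forall>j<n. A i j \<in> X}"

lemma mop_apply:
  "v \<in> carrier (hpow n H) \<Longrightarrow> i < n \<Longrightarrow> mop H K n A v i = (\<Oplus>\<^bsub>K\<^esub>j\<in>{..<n}. A i j (v j))"
  by (simp add: mop_def)

lemma mop_closed [simp]:
  assumes A: "A \<in> mats (carrier (bop H K))"
  shows "mop H K n A \<in> carrier (bop (hpow n H) (hpow n K))"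
proof (rule P.bopI[where C = "\<Sum>i<n. \<Sum>j<n. opnorm H K (A i j)"])
  have [simp]: "(\<Oplus>\<^bsub>K\<^esub>j\<in>{..<n}. A i j (v j)) \<in> carrier K" if "v \<in> carrier (hpow n H)" "i < n" for v i
    using that A by (intro K.finsum_closed) auto
  show cl: "mop H K n A v \<in> carrier (hpow n K)" if "v \<in> carrier (hpow n H)" for v
    using that by (intro K.hpow_memI) (auto simp: mop_def)
  fix v assume v: "v \<in> carrier (hpow n H)"
  have [simp]: "v j \<in> carrier H" if "j < n" for j using v that by simp
  show "hnorm (hpow n K) (mop H K n A v) \<le> (\<Sum>i<n. \<Sum>j<n. opnorm H K (A i j)) * hnorm (hpow n H) v"
  proof -
    have "hnorm (hpow n K) (mop H K n A v) = L2_set (\<lambda>i. hnorm K (mop H K n A v i)) {..<n}"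
      using cl[OF v] by (simp add: K.hnorm_hpow L2_set_def)
    also have "\<dots> \<le> (\<Sum>i<n. hnorm K (mop H K n A v i))"
      using cl[OF v] by (intro L2_set_le_sum) auto
    also have "\<dots> \<le> (\<Sum>i<n. (\<Sum>j<n. opnorm H K (A i j) * hnorm (hpow n H) v))"
    proof (rule sum_mono)
      fix i assume i: "i \<in> {..<n}"
      have "hnorm K (mop H K n A v i) \<le> (\<Sum>j<n. hnorm K (A i j (v j)))"
        using v A i by (simp add: mop_apply, intro K.hnorm_finsum) auto
      also have "\<dots> \<le> (\<Sum>j<n. opnorm H K (A i j) * hnorm (hpow n H) v)"
      proof (rule sum_mono)
        fix j assume j: "j \<in> {..<n}"
        have "hnorm K (A i j (v j)) \<le> opnorm H K (A i j) * hnorm H (v j)"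
          using i j A by (intro hnorm_le_opnorm) auto
        also have "\<dots> \<le> opnorm H K (A i j) * hnorm (hpow n H) v"
          using i j A v by (intro mult_left_mono H.hnorm_component_le) auto
        finally show "hnorm K (A i j (v j)) \<le> opnorm H K (A i j) * hnorm (hpow n H) v" .
      qed
      finally show "hnorm K (mop H K n A v i) \<le> (\<Sum>j<n. opnorm H K (A i j) * hnorm (hpow n H) v)" .
    qed
    also have "\<dots> = (\<Sum>i<n. \<Sum>j<n. opnorm H K (A i j)) * hnorm (hpow n H) v"
      by (simp add: sum_distrib_right)
    finally show ?thesis .
  qed
  fix c
  show "mop H K n A (c \<odot>\<^bsub>hpow n H\<^esub> v) = c \<odot>\<^bsub>hpow n K\<^esub> mop H K n A v"
  proof (rule K.hpow_eqI[OF cl P.K.smult_closed[OF _ cl]])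
    fix i assume i: "i < n"
    have eq: "mop H K n A (c \<odot>\<^bsub>hpow n H\<^esub> v) i = (\<Oplus>\<^bsub>K\<^esub>j\<in>{..<n}. A i j (c \<odot>\<^bsub>H\<^esub> v j))"
      using v i A by (subst mop_apply) (auto simp: H.hpow_apply intro!: K.finsum_cong')
    show "mop H K n A (c \<odot>\<^bsub>hpow n H\<^esub> v) i = (c \<odot>\<^bsub>hpow n K\<^esub> mop H K n A v) i"
      unfolding eq using v i A
      by (intro K.cinner_eqI)
        (auto simp: K.hpow_apply mop_apply K.cinner_simps K.cinner_finsum_lessThan sum_distrib_left)
  qed (use v in auto)
  fix w assume w: "w \<in> carrier (hpow n H)"
  have [simp]: "w j \<in> carrier H" if "j < n" for j using w that by simp
  show "mop H K n A (v \<oplus>\<^bsub>hpow n H\<^esub> w) = mop H K n A v \<oplus>\<^bsub>hpow n K\<^esub> mop H K n A w"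
  proof (rule K.hpow_eqI[OF cl P.K.a_closed[OF cl cl]])
    fix i assume i: "i < n"
    have eq: "mop H K n A (v \<oplus>\<^bsub>hpow n H\<^esub> w) i = (\<Oplus>\<^bsub>K\<^esub>j\<in>{..<n}. A i j (v j \<oplus>\<^bsub>H\<^esub> w j))"
      using v w i A by (subst mop_apply) (auto simp: H.hpow_apply intro!: K.finsum_cong')
    show "mop H K n A (v \<oplus>\<^bsub>hpow n H\<^esub> w) i = (mop H K n A v \<oplus>\<^bsub>hpow n K\<^esub> mop H K n A w) i"
      unfolding eq using v w i A
      by (intro K.cinner_eqI)
        (auto simp: K.hpow_apply mop_apply K.cinner_simps K.cinner_finsum_lessThan sum.distrib)
  qed (use v w in auto)
qed (simp add: mop_def)

lemma cinner_mop:
  assumes "A \<in> mats (carrier (bop H K))" "v \<in> carrier (hpow n H)" "w \<in> carrier (hpow n K)"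
  shows "cinner (hpow n K) (mop H K n A v) w = (\<Sum>i<n. \<Sum>j<n. cinner K (A i j (v j)) (w i))"
  unfolding hpow_simps(5)
  by (rule sum.cong) (use assms in \<open>auto simp: mop_apply intro!: K.cinner_finsum_left\<close>)

lemma mop_eqI:
  assumes "A \<in> mats (carrier (bop H K))" "t \<in> carrier (bop (hpow n H) (hpow n K))"
    "\<And>v w. v \<in> carrier (hpow n H) \<Longrightarrow> w \<in> carrier (hpow n K) \<Longrightarrow>
      cinner (hpow n K) (t v) w = (\<Sum>i<n. \<Sum>j<n. cinner K (A i j (v j)) (w i))"
  shows "t = mop H K n A"
  using assms by (intro P.bop_eqI) (auto simp: cinner_mop)

lemma mop_add:
  assumes "A \<in> mats (carrier (bop H K))" "B \<in> mats (carrier (bop H K))"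
  shows "mop H K n A \<oplus>\<^bsub>bop (hpow n H) (hpow n K)\<^esub> mop H K n B = mop H K n (\<lambda>i j. A i j \<oplus>\<^bsub>bop H K\<^esub> B i j)"
  using assms by (intro mop_eqI) (auto simp: P.K.cinner_simps K.cinner_simps cinner_mop sum.distrib)

lemma mop_smult:
  assumes "A \<in> mats (carrier (bop H K))"
  shows "c \<odot>\<^bsub>bop (hpow n H) (hpow n K)\<^esub> mop H K n A = mop H K n (\<lambda>i j. c \<odot>\<^bsub>bop H K\<^esub> A i j)"
  using assms by (intro mop_eqI) (auto simp: P.K.cinner_simps K.cinner_simps cinner_mop sum_distrib_left)

lemma mop_zero: "\<zero>\<^bsub>bop (hpow n H) (hpow n K)\<^esub> = mop H K n (\<lambda>i j. \<zero>\<^bsub>bop H K\<^esub>)"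
  by (intro mop_eqI) auto

lemma adj_mop:
  assumes "A \<in> mats (carrier (bop H K))"
  shows "adj (hpow n H) (hpow n K) (mop H K n A) = mop K H n (\<lambda>i j. adj H K (A j i))"
proof -
  interpret F: hilbert_pair_power K H n
    using n_pos hilbert_pair_flip by (simp add: hilbert_pair_power_def hilbert_pair_power_axioms_def)
  have cl: "(\<lambda>i j. adj H K (A j i)) \<in> F.mats (carrier (bop K H))" using assms by auto
  show ?thesis
  proof (rule P.adj_eqI)
    fix v w assume vw: "v \<in> carrier (hpow n H)" "w \<in> carrier (hpow n K)"
    have "cinner (hpow n H) v (mop K H n (\<lambda>i j. adj H K (A j i)) w) =
        cnj (\<Sum>i<n. \<Sum>j<n. cinner H (adj H K (A j i) (w j)) (v i))"
      using F.cinner_mop[OF cl vw(2,1)] P.H.cinner_commute[of v] vw F.P.bop_closed[OF F.mop_closed[OF cl]]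
      by simp
    also have "\<dots> = (\<Sum>i<n. \<Sum>j<n. cinner K (A j i (v i)) (w j))"
      using assms vw by (simp add: cinner_adj_left K.cinner_commute[symmetric])
    also have "\<dots> = (\<Sum>j<n. \<Sum>i<n. cinner K (A j i (v i)) (w j))" by (rule sum.swap)
    finally show "cinner (hpow n K) (mop H K n A v) w =
        cinner (hpow n H) v (mop K H n (\<lambda>i j. adj H K (A j i)) w)"
      using assms vw by (simp add: cinner_mop)
  qed (use assms F.mop_closed[OF cl] in auto)
qed

lemma entry_closed [simp]:
  assumes t: "t \<in> carrier (bop (hpow n H) (hpow n K))" and ij: "i < n" "j < n"
  shows "entry H n t i j \<in> carrier (bop H K)"
    and "opnorm H K (entry H n t i j) \<le> opnorm (hpow n H) (hpow n K) t"
proof -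
  define e where "e x = (\<lambda>k\<in>{..<n}. if k = j then x else \<zero>\<^bsub>H\<^esub>)" for x
  have e [simp]: "e x \<in> carrier (hpow n H)" if "x \<in> carrier H" for x
    using that by (intro H.hpow_memI) (auto simp: e_def)
  have add: "e (x \<oplus>\<^bsub>H\<^esub> y) = e x \<oplus>\<^bsub>hpow n H\<^esub> e y" if "x \<in> carrier H" "y \<in> carrier H" for x y
    using that by (intro H.hpow_eqI[of _ n] H.hpow_closed e H.a_closed) (simp_all add: H.hpow_apply, simp add: e_def)
  have smult: "e (c \<odot>\<^bsub>H\<^esub> x) = c \<odot>\<^bsub>hpow n H\<^esub> e x" if "x \<in> carrier H" for x c
    using that H.smult_r_null[of c]
    by (intro H.hpow_eqI[of _ n] H.hpow_closed e H.smult_closed) (simp_all add: H.hpow_apply, simp add: e_def)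
  have "(\<Sum>k<n. (hnorm H (e x k))\<^sup>2) = (hnorm H x)\<^sup>2" if "x \<in> carrier H" for x
  proof -
    have "(\<Sum>k<n. (hnorm H (e x k))\<^sup>2) = (\<Sum>k<n. if k = j then (hnorm H x)\<^sup>2 else 0)"
      by (rule sum.cong) (auto simp: e_def)
    then show ?thesis using ij by simp
  qed
  then have norm: "hnorm (hpow n H) (e x) = hnorm H x" if "x \<in> carrier H" for x
    using that by (simp add: H.hnorm_hpow)
  have bound: "hnorm K (t (e x) i) \<le> opnorm (hpow n H) (hpow n K) t * hnorm H x" if "x \<in> carrier H" for x
    using K.hnorm_component_le[of "t (e x)" n i] P.hnorm_le_opnorm[OF t, of "e x"] that t ij by (simp add: norm)
  have eq: "entry H n t i j = (\<lambda>x\<in>carrier H. t (e x) i)" by (simp add: entry_def e_def)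
  show "entry H n t i j \<in> carrier (bop H K)"
    unfolding eq
    by (rule bopI[where C = "opnorm (hpow n H) (hpow n K) t"])
      (use t ij bound in \<open>auto simp: add smult K.hpow_apply\<close>)
  show "opnorm H K (entry H n t i j) \<le> opnorm (hpow n H) (hpow n K) t"
    unfolding eq by (rule opnorm_le) (use t bound in auto)
qed

text \<open>With \<open>entry_mop\<close> this identifies the operators between the direct sums with
  the operator matrices, which is how a map on entries becomes a map on operators.\<close>

lemma mop_entry:
  assumes t: "t \<in> carrier (bop (hpow n H) (hpow n K))"
  shows "mop H K n (entry H n t) = t"
proof (rule P.bop_ext[OF _ t])
  fix v assume v: "v \<in> carrier (hpow n H)"
  have [simp]: "v j \<in> carrier H" if "j < n" for j using v that by simp
  define e where "e j = (\<lambda>k\<in>{..<n}. if k = j then v j else \<zero>\<^bsub>H\<^esub>)" for j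
  have e [simp]: "e j \<in> carrier (hpow n H)" if "j < n" for j
    using that by (intro H.hpow_memI) (auto simp: e_def)
  have v_eq: "v = (\<Oplus>\<^bsub>hpow n H\<^esub>j\<in>{..<n}. e j)"
  proof (rule P.H.cinner_eqI[OF v])
    fix w assume w: "w \<in> carrier (hpow n H)"
    have "cinner (hpow n H) (\<Oplus>\<^bsub>hpow n H\<^esub>j\<in>{..<n}. e j) w = (\<Sum>j<n. \<Sum>i<n. cinner H (e j i) (w i))"
      using w by (subst P.H.cinner_finsum_left) (auto simp: hpow_simps(5))
    also have "\<dots> = (\<Sum>j<n. \<Sum>i<n. if i = j then cinner H (v j) (w j) else 0)"
      by (intro sum.cong) (use w in \<open>auto simp: e_def\<close>)
    also have "\<dots> = cinner (hpow n H) v w" by (simp add: hpow_simps(5))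
    finally show "Re (cinner (hpow n H) v w) = Re (cinner (hpow n H) (\<Oplus>\<^bsub>hpow n H\<^esub>j\<in>{..<n}. e j) w)" by simp
  qed (auto intro!: P.H.finsum_closed)
  have ent: "entry H n t i j (v j) = t (e j) i" if "i < n" "j < n" for i j
    using that by (simp add: entry_def e_def)
  show "mop H K n (entry H n t) v = t v"
  proof (rule P.K.cinner_eqI)
    fix w assume w: "w \<in> carrier (hpow n K)"
    have "cinner (hpow n K) (t v) w = (\<Sum>j<n. cinner (hpow n K) (t (e j)) w)"
      using t w by (subst v_eq, subst P.bop_finsum) (auto intro!: P.K.cinner_finsum_left)
    also have "\<dots> = (\<Sum>j<n. \<Sum>i<n. cinner K (t (e j) i) (w i))" by (simp add: hpow_simps(5))
    also have "\<dots> = (\<Sum>i<n. \<Sum>j<n. cinner K (t (e j) i) (w i))" by (rule sum.swap)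
    also have "\<dots> = cinner (hpow n K) (mop H K n (entry H n t) v) w"
      using v w t ent by (subst cinner_mop) auto
    finally show "Re (cinner (hpow n K) (mop H K n (entry H n t) v) w) = Re (cinner (hpow n K) (t v) w)" by simp
  qed (use v t in auto)
qed (use t in auto)

lemma entry_mop:
  assumes A: "A \<in> mats (carrier (bop H K))" and ij: "i < n" "j < n"
  shows "entry H n (mop H K n A) i j = A i j"
proof (rule bop_ext)
  fix x assume x: "x \<in> carrier H"
  let ?e = "\<lambda>k\<in>{..<n}. if k = j then x else \<zero>\<^bsub>H\<^esub>"
  have e: "?e \<in> carrier (hpow n H)" using x by (intro H.hpow_memI) auto
  have "mop H K n A ?e i = (\<Oplus>\<^bsub>K\<^esub>k\<in>{..<n}. A i k (?e k))" by (rule mop_apply[OF e ij(1)])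
  also have "\<dots> = A i j x"
  proof (rule K.cinner_eqI)
    fix y assume y: "y \<in> carrier K"
    have "cinner K (\<Oplus>\<^bsub>K\<^esub>k\<in>{..<n}. A i k (?e k)) y = (\<Sum>k<n. cinner K (A i k (?e k)) y)"
      using A x y ij by (intro K.cinner_finsum_left) auto
    also have "\<dots> = (\<Sum>k<n. if k = j then cinner K (A i j x) y else 0)"
      by (intro sum.cong) (use A y ij in auto)
    finally show "Re (cinner K (\<Oplus>\<^bsub>K\<^esub>k\<in>{..<n}. A i k (?e k)) y) = Re (cinner K (A i j x) y)"
      using ij by simp
  qed (use A x ij in \<open>auto intro!: K.finsum_closed\<close>)
  finally show "entry H n (mop H K n A) i j x = A i j x" using x by (simp add: entry_def)
qed (use A ij in auto)

text \<open>The entry at \<open>(i, l)\<close> of the product is the sum of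
  \<open>A i j (B k j)\<^sup>* C k l\<close>, with \<open>p = (j, k)\<close>. Its shape shows that
  matrices over a TRO form a TRO, and the single sum over pairs lets \<open>additive_finsum\<close>
  handle it in one application.\<close>

lemma tprod_mop:
  assumes A: "A \<in> mats (carrier (bop H K))" and B: "B \<in> mats (carrier (bop H K))" and C: "C \<in> mats (carrier (bop H K))"
  shows "tprod (hpow n H) (hpow n K) (mop H K n A) (mop H K n B) (mop H K n C) =
    mop H K n (\<lambda>i l. \<Oplus>\<^bsub>bop H K\<^esub>p\<in>{..<n} \<times> {..<n}. tprod H K (A i (fst p)) (B (snd p) (fst p)) (C (snd p) l))"
    (is "_ = mop H K n ?D")
proof -
  interpret F: hilbert_pair_power K H n
    using n_pos hilbert_pair_flip by (simp add: hilbert_pair_power_def hilbert_pair_power_axioms_def)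
  have cl: "(\<lambda>i j. adj H K (B j i)) \<in> F.mats (carrier (bop K H))" using B by auto
  have D: "?D \<in> mats (carrier (bop H K))" using A B C by (auto intro!: B.finsum_closed)
  show ?thesis
  proof (rule mop_eqI[OF D])
    fix v w assume vw: "v \<in> carrier (hpow n H)" "w \<in> carrier (hpow n K)"
    have D_inner: "cinner K (?D i l (v l)) (w i) =
        (\<Sum>j<n. \<Sum>k<n. cinner K (A i j (adj H K (B k j) (C k l (v l)))) (w i))" if "i < n" "l < n" for i l
    proof -
      have vl: "v l \<in> carrier H" using vw that by simp
      have "?D i l (v l) = (\<Oplus>\<^bsub>K\<^esub>p\<in>{..<n} \<times> {..<n}. tprod H K (A i (fst p)) (B (snd p) (fst p)) (C (snd p) l) (v l))"
        using additive_finsum[of "bop H K" K "carrier (bop H K)" "\<lambda>a. a (v l)" "{..<n} \<times> {..<n}"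
            "\<lambda>p. tprod H K (A i (fst p)) (B (snd p) (fst p)) (C (snd p) l)"] vl A B C that
          B.abelian_monoid_axioms K.abelian_monoid_axioms by auto
      also have "cinner K \<dots> (w i) = (\<Sum>p\<in>{..<n} \<times> {..<n}. cinner K (tprod H K (A i (fst p)) (B (snd p) (fst p)) (C (snd p) l) (v l)) (w i))"
        using vl vw A B C that by (intro K.cinner_finsum_left) auto
      also have "\<dots> = (\<Sum>j<n. \<Sum>k<n. cinner K (tprod H K (A i j) (B k j) (C k l) (v l)) (w i))"
        by (simp add: sum.cartesian_product case_prod_unfold)
      finally show ?thesis using vl by simp
    qed
    have Cv: "mop H K n C v \<in> carrier (hpow n K)" using C vw by auto
    have Bv: "mop K H n (\<lambda>i j. adj H K (B j i)) (mop H K n C v) \<in> carrier (hpow n H)"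
      by (rule F.P.bop_closed[OF F.mop_closed[OF cl] Cv])
    have "cinner (hpow n K) (tprod (hpow n H) (hpow n K) (mop H K n A) (mop H K n B) (mop H K n C) v) w =
        (\<Sum>i<n. \<Sum>j<n. cinner K (A i j (mop K H n (\<lambda>i j. adj H K (B j i)) (mop H K n C v) j)) (w i))"
      using A B C vw Bv by (simp add: adj_mop cinner_mop)
    also have "\<dots> = (\<Sum>i<n. \<Sum>j<n. \<Sum>k<n. \<Sum>l<n. cinner K (A i j (adj H K (B k j) (C k l (v l)))) (w i))"
    proof (intro sum.cong refl)
      fix i j assume "i \<in> {..<n}" "j \<in> {..<n}"
      then have ij: "i < n" "j < n" by auto
      have cll: "C k l (v l) \<in> carrier K" if "k < n" "l < n" for k l using that C vw by auto
      have 1: "mop K H n (\<lambda>i j. adj H K (B j i)) (mop H K n C v) j =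
          (\<Oplus>\<^bsub>H\<^esub>k\<in>{..<n}. adj H K (B k j) (\<Oplus>\<^bsub>K\<^esub>l\<in>{..<n}. C k l (v l)))"
        using ij vw Cv B cll
        by (subst F.mop_apply) (auto simp: mop_apply intro!: H.finsum_cong' K.finsum_closed)
      have "A i j (mop K H n (\<lambda>i j. adj H K (B j i)) (mop H K n C v) j) =
          (\<Oplus>\<^bsub>K\<^esub>k\<in>{..<n}. A i j (adj H K (B k j) (\<Oplus>\<^bsub>K\<^esub>l\<in>{..<n}. C k l (v l))))"
        unfolding 1 using A B ij cll by (intro bop_finsum) (auto intro!: K.finsum_closed)
      then have "cinner K (A i j (mop K H n (\<lambda>i j. adj H K (B j i)) (mop H K n C v) j)) (w i) =
          (\<Sum>k<n. cinner K (A i j (adj H K (B k j) (\<Oplus>\<^bsub>K\<^esub>l\<in>{..<n}. C k l (v l)))) (w i))"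
        using A B ij cll vw by (simp add: K.cinner_finsum_lessThan)
      also have "\<dots> = (\<Sum>k<n. \<Sum>l<n. cinner K (A i j (adj H K (B k j) (C k l (v l)))) (w i))"
      proof (intro sum.cong refl)
        fix k assume "k \<in> {..<n}"
        then have k: "k < n" by auto
        have Bk: "B k j \<in> carrier (bop H K)" "A i j \<in> carrier (bop H K)" using A B ij k by auto
        have "A i j (adj H K (B k j) (\<Oplus>\<^bsub>K\<^esub>l\<in>{..<n}. C k l (v l))) =
            (\<Oplus>\<^bsub>K\<^esub>l\<in>{..<n}. A i j (adj H K (B k j) (C k l (v l))))"
          using Bk k cll F.bop_finsum[OF adj_closed[OF Bk(1)], of "{..<n}" "\<lambda>l. C k l (v l)"]
            bop_finsum[OF Bk(2), of "{..<n}" "\<lambda>l. adj H K (B k j) (C k l (v l))"] by simp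
        then show "cinner K (A i j (adj H K (B k j) (\<Oplus>\<^bsub>K\<^esub>l\<in>{..<n}. C k l (v l)))) (w i) =
            (\<Sum>l<n. cinner K (A i j (adj H K (B k j) (C k l (v l)))) (w i))"
          using Bk k cll vw ij by (simp add: K.cinner_finsum_lessThan)
      qed
      finally show "cinner K (A i j (mop K H n (\<lambda>i j. adj H K (B j i)) (mop H K n C v) j)) (w i) =
        (\<Sum>k<n. \<Sum>l<n. cinner K (A i j (adj H K (B k j) (C k l (v l)))) (w i))" .
    qed
    also have "\<dots> = (\<Sum>i<n. \<Sum>l<n. \<Sum>j<n. \<Sum>k<n. cinner K (A i j (adj H K (B k j) (C k l (v l)))) (w i))"
    proof (rule sum.cong[OF refl])
      fix i
      have "(\<Sum>j<n. \<Sum>k<n. \<Sum>l<n. g j k l) = (\<Sum>l<n. \<Sum>j<n. \<Sum>k<n. g j k l)" for g :: "nat \<Rightarrow> nat \<Rightarrow> nat \<Rightarrow> complex"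
        by (simp only: sum.swap[of "\<lambda>k l. g _ k l" "{..<n}" "{..<n}"]) (rule sum.swap)
      then show "(\<Sum>j<n. \<Sum>k<n. \<Sum>l<n. cinner K (A i j (adj H K (B k j) (C k l (v l)))) (w i)) =
        (\<Sum>l<n. \<Sum>j<n. \<Sum>k<n. cinner K (A i j (adj H K (B k j) (C k l (v l)))) (w i))" .
    qed
    also have "\<dots> = (\<Sum>i<n. \<Sum>l<n. cinner K (?D i l (v l)) (w i))"
      using D_inner by simp
    finally show "cinner (hpow n K) (tprod (hpow n H) (hpow n K) (mop H K n A) (mop H K n B) (mop H K n C) v) w =
        (\<Sum>i<n. \<Sum>l<n. cinner K (?D i l (v l)) (w i))" .
  qed (use A B C in auto)
qed

end

section \<open>Matrix norms as bounds on sesquilinear sums\<close>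

lemma (in complex_hilbert_space) hnorm_pos: "x \<in> carrier H \<Longrightarrow> x \<noteq> \<zero> \<Longrightarrow> 0 < hnorm H x"
  using hnorm_nonneg[of x] hnorm_eq_0_iff[of x] by linarith

text \<open>
  The norm of the operator matrix \<open>A\<close> is at most \<open>r\<close>: by scaling \<open>v\<close> and \<open>w\<close> against each other,
  the arithmetic mean on the right may be replaced by the geometric one.
\<close>

definition mbound :: "'a inner_space \<Rightarrow> 'b inner_space \<Rightarrow> real \<Rightarrow> nat \<Rightarrow> (nat \<Rightarrow> nat \<Rightarrow> 'a \<Rightarrow> 'b) \<Rightarrow> bool"
  where "mbound H K r n A \<longleftrightarrow> (\<forall>v w. (\<forall>j<n. v j \<in> carrier H) \<longrightarrow> (\<forall>i<n. w i \<in> carrier K) \<longrightarrow>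
    Re (\<Sum>i<n. \<Sum>j<n. cinner K (A i j (v j)) (w i)) \<le>
      r * ((\<Sum>j<n. (hnorm H (v j))\<^sup>2) + (\<Sum>i<n. (hnorm K (w i))\<^sup>2)) / 2)"

lemma (in hilbert_pair) opnorm_le_iff:
  assumes a: "a \<in> carrier (bop H K)" and r: "0 \<le> r"
  shows "opnorm H K a \<le> r \<longleftrightarrow>
    (\<forall>x\<in>carrier H. \<forall>y\<in>carrier K. Re (cinner K (a x) y) \<le> r * ((hnorm H x)\<^sup>2 + (hnorm K y)\<^sup>2) / 2)"
proof (intro iffI ballI)
  fix x y assume le: "opnorm H K a \<le> r" and xy: "x \<in> carrier H" "y \<in> carrier K"
  have "Re (cinner K (a x) y) \<le> hnorm K (a x) * hnorm K y"
    using K.Re_cinner_le_mult[of "a x" y] a xy by simp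
  also have "\<dots> \<le> opnorm H K a * hnorm H x * hnorm K y"
    using hnorm_le_opnorm[OF a xy(1)] xy by (intro mult_right_mono) auto
  also have "\<dots> \<le> r * hnorm H x * hnorm K y"
    using le xy by (intro mult_right_mono) auto
  also have "\<dots> \<le> r * (((hnorm H x)\<^sup>2 + (hnorm K y)\<^sup>2) / 2)"
    using r sum_squares_bound[of "hnorm H x" "hnorm K y"] by (simp add: mult.assoc mult_left_mono)
  finally show "Re (cinner K (a x) y) \<le> r * ((hnorm H x)\<^sup>2 + (hnorm K y)\<^sup>2) / 2" by simp
next
  assume *: "\<forall>x\<in>carrier H. \<forall>y\<in>carrier K. Re (cinner K (a x) y) \<le> r * ((hnorm H x)\<^sup>2 + (hnorm K y)\<^sup>2) / 2"
  show "opnorm H K a \<le> r"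
  proof (rule opnorm_le[OF r])
    fix x assume x: "x \<in> carrier H"
    show "hnorm K (a x) \<le> r * hnorm H x"
    proof (cases "hnorm K (a x) = 0 \<or> hnorm H x = 0")
      case False
      define s t where "s = hnorm H x" and "t = hnorm K (a x)"
      have st: "s > 0" "t > 0"
        using False x a by (auto simp: s_def t_def intro!: H.hnorm_pos K.hnorm_pos)
      \<comment> \<open>The test vector is \<open>a x\<close> rescaled to the norm of
        \<open>x\<close>, the case of equality between the two means.\<close>
      have "Re (cinner K (a x) (complex_of_real (s / t) \<odot>\<^bsub>K\<^esub> a x)) \<le>
          r * (s\<^sup>2 + (hnorm K (complex_of_real (s / t) \<odot>\<^bsub>K\<^esub> a x))\<^sup>2) / 2"
        using *[rule_format, of x "complex_of_real (s / t) \<odot>\<^bsub>K\<^esub> a x"] x a by (simp add: s_def)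
      also have "Re (cinner K (a x) (complex_of_real (s / t) \<odot>\<^bsub>K\<^esub> a x)) = s / t * t\<^sup>2"
        using x a by (simp add: K.cinner_simps K.cinner_same t_def flip: of_real_power of_real_mult of_real_divide)
      also have "hnorm K (complex_of_real (s / t) \<odot>\<^bsub>K\<^esub> a x) = s / t * t"
        using x a st by (simp add: t_def[symmetric] norm_divide)
      finally have "s * t \<le> s * (r * s)"
        using st by (simp add: power2_eq_square mult_ac)
      then show ?thesis using st by (simp add: s_def t_def)
    qed (use a x r in auto)
  qed
qed

lemma mat_norm_0 [simp]: "mat_norm H K 0 A = 0"
  by (simp add: mat_norm_def)

context hilbert_pair_power
begin

lemma mop_cong:
  assumes "B \<in> mats (carrier (bop H K))" "\<And>i j. i < n \<Longrightarrow> j < n \<Longrightarrow> A i j = B i j"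
  shows "mop H K n A = mop H K n B"
  unfolding mop_def using assms by (intro restrict_ext K.finsum_cong') auto

lemma mat_norm_eq_opnorm:
  assumes A: "A \<in> mats (carrier (bop H K))"
  shows "mat_norm H K n A = opnorm (hpow n H) (hpow n K) (mop H K n A)"
proof -
  have val: "sqrt (\<Sum>i<n. (hnorm K (\<Oplus>\<^bsub>K\<^esub>j\<in>{..<n}. A i j (v j)))\<^sup>2) = hnorm (hpow n K) (mop H K n A v)"
    if "v \<in> carrier (hpow n H)" for v
    using that A by (simp add: K.hnorm_hpow P.bop_closed[OF mop_closed[OF A]] mop_apply)
  have nm: "(\<Sum>j<n. (hnorm H (v j))\<^sup>2) \<le> 1 \<longleftrightarrow> hnorm (hpow n H) v \<le> 1" if "v \<in> carrier (hpow n H)" for v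
    using that by (simp add: H.hnorm_hpow)
  have "(\<lambda>v. sqrt (\<Sum>i<n. (hnorm K (\<Oplus>\<^bsub>K\<^esub>j\<in>{..<n}. A i j (v j)))\<^sup>2)) `
      {v. (\<forall>j<n. v j \<in> carrier H) \<and> (\<Sum>j<n. (hnorm H (v j))\<^sup>2) \<le> 1} =
    (\<lambda>v. hnorm (hpow n K) (mop H K n A v)) ` {v \<in> carrier (hpow n H). hnorm (hpow n H) v \<le> 1}"
    (is "?f ` ?S = ?g ` ?R")
  proof (intro equalityI subsetI)
    fix z assume "z \<in> ?f ` ?S"
    then obtain v where v: "\<And>j. j < n \<Longrightarrow> v j \<in> carrier H" "(\<Sum>j<n. (hnorm H (v j))\<^sup>2) \<le> 1" "z = ?f v" by auto
    let ?v = "restrict v {..<n}"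
    have vc: "?v \<in> carrier (hpow n H)" using v by (intro H.hpow_memI) auto
    have "(\<Sum>j<n. (hnorm H (?v j))\<^sup>2) \<le> 1" using v(2) by simp
    then have "hnorm (hpow n H) ?v \<le> 1" using nm[OF vc] by blast
    moreover have "?f v = ?f ?v"
      using v(1) A by (intro arg_cong[of _ _ sqrt] sum.cong refl arg_cong[of _ _ "\<lambda>x. (hnorm K x)\<^sup>2"] K.finsum_cong') auto
    ultimately show "z \<in> ?g ` ?R" using v(3) val[OF vc] vc by (intro image_eqI[of _ _ ?v]) auto
  next
    fix z assume "z \<in> ?g ` ?R"
    then obtain v where v: "v \<in> carrier (hpow n H)" "hnorm (hpow n H) v \<le> 1" "z = ?g v" by auto
    then show "z \<in> ?f ` ?S" using nm[OF v(1)] val[OF v(1)] by (intro image_eqI[of _ _ v]) auto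
  qed
  then show ?thesis by (simp add: mat_norm_def opnorm_def)
qed

lemma mbound_iff_opnorm:
  assumes A: "A \<in> mats (carrier (bop H K))" and r: "0 \<le> r"
  shows "mbound H K r n A \<longleftrightarrow> opnorm (hpow n H) (hpow n K) (mop H K n A) \<le> r"
proof
  assume "mbound H K r n A"
  then show "opnorm (hpow n H) (hpow n K) (mop H K n A) \<le> r"
    unfolding P.opnorm_le_iff[OF mop_closed[OF A] r] mbound_def
    using A by (simp add: cinner_mop H.hnorm_hpow_square K.hnorm_hpow_square)
next
  assume le: "opnorm (hpow n H) (hpow n K) (mop H K n A) \<le> r"
  show "mbound H K r n A"
    unfolding mbound_def
  proof (intro allI impI)
    fix v w assume vw: "\<forall>j<n. v j \<in> carrier H" "\<forall>i<n. w i \<in> carrier K"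
    let ?v = "restrict v {..<n}" and ?w = "restrict w {..<n}"
    have c: "?v \<in> carrier (hpow n H)" "?w \<in> carrier (hpow n K)"
      using vw by (auto intro: H.hpow_memI K.hpow_memI)
    have "Re (cinner (hpow n K) (mop H K n A ?v) ?w) \<le> r * ((hnorm (hpow n H) ?v)\<^sup>2 + (hnorm (hpow n K) ?w)\<^sup>2) / 2"
      using le c unfolding P.opnorm_le_iff[OF mop_closed[OF A] r] by blast
    then have "Re (\<Sum>i<n. \<Sum>j<n. cinner K (A i j (?v j)) (?w i)) \<le>
        r * ((\<Sum>j<n. (hnorm H (?v j))\<^sup>2) + (\<Sum>i<n. (hnorm K (?w i))\<^sup>2)) / 2"
      unfolding cinner_mop[OF A c] H.hnorm_hpow_square[OF c(1)] K.hnorm_hpow_square[OF c(2)] .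
    then show "Re (\<Sum>i<n. \<Sum>j<n. cinner K (A i j (v j)) (w i)) \<le>
        r * ((\<Sum>j<n. (hnorm H (v j))\<^sup>2) + (\<Sum>i<n. (hnorm K (w i))\<^sup>2)) / 2" by simp
  qed
qed

end

context hilbert_pair
begin

lemma mat_norm_le_iff:
  assumes "\<forall>i<n. \<forall>j<n. A i j \<in> carrier (bop H K)" "0 \<le> r"
  shows "mat_norm H K n A \<le> r \<longleftrightarrow> mbound H K r n A"
proof (cases "n = 0")
  case False
  then interpret hilbert_pair_power H K n by unfold_locales simp
  show ?thesis using assms mbound_iff_opnorm[of A r] mat_norm_eq_opnorm[of A] by simp
qed (use assms in \<open>simp add: mbound_def\<close>)

lemma mbound_1_iff:
  assumes "A 0 0 \<in> carrier (bop H K)" "0 \<le> r"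
  shows "mbound H K r 1 A \<longleftrightarrow> opnorm H K (A 0 0) \<le> r"
proof -
  have "mbound H K r 1 A \<longleftrightarrow>
    (\<forall>x\<in>carrier H. \<forall>y\<in>carrier K. Re (cinner K (A 0 0 x) y) \<le> r * ((hnorm H x)\<^sup>2 + (hnorm K y)\<^sup>2) / 2)"
    (is "?L \<longleftrightarrow> ?R")
  proof
    assume ?L
    show ?R
    proof (intro ballI)
      fix x y assume "x \<in> carrier H" "y \<in> carrier K"
      then show "Re (cinner K (A 0 0 x) y) \<le> r * ((hnorm H x)\<^sup>2 + (hnorm K y)\<^sup>2) / 2"
        using \<open>?L\<close>[unfolded mbound_def, rule_format, of "\<lambda>_. x" "\<lambda>_. y"] by simp
    qed
  qed (auto simp: mbound_def)
  then show ?thesis using opnorm_le_iff[OF assms] by simp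
qed

end

text \<open>The supremum over all matrices is dissolved into one inequality for each contractive
  matrix; complete boundedness is used in this form from here on.\<close>

lemma cb_norm_le_iff:
  assumes "hilbert_pair H K" "hilbert_pair H' K'" and X: "X \<subseteq> carrier (bop H K)"
    and f: "f \<in> X \<rightarrow> carrier (bop H' K')" and r: "0 \<le> r"
  shows "cb_norm H K X H' K' f \<le> ereal r \<longleftrightarrow>
    (\<forall>n A. (\<forall>i<n. \<forall>j<n. A i j \<in> X) \<longrightarrow> mbound H K 1 n A \<longrightarrow> mbound H' K' r n (\<lambda>i j. f (A i j)))"
proof -
  interpret D: hilbert_pair H K by fact
  interpret C: hilbert_pair H' K' by fact
  have 1: "mat_norm H K n A \<le> 1 \<longleftrightarrow> mbound H K 1 n A" if "\<forall>i<n. \<forall>j<n. A i j \<in> X" for n A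
    using that X by (intro D.mat_norm_le_iff) auto
  have 2: "mat_norm H' K' n (\<lambda>i j. f (A i j)) \<le> r \<longleftrightarrow> mbound H' K' r n (\<lambda>i j. f (A i j))"
    if "\<forall>i<n. \<forall>j<n. A i j \<in> X" for n A
    using that f r by (intro C.mat_norm_le_iff) auto
  show ?thesis
    unfolding cb_norm_def by (auto simp: SUP_le_iff 1 2)
qed

section \<open>Complete contractivity of triple morphisms\<close>

context tro_morphism
begin

lemma sum_T:
  assumes "finite I" "\<And>i. i \<in> I \<Longrightarrow> f i \<in> T"
  shows "finsum (bop H0 K0) f I \<in> T" "\<pi> (finsum (bop H0 K0) f I) = finsum (bop H K) (\<lambda>i. \<pi> (f i)) I"
  using additive_finsum[of "bop H0 K0" "bop H K" T \<pi> I f] assms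
    D.B.abelian_monoid_axioms C.B.abelian_monoid_axioms by (auto simp: subset_eq)

text \<open>The matrices over \<open>T\<close> form a TRO \<open>TT\<close>, and applying
  \<open>\<pi>\<close> to the entries is a triple morphism on it, so \<open>contractive\<close>
  applies at every size. The map \<open>\<pi>\<pi>\<close> is defined through \<open>entry\<close>
  since its arguments are operators and not matrices.\<close>

lemma amplification_contractive:
  assumes n: "0 < n" and A: "\<forall>i<n. \<forall>j<n. A i j \<in> T"
  shows "opnorm (hpow n H) (hpow n K) (mop H K n (\<lambda>i j. \<pi> (A i j))) \<le>
    opnorm (hpow n H0) (hpow n K0) (mop H0 K0 n A)"
proof -
  interpret DP: hilbert_pair_power H0 K0 n
    using n D.hilbert_pair_axioms by (simp add: hilbert_pair_power_def hilbert_pair_power_axioms_def)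
  interpret CP: hilbert_pair_power H K n
    using n C.hilbert_pair_axioms by (simp add: hilbert_pair_power_def hilbert_pair_power_axioms_def)
  define TT where "TT = mop H0 K0 n ` DP.mats T"
  define \<pi>\<pi> where "\<pi>\<pi> t = mop H K n (\<lambda>i j. \<pi> (entry H0 n t i j))" for t
  have matsT: "A \<in> DP.mats (carrier (bop H0 K0))" if "A \<in> DP.mats T" for A using that by auto
  have matsP: "(\<lambda>i j. \<pi> (A i j)) \<in> CP.mats (carrier (bop H K))" if "A \<in> DP.mats T" for A using that by auto
  have TT_closed: "t \<in> carrier (bop (hpow n H0) (hpow n K0))" if "t \<in> TT" for t
    using that matsT by (auto simp: TT_def)
  have mopT: "mop H0 K0 n A \<in> TT" if "A \<in> DP.mats T" for A using that by (auto simp: TT_def)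
  have entT: "entry H0 n t i j \<in> T" if "t \<in> TT" "i < n" "j < n" for t i j
    using that matsT by (auto simp: TT_def DP.entry_mop)
  have \<pi>\<pi>_mop: "\<pi>\<pi> (mop H0 K0 n A) = mop H K n (\<lambda>i j. \<pi> (A i j))" if "A \<in> DP.mats T" for A
    unfolding \<pi>\<pi>_def using DP.entry_mop[OF matsT[OF that]] that by (intro CP.mop_cong) auto
  have "tro (hpow n H0) (hpow n K0) TT"
    unfolding tro_def
  proof (intro conjI ballI)
    show "operator_space (hpow n H0) (hpow n K0) TT"
    proof (rule DP.P.operator_spaceI)
      show "\<zero>\<^bsub>bop (hpow n H0) (hpow n K0)\<^esub> \<in> TT"
        unfolding DP.mop_zero by (rule mopT) simp
      fix a b assume "a \<in> TT" "b \<in> TT"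
      then obtain A B where AB: "A \<in> DP.mats T" "B \<in> DP.mats T" "a = mop H0 K0 n A" "b = mop H0 K0 n B"
        by (auto simp: TT_def)
      show "a \<oplus>\<^bsub>bop (hpow n H0) (hpow n K0)\<^esub> b \<in> TT"
        unfolding AB(3,4) DP.mop_add[OF matsT[OF AB(1)] matsT[OF AB(2)]] by (rule mopT) (use AB in simp)
    next
      fix c a assume "a \<in> TT"
      then obtain A where AB: "A \<in> DP.mats T" "a = mop H0 K0 n A" by (auto simp: TT_def)
      show "c \<odot>\<^bsub>bop (hpow n H0) (hpow n K0)\<^esub> a \<in> TT"
        unfolding AB(2) DP.mop_smult[OF matsT[OF AB(1)]] by (rule mopT) (use AB in simp)
    qed (use TT_closed in auto)
    show "norm_closed (hpow n H0) (hpow n K0) TT"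
      unfolding norm_closed_def
    proof (intro allI ballI impI, elim conjE)
      fix s t assume t: "t \<in> carrier (bop (hpow n H0) (hpow n K0))" and s: "\<forall>m. s m \<in> TT"
        and lim: "(\<lambda>m. opnorm (hpow n H0) (hpow n K0) (s m \<ominus>\<^bsub>bop (hpow n H0) (hpow n K0)\<^esub> t)) \<longlonglongrightarrow> 0"
      \<comment> \<open>Passing to an entry does not increase the norm, so closedness of
        \<open>TT\<close> reduces to that of \<open>T\<close>.\<close>
      have "entry H0 n t i j \<in> T" if ij: "i < n" "j < n" for i j
      proof (rule D.norm_closedD[OF norm_closed_T])
        show "entry H0 n (s m) i j \<in> T" for m using s entT ij by auto
        show "entry H0 n t i j \<in> carrier (bop H0 K0)" by (rule DP.entry_closed[OF t ij])
        have le: "opnorm H0 K0 (entry H0 n (s m) i j \<ominus>\<^bsub>bop H0 K0\<^esub> entry H0 n t i j) \<le>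
            opnorm (hpow n H0) (hpow n K0) (s m \<ominus>\<^bsub>bop (hpow n H0) (hpow n K0)\<^esub> t)" for m
        proof -
          let ?d = "s m \<ominus>\<^bsub>bop (hpow n H0) (hpow n K0)\<^esub> t"
          have sm: "s m \<in> carrier (bop (hpow n H0) (hpow n K0))" using s TT_closed by auto
          then have d: "?d \<in> carrier (bop (hpow n H0) (hpow n K0))" using t by simp
          have eq: "entry H0 n ?d i j = entry H0 n (s m) i j \<ominus>\<^bsub>bop H0 K0\<^esub> entry H0 n t i j"
          proof (rule D.bop_ext)
            fix x assume x: "x \<in> carrier H0"
            let ?e = "\<lambda>k\<in>{..<n}. if k = j then x else \<zero>\<^bsub>H0\<^esub>"
            have e: "?e \<in> carrier (hpow n H0)" using x by (intro D.H.hpow_memI) auto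
            have "?d ?e i = s m ?e i \<ominus>\<^bsub>K0\<^esub> t ?e i"
              using DP.P.K.diff_conv_smult[of "s m ?e" "t ?e"] D.K.diff_conv_smult[of "s m ?e i" "t ?e i"]
                sm t e ij by (simp add: D.K.hpow_apply)
            then show "entry H0 n ?d i j x = (entry H0 n (s m) i j \<ominus>\<^bsub>bop H0 K0\<^esub> entry H0 n t i j) x"
              using x DP.entry_closed(1)[OF sm ij] DP.entry_closed(1)[OF t ij] by (simp add: entry_def)
          qed (use DP.entry_closed(1)[OF sm ij] DP.entry_closed(1)[OF t ij] DP.entry_closed(1)[OF d ij] in auto)
          show ?thesis using DP.entry_closed(2)[OF d ij] by (simp add: eq)
        qed
        have nn: "0 \<le> opnorm H0 K0 (entry H0 n (s m) i j \<ominus>\<^bsub>bop H0 K0\<^esub> entry H0 n t i j)" for m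
          using s entT ij DP.entry_closed(1)[OF t ij] by simp
        show "(\<lambda>m. opnorm H0 K0 (entry H0 n (s m) i j \<ominus>\<^bsub>bop H0 K0\<^esub> entry H0 n t i j)) \<longlonglongrightarrow> 0"
          by (rule real_tendsto_sandwich[OF _ _ tendsto_const lim]) (use le nn in auto)
      qed
      then have "mop H0 K0 n (entry H0 n t) \<in> TT" by (intro mopT) auto
      then show "t \<in> TT" using DP.mop_entry[OF t] by simp
    qed
    fix a b c assume "a \<in> TT" "b \<in> TT" "c \<in> TT"
    then obtain A B C' where AB: "A \<in> DP.mats T" "B \<in> DP.mats T" "C' \<in> DP.mats T"
      "a = mop H0 K0 n A" "b = mop H0 K0 n B" "c = mop H0 K0 n C'"
      by (auto simp: TT_def)
    show "tprod (hpow n H0) (hpow n K0) a b c \<in> TT"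
      unfolding AB(4-6) DP.tprod_mop[OF matsT[OF AB(1)] matsT[OF AB(2)] matsT[OF AB(3)]]
      by (rule mopT) (use AB in \<open>auto intro!: sum_T(1)\<close>)
  qed
  moreover have "triple_morphism (hpow n H0) (hpow n K0) TT (hpow n H) (hpow n K) \<pi>\<pi>"
    unfolding triple_morphism_def clinear_on_def
  proof (intro conjI ballI allI)
    show "\<pi>\<pi> \<in> TT \<rightarrow> carrier (bop (hpow n H) (hpow n K))"
      unfolding \<pi>\<pi>_def using entT by (intro Pi_I CP.mop_closed) auto
    fix a b assume "a \<in> TT" "b \<in> TT"
    then obtain A B where AB: "A \<in> DP.mats T" "B \<in> DP.mats T" "a = mop H0 K0 n A" "b = mop H0 K0 n B"
      by (auto simp: TT_def)
    have S: "(\<lambda>i j. A i j \<oplus>\<^bsub>bop H0 K0\<^esub> B i j) \<in> DP.mats T" using AB by simp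
    show "\<pi>\<pi> (a \<oplus>\<^bsub>bop (hpow n H0) (hpow n K0)\<^esub> b) = \<pi>\<pi> a \<oplus>\<^bsub>bop (hpow n H) (hpow n K)\<^esub> \<pi>\<pi> b"
      unfolding AB(3,4) DP.mop_add[OF matsT[OF AB(1)] matsT[OF AB(2)]] \<pi>\<pi>_mop[OF S] \<pi>\<pi>_mop[OF AB(1)] \<pi>\<pi>_mop[OF AB(2)]
        CP.mop_add[OF matsP[OF AB(1)] matsP[OF AB(2)]]
      by (rule CP.mop_cong) (use AB in auto)
    fix c assume "c \<in> TT"
    then obtain C' where C': "C' \<in> DP.mats T" "c = mop H0 K0 n C'" by (auto simp: TT_def)
    let ?D = "\<lambda>i l. \<Oplus>\<^bsub>bop H0 K0\<^esub>p\<in>{..<n} \<times> {..<n}. tprod H0 K0 (A i (fst p)) (B (snd p) (fst p)) (C' (snd p) l)"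
    have S: "?D \<in> DP.mats T" using AB C' by (auto intro!: sum_T(1))
    show "\<pi>\<pi> (tprod (hpow n H0) (hpow n K0) a b c) = tprod (hpow n H) (hpow n K) (\<pi>\<pi> a) (\<pi>\<pi> b) (\<pi>\<pi> c)"
      unfolding AB(3,4) C'(2) DP.tprod_mop[OF matsT[OF AB(1)] matsT[OF AB(2)] matsT[OF C'(1)]] \<pi>\<pi>_mop[OF S]
        \<pi>\<pi>_mop[OF AB(1)] \<pi>\<pi>_mop[OF AB(2)] \<pi>\<pi>_mop[OF C'(1)] CP.tprod_mop[OF matsP[OF AB(1)] matsP[OF AB(2)] matsP[OF C'(1)]]
    proof (rule CP.mop_cong)
      show "(\<lambda>i l. \<Oplus>\<^bsub>bop H K\<^esub>p\<in>{..<n} \<times> {..<n}. tprod H K (\<pi> (A i (fst p))) (\<pi> (B (snd p) (fst p))) (\<pi> (C' (snd p) l)))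
          \<in> CP.mats (carrier (bop H K))"
        using AB C' by (auto intro!: C.B.finsum_closed)
      fix i l assume "i < n" "l < n"
      then show "\<pi> (?D i l) = (\<Oplus>\<^bsub>bop H K\<^esub>p\<in>{..<n} \<times> {..<n}. tprod H K (\<pi> (A i (fst p))) (\<pi> (B (snd p) (fst p))) (\<pi> (C' (snd p) l)))"
        using AB C' by (subst sum_T(2)) (auto intro!: C.B.finsum_cong')
    qed
  next
    fix c a assume "a \<in> TT"
    then obtain A where AB: "A \<in> DP.mats T" "a = mop H0 K0 n A" by (auto simp: TT_def)
    have S: "(\<lambda>i j. c \<odot>\<^bsub>bop H0 K0\<^esub> A i j) \<in> DP.mats T" using AB by simp
    show "\<pi>\<pi> (c \<odot>\<^bsub>bop (hpow n H0) (hpow n K0)\<^esub> a) = c \<odot>\<^bsub>bop (hpow n H) (hpow n K)\<^esub> \<pi>\<pi> a"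
      unfolding AB(2) DP.mop_smult[OF matsT[OF AB(1)]] \<pi>\<pi>_mop[OF S] \<pi>\<pi>_mop[OF AB(1)] CP.mop_smult[OF matsP[OF AB(1)]]
      by (rule CP.mop_cong) (use AB in auto)
  qed
  ultimately interpret M: tro_morphism "hpow n H0" "hpow n K0" "hpow n H" "hpow n K" TT \<pi>\<pi>
    by unfold_locales
  have A': "A \<in> DP.mats T" using A by simp
  show ?thesis using M.contractive[OF mopT[OF A']] by (simp add: \<pi>\<pi>_mop[OF A'])
qed

lemma cb_norm_le_1: "cb_norm H0 K0 T H K \<pi> \<le> 1"
proof -
  have "mbound H K 1 n (\<lambda>i j. \<pi> (A i j))" if A: "\<forall>i<n. \<forall>j<n. A i j \<in> T" and "mbound H0 K0 1 n A" for n A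
  proof (cases "n = 0")
    case False
    interpret DP: hilbert_pair_power H0 K0 n
      using False D.hilbert_pair_axioms by (simp add: hilbert_pair_power_def hilbert_pair_power_axioms_def)
    interpret CP: hilbert_pair_power H K n
      using False C.hilbert_pair_axioms by (simp add: hilbert_pair_power_def hilbert_pair_power_axioms_def)
    have "opnorm (hpow n H0) (hpow n K0) (mop H0 K0 n A) \<le> 1"
      using that DP.mbound_iff_opnorm[of A 1] by simp
    then show ?thesis
      using amplification_contractive[of n A] that False CP.mbound_iff_opnorm[of "\<lambda>i j. \<pi> (A i j)" 1] by simp
  qed (simp add: mbound_def)
  then show ?thesis
    using cb_norm_le_iff[OF D.hilbert_pair_axioms C.hilbert_pair_axioms, of T \<pi> 1]
    by (auto simp: one_ereal_def subset_eq)
qed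

end

section \<open>The extension theorem for completely contractive maps\<close>

text \<open>
  The functional is given by its graph \<open>G\<close>; domination by \<open>p\<close> makes \<open>G\<close> single-valued.
\<close>

lemma hahn_banach:
  fixes scale :: "real \<Rightarrow> 'v::ab_group_add \<Rightarrow> 'v"
  assumes "vector_space scale"
    and W: "0 \<in> W" "\<And>u v. u \<in> W \<Longrightarrow> v \<in> W \<Longrightarrow> u + v \<in> W" "\<And>c u. u \<in> W \<Longrightarrow> scale c u \<in> W"
    and p: "\<And>u v. u \<in> W \<Longrightarrow> v \<in> W \<Longrightarrow> p (u + v) \<le> p u + p v"
      "\<And>c u. u \<in> W \<Longrightarrow> 0 < c \<Longrightarrow> p (scale c u) = c * p u"
    and G: "G \<subseteq> W \<times> UNIV" "(0, 0) \<in> G" "\<And>u a v b. (u, a) \<in> G \<Longrightarrow> (v, b) \<in> G \<Longrightarrow> (u + v, a + b) \<in> G"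
      "\<And>c u a. (u, a) \<in> G \<Longrightarrow> (scale c u, c * a) \<in> G" "\<And>u a. (u, a) \<in> G \<Longrightarrow> a \<le> p u"
  shows "\<exists>g :: 'v \<Rightarrow> real. (\<forall>u\<in>W. \<forall>v\<in>W. g (u + v) = g u + g v) \<and> (\<forall>c. \<forall>u\<in>W. g (scale c u) = c * g u) \<and>
    (\<forall>u\<in>W. g u \<le> p u) \<and> (\<forall>(u, a)\<in>G. g u = a)"
proof -
  interpret vector_space scale by fact
  define good where "good M \<longleftrightarrow> M \<subseteq> W \<times> UNIV \<and> G \<subseteq> M \<and> (\<forall>u a v b. (u, a) \<in> M \<longrightarrow> (v, b) \<in> M \<longrightarrow> (u + v, a + b) \<in> M) \<and>
    (\<forall>c u a. (u, a) \<in> M \<longrightarrow> (scale c u, c * a) \<in> M) \<and> (\<forall>u a. (u, a) \<in> M \<longrightarrow> a \<le> p u)" for M :: "('v \<times> real) set"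
  have "\<exists>M\<in>Collect good. \<forall>X\<in>Collect good. M \<subseteq> X \<longrightarrow> X = M"
  proof (rule subset_Zorn_nonempty)
    show "Collect good \<noteq> {}" using G by (auto simp: good_def intro!: exI[of _ G])
    fix C assume C: "C \<noteq> {}" "subset.chain (Collect good) C"
    have g: "good M" if "M \<in> C" for M using C that by (auto simp: subset_chain_def)
    have tot: "M \<subseteq> N \<or> N \<subseteq> M" if "M \<in> C" "N \<in> C" for M N using C that by (auto simp: subset_chain_def)
    have "(u + v, a + b) \<in> \<Union>C" if "(u, a) \<in> \<Union>C" "(v, b) \<in> \<Union>C" for u a v b
    proof -
      from that obtain M N where MN: "M \<in> C" "N \<in> C" "(u, a) \<in> M" "(v, b) \<in> N" by blast
      then obtain L where L: "L \<in> C" "(u, a) \<in> L" "(v, b) \<in> L" using tot[of M N] by blast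
      from g[OF L(1), unfolded good_def, THEN conjunct2, THEN conjunct2, THEN conjunct1] L(2,3)
      have "(u + v, a + b) \<in> L" by blast
      then show ?thesis using L(1) by blast
    qed
    moreover have "\<Union>C \<subseteq> W \<times> UNIV" "G \<subseteq> \<Union>C" using g C(1) unfolding good_def by fast+
    moreover have "(scale c u, c * a) \<in> \<Union>C \<and> a \<le> p u" if "(u, a) \<in> \<Union>C" for c u a
    proof -
      from that obtain L where L: "L \<in> C" "(u, a) \<in> L" by blast
      from g[OF L(1), unfolded good_def, THEN conjunct2, THEN conjunct2, THEN conjunct2] L(2)
      have "(scale c u, c * a) \<in> L" "a \<le> p u" by blast+
      then show ?thesis using L(1) by blast
    qed
    ultimately have "good (\<Union>C)" unfolding good_def by (intro conjI allI impI) auto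
    then show "\<Union>C \<in> Collect good" by simp
  qed
  then obtain M where M: "good M" "\<And>X. good X \<Longrightarrow> M \<subseteq> X \<Longrightarrow> X = M" by (metis mem_Collect_eq)
  note M' = M(1)[unfolded good_def]
  have MW: "u \<in> W" if "(u, a) \<in> M" for u a using M'[THEN conjunct1] that by auto
  have GM: "G \<subseteq> M" using M' by (elim conjE)
  have add: "(u + v, a + b) \<in> M" if "(u, a) \<in> M" "(v, b) \<in> M" for u a v b
    using M'[THEN conjunct2, THEN conjunct2, THEN conjunct1] that by blast
  have sc: "(scale c u, c * a) \<in> M" if "(u, a) \<in> M" for c u a
    using M'[THEN conjunct2, THEN conjunct2, THEN conjunct2, THEN conjunct1] that by blast
  have le: "a \<le> p u" if "(u, a) \<in> M" for u a
    using M'[THEN conjunct2, THEN conjunct2, THEN conjunct2, THEN conjunct2] that by blast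
  have p0: "p 0 = 0" using p(2)[OF W(1), of 2] by simp
  have le0: "a \<le> b" if "(u, a) \<in> M" "(u, b) \<in> M" for u a b
    using le[OF add[OF that(1) sc[OF that(2), of "-1"]]] p0 by simp
  have uniq: "a = b" if "(u, a) \<in> M" "(u, b) \<in> M" for u a b
    using le0[OF that] le0[OF that(2,1)] by simp
  have total: "\<exists>a. (u0, a) \<in> M" if u0: "u0 \<in> W" for u0
  proof (rule ccontr)
    assume none: "\<nexists>a. (u0, a) \<in> M"
    \<comment> \<open>The value at \<open>u0\<close> must lie between \<open>a - p (u - u0)\<close>
      and \<open>p (v + u0) - c\<close> for all \<open>(u, a)\<close> and \<open>(v, c)\<close> in
      \<open>M\<close>; \<open>key\<close> puts every lower bound below every upper one, so the
      supremum of the lower bounds qualifies.\<close>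
    define b where "b = (SUP (u, a)\<in>M. a - p (u + scale (-1) u0))"
    have um: "u + scale c u0 \<in> W" if "(u, a) \<in> M" for u a c using MW[OF that] W u0 by auto
    have key: "a - p (u + scale (-1) u0) \<le> p (v + u0) - c" if "(u, a) \<in> M" "(v, c) \<in> M" for u a v c
    proof -
      have "a + c \<le> p ((u + scale (-1) u0) + (v + u0))"
        using le[OF add[OF that]] by (simp add: algebra_simps)
      also have "\<dots> \<le> p (u + scale (-1) u0) + p (v + u0)"
        using p(1)[OF um[OF that(1), of "-1"] um[OF that(2), of 1]] by simp
      finally show ?thesis by simp
    qed
    have ne: "M \<noteq> {}" using GM G(2) by auto
    then obtain v c where vc: "(v, c) \<in> M" by auto
    have bdd: "bdd_above ((\<lambda>(u, a). a - p (u + scale (-1) u0)) ` M)"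
      using key[OF _ vc] by (intro bdd_aboveI[of _ "p (v + u0) - c"]) auto
    have b1: "a - p (u + scale (-1) u0) \<le> b" if "(u, a) \<in> M" for u a
      unfolding b_def using cSUP_upper[OF that bdd] by simp
    have b2: "b \<le> p (v + u0) - c" if "(v, c) \<in> M" for v c
      unfolding b_def using key[OF _ that] ne by (intro cSUP_least) auto
    define M' where "M' = {(u + scale t u0, a + t * b) | u a t. (u, a) \<in> M}"
    have sub: "M \<subseteq> M'" unfolding M'_def by (force intro: exI[of _ 0])
    have "good M'"
      unfolding good_def
    proof (intro conjI allI impI)
      show "M' \<subseteq> W \<times> UNIV" unfolding M'_def using um by auto
      show "G \<subseteq> M'" using sub GM by auto
      show "(u + v, a + c) \<in> M'" if uv: "(u, a) \<in> M'" "(v, c) \<in> M'" for u a v c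
      proof -
        from uv obtain u1 a1 t1 v1 c1 t2 where *: "(u1, a1) \<in> M" "(v1, c1) \<in> M" "u = u1 + scale t1 u0" "a = a1 + t1 * b"
          "v = v1 + scale t2 u0" "c = c1 + t2 * b" unfolding M'_def by blast
        have "u + v = (u1 + v1) + scale (t1 + t2) u0" "a + c = (a1 + c1) + (t1 + t2) * b"
          unfolding * by (simp_all add: scale_left_distrib distrib_right add_ac)
        then show ?thesis unfolding M'_def using add[OF *(1,2)] by blast
      qed
      show "(scale c u, c * a) \<in> M'" if ua: "(u, a) \<in> M'" for c u a
      proof -
        from ua obtain u1 a1 t1 where *: "(u1, a1) \<in> M" "u = u1 + scale t1 u0" "a = a1 + t1 * b" unfolding M'_def by blast
        have "scale c u = scale c u1 + scale (c * t1) u0" "c * a = c * a1 + (c * t1) * b"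
          unfolding * by (simp_all add: scale_right_distrib distrib_left mult.assoc)
        then show ?thesis unfolding M'_def using sc[OF *(1)] by blast
      qed
      show "a \<le> p u" if ua: "(u, a) \<in> M'" for u a
      proof -
        from ua obtain u1 a1 t where *: "(u1, a1) \<in> M" "u = u1 + scale t u0" "a = a1 + t * b" unfolding M'_def by blast
        consider "t = 0" | "t > 0" | "t < 0" by linarith
        then show ?thesis
        proof cases
          case 1 then show ?thesis using le[OF *(1)] * by simp
        next
          case 2
          \<comment> \<open>Scaling by \<open>1 / t\<close> reduces to the coefficient 1 of
            \<open>u0\<close>, for which \<open>b\<close> was chosen; negative \<open>t\<close> is
            reduced to the coefficient -1 in the same way.\<close>
          have "b \<le> p (scale (1/t) u1 + u0) - 1/t * a1" by (rule b2[OF sc[OF *(1)]])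
          then have "t * b \<le> t * p (scale (1/t) u1 + u0) - a1" using 2 by (simp add: field_simps)
          also have "t * p (scale (1/t) u1 + u0) = p (scale t (scale (1/t) u1 + u0))"
            using 2 MW[OF sc[OF *(1)]] W u0 by (simp add: p(2))
          also have "scale t (scale (1/t) u1 + u0) = u" using 2 * by (simp add: scale_right_distrib)
          finally show ?thesis using * by simp
        next
          case 3
          define s where "s = - t"
          have s: "s > 0" using 3 by (simp add: s_def)
          have "1/s * a1 - p (scale (1/s) u1 + scale (-1) u0) \<le> b" by (rule b1[OF sc[OF *(1)]])
          then have "a1 - s * p (scale (1/s) u1 + scale (-1) u0) \<le> s * b" using s by (simp add: field_simps)
          moreover have "s * p (scale (1/s) u1 + scale (-1) u0) = p (scale s (scale (1/s) u1 + scale (-1) u0))"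
            using s um[OF sc[OF *(1)]] by (simp only: p(2))
          moreover have "scale s (scale (1/s) u1 + scale (-1) u0) = u" using s * by (simp add: scale_right_distrib scale_right_diff_distrib s_def)
          ultimately show ?thesis using * by (simp add: s_def)
        qed
      qed
    qed
    then have "M' = M" using M(2) sub by blast
    moreover have "(0 + scale 1 u0, 0 + 1 * b) \<in> M'" unfolding M'_def using GM G(2) by blast
    ultimately show False using none by auto
  qed
  define g where "g u = (THE a. (u, a) \<in> M)" for u
  have gM: "(u, g u) \<in> M" if "u \<in> W" for u
    unfolding g_def using total[OF that] uniq by (metis theI)
  have geq: "g u = a" if "(u, a) \<in> M" for u a using uniq[OF gM[OF MW[OF that]] that] .
  show ?thesis
  proof (intro exI[of _ g] conjI ballI allI)
    fix u v assume "u \<in> W" "v \<in> W"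
    then show "g (u + v) = g u + g v" by (intro geq add gM)
  next
    fix c u assume "u \<in> W"
    then show "g (scale c u) = c * g u" by (intro geq sc gM)
  next
    fix u assume "u \<in> W"
    then show "g u \<le> p u" by (intro le gM)
  next
    fix z assume "z \<in> G"
    then show "case z of (u, a) \<Rightarrow> g u = a" using GM geq by auto
  qed
qed

lemma sum4_swap:
  "(\<Sum>i\<in>A. \<Sum>j\<in>B. \<Sum>k\<in>C. \<Sum>l\<in>D. g i j k l) = (\<Sum>k\<in>C. \<Sum>l\<in>D. \<Sum>i\<in>A. \<Sum>j\<in>B. g i j k l)"
proof -
  have 3: "(\<Sum>j\<in>B. \<Sum>k\<in>C. \<Sum>l\<in>D. h j k l) = (\<Sum>k\<in>C. \<Sum>l\<in>D. \<Sum>j\<in>B. h j k l)" for h B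
    by (subst sum.swap, rule sum.cong[OF refl], rule sum.swap)
  show ?thesis by (simp only: 3)
qed

lemma sum_lessThan_add:
  fixes f :: "nat \<Rightarrow> 'a::comm_monoid_add"
  shows "(\<Sum>i<n+m. f i) = (\<Sum>i<n. f i) + (\<Sum>i<m. f (n + i))"
  by (induction m) (simp_all add: add_ac)

section \<open>Dual families of finitely many vectors\<close>

context complex_hilbert_space
begin

text \<open>The sum of the \<open>\<langle>\<xi>, \<alpha> j\<rangle> \<odot> \<alpha> j\<close>,
  called \<open>S \<xi>\<close> in the proof, is to be the orthogonal projection of \<open>x\<close>
  onto the span of the \<open>\<alpha> j\<close>. The induction adds one vector at a time and
  distinguishes whether it lies in the span of the earlier ones, so dependent families are covered
  without selecting a basis.\<close>

lemma normal_equations: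
  fixes m :: nat
  assumes "\<And>j. j < m \<Longrightarrow> \<alpha> j \<in> carrier H" "x \<in> carrier H"
  shows "\<exists>\<xi>\<in>carrier H. \<forall>k<m. cinner H x (\<alpha> k) = (\<Sum>j<m. cinner H \<xi> (\<alpha> j) * cinner H (\<alpha> j) (\<alpha> k))"
  using assms
proof (induction m arbitrary: x)
  case 0
  then show ?case by auto
next
  case (Suc m)
  have \<alpha> [simp]: "\<alpha> j \<in> carrier H" if "j \<le> m" for j using Suc.prems(1) that by simp
  define S where "S \<xi> = (\<Oplus>j\<in>{..<m}. cinner H \<xi> (\<alpha> j) \<odot> \<alpha> j)" for \<xi>
  have S [simp]: "S \<xi> \<in> carrier H" for \<xi> unfolding S_def by (intro finsum_lessThan_closed) auto
  have S_inner: "cinner H (S \<xi>) y = (\<Sum>j<m. cinner H \<xi> (\<alpha> j) * cinner H (\<alpha> j) y)" if "y \<in> carrier H" for \<xi> y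
    unfolding S_def using that by (simp add: cinner_finsum_lessThan cinner_simps)
  have ex: "\<exists>\<xi>\<in>carrier H. \<forall>k<m. cinner H y (\<alpha> k) = cinner H (S \<xi>) (\<alpha> k)" if "y \<in> carrier H" for y
    using Suc.IH[of y] that by (simp add: S_inner)
  obtain \<zeta> where \<zeta> [simp]: "\<zeta> \<in> carrier H" and \<zeta>_eq: "\<And>k. k < m \<Longrightarrow> cinner H (\<alpha> m) (\<alpha> k) = cinner H (S \<zeta>) (\<alpha> k)"
    using ex[of "\<alpha> m"] by auto
  obtain \<xi> where \<xi> [simp]: "\<xi> \<in> carrier H" and \<xi>_eq: "\<And>k. k < m \<Longrightarrow> cinner H x (\<alpha> k) = cinner H (S \<xi>) (\<alpha> k)"
    using ex[of x] Suc.prems(2) by auto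
  have x [simp]: "x \<in> carrier H" by (rule Suc.prems(2))
  define z w where "z = \<alpha> m \<ominus> S \<zeta>" and "w = x \<ominus> S \<xi>"
  have [simp]: "z \<in> carrier H" "w \<in> carrier H" by (simp_all add: z_def w_def)
  have zk: "cinner H z (\<alpha> k) = 0" if "k < m" for k using \<zeta>_eq[OF that] that by (simp add: z_def cinner_simps)
  have wk: "cinner H w (\<alpha> k) = 0" if "k < m" for k using \<xi>_eq[OF that] that by (simp add: w_def cinner_simps)
  have S_perp: "cinner H y (S \<zeta>') = 0" if "y \<in> carrier H" "\<And>k. k < m \<Longrightarrow> cinner H y (\<alpha> k) = 0" for y \<zeta>'
  proof -
    have "cinner H (S \<zeta>') y = 0"
      using that cinner_commute[of "\<alpha> _" y] by (simp add: S_inner)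
    then show ?thesis using cinner_commute[of y "S \<zeta>'"] that(1) by simp
  qed
  have goal: "\<exists>\<xi>'\<in>carrier H. \<forall>k<Suc m. cinner H x (\<alpha> k) = (\<Sum>j<Suc m. cinner H \<xi>' (\<alpha> j) * cinner H (\<alpha> j) (\<alpha> k))"
    if "\<xi>' \<in> carrier H" "\<And>k. k \<le> m \<Longrightarrow> cinner H x (\<alpha> k) = cinner H (S \<xi>') (\<alpha> k) + cinner H \<xi>' (\<alpha> m) * cinner H (\<alpha> m) (\<alpha> k)" for \<xi>'
    using that by (intro bexI[of _ \<xi>']) (simp_all add: S_inner)
  show ?case
  proof (cases "z = \<zero>")
    case True
    then have am: "\<alpha> m = S \<zeta>" using diff_eq_0_iff[of "\<alpha> m" "S \<zeta>"] by (simp add: z_def)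
    \<comment> \<open>Since \<open>\<alpha> m = S \<zeta>\<close>, this inner product is a sum of
      squares; hence the denominator of \<open>a\<close> does not vanish.\<close>
    have "cinner H \<zeta> (\<alpha> m) = cnj (cinner H (S \<zeta>) \<zeta>)" using am by (simp add: cinner_commute[of \<zeta>])
    also have "\<dots> = (\<Sum>j<m. cnj (cinner H \<zeta> (\<alpha> j)) * cnj (cinner H (\<alpha> j) \<zeta>))" by (simp add: S_inner)
    also have "\<dots> = (\<Sum>j<m. complex_of_real ((cmod (cinner H \<zeta> (\<alpha> j)))\<^sup>2))"
      by (intro sum.cong) (auto simp: cinner_commute[of "\<alpha> _" \<zeta>] complex_norm_square mult.commute simp del: of_real_power)
    also have "\<dots> = complex_of_real (\<Sum>j<m. (cmod (cinner H \<zeta> (\<alpha> j)))\<^sup>2)" by simp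
    finally have "Re (cinner H \<zeta> (\<alpha> m)) \<ge> 0" by (simp add: sum_nonneg)
    then have nz: "1 + cinner H \<zeta> (\<alpha> m) \<noteq> 0" by (auto simp: complex_eq_iff)
    \<comment> \<open>Chosen so that the coefficient of \<open>\<alpha> m\<close> coming from
      \<open>\<xi>'\<close> is \<open>- a\<close>, which cancels the multiple
      \<open>a \<odot> \<alpha> m\<close> that \<open>a \<odot> \<zeta>\<close> contributes through
      \<open>S\<close>.\<close>
    define a where "a = - cinner H \<xi> (\<alpha> m) / (1 + cinner H \<zeta> (\<alpha> m))"
    define \<xi>' where "\<xi>' = \<xi> \<oplus> a \<odot> \<zeta>"
    have a: "cinner H \<xi> (\<alpha> m) + a * cinner H \<zeta> (\<alpha> m) = - a" using nz by (simp add: a_def field_simps)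
    show ?thesis
    proof (rule goal[of \<xi>'])
      show "\<xi>' \<in> carrier H" by (simp add: \<xi>'_def)
      fix k assume k: "k \<le> m"
      have "cinner H (S \<xi>') (\<alpha> k) = cinner H (S \<xi>) (\<alpha> k) + a * cinner H (S \<zeta>) (\<alpha> k)"
        using k by (simp add: S_inner \<xi>'_def cinner_simps algebra_simps sum.distrib sum_distrib_left)
      moreover have "cinner H \<xi>' (\<alpha> m) = - a" using a by (simp add: \<xi>'_def cinner_simps)
      moreover have "cinner H x (\<alpha> k) = cinner H (S \<xi>) (\<alpha> k)"
      proof (cases "k = m")
        case True
        have "cinner H w (\<alpha> m) = 0" unfolding am by (rule S_perp) (use wk in auto)
        then show ?thesis using True by (simp add: w_def cinner_simps)
      qed (use \<xi>_eq k in auto)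
      ultimately show "cinner H x (\<alpha> k) = cinner H (S \<xi>') (\<alpha> k) + cinner H \<xi>' (\<alpha> m) * cinner H (\<alpha> m) (\<alpha> k)"
        using am by simp
    qed
  next
    case False
    define N where "N = cinner H z z"
    have N: "N \<noteq> 0" using cinner_pos[of z] False by (auto simp: N_def)
    have zm: "cinner H z (\<alpha> m) = N"
    proof -
      have "N = cinner H z (\<alpha> m) - cinner H z (S \<zeta>)" unfolding N_def by (subst (2) z_def) (simp add: cinner_simps)
      then show ?thesis using S_perp[of z \<zeta>] zk by simp
    qed
    \<comment> \<open>The projection of \<open>x\<close> grows by \<open>d \<odot> z\<close>.
      Subtracting \<open>d \<odot> \<zeta>\<close> supplies the part \<open>- d\<close> times
      \<open>S \<zeta>\<close>, and \<open>c\<close> adjusts the coefficient at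
      \<open>\<alpha> m\<close> to \<open>d\<close>; the multiple of \<open>z\<close> is invisible
      to the earlier vectors.\<close>
    define d where "d = cinner H w (\<alpha> m) / N"
    define c where "c = (d - cinner H \<xi> (\<alpha> m) + d * cinner H \<zeta> (\<alpha> m)) / N"
    define \<xi>' where "\<xi>' = \<xi> \<ominus> d \<odot> \<zeta> \<oplus> c \<odot> z"
    show ?thesis
    proof (rule goal[of \<xi>'])
      show "\<xi>' \<in> carrier H" by (simp add: \<xi>'_def)
      fix k assume k: "k \<le> m"
      have "cinner H (S \<xi>') (\<alpha> k) = cinner H (S \<xi>) (\<alpha> k) - d * cinner H (S \<zeta>) (\<alpha> k)"
        using k zk by (simp add: S_inner \<xi>'_def cinner_simps algebra_simps sum_subtractf sum_distrib_left)
      moreover have "cinner H \<xi>' (\<alpha> m) = d" using N by (simp add: \<xi>'_def cinner_simps zm c_def)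
      moreover have "cinner H x (\<alpha> k) = cinner H (S \<xi>) (\<alpha> k) + d * cinner H z (\<alpha> k)"
      proof (cases "k = m")
        case True
        have "d * N = cinner H w (\<alpha> m)" using N by (simp add: d_def)
        then show ?thesis using True zm by (simp add: w_def cinner_simps)
      qed (use \<xi>_eq zk k in auto)
      moreover have "cinner H z (\<alpha> k) = cinner H (\<alpha> m) (\<alpha> k) - cinner H (S \<zeta>) (\<alpha> k)"
        using k by (simp add: z_def cinner_simps)
      ultimately show "cinner H x (\<alpha> k) = cinner H (S \<xi>') (\<alpha> k) + cinner H \<xi>' (\<alpha> m) * cinner H (\<alpha> m) (\<alpha> k)"
        by (simp add: right_diff_distrib)
    qed
  qed
qed

text \<open>
  A linearly dependent family still has dual vectors \<open>\<xi>\<close>, for which the matrix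
  \<open>(\<langle>\<alpha> j, \<xi> k\<rangle>)\<close> is a self-adjoint projection instead of the identity.
\<close>

lemma dual_family:
  fixes m :: nat
  assumes \<alpha> [simp]: "\<And>j. j < m \<Longrightarrow> \<alpha> j \<in> carrier H"
  obtains \<xi> where "\<And>k. k < m \<Longrightarrow> \<xi> k \<in> carrier H"
    "\<And>j. j < m \<Longrightarrow> \<alpha> j = (\<Oplus>k\<in>{..<m}. cinner H (\<alpha> j) (\<xi> k) \<odot> \<alpha> k)"
    "\<And>j z. j < m \<Longrightarrow> z \<in> carrier H \<Longrightarrow> cinner H (\<alpha> j) z = (\<Sum>k<m. cinner H (\<alpha> j) (\<xi> k) * cinner H (\<alpha> k) z)"
    "\<And>j k. j < m \<Longrightarrow> k < m \<Longrightarrow> cnj (cinner H (\<alpha> j) (\<xi> k)) = cinner H (\<alpha> k) (\<xi> j)"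
proof -
  define S where "S \<xi> = (\<Oplus>j\<in>{..<m}. cinner H \<xi> (\<alpha> j) \<odot> \<alpha> j)" for \<xi>
  have S [simp]: "S \<xi> \<in> carrier H" for \<xi> unfolding S_def by (intro finsum_lessThan_closed) auto
  have S_inner: "cinner H (S \<xi>) y = (\<Sum>j<m. cinner H \<xi> (\<alpha> j) * cinner H (\<alpha> j) y)" if "y \<in> carrier H" for \<xi> y
    unfolding S_def using that by (simp add: cinner_finsum_lessThan cinner_simps)
  have "\<exists>\<xi>\<in>carrier H. S \<xi> = \<alpha> j" if j: "j < m" for j
  proof -
    obtain \<xi> where \<xi>: "\<xi> \<in> carrier H" "\<And>k. k < m \<Longrightarrow> cinner H (\<alpha> j) (\<alpha> k) = cinner H (S \<xi>) (\<alpha> k)"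
      using normal_equations[of m \<alpha> "\<alpha> j"] j by (auto simp: S_inner)
    \<comment> \<open>\<open>r\<close> is orthogonal to every \<open>\<alpha> k\<close>, hence to
      \<open>S \<xi>\<close> and to \<open>\<alpha> j\<close>, hence to itself.\<close>
    define r where "r = \<alpha> j \<ominus> S \<xi>"
    have r [simp]: "r \<in> carrier H" using j by (simp add: r_def)
    have rk: "cinner H r (\<alpha> k) = 0" if "k < m" for k using \<xi>(2)[OF that] that j by (simp add: r_def cinner_simps)
    have "cinner H (S \<xi>) r = 0" using rk cinner_commute[of "\<alpha> _" r] by (simp add: S_inner)
    then have "cinner H r (S \<xi>) = 0" using cinner_commute[of r "S \<xi>"] by simp
    then have "cinner H r r = 0" using rk[OF j] j by (subst (2) r_def) (simp add: cinner_simps)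
    then have "r = \<zero>" using cinner_pos[of r] by fastforce
    then show ?thesis using \<xi>(1) diff_eq_0_iff[of "\<alpha> j" "S \<xi>"] j by (auto simp: r_def)
  qed
  then obtain \<xi> where \<xi> [simp]: "\<And>j. j < m \<Longrightarrow> \<xi> j \<in> carrier H" and S\<xi>: "\<And>j. j < m \<Longrightarrow> S (\<xi> j) = \<alpha> j" by metis
  have sym: "cinner H (\<alpha> j) (\<xi> k) = cinner H (\<xi> j) (\<alpha> k)" if jk: "j < m" "k < m" for j k
  proof -
    have "cinner H (\<xi> j) (\<alpha> k) = cnj (cinner H (S (\<xi> k)) (\<xi> j))"
      using jk by (simp add: S\<xi> cinner_commute[of "\<xi> j"])
    also have "\<dots> = (\<Sum>l<m. cinner H (\<xi> j) (\<alpha> l) * cinner H (\<alpha> l) (\<xi> k))"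
      using jk by (simp add: S_inner cinner_commute[symmetric] mult.commute)
    also have "\<dots> = cinner H (S (\<xi> j)) (\<xi> k)" using jk by (simp add: S_inner)
    finally show ?thesis using jk by (simp add: S\<xi>)
  qed
  have exp: "\<alpha> j = (\<Oplus>k\<in>{..<m}. cinner H (\<alpha> j) (\<xi> k) \<odot> \<alpha> k)" if "j < m" for j
  proof -
    have "(\<Oplus>k\<in>{..<m}. cinner H (\<alpha> j) (\<xi> k) \<odot> \<alpha> k) = S (\<xi> j)"
      unfolding S_def using sym that by (intro finsum_cong') auto
    then show ?thesis using S\<xi>[OF that] by simp
  qed
  show thesis
  proof (rule that[of \<xi>])
    show "cinner H (\<alpha> j) z = (\<Sum>k<m. cinner H (\<alpha> j) (\<xi> k) * cinner H (\<alpha> k) z)" if "j < m" "z \<in> carrier H" for j z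
      using that S_inner[of z "\<xi> j"] by (simp add: S\<xi> sym)
    show "cnj (cinner H (\<alpha> j) (\<xi> k)) = cinner H (\<alpha> k) (\<xi> j)" if "j < m" "k < m" for j k
      using that sym cinner_commute[of "\<xi> k" "\<alpha> j"] by simp
  qed (use exp in auto)
qed

text \<open>For a self-adjoint idempotent, \<open>\<parallel>P v\<parallel>\<^sup>2 = \<langle>v, P
  v\<rangle> \<le> (\<parallel>v\<parallel>\<^sup>2 + \<parallel>P v\<parallel>\<^sup>2) /
  2\<close>.\<close>

lemma projection_matrix_contractive:
  fixes m :: nat
  assumes v: "\<And>k. k < m \<Longrightarrow> v k \<in> carrier H"
    and herm: "\<And>j k. j < m \<Longrightarrow> k < m \<Longrightarrow> cnj (P j k) = P k j"
    and idem: "\<And>j k. j < m \<Longrightarrow> k < m \<Longrightarrow> (\<Sum>l<m. P j l * P l k) = P j k"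
  shows "(\<Sum>j<m. (hnorm H (\<Oplus>k\<in>{..<m}. P j k \<odot> v k))\<^sup>2) \<le> (\<Sum>k<m. (hnorm H (v k))\<^sup>2)"
proof -
  define y where "y j = (\<Oplus>k\<in>{..<m}. P j k \<odot> v k)" for j
  have y [simp]: "y j \<in> carrier H" for j unfolding y_def using v by simp
  have yl: "cinner H (y j) z = (\<Sum>k<m. P j k * cinner H (v k) z)" if "z \<in> carrier H" for j z
    unfolding y_def using that v by (simp add: cinner_finsum_lessThan cinner_simps)
  have yr: "cinner H z (y j) = (\<Sum>k<m. cnj (P j k) * cinner H z (v k))" if "z \<in> carrier H" for j z
    using that v cinner_commute[of z "y j"] cinner_commute[of z "v _"] by (simp add: yl)
  have fix_y: "(\<Sum>j<m. cnj (P k j) * cinner H z (y j)) = cinner H z (y k)" if "z \<in> carrier H" "k < m" for z k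
  proof -
    have "(\<Sum>j<m. cnj (P k j) * cinner H z (y j)) = (\<Sum>j<m. \<Sum>l<m. cnj (P k j * P j l) * cinner H z (v l))"
      using that by (simp add: yr sum_distrib_left mult.assoc)
    also have "\<dots> = (\<Sum>l<m. cnj (\<Sum>j<m. P k j * P j l) * cinner H z (v l))"
      by (subst sum.swap) (simp add: sum_distrib_right)
    also have "\<dots> = cinner H z (y k)" using that idem by (simp add: yr)
    finally show ?thesis .
  qed
  have "(\<Sum>j<m. cinner H (y j) (y j)) = (\<Sum>k<m. \<Sum>j<m. P j k * cinner H (v k) (y j))"
    by (subst sum.swap) (simp add: yl)
  also have "\<dots> = (\<Sum>k<m. \<Sum>j<m. cnj (P k j) * cinner H (v k) (y j))"
    by (intro sum.cong refl) (simp add: herm)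
  also have "\<dots> = (\<Sum>k<m. cinner H (v k) (y k))" using fix_y v by simp
  finally have "(\<Sum>j<m. (hnorm H (y j))\<^sup>2) = (\<Sum>k<m. Re (cinner H (v k) (y k)))"
    by (simp add: hnorm_square flip: Re_sum)
  also have "\<dots> \<le> (\<Sum>k<m. ((hnorm H (v k))\<^sup>2 + (hnorm H (y k))\<^sup>2) / 2)"
    using v by (intro sum_mono Re_cinner_le) auto
  also have "\<dots> = ((\<Sum>k<m. (hnorm H (v k))\<^sup>2) + (\<Sum>k<m. (hnorm H (y k))\<^sup>2)) / 2"
    by (simp add: sum.distrib add_divide_distrib flip: sum_divide_distrib)
  finally show ?thesis by (simp add: y_def)
qed

end

section \<open>Block sums of vectors and matrices\<close>

definition dsum_vec :: "nat \<Rightarrow> (nat \<Rightarrow> 'x) \<Rightarrow> (nat \<Rightarrow> 'x) \<Rightarrow> nat \<Rightarrow> 'x"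
  where "dsum_vec n a b = (\<lambda>j. if j < n then a j else b (j - n))"

text \<open>The off-diagonal filler \<open>z\<close> is a parameter because the zero of
  \<open>bop H K\<close> depends on the two spaces and is not a constant of the type.\<close>

definition dsum_mat :: "nat \<Rightarrow> 'x \<Rightarrow> (nat \<Rightarrow> nat \<Rightarrow> 'x) \<Rightarrow> (nat \<Rightarrow> nat \<Rightarrow> 'x) \<Rightarrow> nat \<Rightarrow> nat \<Rightarrow> 'x"
  where "dsum_mat n z A B = (\<lambda>i j. if i < n \<and> j < n then A i j else if n \<le> i \<and> n \<le> j then B (i - n) (j - n) else z)"

lemma dsum_vec_mem:
  "\<forall>j<n. a j \<in> S \<Longrightarrow> \<forall>j<m. b j \<in> S \<Longrightarrow> \<forall>j<n+m. dsum_vec n a b j \<in> S"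
  by (auto simp: dsum_vec_def)

lemma dsum_mat_mem:
  "z \<in> S \<Longrightarrow> \<forall>i<n. \<forall>j<n. A i j \<in> S \<Longrightarrow> \<forall>i<m. \<forall>j<m. B i j \<in> S \<Longrightarrow>
    \<forall>i<n+m. \<forall>j<n+m. dsum_mat n z A B i j \<in> S"
  by (auto simp: dsum_mat_def)

lemma sum_dsum_vec:
  fixes g :: "'x \<Rightarrow> 'y::comm_monoid_add"
  shows "(\<Sum>j<n+m. g (dsum_vec n a b j)) = (\<Sum>j<n. g (a j)) + (\<Sum>j<m. g (b j))"
  by (simp add: sum_lessThan_add dsum_vec_def)

lemma sum_dsum:
  fixes \<phi> :: "'x \<Rightarrow> 'y \<Rightarrow> 'z \<Rightarrow> 'w::comm_monoid_add"
  assumes "\<And>i j. i < n + m \<Longrightarrow> j < n + m \<Longrightarrow> \<phi> z (dsum_vec n a a' j) (dsum_vec n b b' i) = 0"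
  shows "(\<Sum>i<n+m. \<Sum>j<n+m. \<phi> (dsum_mat n z A B i j) (dsum_vec n a a' j) (dsum_vec n b b' i)) =
    (\<Sum>i<n. \<Sum>j<n. \<phi> (A i j) (a j) (b i)) + (\<Sum>i<m. \<Sum>j<m. \<phi> (B i j) (a' j) (b' i))"
proof -
  have 1: "(\<Sum>j<n+m. \<phi> (dsum_mat n z A B i j) (dsum_vec n a a' j) (dsum_vec n b b' i)) = (\<Sum>j<n. \<phi> (A i j) (a j) (b i))"
    if "i < n" for i
  proof -
    have "(\<Sum>j<m. \<phi> z (a' j) (b i)) = 0"
      using assms[of i "n + _"] that by (intro sum.neutral) (auto simp: dsum_vec_def)
    then show ?thesis using that by (simp add: sum_lessThan_add dsum_vec_def dsum_mat_def)
  qed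
  have 2: "(\<Sum>j<n+m. \<phi> (dsum_mat n z A B (n + i) j) (dsum_vec n a a' j) (dsum_vec n b b' (n + i))) = (\<Sum>j<m. \<phi> (B i j) (a' j) (b' i))"
    if "i < m" for i
  proof -
    have "(\<Sum>j<n. \<phi> z (a j) (b' i)) = 0"
    proof (intro sum.neutral ballI)
      fix j assume "j \<in> {..<n}"
      then show "\<phi> z (a j) (b' i) = 0" using assms[of "n + i" j] that by (simp add: dsum_vec_def)
    qed
    then show ?thesis using that by (simp add: sum_lessThan_add dsum_vec_def dsum_mat_def)
  qed
  define S where "S i = (\<Sum>j<n+m. \<phi> (dsum_mat n z A B i j) (dsum_vec n a a' j) (dsum_vec n b b' i))" for i
  have "(\<Sum>i<n+m. S i) = (\<Sum>i<n. \<Sum>j<n. \<phi> (A i j) (a j) (b i)) + (\<Sum>i<m. \<Sum>j<m. \<phi> (B i j) (a' j) (b' i))"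
    unfolding sum_lessThan_add[of S n m] by (simp add: S_def 1 2)
  then show ?thesis by (simp add: S_def)
qed

context hilbert_pair
begin

text \<open>Both sides of the inequality in \<open>mbound\<close> add up over the two blocks. This
  is what will make the gauge \<open>tnorm\<close> subadditive.\<close>

lemma mbound_dsum:
  assumes A: "mbound H K r n A" and B: "mbound H K r m B"
  shows "mbound H K r (n + m) (dsum_mat n \<zero>\<^bsub>bop H K\<^esub> A B)"
  unfolding mbound_def
proof (intro allI impI)
  fix v w assume vw: "\<forall>j<n+m. v j \<in> carrier H" "\<forall>i<n+m. w i \<in> carrier K"
  define v1 v2 w1 w2 where "v1 = v" and "v2 = (\<lambda>j. v (n + j))" and "w1 = w" and "w2 = (\<lambda>j. w (n + j))"
  have v: "v = dsum_vec n v1 v2" and w: "w = dsum_vec n w1 w2"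
    by (auto simp: dsum_vec_def v1_def v2_def w1_def w2_def)
  have 1: "Re (\<Sum>i<n. \<Sum>j<n. cinner K (A i j (v1 j)) (w1 i)) \<le>
      r * ((\<Sum>j<n. (hnorm H (v1 j))\<^sup>2) + (\<Sum>i<n. (hnorm K (w1 i))\<^sup>2)) / 2"
    using A[unfolded mbound_def, rule_format, of v1 w1] vw by (simp add: v1_def w1_def)
  have 2: "Re (\<Sum>i<m. \<Sum>j<m. cinner K (B i j (v2 j)) (w2 i)) \<le>
      r * ((\<Sum>j<m. (hnorm H (v2 j))\<^sup>2) + (\<Sum>i<m. (hnorm K (w2 i))\<^sup>2)) / 2"
    using B[unfolded mbound_def, rule_format, of v2 w2] vw by (simp add: v2_def w2_def)
  have "(\<Sum>i<n+m. \<Sum>j<n+m. cinner K (dsum_mat n \<zero>\<^bsub>bop H K\<^esub> A B i j (v j)) (w i)) =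
      (\<Sum>i<n. \<Sum>j<n. cinner K (A i j (v1 j)) (w1 i)) + (\<Sum>i<m. \<Sum>j<m. cinner K (B i j (v2 j)) (w2 i))"
    unfolding v w by (rule sum_dsum[of n m "\<lambda>a x y. cinner K (a x) y"]) (use vw[unfolded v w] in simp)
  moreover have "(\<Sum>j<n+m. (hnorm H (v j))\<^sup>2) = (\<Sum>j<n. (hnorm H (v1 j))\<^sup>2) + (\<Sum>j<m. (hnorm H (v2 j))\<^sup>2)"
    unfolding v by (rule sum_dsum_vec)
  moreover have "(\<Sum>j<n+m. (hnorm K (w j))\<^sup>2) = (\<Sum>j<n. (hnorm K (w1 j))\<^sup>2) + (\<Sum>j<m. (hnorm K (w2 j))\<^sup>2)"
    unfolding w by (rule sum_dsum_vec)
  ultimately show "Re (\<Sum>i<n+m. \<Sum>j<n+m. cinner K (dsum_mat n \<zero>\<^bsub>bop H K\<^esub> A B i j (v j)) (w i)) \<le>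
      r * ((\<Sum>j<n+m. (hnorm H (v j))\<^sup>2) + (\<Sum>i<n+m. (hnorm K (w i))\<^sup>2)) / 2"
    using 1 2 by (simp add: distrib_left add_divide_distrib)
qed

lemma mbound_exists:
  assumes "\<forall>i<n. \<forall>j<n. A i j \<in> carrier (bop H K)"
  shows "\<exists>r>0. mbound H K r n A"
proof (cases "n = 0")
  case False
  then interpret P: hilbert_pair_power H K n by unfold_locales simp
  let ?r = "opnorm (hpow n H) (hpow n K) (mop H K n A)"
  have "?r \<ge> 0" using assms by simp
  then have pos: "0 < ?r + 1" by linarith
  then have "mbound H K (?r + 1) n A"
    using P.mbound_iff_opnorm[of A "?r + 1"] assms by simp
  then show ?thesis using pos by blast
qed (auto simp: mbound_def intro: exI[of _ 1])

lemma mbound_scale: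
  assumes A: "\<forall>i<n. \<forall>j<n. A i j \<in> carrier (bop H K)" and "mbound H K r n A" and c: "0 \<le> c"
  shows "mbound H K (c * r) n (\<lambda>i j. complex_of_real c \<odot>\<^bsub>bop H K\<^esub> A i j)"
  unfolding mbound_def
proof (intro allI impI)
  fix v w assume vw: "\<forall>j<n. v j \<in> carrier H" "\<forall>i<n. w i \<in> carrier K"
  have "(\<Sum>i<n. \<Sum>j<n. cinner K ((complex_of_real c \<odot>\<^bsub>bop H K\<^esub> A i j) (v j)) (w i)) =
      complex_of_real c * (\<Sum>i<n. \<Sum>j<n. cinner K (A i j (v j)) (w i))"
    unfolding sum_distrib_left by (intro sum.cong refl) (use A vw in \<open>simp add: K.cinner_simps\<close>)
  then have "Re (\<Sum>i<n. \<Sum>j<n. cinner K ((complex_of_real c \<odot>\<^bsub>bop H K\<^esub> A i j) (v j)) (w i)) =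
      c * Re (\<Sum>i<n. \<Sum>j<n. cinner K (A i j (v j)) (w i))" by simp
  then show "Re (\<Sum>i<n. \<Sum>j<n. cinner K ((complex_of_real c \<odot>\<^bsub>bop H K\<^esub> A i j) (v j)) (w i)) \<le>
      c * r * ((\<Sum>j<n. (hnorm H (v j))\<^sup>2) + (\<Sum>i<n. (hnorm K (w i))\<^sup>2)) / 2"
    using mult_left_mono[OF assms(2)[unfolded mbound_def, rule_format, of v w] c] vw by (simp add: mult.assoc)
qed

lemma cinner_expand:
  fixes n m :: nat
  assumes "a \<in> carrier (bop H K)" "\<And>k. k < n \<Longrightarrow> u k \<in> carrier H" "\<And>l. l < m \<Longrightarrow> w l \<in> carrier K"
  shows "cinner K (a (\<Oplus>\<^bsub>H\<^esub>k\<in>{..<n}. c k \<odot>\<^bsub>H\<^esub> u k)) (\<Oplus>\<^bsub>K\<^esub>l\<in>{..<m}. d l \<odot>\<^bsub>K\<^esub> w l) =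
    (\<Sum>k<n. \<Sum>l<m. c k * cnj (d l) * cinner K (a (u k)) (w l))"
proof -
  have "a (\<Oplus>\<^bsub>H\<^esub>k\<in>{..<n}. c k \<odot>\<^bsub>H\<^esub> u k) = (\<Oplus>\<^bsub>K\<^esub>k\<in>{..<n}. a (c k \<odot>\<^bsub>H\<^esub> u k))"
    using assms by (intro bop_finsum) auto
  then have "cinner K (a (\<Oplus>\<^bsub>H\<^esub>k\<in>{..<n}. c k \<odot>\<^bsub>H\<^esub> u k)) (\<Oplus>\<^bsub>K\<^esub>l\<in>{..<m}. d l \<odot>\<^bsub>K\<^esub> w l) =
      (\<Sum>k<n. cinner K (a (c k \<odot>\<^bsub>H\<^esub> u k)) (\<Oplus>\<^bsub>K\<^esub>l\<in>{..<m}. d l \<odot>\<^bsub>K\<^esub> w l))"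
    using assms by (simp add: K.cinner_finsum_lessThan)
  also have "\<dots> = (\<Sum>k<n. \<Sum>l<m. cinner K (a (c k \<odot>\<^bsub>H\<^esub> u k)) (d l \<odot>\<^bsub>K\<^esub> w l))"
    using assms by (intro sum.cong refl K.cinner_finsum_right) auto
  also have "\<dots> = (\<Sum>k<n. \<Sum>l<m. c k * cnj (d l) * cinner K (a (u k)) (w l))"
    using assms by (intro sum.cong refl) (simp add: K.cinner_simps)
  finally show ?thesis .
qed

end

section \<open>The functional induced by a completely contractive map\<close>

locale contractive_map = D: hilbert_pair H0 K0 + C: hilbert_pair H K
  for H0 :: "'a inner_space" and K0 :: "'b inner_space" and H :: "'c inner_space" and K :: "'d inner_space" +
  fixes X :: "('a \<Rightarrow> 'b) set" and f :: "('a \<Rightarrow> 'b) \<Rightarrow> ('c \<Rightarrow> 'd)"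
  assumes X: "operator_space H0 K0 X" and f: "clinear_on X (bop H0 K0) (bop H K) f"
    and cc: "\<And>n A. \<forall>i<n. \<forall>j<n. A i j \<in> X \<Longrightarrow> mbound H0 K0 1 n A \<Longrightarrow> mbound H K 1 n (\<lambda>i j. f (A i j))"
begin

lemmas X_closed [simp] = D.operator_spaceD[OF X]

lemma f_closed [simp]: "x \<in> X \<Longrightarrow> f x \<in> carrier (bop H K)"
  and f_add [simp]: "x \<in> X \<Longrightarrow> y \<in> X \<Longrightarrow> f (x \<oplus>\<^bsub>bop H0 K0\<^esub> y) = f x \<oplus>\<^bsub>bop H K\<^esub> f y"
  and f_smult [simp]: "x \<in> X \<Longrightarrow> f (c \<odot>\<^bsub>bop H0 K0\<^esub> x) = c \<odot>\<^bsub>bop H K\<^esub> f x"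
  using f by (auto simp: clinear_on_def)

lemma f_zero [simp]: "f \<zero>\<^bsub>bop H0 K0\<^esub> = \<zero>\<^bsub>bop H K\<^esub>"
  using f_smult[of "\<zero>\<^bsub>bop H0 K0\<^esub>" 0] D.B.csmult_zero[of "\<zero>\<^bsub>bop H0 K0\<^esub>"] by (simp del: f_smult)

text \<open>The combination and its image under \<open>f\<close> are described at once, and through
  inner products, which is the form in which coefficients of tensors arise.\<close>

lemma linear_combination:
  assumes "finite I" "\<And>i. i \<in> I \<Longrightarrow> x i \<in> X"
  shows "\<exists>y\<in>X. (\<forall>\<zeta>\<in>carrier H0. \<forall>\<omega>\<in>carrier K0. cinner K0 (y \<zeta>) \<omega> = (\<Sum>i\<in>I. c i * cinner K0 (x i \<zeta>) \<omega>)) \<and>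
    (\<forall>\<xi>\<in>carrier H. \<forall>\<eta>\<in>carrier K. cinner K (f y \<xi>) \<eta> = (\<Sum>i\<in>I. c i * cinner K (f (x i) \<xi>) \<eta>))"
  using assms
proof (induction I rule: finite_induct)
  case empty
  show ?case by (intro bexI[of _ "\<zero>\<^bsub>bop H0 K0\<^esub>"]) auto
next
  case (insert i I)
  then obtain y where y: "y \<in> X"
    "\<And>\<zeta> \<omega>. \<zeta> \<in> carrier H0 \<Longrightarrow> \<omega> \<in> carrier K0 \<Longrightarrow> cinner K0 (y \<zeta>) \<omega> = (\<Sum>i\<in>I. c i * cinner K0 (x i \<zeta>) \<omega>)"
    "\<And>\<xi> \<eta>. \<xi> \<in> carrier H \<Longrightarrow> \<eta> \<in> carrier K \<Longrightarrow> cinner K (f y \<xi>) \<eta> = (\<Sum>i\<in>I. c i * cinner K (f (x i) \<xi>) \<eta>)"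
    by auto
  have xi: "x i \<in> X" using insert by auto
  show ?case
    using y xi insert(1,2)
    by (intro bexI[of _ "c i \<odot>\<^bsub>bop H0 K0\<^esub> x i \<oplus>\<^bsub>bop H0 K0\<^esub> y"]) (simp_all add: D.K.cinner_simps C.K.cinner_simps)
qed

text \<open>
  The algebraic tensor product of \<open>B(H\<^sub>0, K\<^sub>0)\<close> with \<open>H\<close> and the conjugate of \<open>K\<close> is realised
  by scalar functions: \<open>tens n A \<alpha> \<beta>\<close> stands for the sum of the \<open>A i j \<otimes> \<alpha> j \<otimes> \<beta> i\<close>.
\<close>

definition tens :: "nat \<Rightarrow> (nat \<Rightarrow> nat \<Rightarrow> 'a \<Rightarrow> 'b) \<Rightarrow> (nat \<Rightarrow> 'c) \<Rightarrow> (nat \<Rightarrow> 'd) \<Rightarrow> 'c \<times> 'd \<times> 'a \<times> 'b \<Rightarrow> complex"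
  where "tens n A \<alpha> \<beta> = (\<lambda>(\<xi>, \<eta>, \<zeta>, \<omega>).
    if \<xi> \<in> carrier H \<and> \<eta> \<in> carrier K \<and> \<zeta> \<in> carrier H0 \<and> \<omega> \<in> carrier K0
    then \<Sum>i<n. \<Sum>j<n. cinner H (\<alpha> j) \<xi> * cinner K \<eta> (\<beta> i) * cinner K0 (A i j \<zeta>) \<omega> else 0)"

text \<open>The value at \<open>tens n A \<alpha> \<beta>\<close> of the functional that sends
  \<open>x \<otimes> \<xi> \<otimes> \<eta>\<close> to
  \<open>\<langle>f x \<xi>, \<eta>\<rangle>\<close>; that it depends on the tensor alone is
  \<open>val_cong\<close>.\<close>

definition val :: "nat \<Rightarrow> (nat \<Rightarrow> nat \<Rightarrow> 'a \<Rightarrow> 'b) \<Rightarrow> (nat \<Rightarrow> 'c) \<Rightarrow> (nat \<Rightarrow> 'd) \<Rightarrow> complex"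
  where "val n A \<alpha> \<beta> = (\<Sum>i<n. \<Sum>j<n. cinner K (f (A i j) (\<alpha> j)) (\<beta> i))"

definition adm :: "('a \<Rightarrow> 'b) set \<Rightarrow> nat \<Rightarrow> (nat \<Rightarrow> nat \<Rightarrow> 'a \<Rightarrow> 'b) \<Rightarrow> (nat \<Rightarrow> 'c) \<Rightarrow> (nat \<Rightarrow> 'd) \<Rightarrow> bool"
  where "adm S n A \<alpha> \<beta> \<longleftrightarrow> (\<forall>i<n. \<forall>j<n. A i j \<in> S) \<and> (\<forall>j<n. \<alpha> j \<in> carrier H) \<and> (\<forall>i<n. \<beta> i \<in> carrier K)"

lemma adm_X_bop: "adm X n A \<alpha> \<beta> \<Longrightarrow> adm (carrier (bop H0 K0)) n A \<alpha> \<beta>"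
  by (auto simp: adm_def)

lemma tens_apply:
  "\<xi> \<in> carrier H \<Longrightarrow> \<eta> \<in> carrier K \<Longrightarrow> \<zeta> \<in> carrier H0 \<Longrightarrow> \<omega> \<in> carrier K0 \<Longrightarrow> tens n A \<alpha> \<beta> (\<xi>, \<eta>, \<zeta>, \<omega>) =
    (\<Sum>i<n. \<Sum>j<n. cinner H (\<alpha> j) \<xi> * cinner K \<eta> (\<beta> i) * cinner K0 (A i j \<zeta>) \<omega>)"
  by (simp add: tens_def)

lemma tens_eqI:
  assumes "\<And>\<xi> \<eta> \<zeta> \<omega>. \<xi> \<in> carrier H \<Longrightarrow> \<eta> \<in> carrier K \<Longrightarrow> \<zeta> \<in> carrier H0 \<Longrightarrow> \<omega> \<in> carrier K0 \<Longrightarrow>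
      u (\<xi>, \<eta>, \<zeta>, \<omega>) = v (\<xi>, \<eta>, \<zeta>, \<omega>)"
    "\<And>\<xi> \<eta> \<zeta> \<omega>. \<not> (\<xi> \<in> carrier H \<and> \<eta> \<in> carrier K \<and> \<zeta> \<in> carrier H0 \<and> \<omega> \<in> carrier K0) \<Longrightarrow>
      u (\<xi>, \<eta>, \<zeta>, \<omega>) = v (\<xi>, \<eta>, \<zeta>, \<omega>)"
  shows "u = v"
proof
  fix z :: "'c \<times> 'd \<times> 'a \<times> 'b"
  obtain \<xi> \<eta> \<zeta> \<omega> where z: "z = (\<xi>, \<eta>, \<zeta>, \<omega>)" by (cases z)
  show "u z = v z"
  proof (cases "\<xi> \<in> carrier H \<and> \<eta> \<in> carrier K \<and> \<zeta> \<in> carrier H0 \<and> \<omega> \<in> carrier K0")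
    case True
    then show ?thesis unfolding z by (intro assms(1)) simp_all
  next
    case False
    then show ?thesis unfolding z by (rule assms(2))
  qed
qed

lemma adm_dsum:
  assumes "adm S n A \<alpha> \<beta>" "adm S m A' \<alpha>' \<beta>'" "\<zero>\<^bsub>bop H0 K0\<^esub> \<in> S"
  shows "adm S (n + m) (dsum_mat n \<zero>\<^bsub>bop H0 K0\<^esub> A A') (dsum_vec n \<alpha> \<alpha>') (dsum_vec n \<beta> \<beta>')"
  using assms unfolding adm_def by (intro conjI dsum_mat_mem dsum_vec_mem) auto

lemma tens_dsum:
  "tens (n + m) (dsum_mat n \<zero>\<^bsub>bop H0 K0\<^esub> A A') (dsum_vec n \<alpha> \<alpha>') (dsum_vec n \<beta> \<beta>') = tens n A \<alpha> \<beta> + tens m A' \<alpha>' \<beta>'"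
proof (rule tens_eqI)
  fix \<xi> \<eta> \<zeta> \<omega> assume *: "\<xi> \<in> carrier H" "\<eta> \<in> carrier K" "\<zeta> \<in> carrier H0" "\<omega> \<in> carrier K0"
  show "tens (n + m) (dsum_mat n \<zero>\<^bsub>bop H0 K0\<^esub> A A') (dsum_vec n \<alpha> \<alpha>') (dsum_vec n \<beta> \<beta>') (\<xi>, \<eta>, \<zeta>, \<omega>) =
      (tens n A \<alpha> \<beta> + tens m A' \<alpha>' \<beta>') (\<xi>, \<eta>, \<zeta>, \<omega>)"
    unfolding plus_fun_apply tens_apply[OF *]
    by (rule sum_dsum[of n m "\<lambda>a x y. cinner H x \<xi> * cinner K \<eta> y * cinner K0 (a \<zeta>) \<omega>"]) (use * in simp)
qed (auto simp: tens_def)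

lemma val_dsum:
  assumes "adm X n A \<alpha> \<beta>" "adm X m A' \<alpha>' \<beta>'"
  shows "val (n + m) (dsum_mat n \<zero>\<^bsub>bop H0 K0\<^esub> A A') (dsum_vec n \<alpha> \<alpha>') (dsum_vec n \<beta> \<beta>') = val n A \<alpha> \<beta> + val m A' \<alpha>' \<beta>'"
  unfolding val_def
  by (rule sum_dsum[of n m "\<lambda>a x y. cinner K (f a x) y"])
    (use adm_dsum[OF assms] in \<open>simp add: adm_def\<close>)

lemma tens_smult:
  assumes "\<forall>j<n. \<alpha> j \<in> carrier H"
  shows "tens n A (\<lambda>j. c \<odot>\<^bsub>H\<^esub> \<alpha> j) \<beta> = (\<lambda>z. c * tens n A \<alpha> \<beta> z)"
  by (rule tens_eqI) (use assms in \<open>auto simp: tens_def C.H.cinner_simps sum_distrib_left mult.assoc intro!: sum.cong\<close>)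

lemma val_smult:
  assumes "adm X n A \<alpha> \<beta>"
  shows "val n A (\<lambda>j. c \<odot>\<^bsub>H\<^esub> \<alpha> j) \<beta> = c * val n A \<alpha> \<beta>"
  using assms by (auto simp: val_def adm_def C.K.cinner_simps sum_distrib_left intro!: sum.cong)

text \<open>Expanding \<open>\<alpha>\<close> and \<open>\<beta>\<close> along their dual families
  groups the value into terms \<open>\<langle>f y (\<alpha> k), \<beta> l\<rangle>\<close>, where
  \<open>y\<close> is the coefficient of the tensor at \<open>(\<xi> k, \<eta> l)\<close>. A
  vanishing tensor has vanishing coefficients.\<close>

lemma val_eq_0:
  assumes adm: "adm X n A \<alpha> \<beta>" and 0: "tens n A \<alpha> \<beta> = 0"
  shows "val n A \<alpha> \<beta> = 0"
proof -
  have A: "\<And>i j. i < n \<Longrightarrow> j < n \<Longrightarrow> A i j \<in> X" and \<alpha>: "\<And>j. j < n \<Longrightarrow> \<alpha> j \<in> carrier H"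
    and \<beta>: "\<And>i. i < n \<Longrightarrow> \<beta> i \<in> carrier K" using adm unfolding adm_def by blast+
  obtain \<xi> where \<xi>: "\<And>k. k < n \<Longrightarrow> \<xi> k \<in> carrier H"
    and \<alpha>_eq: "\<And>j. j < n \<Longrightarrow> \<alpha> j = (\<Oplus>\<^bsub>H\<^esub>k\<in>{..<n}. cinner H (\<alpha> j) (\<xi> k) \<odot>\<^bsub>H\<^esub> \<alpha> k)"
    by (rule C.H.dual_family[of n \<alpha>, OF \<alpha>]) blast+
  obtain \<eta> where \<eta>: "\<And>k. k < n \<Longrightarrow> \<eta> k \<in> carrier K"
    and \<beta>_eq: "\<And>j. j < n \<Longrightarrow> \<beta> j = (\<Oplus>\<^bsub>K\<^esub>k\<in>{..<n}. cinner K (\<beta> j) (\<eta> k) \<odot>\<^bsub>K\<^esub> \<beta> k)"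
    by (rule C.K.dual_family[of n \<beta>, OF \<beta>]) blast+
  let ?g = "\<lambda>i j k l. cinner H (\<alpha> j) (\<xi> k) * cnj (cinner K (\<beta> i) (\<eta> l)) * cinner K (f (A i j) (\<alpha> k)) (\<beta> l)"
  have "val n A \<alpha> \<beta> = (\<Sum>i<n. \<Sum>j<n. \<Sum>k<n. \<Sum>l<n. ?g i j k l)"
    unfolding val_def
  proof (intro sum.cong refl)
    fix i j assume "i \<in> {..<n}" "j \<in> {..<n}"
    then have ij: "i < n" "j < n" by auto
    have "cinner K (f (A i j) (\<alpha> j)) (\<beta> i) =
        cinner K (f (A i j) (\<Oplus>\<^bsub>H\<^esub>k\<in>{..<n}. cinner H (\<alpha> j) (\<xi> k) \<odot>\<^bsub>H\<^esub> \<alpha> k)) (\<Oplus>\<^bsub>K\<^esub>l\<in>{..<n}. cinner K (\<beta> i) (\<eta> l) \<odot>\<^bsub>K\<^esub> \<beta> l)"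
      using \<alpha>_eq[OF ij(2)] \<beta>_eq[OF ij(1)] by simp
    also have "\<dots> = (\<Sum>k<n. \<Sum>l<n. ?g i j k l)"
      using \<alpha> \<beta> A ij by (intro C.cinner_expand) auto
    finally show "cinner K (f (A i j) (\<alpha> j)) (\<beta> i) = (\<Sum>k<n. \<Sum>l<n. ?g i j k l)" .
  qed
  also have "\<dots> = (\<Sum>k<n. \<Sum>l<n. \<Sum>i<n. \<Sum>j<n. ?g i j k l)" by (rule sum4_swap)
  also have "\<dots> = 0"
  proof (rule sum.neutral, rule ballI, rule sum.neutral, rule ballI)
    fix k l assume "k \<in> {..<n}" "l \<in> {..<n}"
    then have kl: "k < n" "l < n" by auto
    let ?c = "\<lambda>p. cinner H (\<alpha> (snd p)) (\<xi> k) * cnj (cinner K (\<beta> (fst p)) (\<eta> l))"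
    obtain y where y: "y \<in> X"
      "\<And>\<zeta> \<omega>. \<zeta> \<in> carrier H0 \<Longrightarrow> \<omega> \<in> carrier K0 \<Longrightarrow> cinner K0 (y \<zeta>) \<omega> = (\<Sum>p\<in>{..<n} \<times> {..<n}. ?c p * cinner K0 (A (fst p) (snd p) \<zeta>) \<omega>)"
      "\<And>\<xi> \<eta>. \<xi> \<in> carrier H \<Longrightarrow> \<eta> \<in> carrier K \<Longrightarrow> cinner K (f y \<xi>) \<eta> = (\<Sum>p\<in>{..<n} \<times> {..<n}. ?c p * cinner K (f (A (fst p) (snd p)) \<xi>) \<eta>)"
      using linear_combination[of "{..<n} \<times> {..<n}" "\<lambda>p. A (fst p) (snd p)" ?c] A by auto
    have "y = \<zero>\<^bsub>bop H0 K0\<^esub>"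
    proof (rule D.bop_eqI)
      fix \<zeta> \<omega> assume *: "\<zeta> \<in> carrier H0" "\<omega> \<in> carrier K0"
      have "cinner K0 (y \<zeta>) \<omega> = (\<Sum>i<n. \<Sum>j<n. cinner H (\<alpha> j) (\<xi> k) * cnj (cinner K (\<beta> i) (\<eta> l)) * cinner K0 (A i j \<zeta>) \<omega>)"
        unfolding y(2)[OF *] by (simp add: sum.cartesian_product case_prod_unfold)
      also have "\<dots> = tens n A \<alpha> \<beta> (\<xi> k, \<eta> l, \<zeta>, \<omega>)"
        using \<xi> \<eta> kl * \<beta> by (simp add: tens_apply C.K.cinner_commute[of "\<eta> l"])
      finally show "Re (cinner K0 (y \<zeta>) \<omega>) = Re (cinner K0 (\<zero>\<^bsub>bop H0 K0\<^esub> \<zeta>) \<omega>)" using 0 * by simp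
    qed (use y in auto)
    then have "cinner K (f y (\<alpha> k)) (\<beta> l) = 0" using \<alpha> \<beta> kl by simp
    then show "(\<Sum>i<n. \<Sum>j<n. ?g i j k l) = 0"
      using y(3)[of "\<alpha> k" "\<beta> l"] \<alpha> \<beta> kl by (simp add: sum.cartesian_product case_prod_unfold)
  qed
  finally show ?thesis .
qed

text \<open>The difference of the two tensors is represented by a block sum, the sign being absorbed
  into \<open>\<gamma>\<close>.\<close>

lemma val_cong:
  assumes A: "adm X n A \<alpha> \<beta>" and B: "adm X m B \<gamma> \<delta>" and eq: "tens n A \<alpha> \<beta> = tens m B \<gamma> \<delta>"
  shows "val n A \<alpha> \<beta> = val m B \<gamma> \<delta>"
proof -
  have B': "adm X m B (\<lambda>j. (-1) \<odot>\<^bsub>H\<^esub> \<gamma> j) \<delta>" using B by (auto simp: adm_def)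
  have \<gamma>: "\<forall>j<m. \<gamma> j \<in> carrier H" using B by (auto simp: adm_def)
  have "tens (n + m) (dsum_mat n \<zero>\<^bsub>bop H0 K0\<^esub> A B) (dsum_vec n \<alpha> (\<lambda>j. (-1) \<odot>\<^bsub>H\<^esub> \<gamma> j)) (dsum_vec n \<beta> \<delta>) = 0"
    unfolding tens_dsum tens_smult[OF \<gamma>] eq by (auto simp: fun_eq_iff)
  then have "val (n + m) (dsum_mat n \<zero>\<^bsub>bop H0 K0\<^esub> A B) (dsum_vec n \<alpha> (\<lambda>j. (-1) \<odot>\<^bsub>H\<^esub> \<gamma> j)) (dsum_vec n \<beta> \<delta>) = 0"
    using A B' by (intro val_eq_0 adm_dsum) auto
  then show ?thesis by (simp add: val_dsum[OF A B'] val_smult[OF B])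
qed

text \<open>
  The entries of \<open>B\<close> need not lie in \<open>X\<close>, but those of its compression by the projection
  matrices of \<open>\<gamma>\<close> and \<open>\<delta>\<close> do, since they are coefficients of the tensor; the compression
  represents the same tensor and is again contractive.
\<close>

lemma val_le:
  assumes A: "adm X n A \<alpha> \<beta>" and B: "adm (carrier (bop H0 K0)) m B \<gamma> \<delta>" "mbound H0 K0 1 m B"
    and eq: "tens n A \<alpha> \<beta> = tens m B \<gamma> \<delta>"
  shows "Re (val n A \<alpha> \<beta>) \<le> ((\<Sum>j<m. (hnorm H (\<gamma> j))\<^sup>2) + (\<Sum>i<m. (hnorm K (\<delta> i))\<^sup>2)) / 2"
proof -
  have A': "\<And>i j. i < n \<Longrightarrow> j < n \<Longrightarrow> A i j \<in> X" using A by (auto simp: adm_def)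
  have B' [simp]: "\<And>i j. i < m \<Longrightarrow> j < m \<Longrightarrow> B i j \<in> carrier (bop H0 K0)"
    and \<gamma> [simp]: "\<And>j. j < m \<Longrightarrow> \<gamma> j \<in> carrier H" and \<delta> [simp]: "\<And>i. i < m \<Longrightarrow> \<delta> i \<in> carrier K"
    using B(1) by (auto simp: adm_def)
  obtain \<xi> where \<xi> [simp]: "\<And>k. k < m \<Longrightarrow> \<xi> k \<in> carrier H"
    and \<xi>_exp: "\<And>j z. j < m \<Longrightarrow> z \<in> carrier H \<Longrightarrow> cinner H (\<gamma> j) z = (\<Sum>k<m. cinner H (\<gamma> j) (\<xi> k) * cinner H (\<gamma> k) z)"
    and \<xi>_herm: "\<And>j k. j < m \<Longrightarrow> k < m \<Longrightarrow> cnj (cinner H (\<gamma> j) (\<xi> k)) = cinner H (\<gamma> k) (\<xi> j)"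
    by (rule C.H.dual_family[of m \<gamma>, OF \<gamma>]) blast+
  define P where P: "P j k = cinner H (\<gamma> j) (\<xi> k)" for j k
  note P_exp = \<xi>_exp[folded P] and P_herm = \<xi>_herm[folded P]
  have P_idem: "(\<Sum>l<m. P j l * P l k) = P j k" if "j < m" "k < m" for j k
    using \<xi>_exp[of j "\<xi> k"] that by (simp add: P)
  obtain \<eta> where \<eta> [simp]: "\<And>k. k < m \<Longrightarrow> \<eta> k \<in> carrier K"
    and \<eta>_exp: "\<And>j z. j < m \<Longrightarrow> z \<in> carrier K \<Longrightarrow> cinner K (\<delta> j) z = (\<Sum>k<m. cinner K (\<delta> j) (\<eta> k) * cinner K (\<delta> k) z)"
    and \<eta>_herm: "\<And>j k. j < m \<Longrightarrow> k < m \<Longrightarrow> cnj (cinner K (\<delta> j) (\<eta> k)) = cinner K (\<delta> k) (\<eta> j)"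
    by (rule C.K.dual_family[of m \<delta>, OF \<delta>]) blast+
  define Q where Q: "Q j k = cinner K (\<delta> j) (\<eta> k)" for j k
  note Q_exp = \<eta>_exp[folded Q] and Q_herm = \<eta>_herm[folded Q]
  have Q_idem: "(\<Sum>l<m. Q j l * Q l k) = Q j k" if "j < m" "k < m" for j k
    using \<eta>_exp[of j "\<eta> k"] that by (simp add: Q)
  \<comment> \<open>\<open>y\<close> is the entry at \<open>(i, k)\<close> of
    \<open>Q\<^sup>* B P\<close>, and it is an element of \<open>X\<close>.\<close>
  define R where "R i k y \<longleftrightarrow> y \<in> X \<and> (\<forall>\<zeta>\<in>carrier H0. \<forall>\<omega>\<in>carrier K0.
      cinner K0 (y \<zeta>) \<omega> = (\<Sum>i'<m. \<Sum>j<m. P j k * cnj (Q i' i) * cinner K0 (B i' j \<zeta>) \<omega>))" for i k y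
  \<comment> \<open>Evaluated at \<open>(\<xi> k, \<eta> i)\<close>, the tensor yields this entry
    from \<open>B\<close>, and a linear combination of the \<open>A i j\<close> from the other
    representation; the latter lies in \<open>X\<close>.\<close>
  have ex: "\<exists>y. R i k y" if ik: "i < m" "k < m" for i k
  proof -
    let ?c = "\<lambda>p. cinner H (\<alpha> (snd p)) (\<xi> k) * cinner K (\<eta> i) (\<beta> (fst p))"
    obtain y where y: "y \<in> X" "\<And>\<zeta> \<omega>. \<zeta> \<in> carrier H0 \<Longrightarrow> \<omega> \<in> carrier K0 \<Longrightarrow>
        cinner K0 (y \<zeta>) \<omega> = (\<Sum>p\<in>{..<n} \<times> {..<n}. ?c p * cinner K0 (A (fst p) (snd p) \<zeta>) \<omega>)"
      using linear_combination[of "{..<n} \<times> {..<n}" "\<lambda>p. A (fst p) (snd p)" ?c] A' by auto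
    have "cinner K0 (y \<zeta>) \<omega> = (\<Sum>i'<m. \<Sum>j<m. P j k * cnj (Q i' i) * cinner K0 (B i' j \<zeta>) \<omega>)"
      if *: "\<zeta> \<in> carrier H0" "\<omega> \<in> carrier K0" for \<zeta> \<omega>
    proof -
      have "cinner K0 (y \<zeta>) \<omega> = tens n A \<alpha> \<beta> (\<xi> k, \<eta> i, \<zeta>, \<omega>)"
        unfolding y(2)[OF *] tens_apply[OF \<xi>[OF ik(2)] \<eta>[OF ik(1)] *]
        by (simp add: sum.cartesian_product case_prod_unfold)
      also have "\<dots> = (\<Sum>i'<m. \<Sum>j<m. P j k * cnj (Q i' i) * cinner K0 (B i' j \<zeta>) \<omega>)"
        unfolding eq tens_apply[OF \<xi>[OF ik(2)] \<eta>[OF ik(1)] *] P Q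
        by (intro sum.cong refl) (use ik in \<open>simp add: C.K.cinner_commute[symmetric]\<close>)
      finally show ?thesis .
    qed
    then show ?thesis unfolding R_def using y(1) by blast
  qed
  define C where "C i k = (SOME y. R i k y)" for i k
  have RC: "R i k (C i k)" if "i < m" "k < m" for i k
    unfolding C_def by (rule someI_ex[OF ex[OF that]])
  have C: "\<And>i k. i < m \<Longrightarrow> k < m \<Longrightarrow> C i k \<in> X"
    using RC unfolding R_def by blast
  have C_inner: "\<And>i k \<zeta> \<omega>. i < m \<Longrightarrow> k < m \<Longrightarrow> \<zeta> \<in> carrier H0 \<Longrightarrow> \<omega> \<in> carrier K0 \<Longrightarrow>
      cinner K0 (C i k \<zeta>) \<omega> = (\<Sum>i'<m. \<Sum>j<m. P j k * cnj (Q i' i) * cinner K0 (B i' j \<zeta>) \<omega>)"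
    using RC unfolding R_def by blast
  have admC: "adm X m C \<gamma> \<delta>" using C by (simp add: adm_def)
  have "mbound H0 K0 1 m C"
    unfolding mbound_def
  proof (intro allI impI)
    fix v w assume v: "\<forall>j<m. v j \<in> carrier H0" and w: "\<forall>i<m. w i \<in> carrier K0"
    define V where "V j = (\<Oplus>\<^bsub>H0\<^esub>k\<in>{..<m}. P j k \<odot>\<^bsub>H0\<^esub> v k)" for j
    define U where "U i' = (\<Oplus>\<^bsub>K0\<^esub>i\<in>{..<m}. Q i' i \<odot>\<^bsub>K0\<^esub> w i)" for i'
    have V: "V j \<in> carrier H0" for j unfolding V_def using v by simp
    have U: "U i \<in> carrier K0" for i unfolding U_def using w by simp
    have "(\<Sum>i<m. \<Sum>k<m. cinner K0 (C i k (v k)) (w i)) =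
        (\<Sum>i<m. \<Sum>k<m. \<Sum>i'<m. \<Sum>j<m. P j k * cnj (Q i' i) * cinner K0 (B i' j (v k)) (w i))"
      by (intro sum.cong refl C_inner) (use v w in auto)
    also have "\<dots> = (\<Sum>i'<m. \<Sum>j<m. \<Sum>i<m. \<Sum>k<m. P j k * cnj (Q i' i) * cinner K0 (B i' j (v k)) (w i))"
      by (rule sum4_swap)
    also have "\<dots> = (\<Sum>i'<m. \<Sum>j<m. cinner K0 (B i' j (V j)) (U i'))"
    proof (rule sum.cong[OF refl], rule sum.cong[OF refl])
      fix i' j assume "i' \<in> {..<m}" "j \<in> {..<m}"
      then have "cinner K0 (B i' j (V j)) (U i') = (\<Sum>k<m. \<Sum>i<m. P j k * cnj (Q i' i) * cinner K0 (B i' j (v k)) (w i))"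
        unfolding V_def U_def by (intro D.cinner_expand) (use v w in auto)
      also have "\<dots> = (\<Sum>i<m. \<Sum>k<m. P j k * cnj (Q i' i) * cinner K0 (B i' j (v k)) (w i))"
        by (rule sum.swap)
      finally show "(\<Sum>i<m. \<Sum>k<m. P j k * cnj (Q i' i) * cinner K0 (B i' j (v k)) (w i)) = cinner K0 (B i' j (V j)) (U i')" ..
    qed
    finally have "Re (\<Sum>i<m. \<Sum>k<m. cinner K0 (C i k (v k)) (w i)) \<le>
        1 * ((\<Sum>j<m. (hnorm H0 (V j))\<^sup>2) + (\<Sum>i<m. (hnorm K0 (U i))\<^sup>2)) / 2"
      using B(2)[unfolded mbound_def, rule_format, of V U] V U by simp
    also have "\<dots> \<le> 1 * ((\<Sum>j<m. (hnorm H0 (v j))\<^sup>2) + (\<Sum>i<m. (hnorm K0 (w i))\<^sup>2)) / 2"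
    proof -
      have "(\<Sum>j<m. (hnorm H0 (V j))\<^sup>2) \<le> (\<Sum>j<m. (hnorm H0 (v j))\<^sup>2)"
        unfolding V_def
        by (rule D.H.projection_matrix_contractive) (use v P_herm P_idem in auto)
      moreover have "(\<Sum>j<m. (hnorm K0 (U j))\<^sup>2) \<le> (\<Sum>j<m. (hnorm K0 (w j))\<^sup>2)"
        unfolding U_def
        by (rule D.K.projection_matrix_contractive) (use w Q_herm Q_idem in auto)
      ultimately show ?thesis by simp
    qed
    finally show "Re (\<Sum>i<m. \<Sum>k<m. cinner K0 (C i k (v k)) (w i)) \<le>
        1 * ((\<Sum>j<m. (hnorm H0 (v j))\<^sup>2) + (\<Sum>i<m. (hnorm K0 (w i))\<^sup>2)) / 2" .
  qed
  then have bound: "mbound H K 1 m (\<lambda>i j. f (C i j))" using C by (intro cc) auto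
  \<comment> \<open>\<open>P\<close> fixes the family \<open>\<gamma>\<close> and \<open>Q\<close>
    fixes \<open>\<delta>\<close>, so the compression does not change the tensor.\<close>
  have "tens m C \<gamma> \<delta> = tens m B \<gamma> \<delta>"
  proof (rule tens_eqI)
    fix x y \<zeta> \<omega> assume *: "x \<in> carrier H" "y \<in> carrier K" "\<zeta> \<in> carrier H0" "\<omega> \<in> carrier K0"
    have Q_exp': "cinner K y (\<delta> i') = (\<Sum>i<m. cnj (Q i' i) * cinner K y (\<delta> i))" if "i' < m" for i'
    proof -
      have "cinner K y (\<delta> i') = cnj (cinner K (\<delta> i') y)" using that * by (intro C.K.cinner_commute) auto
      also have "\<dots> = (\<Sum>i<m. cnj (Q i' i) * cnj (cinner K (\<delta> i) y))"
        by (subst Q_exp[OF that *(2)]) simp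
      also have "\<dots> = (\<Sum>i<m. cnj (Q i' i) * cinner K y (\<delta> i))"
        by (intro sum.cong refl) (use * in \<open>simp add: C.K.cinner_commute[symmetric]\<close>)
      finally show ?thesis .
    qed
    have "tens m C \<gamma> \<delta> (x, y, \<zeta>, \<omega>) =
        (\<Sum>i<m. \<Sum>k<m. \<Sum>i'<m. \<Sum>j<m. (cnj (Q i' i) * cinner K y (\<delta> i)) * (P j k * cinner H (\<gamma> k) x) * cinner K0 (B i' j \<zeta>) \<omega>)"
      unfolding tens_apply[OF *]
      by (intro sum.cong refl) (use * in \<open>simp add: C_inner sum_distrib_left mult_ac\<close>)
    also have "\<dots> = (\<Sum>i'<m. \<Sum>j<m. \<Sum>i<m. \<Sum>k<m. (cnj (Q i' i) * cinner K y (\<delta> i)) * (P j k * cinner H (\<gamma> k) x) * cinner K0 (B i' j \<zeta>) \<omega>)"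
      by (rule sum4_swap)
    also have "\<dots> = (\<Sum>i'<m. \<Sum>j<m. cinner K y (\<delta> i') * cinner H (\<gamma> j) x * cinner K0 (B i' j \<zeta>) \<omega>)"
    proof (rule sum.cong[OF refl], rule sum.cong[OF refl])
      fix i' j assume "i' \<in> {..<m}" "j \<in> {..<m}"
      then have "cinner K y (\<delta> i') * cinner H (\<gamma> j) x * cinner K0 (B i' j \<zeta>) \<omega> =
          (\<Sum>i<m. cnj (Q i' i) * cinner K y (\<delta> i)) * (\<Sum>k<m. P j k * cinner H (\<gamma> k) x) * cinner K0 (B i' j \<zeta>) \<omega>"
        using P_exp[of j x] Q_exp'[of i'] * by simp
      then show "(\<Sum>i<m. \<Sum>k<m. (cnj (Q i' i) * cinner K y (\<delta> i)) * (P j k * cinner H (\<gamma> k) x) * cinner K0 (B i' j \<zeta>) \<omega>) =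
          cinner K y (\<delta> i') * cinner H (\<gamma> j) x * cinner K0 (B i' j \<zeta>) \<omega>"
        by (simp only: sum_product) (simp only: sum_distrib_right)
    qed
    also have "\<dots> = tens m B \<gamma> \<delta> (x, y, \<zeta>, \<omega>)"
      unfolding tens_apply[OF *] by (simp add: mult_ac)
    finally show "tens m C \<gamma> \<delta> (x, y, \<zeta>, \<omega>) = tens m B \<gamma> \<delta> (x, y, \<zeta>, \<omega>)" .
  qed (auto simp: tens_def)
  then have "val n A \<alpha> \<beta> = val m C \<gamma> \<delta>" using eq by (intro val_cong A admC) simp
  then show ?thesis
    using bound[unfolded mbound_def, rule_format, of \<gamma> \<delta>] by (simp add: val_def)
qed

end

lemma sum_fun_apply: "(\<Sum>i\<in>I. f i) z = (\<Sum>i\<in>I. f i z)" for f :: "'i \<Rightarrow> 'z \<Rightarrow> 'v::comm_monoid_add"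
  by (induction I rule: infinite_finite_induct) auto

section \<open>The tensor norm\<close>

context contractive_map
begin

lemma tens_smult_right:
  assumes "\<forall>i<n. \<beta> i \<in> carrier K"
  shows "tens n A \<alpha> (\<lambda>i. c \<odot>\<^bsub>K\<^esub> \<beta> i) = (\<lambda>z. cnj c * tens n A \<alpha> \<beta> z)"
  by (rule tens_eqI) (use assms in \<open>auto simp: tens_def C.K.cinner_simps sum_distrib_left mult_ac intro!: sum.cong\<close>)

lemma tens_smult_mat:
  assumes "\<forall>i<n. \<forall>j<n. A i j \<in> carrier (bop H0 K0)"
  shows "tens n (\<lambda>i j. c \<odot>\<^bsub>bop H0 K0\<^esub> A i j) \<alpha> \<beta> = (\<lambda>z. c * tens n A \<alpha> \<beta> z)"
  by (rule tens_eqI) (use assms in \<open>auto simp: tens_def D.K.cinner_simps sum_distrib_left mult_ac intro!: sum.cong\<close>)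

text \<open>\<open>s\<close> is the cost of one representation of \<open>u\<close> with a
  contractive middle matrix. The arithmetic mean of the two sums of squares stands in for the
  product of the norms of \<open>\<alpha>\<close> and \<open>\<beta>\<close>; as the vectors may be
  rescaled against each other, both lead to the same infimum.\<close>

definition rep :: "('c \<times> 'd \<times> 'a \<times> 'b \<Rightarrow> complex) \<Rightarrow> real \<Rightarrow> bool"
  where "rep u s \<longleftrightarrow> (\<exists>n A \<alpha> \<beta>. adm (carrier (bop H0 K0)) n A \<alpha> \<beta> \<and> mbound H0 K0 1 n A \<and> u = tens n A \<alpha> \<beta> \<and>
    s = ((\<Sum>j<n. (hnorm H (\<alpha> j))\<^sup>2) + (\<Sum>i<n. (hnorm K (\<beta> i))\<^sup>2)) / 2)"

lemma repI:
  "adm (carrier (bop H0 K0)) n A \<alpha> \<beta> \<Longrightarrow> mbound H0 K0 1 n A \<Longrightarrow>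
    rep (tens n A \<alpha> \<beta>) (((\<Sum>j<n. (hnorm H (\<alpha> j))\<^sup>2) + (\<Sum>i<n. (hnorm K (\<beta> i))\<^sup>2)) / 2)"
  unfolding rep_def by blast

lemma rep_nonneg: "rep u s \<Longrightarrow> 0 \<le> s"
  unfolding rep_def by (elim exE conjE) (simp only:, intro divide_nonneg_nonneg add_nonneg_nonneg sum_nonneg, auto)

lemma rep_add:
  assumes "rep u s" "rep v t" shows "rep (u + v) (s + t)"
proof -
  obtain n A \<alpha> \<beta> where 1: "adm (carrier (bop H0 K0)) n A \<alpha> \<beta>" "mbound H0 K0 1 n A" "u = tens n A \<alpha> \<beta>"
    "s = ((\<Sum>j<n. (hnorm H (\<alpha> j))\<^sup>2) + (\<Sum>i<n. (hnorm K (\<beta> i))\<^sup>2)) / 2"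
    using assms(1) unfolding rep_def by blast
  obtain m A' \<alpha>' \<beta>' where 2: "adm (carrier (bop H0 K0)) m A' \<alpha>' \<beta>'" "mbound H0 K0 1 m A'" "v = tens m A' \<alpha>' \<beta>'"
    "t = ((\<Sum>j<m. (hnorm H (\<alpha>' j))\<^sup>2) + (\<Sum>i<m. (hnorm K (\<beta>' i))\<^sup>2)) / 2"
    using assms(2) unfolding rep_def by blast
  show ?thesis
    using repI[OF adm_dsum[OF 1(1) 2(1) D.B.zero_closed] D.mbound_dsum[OF 1(2) 2(2)]]

    unfolding tens_dsum sum_dsum_vec[where g = "\<lambda>x. (hnorm H x)\<^sup>2"] sum_dsum_vec[where g = "\<lambda>x. (hnorm K x)\<^sup>2"] 1(3,4) 2(3,4)
    by (simp add: add_divide_distrib algebra_simps)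
qed

lemma rep_scale_pos:
  assumes "rep u s" "0 < c" shows "rep (\<lambda>z. complex_of_real c * u z) (c * s)"
proof -
  obtain n A \<alpha> \<beta> where 1: "adm (carrier (bop H0 K0)) n A \<alpha> \<beta>" "mbound H0 K0 1 n A" "u = tens n A \<alpha> \<beta>"
    "s = ((\<Sum>j<n. (hnorm H (\<alpha> j))\<^sup>2) + (\<Sum>i<n. (hnorm K (\<beta> i))\<^sup>2)) / 2"
    using assms(1) unfolding rep_def by blast
  \<comment> \<open>The factor is divided equally, so that both sums of squares, and with them the
    cost, are multiplied by \<open>c\<close>.\<close>
  let ?c = "complex_of_real (sqrt c)"
  have \<alpha>: "\<forall>j<n. \<alpha> j \<in> carrier H" and \<beta>: "\<forall>j<n. \<beta> j \<in> carrier K" using 1(1) by (auto simp: adm_def)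
  have 2: "adm (carrier (bop H0 K0)) n A (\<lambda>j. ?c \<odot>\<^bsub>H\<^esub> \<alpha> j) (\<lambda>j. ?c \<odot>\<^bsub>K\<^esub> \<beta> j)"
    using 1(1) by (auto simp: adm_def)
  have t: "tens n A (\<lambda>j. ?c \<odot>\<^bsub>H\<^esub> \<alpha> j) (\<lambda>j. ?c \<odot>\<^bsub>K\<^esub> \<beta> j) = (\<lambda>z. complex_of_real c * u z)"
    unfolding tens_smult[OF \<alpha>] tens_smult_right[OF \<beta>] 1(3) using assms(2)
    by (auto simp: fun_eq_iff mult.assoc[symmetric] simp flip: of_real_mult)
  have s1: "(\<Sum>j<n. (hnorm H (?c \<odot>\<^bsub>H\<^esub> \<alpha> j))\<^sup>2) = c * (\<Sum>j<n. (hnorm H (\<alpha> j))\<^sup>2)"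
    unfolding sum_distrib_left using assms(2) \<alpha> by (intro sum.cong) (auto simp: power_mult_distrib)
  have s2: "(\<Sum>j<n. (hnorm K (?c \<odot>\<^bsub>K\<^esub> \<beta> j))\<^sup>2) = c * (\<Sum>j<n. (hnorm K (\<beta> j))\<^sup>2)"
    unfolding sum_distrib_left using assms(2) \<beta> by (intro sum.cong) (auto simp: power_mult_distrib)
  show ?thesis using repI[OF 2 1(2)] unfolding t s1 s2 1(4) by (simp add: algebra_simps)
qed

lemma rep_tens:
  assumes "adm (carrier (bop H0 K0)) n A \<alpha> \<beta>" shows "\<exists>s. rep (tens n A \<alpha> \<beta>) s"
proof -
  have A: "\<forall>i<n. \<forall>j<n. A i j \<in> carrier (bop H0 K0)" and \<alpha>: "\<forall>j<n. \<alpha> j \<in> carrier H" using assms by (auto simp: adm_def)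
  obtain r where r: "r > 0" "mbound H0 K0 r n A" using D.mbound_exists[OF A] by blast
  \<comment> \<open>The matrix is normalised by its bound \<open>r\<close>, and the factor is moved
    to the vectors.\<close>
  let ?A = "\<lambda>i j. complex_of_real (1 / r) \<odot>\<^bsub>bop H0 K0\<^esub> A i j" and ?\<alpha> = "\<lambda>j. complex_of_real r \<odot>\<^bsub>H\<^esub> \<alpha> j"
  have "mbound H0 K0 (1 / r * r) n ?A" using r A by (intro D.mbound_scale) auto
  then have m: "mbound H0 K0 1 n ?A" using r by simp
  have adm: "adm (carrier (bop H0 K0)) n ?A ?\<alpha> \<beta>" using assms by (auto simp: adm_def)
  have "tens n ?A ?\<alpha> \<beta> = tens n A \<alpha> \<beta>"
    unfolding tens_smult[OF \<alpha>] tens_smult_mat[OF A] using r by (simp add: fun_eq_iff)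
  then show ?thesis using repI[OF adm m] by metis
qed

lemma rep_scale:
  assumes "rep u s" shows "\<exists>t. rep (\<lambda>z. c * u z) t"
proof -
  obtain n A \<alpha> \<beta> where 1: "adm (carrier (bop H0 K0)) n A \<alpha> \<beta>" "u = tens n A \<alpha> \<beta>"
    using assms(1) unfolding rep_def by blast
  have \<alpha>: "\<forall>j<n. \<alpha> j \<in> carrier H" using 1(1) by (auto simp: adm_def)
  have "adm (carrier (bop H0 K0)) n A (\<lambda>j. c \<odot>\<^bsub>H\<^esub> \<alpha> j) \<beta>" using 1(1) by (auto simp: adm_def)
  from rep_tens[OF this] show ?thesis unfolding tens_smult[OF \<alpha>] 1(2) .
qed

text \<open>The Haagerup norm on the tensor product of the conjugate of \<open>K\<close> as a row
  space, \<open>B(H0, K0)\<close>, and \<open>H\<close> as a column space. The real functionals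
  below it correspond to the completely contractive maps from \<open>B(H0, K0)\<close> into
  \<open>B(H, K)\<close>.\<close>

definition tnorm :: "('c \<times> 'd \<times> 'a \<times> 'b \<Rightarrow> complex) \<Rightarrow> real"
  where "tnorm u = Inf {s. rep u s}"

lemma tnorm_le: "rep u s \<Longrightarrow> tnorm u \<le> s"
  unfolding tnorm_def by (rule cInf_lower) (auto intro: rep_nonneg bdd_belowI)

lemma tnorm_ge: "rep u s \<Longrightarrow> (\<And>t. rep u t \<Longrightarrow> c \<le> t) \<Longrightarrow> c \<le> tnorm u"
  unfolding tnorm_def by (rule cInf_greatest) auto

lemma tnorm_add:
  assumes "rep u s0" "rep v t0" shows "tnorm (u + v) \<le> tnorm u + tnorm v"
proof -
  have "tnorm (u + v) - t \<le> tnorm u" if "rep v t" for t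
    using tnorm_le[OF rep_add[OF _ that]] by (intro tnorm_ge[OF assms(1)]) fastforce
  then have "tnorm (u + v) - tnorm u \<le> tnorm v"
    by (intro tnorm_ge[OF assms(2)]) fastforce
  then show ?thesis by simp
qed

lemma tnorm_scale:
  assumes "rep u s0" "0 < c" shows "tnorm (\<lambda>z. complex_of_real c * u z) = c * tnorm u"
proof (rule antisym)
  have le: "tnorm (\<lambda>z. complex_of_real c * u z) \<le> c * tnorm u" if "rep u s0" "0 < c" for u s0 c
  proof -
    have "tnorm (\<lambda>z. complex_of_real c * u z) / c \<le> tnorm u"
    proof (rule tnorm_ge[OF that(1)])
      fix t assume "rep u t"
      from tnorm_le[OF rep_scale_pos[OF this that(2)]] show "tnorm (\<lambda>z. complex_of_real c * u z) / c \<le> t"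
        using that(2) by (simp add: pos_divide_le_eq mult.commute[of c t])
    qed
    then show ?thesis using that(2) by (simp add: pos_divide_le_eq mult.commute[of c "tnorm u"])
  qed
  show "tnorm (\<lambda>z. complex_of_real c * u z) \<le> c * tnorm u" by (rule le[OF assms])
  have "tnorm (\<lambda>z. complex_of_real (1 / c) * (complex_of_real c * u z)) \<le> 1 / c * tnorm (\<lambda>z. complex_of_real c * u z)"
    by (rule le[OF rep_scale_pos[OF assms]]) (use assms in simp)
  then show "c * tnorm u \<le> tnorm (\<lambda>z. complex_of_real c * u z)"
    using assms(2) by (simp add: field_simps)
qed

definition etens :: "('a \<Rightarrow> 'b) \<Rightarrow> 'c \<Rightarrow> 'd \<Rightarrow> 'c \<times> 'd \<times> 'a \<times> 'b \<Rightarrow> complex"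
  where "etens a \<xi> \<eta> = tens 1 (\<lambda>_ _. a) (\<lambda>_. \<xi>) (\<lambda>_. \<eta>)"

lemma etens_apply:
  "x \<in> carrier H \<Longrightarrow> y \<in> carrier K \<Longrightarrow> \<zeta> \<in> carrier H0 \<Longrightarrow> \<omega> \<in> carrier K0 \<Longrightarrow>
    etens a \<xi> \<eta> (x, y, \<zeta>, \<omega>) = cinner H \<xi> x * cinner K y \<eta> * cinner K0 (a \<zeta>) \<omega>"
  by (simp add: etens_def tens_def)

lemma etens_outside: "z \<notin> carrier H \<times> carrier K \<times> carrier H0 \<times> carrier K0 \<Longrightarrow> etens a \<xi> \<eta> z = 0"
  by (auto simp: etens_def tens_def split: prod.splits)

lemma etens_eqI:
  assumes "\<And>\<xi> \<eta> \<zeta> \<omega>. \<xi> \<in> carrier H \<Longrightarrow> \<eta> \<in> carrier K \<Longrightarrow> \<zeta> \<in> carrier H0 \<Longrightarrow> \<omega> \<in> carrier K0 \<Longrightarrow>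
      u (\<xi>, \<eta>, \<zeta>, \<omega>) = v (\<xi>, \<eta>, \<zeta>, \<omega>)"
    "\<And>z. z \<notin> carrier H \<times> carrier K \<times> carrier H0 \<times> carrier K0 \<Longrightarrow> u z = v z"
  shows "u = v"
  by (rule tens_eqI) (auto intro: assms)

lemma tens_eq_sum: "tens n A \<alpha> \<beta> = (\<Sum>i<n. \<Sum>j<n. etens (A i j) (\<alpha> j) (\<beta> i))"
proof (rule etens_eqI)
  fix z assume "z \<notin> carrier H \<times> carrier K \<times> carrier H0 \<times> carrier K0"
  then show "tens n A \<alpha> \<beta> z = (\<Sum>i<n. \<Sum>j<n. etens (A i j) (\<alpha> j) (\<beta> i)) z"
    by (simp add: sum_fun_apply etens_outside) (auto simp: tens_def split: prod.splits)
qed (simp add: tens_def sum_fun_apply etens_apply)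

text \<open>Wittstock's theorem. By \<open>val_le\<close> the functional of \<open>f\<close> is
  dominated by \<open>tnorm\<close>; Hahn-Banach extends it to all tensors, and
  \<open>bop_of_form\<close> reads off \<open>F a\<close> from its values on
  \<open>a \<otimes> \<xi> \<otimes> \<eta>\<close>. Domination by \<open>tnorm\<close>, evaluated
  on a given representation, is complete contractivity of \<open>F\<close>.\<close>

theorem extension:
  "\<exists>F. clinear_on (carrier (bop H0 K0)) (bop H0 K0) (bop H K) F \<and> (\<forall>x\<in>X. F x = f x) \<and>
    (\<forall>n A. (\<forall>i<n. \<forall>j<n. A i j \<in> carrier (bop H0 K0)) \<longrightarrow> mbound H0 K0 1 n A \<longrightarrow> mbound H K 1 n (\<lambda>i j. F (A i j)))"
proof -
  \<comment> \<open>Hahn-Banach is applied over the reals; complex linearity of \<open>F\<close>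
    comes back through \<open>etens_bal\<close> and \<open>etens_mat\<close>, which move complex
    scalars between the factors.\<close>
  define scale :: "real \<Rightarrow> ('c \<times> 'd \<times> 'a \<times> 'b \<Rightarrow> complex) \<Rightarrow> _"
    where "scale c u = (\<lambda>z. complex_of_real c * u z)" for c u
  define W where "W = {u. \<exists>s. rep u s}"
  define G where "G = {(tens n A \<alpha> \<beta>, Re (val n A \<alpha> \<beta>)) | n A \<alpha> \<beta>. adm X n A \<alpha> \<beta>}"
  have adm0: "adm X 0 A \<alpha> \<beta>" for A \<alpha> \<beta> by (simp add: adm_def)
  have t0: "tens 0 A \<alpha> \<beta> = 0" for A \<alpha> \<beta> by (rule tens_eqI) (auto simp: tens_def)
  have "\<exists>g :: _ \<Rightarrow> real. (\<forall>u\<in>W. \<forall>v\<in>W. g (u + v) = g u + g v) \<and> (\<forall>c. \<forall>u\<in>W. g (scale c u) = c * g u) \<and>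
    (\<forall>u\<in>W. g u \<le> tnorm u) \<and> (\<forall>(u, a)\<in>G. g u = a)"
  proof (rule hahn_banach)
    show "vector_space scale"
      by standard (auto simp: scale_def fun_eq_iff algebra_simps)
    show "0 \<in> W" using rep_tens[OF adm_X_bop[OF adm0]] unfolding t0 W_def by simp
    show "u + v \<in> W" if "u \<in> W" "v \<in> W" for u v using that rep_add unfolding W_def by blast
    show "scale c u \<in> W" if "u \<in> W" for c u using that rep_scale unfolding W_def scale_def by blast
    show "tnorm (u + v) \<le> tnorm u + tnorm v" if "u \<in> W" "v \<in> W" for u v
      using that tnorm_add unfolding W_def by blast
    show "tnorm (scale c u) = c * tnorm u" if "u \<in> W" "0 < c" for c u
      using that tnorm_scale unfolding W_def scale_def by blast
    show "G \<subseteq> W \<times> UNIV" unfolding G_def W_def using rep_tens[OF adm_X_bop] by auto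
    have "(tens 0 A \<alpha> \<beta>, Re (val 0 A \<alpha> \<beta>)) \<in> G" for A \<alpha> \<beta> unfolding G_def using adm0 by blast
    then show "(0, 0) \<in> G" unfolding t0 by (simp add: val_def)
    show "(u + v, a + b) \<in> G" if uv: "(u, a) \<in> G" "(v, b) \<in> G" for u a v b
    proof -
      obtain n A \<alpha> \<beta> where 1: "adm X n A \<alpha> \<beta>" "u = tens n A \<alpha> \<beta>" "a = Re (val n A \<alpha> \<beta>)"
        using uv(1) unfolding G_def by blast
      obtain m A' \<alpha>' \<beta>' where 2: "adm X m A' \<alpha>' \<beta>'" "v = tens m A' \<alpha>' \<beta>'" "b = Re (val m A' \<alpha>' \<beta>')"
        using uv(2) unfolding G_def by blast
      have "u + v = tens (n + m) (dsum_mat n \<zero>\<^bsub>bop H0 K0\<^esub> A A') (dsum_vec n \<alpha> \<alpha>') (dsum_vec n \<beta> \<beta>')"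
        unfolding 1 2 tens_dsum ..
      moreover have "a + b = Re (val (n + m) (dsum_mat n \<zero>\<^bsub>bop H0 K0\<^esub> A A') (dsum_vec n \<alpha> \<alpha>') (dsum_vec n \<beta> \<beta>'))"
        unfolding val_dsum[OF 1(1) 2(1)] 1 2 by simp
      moreover have "adm X (n + m) (dsum_mat n \<zero>\<^bsub>bop H0 K0\<^esub> A A') (dsum_vec n \<alpha> \<alpha>') (dsum_vec n \<beta> \<beta>')"
        by (intro adm_dsum 1 2) simp
      ultimately show ?thesis unfolding G_def by blast
    qed
    show "(scale c u, c * a) \<in> G" if ua: "(u, a) \<in> G" for c u a
    proof -
      obtain n A \<alpha> \<beta> where 1: "adm X n A \<alpha> \<beta>" "u = tens n A \<alpha> \<beta>" "a = Re (val n A \<alpha> \<beta>)"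
        using ua unfolding G_def by blast
      have \<alpha>: "\<forall>j<n. \<alpha> j \<in> carrier H" using 1(1) by (auto simp: adm_def)
      let ?\<alpha> = "\<lambda>j. complex_of_real c \<odot>\<^bsub>H\<^esub> \<alpha> j"
      have "scale c u = tens n A ?\<alpha> \<beta>" unfolding scale_def 1 tens_smult[OF \<alpha>] ..
      moreover have "c * a = Re (val n A ?\<alpha> \<beta>)" unfolding val_smult[OF 1(1)] 1 by simp
      moreover have "adm X n A ?\<alpha> \<beta>" using 1(1) by (auto simp: adm_def)
      ultimately show ?thesis unfolding G_def by blast
    qed
    show "a \<le> tnorm u" if ua: "(u, a) \<in> G" for u a
    proof -
      obtain n A \<alpha> \<beta> where 1: "adm X n A \<alpha> \<beta>" "u = tens n A \<alpha> \<beta>" "a = Re (val n A \<alpha> \<beta>)"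
        using ua unfolding G_def by blast
      obtain s where s: "rep u s" using rep_tens[OF adm_X_bop[OF 1(1)]] 1(2) by blast
      show ?thesis
      proof (rule tnorm_ge[OF s])
        fix t assume "rep u t"
        then show "a \<le> t" unfolding rep_def using val_le[OF 1(1)] 1(2,3) by metis
      qed
    qed
  qed
  then obtain g :: "_ \<Rightarrow> real" where g: "(\<forall>u\<in>W. \<forall>v\<in>W. g (u + v) = g u + g v) \<and> (\<forall>c. \<forall>u\<in>W. g (scale c u) = c * g u) \<and>
    (\<forall>u\<in>W. g u \<le> tnorm u) \<and> (\<forall>(u, a)\<in>G. g u = a)" by (elim exE)
  have g_add: "g (u + v) = g u + g v" if "u \<in> W" "v \<in> W" for u v
    using g[THEN conjunct1] that by blast
  have g_scale: "g (scale c u) = c * g u" if "u \<in> W" for c u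
    using g[THEN conjunct2, THEN conjunct1] that by blast
  have g_le: "g u \<le> tnorm u" if "u \<in> W" for u
    using g[THEN conjunct2, THEN conjunct2, THEN conjunct1] that by blast
  have g_G: "g u = a" if "(u, a) \<in> G" for u a
    using g[THEN conjunct2, THEN conjunct2, THEN conjunct2] that by auto
  have W0: "0 \<in> W" using rep_tens[OF adm_X_bop[OF adm0]] unfolding t0 W_def by simp
  have W_add: "u + v \<in> W" if "u \<in> W" "v \<in> W" for u v using that rep_add unfolding W_def by blast
  have g0: "g 0 = 0" using g_add[OF W0 W0] by simp
  have W_sum: "(\<Sum>i\<in>I. h i) \<in> W \<and> g (\<Sum>i\<in>I. h i) = (\<Sum>i\<in>I. g (h i))" if "finite I" "\<And>i. i \<in> I \<Longrightarrow> h i \<in> W" for I :: "nat set" and h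
    using that
  proof (induction I rule: finite_induct)
    case empty
    show ?case unfolding sum.empty using W0 g0 by blast
  next
    case (insert i I)
    have hi: "h i \<in> W" by (rule insert.prems) simp
    have IH: "sum h I \<in> W" "g (sum h I) = (\<Sum>i\<in>I. g (h i))" using insert.IH[OF insert.prems] by auto
    show ?case unfolding sum.insert[OF insert(1,2)] IH(2)[symmetric]
      by (intro conjI W_add g_add hi IH(1))
  qed
  have eW: "etens a \<xi> \<eta> \<in> W" if "a \<in> carrier (bop H0 K0)" "\<xi> \<in> carrier H" "\<eta> \<in> carrier K" for a \<xi> \<eta>
    unfolding W_def etens_def using rep_tens[of 1 "\<lambda>_ _. a" "\<lambda>_. \<xi>" "\<lambda>_. \<eta>"] that by (simp add: adm_def)
  have g_tens: "g (tens n A \<alpha> \<beta>) = (\<Sum>i<n. \<Sum>j<n. g (etens (A i j) (\<alpha> j) (\<beta> i)))"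
    if "adm (carrier (bop H0 K0)) n A \<alpha> \<beta>" for n A \<alpha> \<beta>
  proof -
    have e: "etens (A i j) (\<alpha> j) (\<beta> i) \<in> W" if "i < n" "j < n" for i j
      using \<open>adm (carrier (bop H0 K0)) n A \<alpha> \<beta>\<close> that by (intro eW) (auto simp: adm_def)
    have 1: "(\<Sum>j<n. etens (A i j) (\<alpha> j) (\<beta> i)) \<in> W \<and>
        g (\<Sum>j<n. etens (A i j) (\<alpha> j) (\<beta> i)) = (\<Sum>j<n. g (etens (A i j) (\<alpha> j) (\<beta> i)))" if "i < n" for i
      by (rule W_sum) (use e that in auto)
    have "g (\<Sum>i<n. \<Sum>j<n. etens (A i j) (\<alpha> j) (\<beta> i)) = (\<Sum>i<n. g (\<Sum>j<n. etens (A i j) (\<alpha> j) (\<beta> i)))"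
      using W_sum[of "{..<n}" "\<lambda>i. \<Sum>j<n. etens (A i j) (\<alpha> j) (\<beta> i)"] 1 by auto
    then show ?thesis unfolding tens_eq_sum using 1 by simp
  qed
  have etens_add1: "etens a (\<xi> \<oplus>\<^bsub>H\<^esub> \<xi>') \<eta> = etens a \<xi> \<eta> + etens a \<xi>' \<eta>" if "\<xi> \<in> carrier H" "\<xi>' \<in> carrier H" for a \<xi> \<xi>' \<eta>
    by (rule etens_eqI) (use that in \<open>simp_all add: etens_outside etens_apply C.H.cinner_simps algebra_simps\<close>)
  have etens_add2: "etens a \<xi> (\<eta> \<oplus>\<^bsub>K\<^esub> \<eta>') = etens a \<xi> \<eta> + etens a \<xi> \<eta>'" if "\<eta> \<in> carrier K" "\<eta>' \<in> carrier K" for a \<xi> \<eta>' \<eta>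
    by (rule etens_eqI) (use that in \<open>simp_all add: etens_outside etens_apply C.K.cinner_simps algebra_simps\<close>)
  have etens_scale: "etens a \<xi> (complex_of_real c \<odot>\<^bsub>K\<^esub> \<eta>) = scale c (etens a \<xi> \<eta>)" if "\<eta> \<in> carrier K" for a \<xi> \<eta> c
    by (rule etens_eqI) (use that in \<open>simp_all add: etens_outside etens_apply C.K.cinner_simps scale_def\<close>)
  have etens_bal: "etens a (c \<odot>\<^bsub>H\<^esub> \<xi>) \<eta> = etens a \<xi> (cnj c \<odot>\<^bsub>K\<^esub> \<eta>)" if "\<xi> \<in> carrier H" "\<eta> \<in> carrier K" for a \<xi> \<eta> c
    by (rule etens_eqI) (use that in \<open>simp_all add: etens_outside etens_apply C.H.cinner_simps C.K.cinner_simps\<close>)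
  have etens_mat: "etens (c \<odot>\<^bsub>bop H0 K0\<^esub> a) \<xi> \<eta> = etens a (c \<odot>\<^bsub>H\<^esub> \<xi>) \<eta>"
    if "a \<in> carrier (bop H0 K0)" "\<xi> \<in> carrier H" for a \<xi> \<eta> c
    by (rule etens_eqI) (use that in \<open>simp_all add: etens_outside etens_apply C.H.cinner_simps D.K.cinner_simps\<close>)
  have etens_add0: "etens (a \<oplus>\<^bsub>bop H0 K0\<^esub> b) \<xi> \<eta> = etens a \<xi> \<eta> + etens b \<xi> \<eta>"
    if "a \<in> carrier (bop H0 K0)" "b \<in> carrier (bop H0 K0)" for a b \<xi> \<eta>
    by (rule etens_eqI) (use that in \<open>simp_all add: etens_outside etens_apply D.K.cinner_simps algebra_simps\<close>)
  have etens_bound: "g (etens a \<xi> \<eta>) \<le> r * hnorm H \<xi> * hnorm K \<eta>"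
    if a: "a \<in> carrier (bop H0 K0)" and \<xi>: "\<xi> \<in> carrier H" and \<eta>: "\<eta> \<in> carrier K"
      and r: "0 < r" "mbound H0 K0 r 1 (\<lambda>_ _. a)" for a \<xi> \<eta> r
  proof (cases "\<xi> = \<zero>\<^bsub>H\<^esub> \<or> \<eta> = \<zero>\<^bsub>K\<^esub>")
    case True
    then have "etens a \<xi> \<eta> = 0" by (intro etens_eqI) (auto simp: etens_apply etens_outside)
    then show ?thesis using True g0 by auto
  next
    case False
    define x y where "x = hnorm H \<xi>" and "y = hnorm K \<eta>"
    have xy: "x > 0" "y > 0" using False \<xi> \<eta> by (auto simp: x_def y_def intro: C.H.hnorm_pos C.K.hnorm_pos)
    \<comment> \<open>With these factors \<open>(s x)\<^sup>2 = (t y)\<^sup>2 = r x y\<close>, so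
      that the arithmetic mean in \<open>rep\<close> equals the geometric one, while
      \<open>s t = r\<close> undoes the normalisation of \<open>a\<close>.\<close>
    define s t where "s = sqrt (r * y / x)" and "t = sqrt (r * x / y)"
    have st: "s * t = r" unfolding s_def t_def real_sqrt_mult[symmetric] using xy r by simp
    have s2: "s\<^sup>2 = r * y / x" "t\<^sup>2 = r * x / y" using xy r by (simp_all add: s_def t_def)
    let ?A = "\<lambda>_ _ :: nat. complex_of_real (1 / r) \<odot>\<^bsub>bop H0 K0\<^esub> a"
    let ?\<alpha> = "\<lambda>_ :: nat. complex_of_real s \<odot>\<^bsub>H\<^esub> \<xi>" and ?\<beta> = "\<lambda>_ :: nat. complex_of_real t \<odot>\<^bsub>K\<^esub> \<eta>"
    have "mbound H0 K0 (1 / r * r) 1 ?A" using r a by (intro D.mbound_scale) auto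
    then have m: "mbound H0 K0 1 1 ?A" using r by simp
    have adm: "adm (carrier (bop H0 K0)) 1 ?A ?\<alpha> ?\<beta>" using a \<xi> \<eta> by (simp add: adm_def)
    have "complex_of_real s * complex_of_real t = complex_of_real r" using st by (simp flip: of_real_mult)
    then have stz: "complex_of_real s * (complex_of_real t * z) / complex_of_real r = z" for z
      using r by (simp add: mult.assoc[symmetric])
    have "tens 1 ?A ?\<alpha> ?\<beta> = etens a \<xi> \<eta>"
      using a \<xi> \<eta> unfolding etens_def
      by (subst tens_smult_mat, simp, subst tens_smult, simp, subst tens_smult_right, simp) (simp add: fun_eq_iff stz)
    then have "rep (etens a \<xi> \<eta>) (((s * x)\<^sup>2 + (t * y)\<^sup>2) / 2)"
      using repI[OF adm m] \<xi> \<eta> xy r by (simp add: x_def y_def s_def t_def power_mult_distrib)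
    then have "g (etens a \<xi> \<eta>) \<le> ((s * x)\<^sup>2 + (t * y)\<^sup>2) / 2"
      using tnorm_le g_le[OF eW[OF a \<xi> \<eta>]] by force
    also have "\<dots> = r * x * y" unfolding power_mult_distrib s2 using xy by (simp add: field_simps power2_eq_square)
    finally show ?thesis by (simp add: x_def y_def)
  qed
  have "\<exists>b\<in>carrier (bop H K). \<forall>\<xi>\<in>carrier H. \<forall>\<eta>\<in>carrier K. Re (cinner K (b \<xi>) \<eta>) = g (etens a \<xi> \<eta>)"
    if a: "a \<in> carrier (bop H0 K0)" for a
  proof -
    obtain r where r: "0 < r" "mbound H0 K0 r 1 (\<lambda>_ _. a)" using D.mbound_exists[of 1 "\<lambda>_ _. a"] a by auto
    show ?thesis
      by (rule C.bop_of_form[where C = r])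
        (use a r in \<open>simp_all add: etens_add1 etens_add2 g_add eW etens_scale g_scale etens_bal etens_bound\<close>)
  qed
  then obtain F where F: "\<And>a. a \<in> carrier (bop H0 K0) \<Longrightarrow> F a \<in> carrier (bop H K)"
    and F_inner: "\<And>a \<xi> \<eta>. a \<in> carrier (bop H0 K0) \<Longrightarrow> \<xi> \<in> carrier H \<Longrightarrow> \<eta> \<in> carrier K \<Longrightarrow>
      Re (cinner K (F a \<xi>) \<eta>) = g (etens a \<xi> \<eta>)"
    by metis
  have "clinear_on (carrier (bop H0 K0)) (bop H0 K0) (bop H K) F"
    unfolding clinear_on_def
  proof (intro conjI ballI allI)
    show "F \<in> carrier (bop H0 K0) \<rightarrow> carrier (bop H K)" using F by auto
    fix a assume a: "a \<in> carrier (bop H0 K0)"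
    fix b assume b: "b \<in> carrier (bop H0 K0)"
    show "F (a \<oplus>\<^bsub>bop H0 K0\<^esub> b) = F a \<oplus>\<^bsub>bop H K\<^esub> F b"
      by (rule C.bop_eqI) (use a b F in \<open>simp_all add: F_inner etens_add0 g_add eW C.K.cinner_simps\<close>)
  next
    fix c a assume a: "a \<in> carrier (bop H0 K0)"
    show "F (c \<odot>\<^bsub>bop H0 K0\<^esub> a) = c \<odot>\<^bsub>bop H K\<^esub> F a"
    proof (rule C.bop_eqI)
      fix \<xi> \<eta> assume *: "\<xi> \<in> carrier H" "\<eta> \<in> carrier K"
      have "Re (cinner K (F (c \<odot>\<^bsub>bop H0 K0\<^esub> a) \<xi>) \<eta>) = g (etens a (c \<odot>\<^bsub>H\<^esub> \<xi>) \<eta>)"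
        using a * by (simp add: F_inner etens_mat)
      also have "\<dots> = Re (cinner K (F a (c \<odot>\<^bsub>H\<^esub> \<xi>)) \<eta>)" using a * by (simp only: F_inner C.H.smult_closed complex_field_simps UNIV_I)
      finally show "Re (cinner K (F (c \<odot>\<^bsub>bop H0 K0\<^esub> a) \<xi>) \<eta>) = Re (cinner K ((c \<odot>\<^bsub>bop H K\<^esub> F a) \<xi>) \<eta>)"
        using a * F by simp
    qed (use a F in auto)
  qed
  moreover have "F x = f x" if x: "x \<in> X" for x
  proof (rule C.bop_eqI)
    fix \<xi> \<eta> assume *: "\<xi> \<in> carrier H" "\<eta> \<in> carrier K"
    have "adm X 1 (\<lambda>_ _. x) (\<lambda>_. \<xi>) (\<lambda>_. \<eta>)" using x * by (simp add: adm_def)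
    then have "(etens x \<xi> \<eta>, Re (val 1 (\<lambda>_ _. x) (\<lambda>_. \<xi>) (\<lambda>_. \<eta>))) \<in> G" unfolding G_def etens_def by blast
    then show "Re (cinner K (F x \<xi>) \<eta>) = Re (cinner K (f x \<xi>) \<eta>)"
      using g_G x * by (simp add: F_inner val_def)
  qed (use F x in auto)
  moreover have "mbound H K 1 n (\<lambda>i j. F (A i j))"
    if A: "\<forall>i<n. \<forall>j<n. A i j \<in> carrier (bop H0 K0)" "mbound H0 K0 1 n A" for n A
    unfolding mbound_def
  proof (intro allI impI)
    fix v w assume vw: "\<forall>j<n. v j \<in> carrier H" "\<forall>i<n. w i \<in> carrier K"
    have adm: "adm (carrier (bop H0 K0)) n A v w" using A vw by (simp add: adm_def)
    have "Re (\<Sum>i<n. \<Sum>j<n. cinner K (F (A i j) (v j)) (w i)) = (\<Sum>i<n. \<Sum>j<n. g (etens (A i j) (v j) (w i)))"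
      unfolding Re_sum by (intro sum.cong refl) (use A vw in \<open>simp add: F_inner\<close>)
    also have "\<dots> = g (tens n A v w)" using g_tens[OF adm] by simp
    also have "\<dots> \<le> tnorm (tens n A v w)" using rep_tens[OF adm] by (intro g_le) (simp add: W_def)
    also have "\<dots> \<le> 1 * ((\<Sum>j<n. (hnorm H (v j))\<^sup>2) + (\<Sum>i<n. (hnorm K (w i))\<^sup>2)) / 2"
      using tnorm_le[OF repI[OF adm A(2)]] by simp
    finally show "Re (\<Sum>i<n. \<Sum>j<n. cinner K (F (A i j) (v j)) (w i)) \<le>
      1 * ((\<Sum>j<n. (hnorm H (v j))\<^sup>2) + (\<Sum>i<n. (hnorm K (w i))\<^sup>2)) / 2" .
  qed
  ultimately show ?thesis by blast
qed

end

section \<open>Irreducible representations\<close>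

context complex_hilbert_space
begin

lemma hilbert_pair_self: "hilbert_pair H H"
  by (rule hilbert_pairI) (rule complex_hilbert_space_axioms)+

lemma zero_projection: "\<zero>\<^bsub>bop H H\<^esub> \<in> projections H"
proof -
  interpret P: hilbert_pair H H by (rule hilbert_pair_self)
  have "compose (carrier H) \<zero>\<^bsub>bop H H\<^esub> \<zero>\<^bsub>bop H H\<^esub> = \<zero>\<^bsub>bop H H\<^esub>"
    by (rule P.bop_ext) (use bop_compose[OF hilbert_pair_self hilbert_pair_self] in \<open>auto simp: compose_eq\<close>)
  moreover have "adj H H \<zero>\<^bsub>bop H H\<^esub> = \<zero>\<^bsub>bop H H\<^esub>"
    by (rule P.adj_eqI) auto
  ultimately show ?thesis by (simp add: projections_def)
qed

lemma idop_apply [simp]: "x \<in> carrier H \<Longrightarrow> idop H x = x"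
  by (simp add: idop_def)

lemma idop_closed: "idop H \<in> carrier (bop H H)"
proof -
  interpret P: hilbert_pair H H by (rule hilbert_pair_self)
  show ?thesis by (rule P.bopI[where C = 1]) (auto simp: idop_def)
qed

lemma idop_projection: "idop H \<in> projections H"
proof -
  interpret P: hilbert_pair H H by (rule hilbert_pair_self)
  have "compose (carrier H) (idop H) (idop H) = idop H"
    by (rule P.bop_ext) (use bop_compose[OF hilbert_pair_self hilbert_pair_self] idop_closed in \<open>auto simp: compose_eq\<close>)
  moreover have "adj H H (idop H) = idop H"
    by (rule P.adj_eqI) (use idop_closed in auto)
  ultimately show ?thesis using idop_closed by (simp add: projections_def)
qed

lemma idop_neq_zero: "idop H \<noteq> \<zero>\<^bsub>bop H H\<^esub>"
proof
  interpret P: hilbert_pair H H by (rule hilbert_pair_self)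
  assume eq: "idop H = \<zero>\<^bsub>bop H H\<^esub>"
  obtain x where "x \<in> carrier H" "x \<noteq> \<zero>" using nonzero by blast
  then show False using P.zero_apply[of x] idop_apply[of x] eq by simp
qed

lemma projectionD:
  assumes "p \<in> projections H"
  shows "p \<in> carrier (bop H H)" "x \<in> carrier H \<Longrightarrow> p x \<in> carrier H" "x \<in> carrier H \<Longrightarrow> p (p x) = p x"
    "x \<in> carrier H \<Longrightarrow> y \<in> carrier H \<Longrightarrow> cinner H (p x) y = cinner H x (p y)"
proof -
  interpret P: hilbert_pair H H by (rule hilbert_pair_self)
  show p: "p \<in> carrier (bop H H)" using assms by (simp add: projections_def)
  then show "x \<in> carrier H \<Longrightarrow> p x \<in> carrier H" by simp
  have "compose (carrier H) p p = p" "adj H H p = p" using assms by (auto simp: projections_def)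
  then show "x \<in> carrier H \<Longrightarrow> p (p x) = p x" by (metis compose_eq)
  show "x \<in> carrier H \<Longrightarrow> y \<in> carrier H \<Longrightarrow> cinner H (p x) y = cinner H x (p y)"
    using P.cinner_adj_right[OF p, of x y] \<open>adj H H p = p\<close> by simp
qed

definition closed_subspace :: "'a set \<Rightarrow> bool"
  where "closed_subspace M \<longleftrightarrow> M \<subseteq> carrier H \<and> \<zero> \<in> M \<and> (\<forall>x\<in>M. \<forall>y\<in>M. x \<oplus> y \<in> M) \<and> (\<forall>c. \<forall>x\<in>M. c \<odot> x \<in> M) \<and>
    (\<forall>s x. (\<forall>n::nat. s n \<in> M) \<longrightarrow> x \<in> carrier H \<longrightarrow> (\<lambda>n. hnorm H (s n \<ominus> x)) \<longlonglongrightarrow> 0 \<longrightarrow> x \<in> M)"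

lemma orthogonal_closed_subspace:
  assumes "N \<subseteq> carrier H" shows "closed_subspace {x \<in> carrier H. \<forall>y\<in>N. cinner H x y = 0}"
  unfolding closed_subspace_def
proof (intro conjI allI impI)
  fix s x assume s: "\<forall>n::nat. s n \<in> {x \<in> carrier H. \<forall>y\<in>N. cinner H x y = 0}" and x: "x \<in> carrier H"
    and lim: "(\<lambda>n. hnorm H (s n \<ominus> x)) \<longlonglongrightarrow> 0"
  have "cinner H x y = 0" if "y \<in> N" for y
  proof -
    have "(\<lambda>n. cinner H (s n) y) \<longlonglongrightarrow> cinner H x y"
      using s x lim that assms by (intro tendsto_cinner) auto
    moreover have "(\<lambda>n. cinner H (s n) y) = (\<lambda>n. 0)" using s that by auto
    ultimately show ?thesis by (simp add: LIMSEQ_const_iff)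
  qed
  then show "x \<in> {x \<in> carrier H. \<forall>y\<in>N. cinner H x y = 0}" using x by simp
qed (use assms in \<open>auto simp: cinner_simps subset_eq\<close>)

text \<open>Riesz for \<open>y \<mapsto> Re \<langle>x, y\<rangle>\<close> on \<open>M\<close> gives
  the projection of \<open>x\<close>; the imaginary parts agree as well, because \<open>M\<close> is
  a complex subspace and \<open>\<i> \<odot> y\<close> may be tested.\<close>

lemma closed_subspace_projection:
  assumes M: "closed_subspace M"
  shows "\<exists>p\<in>projections H. (\<forall>x\<in>carrier H. p x \<in> M) \<and> (\<forall>x\<in>M. p x = x) \<and>
    (\<forall>x\<in>carrier H. \<forall>y\<in>M. cinner H (p x) y = cinner H x y)"
proof -
  interpret P: hilbert_pair H H by (rule hilbert_pair_self)
  have MH [simp]: "x \<in> carrier H" if "x \<in> M" for x using M that by (auto simp: closed_subspace_def)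
  have Madd: "x \<oplus> y \<in> M" if "x \<in> M" "y \<in> M" for x y using M that unfolding closed_subspace_def by blast
  have Msm: "c \<odot> x \<in> M" if "x \<in> M" for x c using M that unfolding closed_subspace_def by blast
  have M0: "\<zero> \<in> M" using M unfolding closed_subspace_def by blast
  have Mcl: "x \<in> M" if "\<And>n::nat. s n \<in> M" "x \<in> carrier H" "(\<lambda>n. hnorm H (s n \<ominus> x)) \<longlonglongrightarrow> 0" for s x
    using M that unfolding closed_subspace_def by blast
  have "\<exists>z\<in>M. \<forall>y\<in>M. cinner H z y = cinner H x y" if x: "x \<in> carrier H" for x
  proof -
    have "\<exists>z\<in>M. \<forall>y\<in>M. Re (cinner H z y) = Re (cinner H x y)"
    proof (rule riesz_real_subspace[OF _ M0 Madd Msm Mcl, where C = "hnorm H x"])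
      fix y assume "y \<in> M"
      then show "Re (cinner H x y) \<le> hnorm H x * hnorm H y" using Re_cinner_le_mult[OF x, of y] by simp
    qed (use x in \<open>auto simp: cinner_simps\<close>)
    then obtain z where z: "z \<in> M" "\<And>y. y \<in> M \<Longrightarrow> Re (cinner H z y) = Re (cinner H x y)" by blast
    have "cinner H z y = cinner H x y" if y: "y \<in> M" for y
      using z(2)[OF y] z(2)[OF Msm[OF y, of \<i>]] x y z(1) by (simp add: cinner_simps complex_eq_iff)
    then show ?thesis using z(1) by blast
  qed
  then obtain p where p: "\<And>x. x \<in> carrier H \<Longrightarrow> p x \<in> M"
    "\<And>x y. x \<in> carrier H \<Longrightarrow> y \<in> M \<Longrightarrow> cinner H (p x) y = cinner H x y" by metis
  have pH [simp]: "p x \<in> carrier H" if "x \<in> carrier H" for x using p that by auto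
  have eqI: "x = y" if "x \<in> M" "y \<in> M" "\<And>z. z \<in> M \<Longrightarrow> cinner H x z = cinner H y z" for x y
  proof -
    have d: "x \<oplus> (-1) \<odot> y \<in> M" by (intro Madd Msm that)
    have "cinner H (x \<oplus> (-1) \<odot> y) (x \<oplus> (-1) \<odot> y) = 0"
      using that(3)[OF d] that(1,2) d by (simp add: cinner_add_left cinner_smult_left)
    then have "x \<oplus> (-1) \<odot> y = \<zero>" using cinner_pos[of "x \<oplus> (-1) \<odot> y"] MH[OF d] by fastforce
    then show ?thesis using that diff_eq_0_iff[of x y] by (simp add: diff_conv_smult)
  qed
  let ?p = "restrict p (carrier H)"
  have pM: "p x = x" if "x \<in> M" for x by (rule eqI) (use that p in auto)
  have pB: "?p \<in> carrier (bop H H)"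
  proof (rule P.bopI[where C = 1])
    fix x assume x: "x \<in> carrier H"
    have "Re (cinner H x (p x)) \<le> hnorm H x * hnorm H (p x)" using Re_cinner_le_mult[OF x, of "p x"] x by simp
    moreover have "Re (cinner H x (p x)) = hnorm H (p x) * hnorm H (p x)"
      using p(2)[OF x p(1)[OF x]] x by (simp add: hnorm_square[symmetric] power2_eq_square[symmetric])
        (metis hnorm_square pH)
    ultimately have le: "hnorm H (p x) * hnorm H (p x) \<le> hnorm H x * hnorm H (p x)" by simp
    show "hnorm H (?p x) \<le> 1 * hnorm H x"
    proof (cases "p x = \<zero>")
      case False
      then show ?thesis using mult_right_le_imp_le[OF le hnorm_pos] x by simp
    qed (use x in simp)
    fix c
    have "p (c \<odot> x) = c \<odot> p x"
      by (rule eqI) (use x p Msm in \<open>auto simp: cinner_smult_left\<close>)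
    then show "?p (c \<odot> x) = c \<odot> ?p x" using x by simp
    fix y assume y: "y \<in> carrier H"
    have "p (x \<oplus> y) = p x \<oplus> p y"
      by (rule eqI) (use x y p Madd in \<open>auto simp: cinner_add_left\<close>)
    then show "?p (x \<oplus> y) = ?p x \<oplus> ?p y" using x y by simp
  qed auto
  have "adj H H ?p = ?p"
  proof (rule P.adj_eqI[OF pB pB])
    fix x y assume xy: "x \<in> carrier H" "y \<in> carrier H"
    have "cinner H (p x) y = cnj (cinner H y (p x))" using xy by (intro cinner_commute) auto
    also have "\<dots> = cnj (cinner H (p y) (p x))" using p xy by simp
    also have "\<dots> = cinner H (p x) (p y)" using xy by (intro cinner_commute[symmetric]) auto
    also have "\<dots> = cinner H x (p y)" using p xy by simp
    finally show "cinner H (?p x) y = cinner H x (?p y)" using xy by simp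
  qed
  moreover have "compose (carrier H) ?p ?p = ?p"
    by (rule P.bop_ext) (use pB bop_compose[OF hilbert_pair_self hilbert_pair_self pB pB] pM p in \<open>auto simp: compose_eq\<close>)
  ultimately have "?p \<in> projections H" using pB by (simp add: projections_def)
  then show ?thesis using p pM by (intro bexI[of _ ?p]) auto
qed

text \<open>Closure under scalars from a dense set \<open>Q\<close> is enough, which is what allows
  the generating set \<open>A\<close> to be countable.\<close>

lemma closure_closed_subspace:
  assumes A: "A \<subseteq> carrier H" "A \<noteq> {}" and add: "\<And>a b. a \<in> A \<Longrightarrow> b \<in> A \<Longrightarrow> a \<oplus> b \<in> A"
    and sm: "\<And>c a. c \<in> Q \<Longrightarrow> a \<in> A \<Longrightarrow> c \<odot> a \<in> A"
    and Q: "\<And>z e. e > 0 \<Longrightarrow> \<exists>q\<in>Q. cmod (z - q) < e"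
  shows "closed_subspace {x \<in> carrier H. \<forall>e>0. \<exists>a\<in>A. hnorm H (x \<ominus> a) < e}" (is "closed_subspace ?M")
proof -
  have MI: "x \<in> ?M" if "x \<in> carrier H" "\<And>e. e > 0 \<Longrightarrow> \<exists>a\<in>A. hnorm H (x \<ominus> a) < e" for x
    using that by blast
  have sm': "c \<odot> x \<in> ?M" if x: "x \<in> ?M" for c x
  proof (rule MI)
    show "c \<odot> x \<in> carrier H" using x by simp
    fix e :: real assume e: "e > 0"
    have xH [simp]: "x \<in> carrier H" using x by simp
    have pos: "hnorm H x + 1 > 0" "cmod c + 2 > 0" using hnorm_nonneg[OF xH] by (auto simp: add_nonneg_pos)
    \<comment> \<open>The bound 1 keeps \<open>cmod q\<close> at most \<open>cmod c + 1\<close>; the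
      other makes the error from replacing \<open>c\<close> by \<open>q\<close> at most
      \<open>e / 2\<close>.\<close>
    define d where "d = min 1 (e / 2 / (hnorm H x + 1))"
    have "d > 0" using e pos by (simp add: d_def)
    then obtain q where q: "q \<in> Q" "cmod (c - q) < d" using Q by blast
    have qn: "cmod q \<le> cmod c + 1" using q(2) norm_triangle_ineq2[of q c] by (simp add: d_def norm_minus_commute)
    have "e / 2 / (cmod c + 2) > 0" using e pos by simp
    then obtain a where a: "a \<in> A" "hnorm H (x \<ominus> a) < e / 2 / (cmod c + 2)" using x by blast
    have aH [simp]: "a \<in> carrier H" using a A by auto
    have "c \<odot> x \<ominus> q \<odot> a = (c - q) \<odot> x \<oplus> q \<odot> (x \<ominus> a)"
      by (rule cinner_eqI) (simp_all add: cinner_simps algebra_simps)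
    then have "hnorm H (c \<odot> x \<ominus> q \<odot> a) \<le> cmod (c - q) * hnorm H x + cmod q * hnorm H (x \<ominus> a)"
      using hnorm_triangle[of "(c - q) \<odot> x" "q \<odot> (x \<ominus> a)"] by simp
    also have "cmod (c - q) * hnorm H x \<le> d * (hnorm H x + 1)"
      using q(2) \<open>d > 0\<close> by (intro mult_mono) auto
    also have "d * (hnorm H x + 1) \<le> e / 2"
      unfolding pos_le_divide_eq[OF pos(1), symmetric] by (simp add: d_def)
    also have "cmod q * hnorm H (x \<ominus> a) \<le> (cmod c + 1) * hnorm H (x \<ominus> a)"
      using qn by (intro mult_right_mono) auto
    also have "\<dots> \<le> (cmod c + 1) * (e / 2 / (cmod c + 2))"
      using a by (intro mult_left_mono) auto
    also have "\<dots> < e / 2" using e pos by (simp add: field_simps)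
    finally show "\<exists>a\<in>A. hnorm H (c \<odot> x \<ominus> a) < e" using sm[OF q(1) a(1)] by auto
  qed
  have add': "x \<oplus> y \<in> ?M" if xy: "x \<in> ?M" "y \<in> ?M" for x y
  proof (rule MI)
    show "x \<oplus> y \<in> carrier H" using xy by simp
    fix e :: real assume e: "e > 0"
    obtain a where a: "a \<in> A" "hnorm H (x \<ominus> a) < e / 2" using xy e half_gt_zero by blast
    obtain b where b: "b \<in> A" "hnorm H (y \<ominus> b) < e / 2" using xy e half_gt_zero by blast
    have [simp]: "x \<in> carrier H" "y \<in> carrier H" "a \<in> carrier H" "b \<in> carrier H" using xy a b A by auto
    have "(x \<oplus> y) \<ominus> (a \<oplus> b) = (x \<ominus> a) \<oplus> (y \<ominus> b)"
      by (rule cinner_eqI) (simp_all add: cinner_simps)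
    then have "hnorm H ((x \<oplus> y) \<ominus> (a \<oplus> b)) < e"
      using hnorm_triangle[of "x \<ominus> a" "y \<ominus> b"] a b by simp
    then show "\<exists>a\<in>A. hnorm H (x \<oplus> y \<ominus> a) < e" using add[OF a(1) b(1)] by auto
  qed
  have AM: "a \<in> ?M" if "a \<in> A" for a
    using that A by (auto intro!: bexI[of _ a] simp: minus_eq r_neg)
  obtain a where "a \<in> A" using A by auto
  then have "0 \<odot> a \<in> ?M" by (intro sm' AM)
  then have M0: "\<zero> \<in> ?M" using \<open>a \<in> A\<close> A by auto
  have cl: "x \<in> ?M" if s: "\<And>n::nat. s n \<in> ?M" "x \<in> carrier H" "(\<lambda>n. hnorm H (s n \<ominus> x)) \<longlonglongrightarrow> 0" for s x
  proof (rule MI[OF s(2)])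
    fix e :: real assume e: "e > 0"
    then have "\<forall>\<^sub>F n in sequentially. hnorm H (s n \<ominus> x) < e / 2" using s(3) by (intro order_tendstoD) auto
    then obtain n where n: "hnorm H (s n \<ominus> x) < e / 2" by (auto simp: eventually_sequentially)
    obtain a where a: "a \<in> A" "hnorm H (s n \<ominus> a) < e / 2" using s(1)[of n] e half_gt_zero by blast
    have "hnorm H (x \<ominus> a) < e"
      using hnorm_diff_triangle[of x "s n" a] hnorm_minus_commute[of x "s n"] n a s(1)[of n] s(2) A by auto
    then show "\<exists>a\<in>A. hnorm H (x \<ominus> a) < e" using a by blast
  qed
  show ?thesis
    unfolding closed_subspace_def
  proof (intro conjI ballI allI impI add' sm' M0)
    fix s x assume "\<forall>n::nat. s n \<in> ?M" "x \<in> carrier H" "(\<lambda>n. hnorm H (s n \<ominus> x)) \<longlonglongrightarrow> 0"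
    then show "x \<in> ?M" using cl by blast
  qed auto
qed

text \<open>A point is determined by the balls of radius \<open>1 / (k + 1)\<close> around the
  members of a dense sequence that contain it, so the space embeds into the sets of natural numbers,
  of which there are continuum many.\<close>

lemma separable_lepoll:
  assumes A: "countable A" "A \<subseteq> carrier H" "\<And>x e. x \<in> carrier H \<Longrightarrow> e > 0 \<Longrightarrow> \<exists>a\<in>A. hnorm H (x \<ominus> a) < e"
  shows "carrier H \<lesssim> (UNIV :: real set)"
proof -
  define a where "a = from_nat_into A"
  have ne: "A \<noteq> {}" using A(3)[of \<zero> 1] by auto
  have aA: "a n \<in> A" for n unfolding a_def by (rule from_nat_into[OF ne])
  have aH [simp]: "a n \<in> carrier H" for n using aA A(2) by auto
  have surj: "\<exists>n. b = a n" if "b \<in> A" for b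
    unfolding a_def using from_nat_into_surj[OF A(1) that] by metis
  define f where "f x = {prod_encode (n, k) | n k. hnorm H (x \<ominus> a n) < 1 / (real k + 1)}" for x
  have "inj_on f (carrier H)"
  proof (rule inj_onI, rule ccontr)
    fix x y assume x: "x \<in> carrier H" and y: "y \<in> carrier H" and eq: "f x = f y" and "x \<noteq> y"
    then have "hnorm H (x \<ominus> y) > 0" using diff_eq_0_iff[of x y] by (intro hnorm_pos) auto
    then obtain k where k: "1 / (real k + 1) < hnorm H (x \<ominus> y) / 2"
      by (metis half_gt_zero nat_approx_posE of_nat_Suc add.commute)
    obtain b where b: "b \<in> A" "hnorm H (x \<ominus> b) < 1 / (real k + 1)" using A(3)[OF x, of "1 / (real k + 1)"] by auto
    then obtain n where n: "b = a n" using surj by blast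
    have "prod_encode (n, k) \<in> f x" using b n unfolding f_def by blast
    then have "prod_encode (n, k) \<in> f y" by (simp only: eq)
    then have "hnorm H (y \<ominus> a n) < 1 / (real k + 1)" by (auto simp: f_def prod_encode_eq)
    then show False
      using hnorm_diff_triangle[of x "a n" y] hnorm_minus_commute[of "a n" y] b n k x y by auto
  qed
  then have "carrier H \<lesssim> (UNIV :: nat set set)" unfolding lepoll_def by auto
  then show ?thesis using nat_sets_eqpoll_reals lepoll_trans1 lepoll_trans eqpoll_imp_lepoll by blast
qed

lemma reals_lepoll_carrier: "(UNIV :: real set) \<lesssim> carrier H"
proof -
  obtain x where x: "x \<in> carrier H" "x \<noteq> \<zero>" using nonzero by blast
  have "inj_on (\<lambda>r. complex_of_real r \<odot> x) UNIV"
  proof (rule inj_onI)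
    fix r s assume "complex_of_real r \<odot> x = complex_of_real s \<odot> x"
    then have "cinner H (complex_of_real r \<odot> x) x = cinner H (complex_of_real s \<odot> x) x" by simp
    then show "r = s" using x cinner_pos[OF x] by (auto simp: cinner_simps)
  qed
  then show ?thesis unfolding lepoll_def using x by (intro exI[of _ "\<lambda>r. complex_of_real r \<odot> x"]) auto
qed

text \<open>An infinite cardinal absorbs its own square, and \<open>carrier H\<close> has at least
  the cardinality of the reals. This is what fits a direct sum with a separable space into the type
  that already carries \<open>H\<close>.\<close>

lemma carrier_times_injection:
  assumes "B \<lesssim> (UNIV :: real set)"
  shows "\<exists>g. inj_on g (carrier H \<times> B) \<and> g ` (carrier H \<times> B) \<subseteq> carrier H"
proof -
  have inf: "infinite (carrier H)"
    using reals_lepoll_carrier infinite_UNIV_char_0[where 'a = real] inj_on_finite unfolding lepoll_def by blast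
  have "B \<lesssim> carrier H" using assms reals_lepoll_carrier lepoll_trans by blast
  then have "carrier H \<times> B \<lesssim> carrier H \<times> carrier H" by (intro times_lepoll_mono) auto
  moreover have "carrier H \<times> carrier H \<lesssim> carrier H"
    using card_of_Times_same_infinite[OF inf] unfolding card_of_ordIso[symmetric] lepoll_def bij_betw_def by blast
  ultimately have "carrier H \<times> B \<lesssim> carrier H" by (rule lepoll_trans)
  then show ?thesis unfolding lepoll_def .
qed

end

section \<open>Generation, irreducibility and separability\<close>

lemma generates_induct:
  assumes "generates H0 K0 X T" "tro H0 K0 S" "X \<subseteq> S" shows "T \<subseteq> S"
  using assms unfolding generates_def by blast

lemma generates_subset: "generates H0 K0 X T \<Longrightarrow> X \<subseteq> T"
  unfolding generates_def by blast

context tro_morphism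
begin

lemma tendsto_\<pi>:
  assumes s: "\<And>n::nat. s n \<in> T" and t: "t \<in> T" and lim: "(\<lambda>n. opnorm H0 K0 (s n \<ominus>\<^bsub>bop H0 K0\<^esub> t)) \<longlonglongrightarrow> 0"
    and v: "v \<in> carrier H" and w: "w \<in> carrier K"
  shows "(\<lambda>n. cinner K (\<pi> (s n) v) w) \<longlonglongrightarrow> cinner K (\<pi> t v) w"
proof (rule C.K.tendsto_cinner)
  have le: "hnorm K (\<pi> (s n) v \<ominus>\<^bsub>K\<^esub> \<pi> t v) \<le> opnorm H0 K0 (s n \<ominus>\<^bsub>bop H0 K0\<^esub> t) * hnorm H v" for n
  proof -
    have "\<pi> (s n) v \<ominus>\<^bsub>K\<^esub> \<pi> t v = \<pi> (s n \<ominus>\<^bsub>bop H0 K0\<^esub> t) v" using s t v by simp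
    also have "hnorm K \<dots> \<le> opnorm H K (\<pi> (s n \<ominus>\<^bsub>bop H0 K0\<^esub> t)) * hnorm H v"
      using s t v by (intro C.hnorm_le_opnorm) (auto simp del: \<pi>_diff)
    also have "\<dots> \<le> opnorm H0 K0 (s n \<ominus>\<^bsub>bop H0 K0\<^esub> t) * hnorm H v"
      using s t v by (intro mult_right_mono contractive) auto
    finally show ?thesis .
  qed
  have lim0: "(\<lambda>n. opnorm H0 K0 (s n \<ominus>\<^bsub>bop H0 K0\<^esub> t) * hnorm H v) \<longlonglongrightarrow> 0"
    using lim by (rule tendsto_mult_left_zero)
  have nn: "0 \<le> hnorm K (\<pi> (s n) v \<ominus>\<^bsub>K\<^esub> \<pi> t v)" for n using s t v by simp
  show "(\<lambda>n. hnorm K (\<pi> (s n) v \<ominus>\<^bsub>K\<^esub> \<pi> t v)) \<longlonglongrightarrow> 0"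
    by (rule real_tendsto_sandwich[OF always_eventually[OF allI[OF nn]] always_eventually[OF allI[OF le]] tendsto_const lim0])
qed (use s t v w in auto)

text \<open>The elements of \<open>T\<close> that intertwine \<open>p\<close> and \<open>q\<close>
  form a TRO: it is norm closed because \<open>\<pi>\<close> is contractive, and closed under the
  ternary product because the self-adjoint \<open>p\<close> and \<open>q\<close> intertwine the
  adjoints too. Testing on the generators therefore suffices.\<close>

lemma reducing_projections:
  assumes gen: "generates H0 K0 X T" and p: "p \<in> projections H" and q: "q \<in> projections K"
    and comm: "\<And>x v. x \<in> X \<Longrightarrow> v \<in> carrier H \<Longrightarrow> q (\<pi> x v) = \<pi> x (p v)"
    and t: "t \<in> T" and v: "v \<in> carrier H"
  shows "q (\<pi> t v) = \<pi> t (p v)"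
proof -
  note [simp] = C.H.projectionD(2)[OF p] C.K.projectionD(2)[OF q]
  interpret PP: hilbert_pair H H by (rule C.H.hilbert_pair_self)
  interpret QQ: hilbert_pair K K by (rule C.K.hilbert_pair_self)
  note pB = C.H.projectionD(1)[OF p] and qB = C.K.projectionD(1)[OF q]
  define S where "S = {t \<in> T. \<forall>v\<in>carrier H. q (\<pi> t v) = \<pi> t (p v)}"
  have adj_comm: "p (adj H K (\<pi> y) k) = adj H K (\<pi> y) (q k)" if y: "y \<in> S" and k: "k \<in> carrier K" for y k
  proof (rule C.H.cinner_eqI)
    have yT: "y \<in> T" using y by (simp add: S_def)
    fix z assume z: "z \<in> carrier H"
    have "cinner H (p (adj H K (\<pi> y) k)) z = cinner H (adj H K (\<pi> y) k) (p z)"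
      using yT k z by (intro C.H.projectionD(4)[OF p]) auto
    also have "\<dots> = cinner K k (q (\<pi> y z))"
      using y yT k z by (simp add: C.cinner_adj_left S_def)
    also have "\<dots> = cinner K (q k) (\<pi> y z)" using yT k z by (intro C.K.projectionD(4)[OF q, symmetric]) auto
    also have "\<dots> = cinner H (adj H K (\<pi> y) (q k)) z" using yT k z by (simp add: C.cinner_adj_left)
    finally show "Re (cinner H (p (adj H K (\<pi> y) k)) z) = Re (cinner H (adj H K (\<pi> y) (q k)) z)" by simp
  qed (use y k in \<open>auto simp: S_def\<close>)
  have "tro H0 K0 S"
    unfolding tro_def
  proof (intro conjI ballI)
    show "operator_space H0 K0 S"
    proof (rule D.operator_spaceI)
      show "\<zero>\<^bsub>bop H0 K0\<^esub> \<in> S" using QQ.bop_zero[OF qB] by (simp add: S_def)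
      show "a \<oplus>\<^bsub>bop H0 K0\<^esub> b \<in> S" if "a \<in> S" "b \<in> S" for a b
        using that QQ.bop_add[OF qB] by (simp add: S_def)
      show "c \<odot>\<^bsub>bop H0 K0\<^esub> a \<in> S" if "a \<in> S" for a c
        using that QQ.bop_smult[OF qB] by (simp add: S_def)
    qed (auto simp: S_def)
    show "norm_closed H0 K0 S"
      unfolding norm_closed_def
    proof (intro allI ballI impI, elim conjE)
      fix s t assume t: "t \<in> carrier (bop H0 K0)" and s: "\<forall>n. s n \<in> S"
        and lim: "(\<lambda>n. opnorm H0 K0 (s n \<ominus>\<^bsub>bop H0 K0\<^esub> t)) \<longlonglongrightarrow> 0"
      have sT: "s n \<in> T" for n using s by (auto simp: S_def)
      have tT: "t \<in> T" by (rule D.norm_closedD[OF norm_closed_T sT t lim])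
      have "q (\<pi> t v) = \<pi> t (p v)" if v: "v \<in> carrier H" for v
      proof (rule C.K.cinner_eqI)
        fix w assume w: "w \<in> carrier K"
        have "(\<lambda>n. cinner K (\<pi> (s n) v) (q w)) \<longlonglongrightarrow> cinner K (\<pi> t v) (q w)"
          by (rule tendsto_\<pi>[OF sT tT lim]) (use v w in auto)
        moreover have "(\<lambda>n. cinner K (\<pi> (s n) (p v)) w) \<longlonglongrightarrow> cinner K (\<pi> t (p v)) w"
          by (rule tendsto_\<pi>[OF sT tT lim]) (use v w in auto)
        moreover have "cinner K (\<pi> (s n) v) (q w) = cinner K (\<pi> (s n) (p v)) w" for n
          using s sT v w C.K.projectionD(4)[OF q, of "\<pi> (s n) v" w] by (auto simp: S_def)
        ultimately have "cinner K (\<pi> t v) (q w) = cinner K (\<pi> t (p v)) w"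
          using LIMSEQ_unique by fastforce
        then show "Re (cinner K (q (\<pi> t v)) w) = Re (cinner K (\<pi> t (p v)) w)"
          using tT v w C.K.projectionD(4)[OF q, of "\<pi> t v" w] by simp
      qed (use tT v in auto)
      then show "t \<in> S" using tT by (simp add: S_def)
    qed
    fix x y z assume xyz: "x \<in> S" "y \<in> S" "z \<in> S"
    then have xyzT: "x \<in> T" "y \<in> T" "z \<in> T" by (auto simp: S_def)
    have "q (tprod H K (\<pi> x) (\<pi> y) (\<pi> z) v) = tprod H K (\<pi> x) (\<pi> y) (\<pi> z) (p v)" if v: "v \<in> carrier H" for v
    proof -
      have "q (\<pi> x (adj H K (\<pi> y) (\<pi> z v))) = \<pi> x (p (adj H K (\<pi> y) (\<pi> z v)))"
        using xyz xyzT v by (simp add: S_def)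
      also have "\<dots> = \<pi> x (adj H K (\<pi> y) (q (\<pi> z v)))" using adj_comm[OF xyz(2), of "\<pi> z v"] xyzT v by simp
      also have "q (\<pi> z v) = \<pi> z (p v)" using xyz v by (simp add: S_def)
      finally show ?thesis using v by simp
    qed
    then show "tprod H0 K0 x y z \<in> S" using xyzT by (simp add: S_def del: C.tprod_apply)
  qed
  moreover have "X \<subseteq> S" using comm generates_subset[OF gen] by (auto simp: S_def)
  ultimately have "T \<subseteq> S" by (rule generates_induct[OF gen])
  then show ?thesis using t v by (auto simp: S_def)
qed

end

locale irreducible_tro_morphism = tro_morphism H0 K0 H K T \<pi>
  for H0 :: "'a inner_space" and K0 :: "'b inner_space" and H :: "'c inner_space" and K :: "'d inner_space"
    and T :: "('a \<Rightarrow> 'b) set" and \<pi> :: "('a \<Rightarrow> 'b) \<Rightarrow> ('c \<Rightarrow> 'd)" +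
  fixes X :: "('a \<Rightarrow> 'b) set"
  assumes X: "operator_space H0 K0 X" and gen: "generates H0 K0 X T"
    and irreducible: "irreducible_representation H0 K0 T H K \<pi>"
begin

lemma X_sub_T: "x \<in> X \<Longrightarrow> x \<in> T"
  using generates_subset[OF gen] by auto

lemma irreducibleD:
  assumes p: "p \<in> projections H" and q: "q \<in> projections K"
    and comm: "\<And>x v. x \<in> X \<Longrightarrow> v \<in> carrier H \<Longrightarrow> q (\<pi> x v) = \<pi> x (p v)"
  shows "(p = \<zero>\<^bsub>bop H H\<^esub> \<and> q = \<zero>\<^bsub>bop K K\<^esub>) \<or> (p = idop H \<and> q = idop K)"
proof -
  have "compose (carrier H) q (\<pi> t) = compose (carrier H) (\<pi> t) p" if "t \<in> T" for t
    using reducing_projections[OF gen p q comm that] by (auto simp: compose_def intro!: restrict_ext)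
  then show ?thesis using irreducible p q unfolding irreducible_representation_def by blast
qed

text \<open>Otherwise \<open>p = 0\<close>, \<open>q = 1\<close> would be an intertwining pair of
  the kind that irreducibility forbids. The next two lemmas use the pairs \<open>(0, q)\<close> and
  \<open>(p, 0)\<close> in the same way.\<close>

lemma nonzero_on_X:
  assumes "\<And>x v. x \<in> X \<Longrightarrow> v \<in> carrier H \<Longrightarrow> \<pi> x v = \<zero>\<^bsub>K\<^esub>" shows False
proof -
  interpret PP: hilbert_pair H H by (rule C.H.hilbert_pair_self)
  have "(\<zero>\<^bsub>bop H H\<^esub> = \<zero>\<^bsub>bop H H\<^esub> \<and> idop K = \<zero>\<^bsub>bop K K\<^esub>) \<or> (\<zero>\<^bsub>bop H H\<^esub> = idop H \<and> idop K = idop K)"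
    by (rule irreducibleD[OF C.H.zero_projection C.K.idop_projection]) (use assms X_sub_T in auto)
  then show False using C.H.idop_neq_zero C.K.idop_neq_zero by metis
qed

lemma nondegenerate_left:
  assumes q: "q \<in> projections K" and zero: "\<And>x v. x \<in> X \<Longrightarrow> v \<in> carrier H \<Longrightarrow> q (\<pi> x v) = \<zero>\<^bsub>K\<^esub>"
  shows "q = \<zero>\<^bsub>bop K K\<^esub>"
proof -
  interpret PP: hilbert_pair H H by (rule C.H.hilbert_pair_self)
  have "(\<zero>\<^bsub>bop H H\<^esub> = \<zero>\<^bsub>bop H H\<^esub> \<and> q = \<zero>\<^bsub>bop K K\<^esub>) \<or> (\<zero>\<^bsub>bop H H\<^esub> = idop H \<and> q = idop K)"
    by (rule irreducibleD[OF C.H.zero_projection q]) (use zero X_sub_T in auto)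
  then show ?thesis using C.H.idop_neq_zero by metis
qed

lemma nondegenerate_right:
  assumes p: "p \<in> projections H" and zero: "\<And>x v. x \<in> X \<Longrightarrow> v \<in> carrier H \<Longrightarrow> \<pi> x (p v) = \<zero>\<^bsub>K\<^esub>"
  shows "p = \<zero>\<^bsub>bop H H\<^esub>"
proof -
  interpret QQ: hilbert_pair K K by (rule C.K.hilbert_pair_self)
  have "(p = \<zero>\<^bsub>bop H H\<^esub> \<and> \<zero>\<^bsub>bop K K\<^esub> = \<zero>\<^bsub>bop K K\<^esub>) \<or> (p = idop H \<and> \<zero>\<^bsub>bop K K\<^esub> = idop K)"
    by (rule irreducibleD[OF p C.K.zero_projection]) (use zero X_sub_T in auto)
  then show ?thesis using C.K.idop_neq_zero by metis
qed

text \<open>One nonzero vector is closed up, countably, under the operators \<open>\<pi> d\<close>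
  and their adjoints for \<open>d\<close> in a countable dense subset of \<open>X\<close>. The
  closures \<open>M\<close> and \<open>N\<close> of the resulting sets reduce \<open>\<pi>\<close>
  on \<open>X\<close>, so by irreducibility they are the whole spaces.\<close>

lemma separable:
  assumes sep: "norm_separable H0 K0 X"
  shows "carrier H \<lesssim> (UNIV :: real set)" "carrier K \<lesssim> (UNIV :: real set)"
proof -
  obtain D0 where D0': "countable D0 \<and> D0 \<subseteq> X \<and> (\<forall>x\<in>X. \<forall>e>0. \<exists>d\<in>D0. opnorm H0 K0 (x \<ominus>\<^bsub>bop H0 K0\<^esub> d) < e)"
    using sep unfolding norm_separable_def by (elim exE)
  note D0 = D0'[THEN conjunct1] D0'[THEN conjunct2, THEN conjunct1] D0'[THEN conjunct2, THEN conjunct2, rule_format]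
  obtain Q :: "complex set" where Q: "countable Q" "\<And>U. open U \<Longrightarrow> U \<noteq> {} \<Longrightarrow> \<exists>q\<in>Q. q \<in> U"
    by (rule countable_dense_setE) blast
  have Qd: "\<exists>q\<in>Q. cmod (z - q) < e" if "e > 0" for z e
    using Q(2)[of "ball z e"] that by (auto simp: dist_norm)
  have DT: "d \<in> T" if "d \<in> D0" for d using that D0(2) X_sub_T by blast
  obtain h0 where h0: "h0 \<in> carrier H" "h0 \<noteq> \<zero>\<^bsub>H\<^esub>" using C.H.nonzero by blast
  \<comment> \<open>One round of closing up. Sums, multiples by the countable dense set
    \<open>Q\<close> of scalars, and images under the \<open>\<pi> d\<close> and their adjoints keep
    both sets countable. The zero of \<open>K\<close> at the start makes the second set
    nonempty.\<close>
  define F where "F = (\<lambda>(A, B).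
    (A \<union> (\<lambda>(a, b). a \<oplus>\<^bsub>H\<^esub> b) ` (A \<times> A) \<union> (\<lambda>(c, a). c \<odot>\<^bsub>H\<^esub> a) ` (Q \<times> A) \<union> (\<lambda>(d, b). adj H K (\<pi> d) b) ` (D0 \<times> B),
     B \<union> (\<lambda>(a, b). a \<oplus>\<^bsub>K\<^esub> b) ` (B \<times> B) \<union> (\<lambda>(c, a). c \<odot>\<^bsub>K\<^esub> a) ` (Q \<times> B) \<union> (\<lambda>(d, a). \<pi> d a) ` (D0 \<times> A)))"
  define st where "st n = (F ^^ n) ({h0}, {\<zero>\<^bsub>K\<^esub>})" for n
  define As Bs where "As n = fst (st n)" and "Bs n = snd (st n)" for n
  have st_Suc: "st (Suc n) = F (As n, Bs n)" for n by (simp add: st_def As_def Bs_def)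
  have As_Suc: "As (Suc n) = As n \<union> (\<lambda>(a, b). a \<oplus>\<^bsub>H\<^esub> b) ` (As n \<times> As n) \<union> (\<lambda>(c, a). c \<odot>\<^bsub>H\<^esub> a) ` (Q \<times> As n)
      \<union> (\<lambda>(d, b). adj H K (\<pi> d) b) ` (D0 \<times> Bs n)" for n
    unfolding As_def[of "Suc n"] st_Suc F_def by simp
  have Bs_Suc: "Bs (Suc n) = Bs n \<union> (\<lambda>(a, b). a \<oplus>\<^bsub>K\<^esub> b) ` (Bs n \<times> Bs n) \<union> (\<lambda>(c, a). c \<odot>\<^bsub>K\<^esub> a) ` (Q \<times> Bs n)
      \<union> (\<lambda>(d, a). \<pi> d a) ` (D0 \<times> As n)" for n
    unfolding Bs_def[of "Suc n"] st_Suc F_def by simp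
  have sub: "As n \<subseteq> carrier H \<and> Bs n \<subseteq> carrier K" for n
  proof (induction n)
    case 0
    then show ?case using h0 by (simp add: As_def Bs_def st_def)
  next
    case (Suc n)
    then have [simp]: "a \<in> As n \<Longrightarrow> a \<in> carrier H" "b \<in> Bs n \<Longrightarrow> b \<in> carrier K" for a b by auto
    show ?case unfolding As_Suc Bs_Suc using DT by auto
  qed
  have cnt: "countable (As n) \<and> countable (Bs n)" for n
  proof (induction n)
    case 0
    then show ?case by (simp add: As_def Bs_def st_def)
  next
    case (Suc n)
    then show ?case unfolding As_Suc Bs_Suc using D0(1) Q(1) by (intro conjI countable_Un countable_image countable_SIGMA) auto
  qed
  have sA: "As n \<subseteq> As (Suc n)" and sB: "Bs n \<subseteq> Bs (Suc n)" for n unfolding As_Suc Bs_Suc by blast+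
  note monoA = lift_Suc_mono_le[of As, OF sA] and monoB = lift_Suc_mono_le[of Bs, OF sB]
  define A B where "A = (\<Union>n. As n)" and "B = (\<Union>n. Bs n)"
  have AH: "A \<subseteq> carrier H" and BK: "B \<subseteq> carrier K" using sub by (auto simp: A_def B_def)
  have cA: "countable A" and cB: "countable B" using cnt by (auto simp: A_def B_def)
  have h0A: "h0 \<in> A" unfolding A_def by (rule UN_I[of 0]) (auto simp: As_def st_def)
  have 0: "\<zero>\<^bsub>K\<^esub> \<in> B" unfolding B_def by (rule UN_I[of 0]) (auto simp: Bs_def st_def)
  have addA: "a \<oplus>\<^bsub>H\<^esub> b \<in> A" if ab: "a \<in> A" "b \<in> A" for a b
  proof -
    obtain m n where mn: "a \<in> As m" "b \<in> As n" using ab unfolding A_def by blast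
    then have "a \<in> As (max m n)" "b \<in> As (max m n)" using monoA[of m "max m n"] monoA[of n "max m n"] by auto
    then have "a \<oplus>\<^bsub>H\<^esub> b \<in> As (Suc (max m n))" unfolding As_Suc by force
    then show ?thesis unfolding A_def by blast
  qed
  have addB: "a \<oplus>\<^bsub>K\<^esub> b \<in> B" if ab: "a \<in> B" "b \<in> B" for a b
  proof -
    obtain m n where mn: "a \<in> Bs m" "b \<in> Bs n" using ab unfolding B_def by blast
    then have "a \<in> Bs (max m n)" "b \<in> Bs (max m n)" using monoB[of m "max m n"] monoB[of n "max m n"] by auto
    then have "a \<oplus>\<^bsub>K\<^esub> b \<in> Bs (Suc (max m n))" unfolding Bs_Suc by force
    then show ?thesis unfolding B_def by blast
  qed
  have smA: "c \<odot>\<^bsub>H\<^esub> a \<in> A" if ca: "c \<in> Q" "a \<in> A" for c a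
  proof -
    obtain n where "a \<in> As n" using ca unfolding A_def by blast
    then have "c \<odot>\<^bsub>H\<^esub> a \<in> As (Suc n)" unfolding As_Suc using ca by force
    then show ?thesis unfolding A_def by blast
  qed
  have smB: "c \<odot>\<^bsub>K\<^esub> a \<in> B" if ca: "c \<in> Q" "a \<in> B" for c a
  proof -
    obtain n where "a \<in> Bs n" using ca unfolding B_def by blast
    then have "c \<odot>\<^bsub>K\<^esub> a \<in> Bs (Suc n)" unfolding Bs_Suc using ca by force
    then show ?thesis unfolding B_def by blast
  qed
  have \<pi>A: "\<pi> d a \<in> B" if da: "d \<in> D0" "a \<in> A" for d a
  proof -
    obtain n where "a \<in> As n" using da unfolding A_def by blast
    then have "\<pi> d a \<in> Bs (Suc n)" unfolding Bs_Suc using da by force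
    then show ?thesis unfolding B_def by blast
  qed
  have \<pi>B: "adj H K (\<pi> d) b \<in> A" if db: "d \<in> D0" "b \<in> B" for d b
  proof -
    obtain n where "b \<in> Bs n" using db unfolding B_def by blast
    then have "adj H K (\<pi> d) b \<in> As (Suc n)" unfolding As_Suc using db by force
    then show ?thesis unfolding A_def by blast
  qed
  define M where "M = {x \<in> carrier H. \<forall>e>0. \<exists>a\<in>A. hnorm H (x \<ominus>\<^bsub>H\<^esub> a) < e}"
  define N where "N = {x \<in> carrier K. \<forall>e>0. \<exists>a\<in>B. hnorm K (x \<ominus>\<^bsub>K\<^esub> a) < e}"
  have M: "C.H.closed_subspace M" unfolding M_def
    by (rule C.H.closure_closed_subspace[where Q = Q]) (use AH h0A addA smA Qd in auto)
  have N: "C.K.closed_subspace N" unfolding N_def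
    by (rule C.K.closure_closed_subspace[where Q = Q]) (use BK 0 addB smB Qd in auto)
  \<comment> \<open>One estimate serves the two invariance claims: \<open>f\<close> is first
    \<open>\<pi>\<close> and then its adjoint, which is why the spaces are arbitrary here and
    \<open>f\<close> is controlled by a joint continuity bound.\<close>
  have approx: "\<exists>b\<in>S. hnorm K1 (f x m \<ominus>\<^bsub>K1\<^esub> b) < e"
    if "complex_hilbert_space K1" "complex_hilbert_space H1" "S \<subseteq> carrier K1"
      and f: "\<And>x v. x \<in> X \<Longrightarrow> v \<in> carrier H1 \<Longrightarrow> f x v \<in> carrier K1"
      and dist: "\<And>x d v a. x \<in> X \<Longrightarrow> d \<in> X \<Longrightarrow> v \<in> carrier H1 \<Longrightarrow> a \<in> carrier H1 \<Longrightarrow>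
        hnorm K1 (f x v \<ominus>\<^bsub>K1\<^esub> f d a) \<le> opnorm H0 K0 (x \<ominus>\<^bsub>bop H0 K0\<^esub> d) * hnorm H1 v + opnorm H0 K0 d * hnorm H1 (v \<ominus>\<^bsub>H1\<^esub> a)"
      and R: "R \<subseteq> carrier H1" "\<And>d a. d \<in> D0 \<Longrightarrow> a \<in> R \<Longrightarrow> f d a \<in> S"
      and x: "x \<in> X" and m: "m \<in> carrier H1" "\<And>e. e > 0 \<Longrightarrow> \<exists>a\<in>R. hnorm H1 (m \<ominus>\<^bsub>H1\<^esub> a) < e" and e: "e > 0"
    for K1 :: "'k inner_space" and H1 :: "'h inner_space" and S R f x m e
  proof -
    interpret K1: complex_hilbert_space K1 by fact
    interpret H1: complex_hilbert_space H1 by fact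
    have pos: "hnorm H1 m + 1 > 0" using H1.hnorm_nonneg[OF m(1)] by linarith
    have "e / 2 / (hnorm H1 m + 1) > 0" using e pos by simp
    then obtain d where d: "d \<in> D0" "opnorm H0 K0 (x \<ominus>\<^bsub>bop H0 K0\<^esub> d) < e / 2 / (hnorm H1 m + 1)" using D0(3)[OF x] by blast
    have dX: "d \<in> X" using d D0 by auto
    have xT: "x \<in> T" "d \<in> T" using x dX X_sub_T by auto
    have dn: "opnorm H0 K0 d \<ge> 0" using xT by simp
    have pos2: "opnorm H0 K0 d + 1 > 0" using dn by linarith
    have "e / 2 / (opnorm H0 K0 d + 1) > 0" using e pos2 by simp
    then obtain a where a: "a \<in> R" "hnorm H1 (m \<ominus>\<^bsub>H1\<^esub> a) < e / 2 / (opnorm H0 K0 d + 1)" using m(2) by blast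
    have aH: "a \<in> carrier H1" using a R by auto
    have "opnorm H0 K0 (x \<ominus>\<^bsub>bop H0 K0\<^esub> d) * hnorm H1 m \<le> opnorm H0 K0 (x \<ominus>\<^bsub>bop H0 K0\<^esub> d) * (hnorm H1 m + 1)"
      using xT by (intro mult_left_mono) auto
    also have "\<dots> < e / 2" using d(2) unfolding pos_less_divide_eq[OF pos] .
    finally have 1: "opnorm H0 K0 (x \<ominus>\<^bsub>bop H0 K0\<^esub> d) * hnorm H1 m < e / 2" .
    have "opnorm H0 K0 d * hnorm H1 (m \<ominus>\<^bsub>H1\<^esub> a) \<le> hnorm H1 (m \<ominus>\<^bsub>H1\<^esub> a) * (opnorm H0 K0 d + 1)"
      using m(1) aH by (simp add: distrib_left mult.commute)
    also have "\<dots> < e / 2" using a(2) unfolding pos_less_divide_eq[OF pos2] .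
    finally have 2: "opnorm H0 K0 d * hnorm H1 (m \<ominus>\<^bsub>H1\<^esub> a) < e / 2" .
    have "hnorm K1 (f x m \<ominus>\<^bsub>K1\<^esub> f d a) < e" using dist[OF x dX m(1) aH] 1 2 by linarith
    then show ?thesis using R(2)[OF d(1) a(1)] by blast
  qed
  have \<pi>M: "\<pi> x m \<in> N" if x: "x \<in> X" and m: "m \<in> M" for x m
  proof -
    have mH: "m \<in> carrier H" using m by (simp add: M_def)
    have "\<exists>b\<in>B. hnorm K (\<pi> x m \<ominus>\<^bsub>K\<^esub> b) < e" if e: "e > 0" for e
    proof (rule approx[OF C.K.complex_hilbert_space_axioms C.H.complex_hilbert_space_axioms BK _ _ AH \<pi>A x mH _ e])
      fix x d v a assume *: "x \<in> X" "d \<in> X" "v \<in> carrier H" "a \<in> carrier H"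
      then have xT: "x \<in> T" "d \<in> T" using X_sub_T by auto
      have "\<pi> x v \<ominus>\<^bsub>K\<^esub> \<pi> d a = \<pi> (x \<ominus>\<^bsub>bop H0 K0\<^esub> d) v \<oplus>\<^bsub>K\<^esub> \<pi> d (v \<ominus>\<^bsub>H\<^esub> a)"
        using xT * by (intro C.K.cinner_eqI) (auto simp: C.K.cinner_simps)
      then have "hnorm K (\<pi> x v \<ominus>\<^bsub>K\<^esub> \<pi> d a) \<le> hnorm K (\<pi> (x \<ominus>\<^bsub>bop H0 K0\<^esub> d) v) + hnorm K (\<pi> d (v \<ominus>\<^bsub>H\<^esub> a))"
        using xT * C.K.hnorm_triangle by simp
      also have "hnorm K (\<pi> (x \<ominus>\<^bsub>bop H0 K0\<^esub> d) v) \<le> opnorm H0 K0 (x \<ominus>\<^bsub>bop H0 K0\<^esub> d) * hnorm H v"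
        using xT * by (intro order_trans[OF C.hnorm_le_opnorm mult_right_mono[OF contractive]]) (auto simp del: \<pi>_diff)
      also have "hnorm K (\<pi> d (v \<ominus>\<^bsub>H\<^esub> a)) \<le> opnorm H0 K0 d * hnorm H (v \<ominus>\<^bsub>H\<^esub> a)"
        using xT * by (intro order_trans[OF C.hnorm_le_opnorm mult_right_mono[OF contractive]]) auto
      finally show "hnorm K (\<pi> x v \<ominus>\<^bsub>K\<^esub> \<pi> d a) \<le> opnorm H0 K0 (x \<ominus>\<^bsub>bop H0 K0\<^esub> d) * hnorm H v + opnorm H0 K0 d * hnorm H (v \<ominus>\<^bsub>H\<^esub> a)"
        by simp
    qed (use m X_sub_T in \<open>auto simp: M_def\<close>)
    then show ?thesis using X_sub_T[OF x] mH by (simp add: N_def)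
  qed
  have \<pi>N: "adj H K (\<pi> x) m \<in> M" if x: "x \<in> X" and m: "m \<in> N" for x m
  proof -
    have mH: "m \<in> carrier K" using m by (simp add: N_def)
    have "\<exists>b\<in>A. hnorm H (adj H K (\<pi> x) m \<ominus>\<^bsub>H\<^esub> b) < e" if e: "e > 0" for e
    proof (rule approx[OF C.H.complex_hilbert_space_axioms C.K.complex_hilbert_space_axioms AH _ _ BK \<pi>B x mH _ e])
      fix x d v a assume *: "x \<in> X" "d \<in> X" "v \<in> carrier K" "a \<in> carrier K"
      then have xT: "x \<in> T" "d \<in> T" using X_sub_T by auto
      have "adj H K (\<pi> x) v \<ominus>\<^bsub>H\<^esub> adj H K (\<pi> d) a = adj H K (\<pi> (x \<ominus>\<^bsub>bop H0 K0\<^esub> d)) v \<oplus>\<^bsub>H\<^esub> adj H K (\<pi> d) (v \<ominus>\<^bsub>K\<^esub> a)"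
        using xT * by (intro C.H.cinner_eqI) (auto simp: C.H.cinner_simps C.K.cinner_simps C.cinner_adj_left)
      then have "hnorm H (adj H K (\<pi> x) v \<ominus>\<^bsub>H\<^esub> adj H K (\<pi> d) a) \<le>
          hnorm H (adj H K (\<pi> (x \<ominus>\<^bsub>bop H0 K0\<^esub> d)) v) + hnorm H (adj H K (\<pi> d) (v \<ominus>\<^bsub>K\<^esub> a))"
        using xT * C.H.hnorm_triangle by simp
      also have "hnorm H (adj H K (\<pi> (x \<ominus>\<^bsub>bop H0 K0\<^esub> d)) v) \<le> opnorm H0 K0 (x \<ominus>\<^bsub>bop H0 K0\<^esub> d) * hnorm K v"
        using xT * by (intro order_trans[OF C.hnorm_adj_le mult_right_mono[OF contractive]]) (auto simp del: \<pi>_diff)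
      also have "hnorm H (adj H K (\<pi> d) (v \<ominus>\<^bsub>K\<^esub> a)) \<le> opnorm H0 K0 d * hnorm K (v \<ominus>\<^bsub>K\<^esub> a)"
        using xT * by (intro order_trans[OF C.hnorm_adj_le mult_right_mono[OF contractive]]) auto
      finally show "hnorm H (adj H K (\<pi> x) v \<ominus>\<^bsub>H\<^esub> adj H K (\<pi> d) a) \<le>
          opnorm H0 K0 (x \<ominus>\<^bsub>bop H0 K0\<^esub> d) * hnorm K v + opnorm H0 K0 d * hnorm K (v \<ominus>\<^bsub>K\<^esub> a)"
        by simp
    qed (use m X_sub_T in \<open>auto simp: N_def\<close>)
    then show ?thesis using X_sub_T[OF x] mH by (simp add: M_def)
  qed
  obtain p where p: "p \<in> projections H" "\<And>x. x \<in> carrier H \<Longrightarrow> p x \<in> M" "\<And>x. x \<in> M \<Longrightarrow> p x = x"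
    "\<And>x y. x \<in> carrier H \<Longrightarrow> y \<in> M \<Longrightarrow> cinner H (p x) y = cinner H x y"
    using C.H.closed_subspace_projection[OF M] by blast
  obtain q where q: "q \<in> projections K" "\<And>x. x \<in> carrier K \<Longrightarrow> q x \<in> N" "\<And>x. x \<in> N \<Longrightarrow> q x = x"
    "\<And>x y. x \<in> carrier K \<Longrightarrow> y \<in> N \<Longrightarrow> cinner K (q x) y = cinner K x y"
    using C.K.closed_subspace_projection[OF N] by blast
  have "(p = \<zero>\<^bsub>bop H H\<^esub> \<and> q = \<zero>\<^bsub>bop K K\<^esub>) \<or> (p = idop H \<and> q = idop K)"
  proof (rule irreducibleD[OF p(1) q(1)])
    fix x v assume x: "x \<in> X" and v: "v \<in> carrier H"
    have xT: "x \<in> T" by (rule X_sub_T[OF x])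
    have pv: "p v \<in> carrier H" by (rule C.H.projectionD(2)[OF p(1) v])
    show "q (\<pi> x v) = \<pi> x (p v)"
    proof (rule C.K.cinner_eqI)
      fix w assume w: "w \<in> carrier K"
      have qw: "q w \<in> carrier K" by (rule C.K.projectionD(2)[OF q(1) w])
      \<comment> \<open>Invariance of \<open>M\<close> under the adjoints lets \<open>p\<close> be
        inserted; invariance of \<open>N\<close> under \<open>\<pi> x\<close> lets \<open>q\<close>
        be dropped.\<close>
      have "cinner K (q (\<pi> x v)) w = cinner K (\<pi> x v) (q w)"
        using xT v w by (intro C.K.projectionD(4)[OF q(1)]) auto
      also have "\<dots> = cinner H v (adj H K (\<pi> x) (q w))" using xT v qw by (simp add: C.cinner_adj_right)
      also have "\<dots> = cinner H (p v) (adj H K (\<pi> x) (q w))"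
        using p(4)[OF v \<pi>N[OF x q(2)[OF w]]] by simp
      also have "\<dots> = cinner K (\<pi> x (p v)) (q w)" using xT pv qw by (simp add: C.cinner_adj_right)
      also have "\<dots> = cinner K (q (\<pi> x (p v))) w"
        using xT pv w by (intro C.K.projectionD(4)[OF q(1), symmetric]) auto
      also have "q (\<pi> x (p v)) = \<pi> x (p v)" by (rule q(3)[OF \<pi>M[OF x p(2)[OF v]]])
      finally show "Re (cinner K (q (\<pi> x v)) w) = Re (cinner K (\<pi> x (p v)) w)" by simp
    qed (use xT v pv in \<open>auto intro: C.K.projectionD(2)[OF q(1)]\<close>)
  qed
  moreover have "p \<noteq> \<zero>\<^bsub>bop H H\<^esub>"
  proof
    interpret PP: hilbert_pair H H by (rule C.H.hilbert_pair_self)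
    assume "p = \<zero>\<^bsub>bop H H\<^esub>"
    moreover have "h0 \<in> M" unfolding M_def using h0A h0(1) by (auto intro!: bexI[of _ h0] simp: C.H.minus_eq C.H.r_neg)
    ultimately show False using p(3)[of h0] h0 by simp
  qed
  ultimately have pq: "p = idop H" "q = idop K" by auto
  show "carrier H \<lesssim> (UNIV :: real set)"
  proof (rule C.H.separable_lepoll[OF cA AH])
    fix x e assume "x \<in> carrier H" "(e::real) > 0"
    then show "\<exists>a\<in>A. hnorm H (x \<ominus>\<^bsub>H\<^esub> a) < e" using p(2)[of x] by (simp add: pq M_def)
  qed
  show "carrier K \<lesssim> (UNIV :: real set)"
  proof (rule C.K.separable_lepoll[OF cB BK])
    fix x e assume "x \<in> carrier K" "(e::real) > 0"
    then show "\<exists>a\<in>B. hnorm K (x \<ominus>\<^bsub>K\<^esub> a) < e" using q(2)[of x] by (simp add: pq N_def)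
  qed
qed

end

section \<open>Hyperrigidity\<close>

text \<open>
  The direct sum of the orthogonal complement of \<open>N\<close> in \<open>H\<^sub>0\<close> with \<open>H\<close>, carried by the type
  \<open>'e\<close> along the injection \<open>g\<close>.
\<close>

locale orth_sum = A: complex_hilbert_space H0 + B: complex_hilbert_space H
  for H0 :: "'a inner_space" and H :: "'c inner_space" +
  fixes N :: "'a set" and g :: "'a \<times> 'c \<Rightarrow> 'e"
  assumes N: "N \<subseteq> carrier H0" and inj: "inj_on g (carrier H0 \<times> carrier H)"
begin

definition L :: "'a set" where "L = {x \<in> carrier H0. \<forall>y\<in>N. cinner H0 x y = 0}"

definition P1 :: "'e \<Rightarrow> 'a" where "P1 u = fst (inv_into (L \<times> carrier H) g u)"
definition P2 :: "'e \<Rightarrow> 'c" where "P2 u = snd (inv_into (L \<times> carrier H) g u)"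

definition S :: "'e inner_space"
  where "S = \<lparr>carrier = g ` (L \<times> carrier H), monoid.mult = undefined, one = undefined,
    zero = g (\<zero>\<^bsub>H0\<^esub>, \<zero>\<^bsub>H\<^esub>), add = (\<lambda>u v. g (P1 u \<oplus>\<^bsub>H0\<^esub> P1 v, P2 u \<oplus>\<^bsub>H\<^esub> P2 v)),
    module.smult = (\<lambda>c u. g (c \<odot>\<^bsub>H0\<^esub> P1 u, c \<odot>\<^bsub>H\<^esub> P2 u)),
    cinner = (\<lambda>u v. cinner H0 (P1 u) (P1 v) + cinner H (P2 u) (P2 v))\<rparr>"

lemma S_simps:
  "carrier S = g ` (L \<times> carrier H)" "\<zero>\<^bsub>S\<^esub> = g (\<zero>\<^bsub>H0\<^esub>, \<zero>\<^bsub>H\<^esub>)"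
  "u \<oplus>\<^bsub>S\<^esub> v = g (P1 u \<oplus>\<^bsub>H0\<^esub> P1 v, P2 u \<oplus>\<^bsub>H\<^esub> P2 v)" "c \<odot>\<^bsub>S\<^esub> u = g (c \<odot>\<^bsub>H0\<^esub> P1 u, c \<odot>\<^bsub>H\<^esub> P2 u)"
  "cinner S u v = cinner H0 (P1 u) (P1 v) + cinner H (P2 u) (P2 v)"
  by (simp_all add: S_def)

lemma L_closed_subspace: "A.closed_subspace L"
  unfolding L_def by (rule A.orthogonal_closed_subspace[OF N])

lemma L_carrier [simp]: "x \<in> L \<Longrightarrow> x \<in> carrier H0"
  by (simp add: L_def)

lemma L_zero [simp]: "\<zero>\<^bsub>H0\<^esub> \<in> L" and L_add [simp]: "x \<in> L \<Longrightarrow> y \<in> L \<Longrightarrow> x \<oplus>\<^bsub>H0\<^esub> y \<in> L"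
  and L_smult [simp]: "x \<in> L \<Longrightarrow> c \<odot>\<^bsub>H0\<^esub> x \<in> L"
  using L_closed_subspace unfolding A.closed_subspace_def by blast+

lemma inj_L: "inj_on g (L \<times> carrier H)"
  by (rule inj_on_subset[OF inj]) auto

lemma P1_g [simp]: "x \<in> L \<Longrightarrow> y \<in> carrier H \<Longrightarrow> P1 (g (x, y)) = x"
  and P2_g [simp]: "x \<in> L \<Longrightarrow> y \<in> carrier H \<Longrightarrow> P2 (g (x, y)) = y"
  by (simp_all add: P1_def P2_def inv_into_f_f[OF inj_L])

lemma g_closed [simp]: "x \<in> L \<Longrightarrow> y \<in> carrier H \<Longrightarrow> g (x, y) \<in> carrier S"
  by (simp add: S_simps)

lemma P_closed [simp]: "u \<in> carrier S \<Longrightarrow> P1 u \<in> L" "u \<in> carrier S \<Longrightarrow> P2 u \<in> carrier H"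
  by (auto simp: S_simps)

lemma g_P [simp]: "u \<in> carrier S \<Longrightarrow> g (P1 u, P2 u) = u"
  by (auto simp: S_simps)

lemma S_eqI: "u \<in> carrier S \<Longrightarrow> v \<in> carrier S \<Longrightarrow> P1 u = P1 v \<Longrightarrow> P2 u = P2 v \<Longrightarrow> u = v"
  by (metis g_P)

lemma S_closed:
  "\<zero>\<^bsub>S\<^esub> \<in> carrier S" "u \<in> carrier S \<Longrightarrow> v \<in> carrier S \<Longrightarrow> u \<oplus>\<^bsub>S\<^esub> v \<in> carrier S"
  "u \<in> carrier S \<Longrightarrow> c \<odot>\<^bsub>S\<^esub> u \<in> carrier S"
  by (simp_all add: S_simps(2-4))

lemma P_zero [simp]: "P1 \<zero>\<^bsub>S\<^esub> = \<zero>\<^bsub>H0\<^esub>" "P2 \<zero>\<^bsub>S\<^esub> = \<zero>\<^bsub>H\<^esub>"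
  and P_add [simp]: "u \<in> carrier S \<Longrightarrow> v \<in> carrier S \<Longrightarrow> P1 (u \<oplus>\<^bsub>S\<^esub> v) = P1 u \<oplus>\<^bsub>H0\<^esub> P1 v"
    "u \<in> carrier S \<Longrightarrow> v \<in> carrier S \<Longrightarrow> P2 (u \<oplus>\<^bsub>S\<^esub> v) = P2 u \<oplus>\<^bsub>H\<^esub> P2 v"
  and P_smult [simp]: "u \<in> carrier S \<Longrightarrow> P1 (c \<odot>\<^bsub>S\<^esub> u) = c \<odot>\<^bsub>H0\<^esub> P1 u"
    "u \<in> carrier S \<Longrightarrow> P2 (c \<odot>\<^bsub>S\<^esub> u) = c \<odot>\<^bsub>H\<^esub> P2 u"
  by (simp_all add: S_simps(2-4))

lemma module_S: "Module.module complex_field S"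
proof (intro moduleI abelian_groupI cring_complex_field)
  fix u assume u: "u \<in> carrier S"
  note m = S_closed(3)[OF u, of "-1"]
  show "\<exists>v\<in>carrier S. v \<oplus>\<^bsub>S\<^esub> u = \<zero>\<^bsub>S\<^esub>"
  proof (intro bexI[OF S_eqI m] S_closed m u)
    show "P1 ((-1) \<odot>\<^bsub>S\<^esub> u \<oplus>\<^bsub>S\<^esub> u) = P1 \<zero>\<^bsub>S\<^esub>" "P2 ((-1) \<odot>\<^bsub>S\<^esub> u \<oplus>\<^bsub>S\<^esub> u) = P2 \<zero>\<^bsub>S\<^esub>"
      using u m by (simp_all add: A.csmult_minus_one B.csmult_minus_one A.l_neg B.l_neg)
  qed
next
  fix u v w assume "u \<in> carrier S" "v \<in> carrier S" "w \<in> carrier S"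
  then show "u \<oplus>\<^bsub>S\<^esub> v \<oplus>\<^bsub>S\<^esub> w = u \<oplus>\<^bsub>S\<^esub> (v \<oplus>\<^bsub>S\<^esub> w)"
    by (intro S_eqI S_closed) (simp_all add: S_closed A.a_assoc B.a_assoc)
qed (intro S_eqI S_closed;
    (assumption | simp add: S_closed A.a_ac A.smult_r_distr A.csmult_add_left A.csmult_assoc
      B.a_ac B.smult_r_distr B.csmult_add_left B.csmult_assoc))+

lemma hnorm_S_square: "u \<in> carrier S \<Longrightarrow> (hnorm S u)\<^sup>2 = (hnorm H0 (P1 u))\<^sup>2 + (hnorm H (P2 u))\<^sup>2"
  by (simp add: hnorm_def S_simps(5))

lemma hnorm_S: "u \<in> carrier S \<Longrightarrow> hnorm S u = sqrt ((hnorm H0 (P1 u))\<^sup>2 + (hnorm H (P2 u))\<^sup>2)"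
  by (simp add: hnorm_def S_simps(5))

lemma hnorm_P_le:
  "u \<in> carrier S \<Longrightarrow> hnorm H0 (P1 u) \<le> hnorm S u" "u \<in> carrier S \<Longrightarrow> hnorm H (P2 u) \<le> hnorm S u"
  by (simp_all add: hnorm_S)

lemma complex_hilbert_space_S: "complex_hilbert_space S"
proof -
  interpret S: complex_module S
    unfolding complex_module_def by (rule module_S)
  have diff: "P1 (u \<ominus>\<^bsub>S\<^esub> v) = P1 u \<ominus>\<^bsub>H0\<^esub> P1 v" "P2 (u \<ominus>\<^bsub>S\<^esub> v) = P2 u \<ominus>\<^bsub>H\<^esub> P2 v"
    if "u \<in> carrier S" "v \<in> carrier S" for u v
    using that by (simp_all add: S.diff_conv_smult A.diff_conv_smult B.diff_conv_smult)
  show ?thesis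
  proof
    fix x y z and c :: complex
    assume v: "x \<in> carrier S" "y \<in> carrier S"
    then show "cinner S (c \<odot>\<^bsub>S\<^esub> x) y = c * cinner S x y"
      by (simp add: S_simps(5) A.cinner_simps B.cinner_simps distrib_left)
    show "cinner S x y = cnj (cinner S y x)"
      using v A.cinner_commute[of "P1 x" "P1 y"] B.cinner_commute[of "P2 x" "P2 y"] by (simp add: S_simps(5))
    assume "z \<in> carrier S"
    with v show "cinner S (x \<oplus>\<^bsub>S\<^esub> y) z = cinner S x z + cinner S y z"
      by (simp add: S_simps(5) A.cinner_simps B.cinner_simps)
  next
    fix x assume x: "x \<in> carrier S" "x \<noteq> \<zero>\<^bsub>S\<^esub>"
    then have "P1 x \<noteq> \<zero>\<^bsub>H0\<^esub> \<or> P2 x \<noteq> \<zero>\<^bsub>H\<^esub>" using S_eqI[of x "\<zero>\<^bsub>S\<^esub>"] S_closed by auto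
    then show "0 < Re (cinner S x x)"
      using x A.cinner_pos[of "P1 x"] B.cinner_pos[of "P2 x"] A.cinner_same_nonneg[of "P1 x"] B.cinner_same_nonneg[of "P2 x"]
      by (fastforce simp: S_simps(5))
  next
    fix s :: "nat \<Rightarrow> 'e"
    assume s: "\<And>m. s m \<in> carrier S" "\<forall>e>0. \<exists>N. \<forall>m\<ge>N. \<forall>k\<ge>N. hnorm S (s m \<ominus>\<^bsub>S\<^esub> s k) < e"
    have le: "hnorm H0 (P1 (s m) \<ominus>\<^bsub>H0\<^esub> P1 (s k)) \<le> hnorm S (s m \<ominus>\<^bsub>S\<^esub> s k)"
      "hnorm H (P2 (s m) \<ominus>\<^bsub>H\<^esub> P2 (s k)) \<le> hnorm S (s m \<ominus>\<^bsub>S\<^esub> s k)" for m k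
      using hnorm_P_le[of "s m \<ominus>\<^bsub>S\<^esub> s k"] s(1) by (simp_all add: diff)
    obtain x where x: "x \<in> carrier H0" "(\<lambda>m. hnorm H0 (P1 (s m) \<ominus>\<^bsub>H0\<^esub> x)) \<longlonglongrightarrow> 0"
      using A.complete[of "\<lambda>m. P1 (s m)"] s le(1) by (meson L_carrier P_closed(1) order_le_less_trans)
    obtain y where y: "y \<in> carrier H" "(\<lambda>m. hnorm H (P2 (s m) \<ominus>\<^bsub>H\<^esub> y)) \<longlonglongrightarrow> 0"
      using B.complete[of "\<lambda>m. P2 (s m)"] s le(2) by (meson P_closed(2) order_le_less_trans)
    have xL: "x \<in> L"
      using L_closed_subspace s(1) x unfolding A.closed_subspace_def by (meson P_closed(1))
    have "(\<lambda>m. sqrt ((hnorm H0 (P1 (s m) \<ominus>\<^bsub>H0\<^esub> x))\<^sup>2 + (hnorm H (P2 (s m) \<ominus>\<^bsub>H\<^esub> y))\<^sup>2)) \<longlonglongrightarrow> sqrt (0\<^sup>2 + 0\<^sup>2)"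
      using x(2) y(2) by (intro tendsto_intros)
    then have "(\<lambda>m. hnorm S (s m \<ominus>\<^bsub>S\<^esub> g (x, y))) \<longlonglongrightarrow> 0"
      using s(1) xL y(1) by (simp add: hnorm_S diff)
    then show "\<exists>x\<in>carrier S. (\<lambda>m. hnorm S (s m \<ominus>\<^bsub>S\<^esub> x)) \<longlonglongrightarrow> 0"
      using xL y(1) g_closed by blast
  next
    \<comment> \<open>A vector of the second summand is used because \<open>L\<close> may be
      zero.\<close>
    obtain y where y: "y \<in> carrier H" "y \<noteq> \<zero>\<^bsub>H\<^esub>" using B.nonzero by blast
    then have "g (\<zero>\<^bsub>H0\<^esub>, y) \<noteq> \<zero>\<^bsub>S\<^esub>" using P2_g[of "\<zero>\<^bsub>H0\<^esub>" y] P_zero(2) by force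
    then show "\<exists>x\<in>carrier S. x \<noteq> \<zero>\<^bsub>S\<^esub>" using y by (intro bexI[of _ "g (\<zero>\<^bsub>H0\<^esub>, y)"]) auto
  qed
qed

end

section \<open>Block diagonal operators between direct sums\<close>

locale orth_sum_pair = SH: orth_sum H0 H NH gH + SK: orth_sum K0 K NK gK
  for H0 :: "'a inner_space" and H :: "'c inner_space" and NH and gH :: "'a \<times> 'c \<Rightarrow> 'e"
    and K0 :: "'b inner_space" and K :: "'d inner_space" and NK and gK :: "'b \<times> 'd \<Rightarrow> 'f"
begin

sublocale S: hilbert_pair SH.S SK.S
  by (intro hilbert_pairI SH.complex_hilbert_space_S SK.complex_hilbert_space_S)

sublocale D0: hilbert_pair H0 K0
  by (intro hilbert_pairI SH.A.complex_hilbert_space_axioms SK.A.complex_hilbert_space_axioms)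

sublocale C0: hilbert_pair H K
  by (intro hilbert_pairI SH.B.complex_hilbert_space_axioms SK.B.complex_hilbert_space_axioms)

definition block :: "('a \<Rightarrow> 'b) \<Rightarrow> ('c \<Rightarrow> 'd) \<Rightarrow> 'e \<Rightarrow> 'f"
  where "block a b = (\<lambda>u\<in>carrier SH.S. gK (a (SH.P1 u), b (SH.P2 u)))"

lemma block_apply [simp]: "u \<in> carrier SH.S \<Longrightarrow> block a b u = gK (a (SH.P1 u), b (SH.P2 u))"
  by (simp add: block_def)

lemma block_closed [simp]:
  assumes a: "a \<in> carrier (bop H0 K0)" and b: "b \<in> carrier (bop H K)" and aL: "\<And>x. x \<in> SH.L \<Longrightarrow> a x \<in> SK.L"
  shows "block a b \<in> carrier (bop SH.S SK.S)"
proof (rule S.bopI[where C = "opnorm H0 K0 a + opnorm H K b"])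
  fix u assume u: "u \<in> carrier SH.S"
  have "hnorm SK.S (block a b u) \<le> hnorm K0 (a (SH.P1 u)) + hnorm K (b (SH.P2 u))"
    using u a b aL by (simp add: SK.hnorm_S sqrt_sum_squares_le_sum)
  also have "hnorm K0 (a (SH.P1 u)) \<le> opnorm H0 K0 a * hnorm H0 (SH.P1 u)"
    using u a by (intro D0.hnorm_le_opnorm) auto
  also have "hnorm K (b (SH.P2 u)) \<le> opnorm H K b * hnorm H (SH.P2 u)"
    using u b by (intro C0.hnorm_le_opnorm) auto
  also have "opnorm H0 K0 a * hnorm H0 (SH.P1 u) + opnorm H K b * hnorm H (SH.P2 u) \<le>
      opnorm H0 K0 a * hnorm SH.S u + opnorm H K b * hnorm SH.S u"
    using u a b by (intro add_mono mult_left_mono SH.hnorm_P_le) auto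
  finally show "hnorm SK.S (block a b u) \<le> (opnorm H0 K0 a + opnorm H K b) * hnorm SH.S u"
    by (simp add: distrib_right)
  fix c
  show "block a b (c \<odot>\<^bsub>SH.S\<^esub> u) = c \<odot>\<^bsub>SK.S\<^esub> block a b u"
    using u a b aL SH.S_closed(3)[OF u] by (intro SK.S_eqI SK.S_closed) auto
  fix v assume v: "v \<in> carrier SH.S"
  show "block a b (u \<oplus>\<^bsub>SH.S\<^esub> v) = block a b u \<oplus>\<^bsub>SK.S\<^esub> block a b v"
    using u v a b aL SH.S_closed(2)[OF u v] by (intro SK.S_eqI SK.S_closed) auto
qed (use a b aL in \<open>auto simp: block_def\<close>)

lemma cinner_block:
  assumes "a \<in> carrier (bop H0 K0)" "b \<in> carrier (bop H K)" "\<And>x. x \<in> SH.L \<Longrightarrow> a x \<in> SK.L"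
    "u \<in> carrier SH.S" "w \<in> carrier SK.S"
  shows "cinner SK.S (block a b u) w = cinner K0 (a (SH.P1 u)) (SK.P1 w) + cinner K (b (SH.P2 u)) (SK.P2 w)"
  using assms by (simp add: SK.S_simps(5))

end

lemma (in complex_hilbert_space) hnorm_projection_complement_le:
  assumes p: "p \<in> projections H" and x: "x \<in> carrier H"
  shows "hnorm H (x \<ominus> p x) \<le> hnorm H x"
proof (rule power2_le_imp_le)
  have px: "p x \<in> carrier H" by (rule projectionD(2)[OF p x])
  have "cinner H (p x) (p x) = cinner H (p x) x" "cinner H x (p x) = cinner H (p x) x"
    using projectionD(3,4)[OF p] x px by metis+
  then have "(hnorm H (x \<ominus> p x))\<^sup>2 = (hnorm H x)\<^sup>2 - (hnorm H (p x))\<^sup>2"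
    using x px by (simp add: hnorm_square cinner_simps)
  then show "(hnorm H (x \<ominus> p x))\<^sup>2 \<le> (hnorm H x)\<^sup>2" by simp
qed (use x in simp)

text \<open>Matrices of size 1 give the estimate on the unit ball, and scaling gives the rest; an
  element of norm 0 is zero and is mapped to zero by linearity.\<close>

lemma cb_norm_opnorm:
  assumes "hilbert_pair H K" "hilbert_pair H' K'" and X: "operator_space H K X"
    and f: "clinear_on X (bop H K) (bop H' K') f" and r: "0 \<le> r" "cb_norm H K X H' K' f \<le> ereal r" and x: "x \<in> X"
  shows "opnorm H' K' (f x) \<le> r * opnorm H K x"
proof -
  interpret D: hilbert_pair H K by fact
  interpret C: hilbert_pair H' K' by fact
  note [simp] = D.operator_spaceD[OF X]
  have f_closed: "f x \<in> carrier (bop H' K')" if "x \<in> X" for x using f that by (auto simp: clinear_on_def)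
  have f_smult: "f (c \<odot>\<^bsub>bop H K\<^esub> x) = c \<odot>\<^bsub>bop H' K'\<^esub> f x" if "x \<in> X" for c x using f that by (auto simp: clinear_on_def)
  have bound: "opnorm H' K' (f y) \<le> r" if y: "y \<in> X" "opnorm H K y \<le> 1" for y
  proof -
    have "X \<subseteq> carrier (bop H K)" "f \<in> X \<rightarrow> carrier (bop H' K')" using f_closed by auto
    then have "\<And>n A. (\<forall>i<n. \<forall>j<n. A i j \<in> X) \<Longrightarrow> mbound H K 1 n A \<Longrightarrow> mbound H' K' r n (\<lambda>i j. f (A i j))"
      using r cb_norm_le_iff[OF assms(1,2)] by blast
    from this[of 1 "\<lambda>_ _. y"] have "mbound H' K' r 1 (\<lambda>_ _. f y)"
      using y D.mbound_1_iff[of "\<lambda>_ _. y" 1] by simp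
    then show ?thesis using C.mbound_1_iff[of "\<lambda>_ _. f y" r] f_closed[OF y(1)] r by simp
  qed
  define c where "c = opnorm H K x"
  have c: "c \<ge> 0" using x by (simp add: c_def)
  show ?thesis
  proof (cases "c = 0")
    case True
    then have "x = \<zero>\<^bsub>bop H K\<^esub>" using x by (intro D.opnorm_eq_0) (auto simp: c_def)
    then have "f x = \<zero>\<^bsub>bop H' K'\<^esub>"
      using f_smult[OF x, of 0] f_closed[OF x] x by simp
    then show ?thesis using True by (simp add: c_def)
  next
    case False
    then have pos: "c > 0" using c by simp
    have "opnorm H' K' (f (complex_of_real (1 / c) \<odot>\<^bsub>bop H K\<^esub> x)) \<le> r"
      by (rule bound) (use x pos in \<open>auto simp: D.opnorm_smult norm_divide c_def\<close>)
    then have "opnorm H' K' (f x) / c \<le> r"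
      using x pos f_closed[OF x] by (simp add: f_smult C.opnorm_smult norm_divide)
    then show ?thesis using pos by (simp add: pos_divide_le_eq c_def)
  qed
qed

lemma cb_norm_nonneg: "0 \<le> cb_norm H K X H' K' f"
  unfolding cb_norm_def by (rule SUP_upper2[of "(0, \<lambda>_ _. undefined)"]) auto

text \<open>A norm bounded by 1 is finite, so the lower estimate can be tested at its real
  value.\<close>

lemma cb_norm_eq_1:
  assumes "cb_norm H K X H' K' f \<le> 1" "\<And>r. 0 \<le> r \<Longrightarrow> cb_norm H K X H' K' f \<le> ereal r \<Longrightarrow> 1 \<le> r"
  shows "cb_norm H K X H' K' f = 1"
proof -
  obtain r where r: "cb_norm H K X H' K' f = ereal r"
    using assms(1) cb_norm_nonneg[of H K X H' K' f] by (cases "cb_norm H K X H' K' f") auto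
  then show ?thesis using assms cb_norm_nonneg[of H K X H' K' f] by (auto simp: one_ereal_def intro: antisym)
qed

lemma nondegenerateI:
  assumes H': "complex_hilbert_space H'" "complex_hilbert_space K'" and f: "\<And>x. x \<in> X \<Longrightarrow> f x \<in> carrier (bop H' K')"
    and p: "\<And>p. p \<in> projections H' \<Longrightarrow> (\<And>x v. x \<in> X \<Longrightarrow> v \<in> carrier H' \<Longrightarrow> f x (p v) = \<zero>\<^bsub>K'\<^esub>) \<Longrightarrow> p = \<zero>\<^bsub>bop H' H'\<^esub>"
    and q: "\<And>q. q \<in> projections K' \<Longrightarrow> (\<And>x v. x \<in> X \<Longrightarrow> v \<in> carrier H' \<Longrightarrow> q (f x v) = \<zero>\<^bsub>K'\<^esub>) \<Longrightarrow> q = \<zero>\<^bsub>bop K' K'\<^esub>"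
  shows "nondegenerate X H' K' f"
  unfolding nondegenerate_def
proof (intro ballI impI)
  interpret C: hilbert_pair H' K' by (rule hilbert_pairI[OF H'])
  fix p0 q0 assume pq: "p0 \<in> projections H'" "q0 \<in> projections K'"
    and *: "\<forall>x\<in>X. compose (carrier H') q0 (f x) = \<zero>\<^bsub>bop H' K'\<^esub> \<and> compose (carrier H') (f x) p0 = \<zero>\<^bsub>bop H' K'\<^esub>"
  have 1: "q0 (f x v) = \<zero>\<^bsub>K'\<^esub>" "f x (p0 v) = \<zero>\<^bsub>K'\<^esub>" if "x \<in> X" "v \<in> carrier H'" for x v
    using *[rule_format, OF that(1)] C.zero_apply[OF that(2)] that by (metis compose_eq)+
  show "p0 = \<zero>\<^bsub>bop H' H'\<^esub> \<and> q0 = \<zero>\<^bsub>bop K' K'\<^esub>" using p[OF pq(1)] q[OF pq(2)] 1 by blast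
qed

section \<open>The nondegenerate part of \<open>T\<close> and the representation
  \<open>\<sigma>\<close>\<close>

context irreducible_tro_morphism
begin

text \<open>The joint kernel of \<open>T\<close>, see \<open>kerH_iff\<close>. It is written as the
  orthogonal complement of the ranges of the adjoints so that closedness is immediate;
  \<open>kerK\<close> below is the complement of the ranges of \<open>T\<close>.\<close>

definition kerH :: "'a set"
  where "kerH = {x \<in> carrier H0. \<forall>z\<in>{adj H0 K0 t y | t y. t \<in> T \<and> y \<in> carrier K0}. cinner H0 x z = 0}"

definition kerK :: "'b set"
  where "kerK = {x \<in> carrier K0. \<forall>z\<in>{t y | t y. t \<in> T \<and> y \<in> carrier H0}. cinner K0 x z = 0}"

lemma kerH_closed: "D.H.closed_subspace kerH"
  unfolding kerH_def by (rule D.H.orthogonal_closed_subspace) auto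

lemma kerK_closed: "D.K.closed_subspace kerK"
  unfolding kerK_def by (rule D.K.orthogonal_closed_subspace) auto

lemma kerH_iff: "x \<in> kerH \<longleftrightarrow> x \<in> carrier H0 \<and> (\<forall>t\<in>T. t x = \<zero>\<^bsub>K0\<^esub>)"
proof (intro iffI conjI ballI)
  fix t assume x: "x \<in> kerH" and t: "t \<in> T"
  then have xH: "x \<in> carrier H0" by (simp add: kerH_def)
  show "t x = \<zero>\<^bsub>K0\<^esub>"
  proof (rule D.K.cinner_eqI)
    fix y assume y: "y \<in> carrier K0"
    have "cinner H0 x (adj H0 K0 t y) = 0" using x t y unfolding kerH_def by blast
    then show "Re (cinner K0 (t x) y) = Re (cinner K0 \<zero>\<^bsub>K0\<^esub> y)" using t xH y by (simp add: D.cinner_adj_right)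
  qed (use t xH in auto)
qed (auto simp: kerH_def D.cinner_adj_right)

lemma kerK_iff: "x \<in> kerK \<longleftrightarrow> x \<in> carrier K0 \<and> (\<forall>t\<in>T. \<forall>y\<in>carrier H0. cinner K0 (t y) x = 0)"
proof (intro iffI conjI ballI)
  fix t y assume x: "x \<in> kerK" and ty: "t \<in> T" "y \<in> carrier H0"
  have "cinner K0 x (t y) = 0" using x ty unfolding kerK_def by blast
  moreover have "x \<in> carrier K0" using x by (simp add: kerK_def)
  ultimately show "cinner K0 (t y) x = 0" using D.K.cinner_commute[of "t y" x] ty by simp
next
  assume x: "x \<in> carrier K0 \<and> (\<forall>t\<in>T. \<forall>y\<in>carrier H0. cinner K0 (t y) x = 0)"
  have "cinner K0 x (t y) = 0" if "t \<in> T" "y \<in> carrier H0" for t y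
    using D.K.cinner_commute[of x "t y"] that x by simp
  then show "x \<in> kerK" using x unfolding kerK_def by blast
qed (simp add: kerK_def)

end

text \<open>The carrier types \<open>'e\<close> and \<open>'f\<close> of the direct sums stay free;
  when hyperrigidity is invoked, they become the types of \<open>H0\<close> and \<open>K0\<close>.
  The ranges of \<open>pH\<close> and \<open>pK\<close> are what has to be cut off for
  \<open>\<sigma>\<close> to be nondegenerate.\<close>

locale doubled_tro = irreducible_tro_morphism H0 K0 H K T \<pi> X
  for H0 :: "'a inner_space" and K0 :: "'b inner_space" and H :: "'c inner_space" and K :: "'d inner_space"
    and T :: "('a \<Rightarrow> 'b) set" and \<pi> :: "('a \<Rightarrow> 'b) \<Rightarrow> ('c \<Rightarrow> 'd)" and X :: "('a \<Rightarrow> 'b) set" +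
  fixes gH :: "'a \<times> 'c \<Rightarrow> 'e" and gK :: "'b \<times> 'd \<Rightarrow> 'f" and pH :: "'a \<Rightarrow> 'a" and pK :: "'b \<Rightarrow> 'b"
  assumes gH: "inj_on gH (carrier H0 \<times> carrier H)" and gK: "inj_on gK (carrier K0 \<times> carrier K)"
    and pH: "pH \<in> projections H0" and pH_ker: "\<And>x. x \<in> carrier H0 \<Longrightarrow> pH x \<in> kerH"
    and pH_cinner: "\<And>x y. x \<in> carrier H0 \<Longrightarrow> y \<in> kerH \<Longrightarrow> cinner H0 (pH x) y = cinner H0 x y"
    and pK: "pK \<in> projections K0" and pK_ker: "\<And>x. x \<in> carrier K0 \<Longrightarrow> pK x \<in> kerK"
    and pK_cinner: "\<And>x y. x \<in> carrier K0 \<Longrightarrow> y \<in> kerK \<Longrightarrow> cinner K0 (pK x) y = cinner K0 x y"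
begin

sublocale Q: orth_sum_pair H0 H kerH gH K0 K kerK gK
  by unfold_locales (use gH gK in \<open>auto simp: kerH_def kerK_def\<close>)

text \<open>The projection onto the complement \<open>L\<close> of the joint kernel; by
  \<open>T_cH\<close> the elements of \<open>T\<close> do not notice it.\<close>

definition cH :: "'a \<Rightarrow> 'a" where "cH x = x \<ominus>\<^bsub>H0\<^esub> pH x"
definition cK :: "'b \<Rightarrow> 'b" where "cK x = x \<ominus>\<^bsub>K0\<^esub> pK x"

lemma pH_closed [simp]: "x \<in> carrier H0 \<Longrightarrow> pH x \<in> carrier H0"
  by (rule D.H.projectionD(2)[OF pH])
lemma pK_closed [simp]: "x \<in> carrier K0 \<Longrightarrow> pK x \<in> carrier K0"
  by (rule D.K.projectionD(2)[OF pK])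

lemma cH_L [simp]:
  assumes x: "x \<in> carrier H0" shows "cH x \<in> Q.SH.L"
proof -
  have "cinner H0 (cH x) y = 0" if y: "y \<in> kerH" for y
  proof -
    have "y \<in> carrier H0" using y kerH_iff by blast
    then show ?thesis using x pH_cinner[OF x y] by (simp add: cH_def D.H.cinner_simps)
  qed
  moreover have "cH x \<in> carrier H0" using x by (simp add: cH_def)
  ultimately show ?thesis unfolding Q.SH.L_def by blast
qed

lemma cK_L [simp]:
  assumes x: "x \<in> carrier K0" shows "cK x \<in> Q.SK.L"
proof -
  have "cinner K0 (cK x) y = 0" if y: "y \<in> kerK" for y
  proof -
    have "y \<in> carrier K0" using y kerK_iff by blast
    then show ?thesis using x pK_cinner[OF x y] by (simp add: cK_def D.K.cinner_simps)
  qed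
  moreover have "cK x \<in> carrier K0" using x by (simp add: cK_def)
  ultimately show ?thesis unfolding Q.SK.L_def by blast
qed

lemma cH_add: "x \<in> carrier H0 \<Longrightarrow> y \<in> carrier H0 \<Longrightarrow> cH (x \<oplus>\<^bsub>H0\<^esub> y) = cH x \<oplus>\<^bsub>H0\<^esub> cH y"
  and cH_smult: "x \<in> carrier H0 \<Longrightarrow> cH (c \<odot>\<^bsub>H0\<^esub> x) = c \<odot>\<^bsub>H0\<^esub> cH x"
proof -
  interpret PP: hilbert_pair H0 H0 by (rule D.H.hilbert_pair_self)
  note pB = D.H.projectionD(1)[OF pH]
  show "x \<in> carrier H0 \<Longrightarrow> y \<in> carrier H0 \<Longrightarrow> cH (x \<oplus>\<^bsub>H0\<^esub> y) = cH x \<oplus>\<^bsub>H0\<^esub> cH y"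
    unfolding cH_def using PP.bop_add[OF pB, of x y]
    by (intro D.H.cinner_eqI) (simp_all add: D.H.cinner_simps)
  show "x \<in> carrier H0 \<Longrightarrow> cH (c \<odot>\<^bsub>H0\<^esub> x) = c \<odot>\<^bsub>H0\<^esub> cH x"
    unfolding cH_def using PP.bop_smult[OF pB, of x c]
    by (intro D.H.cinner_eqI) (simp_all add: D.H.cinner_simps algebra_simps)
qed

lemma T_cH [simp]:
  assumes t: "t \<in> T" and x: "x \<in> carrier H0" shows "t (cH x) = t x"
proof (rule D.K.cinner_eqI)
  have "t (pH x) = \<zero>\<^bsub>K0\<^esub>" using pH_ker[OF x] t kerH_iff by blast
  then show "Re (cinner K0 (t (cH x)) y) = Re (cinner K0 (t x) y)" if "y \<in> carrier K0" for y
    using that t x by (simp add: cH_def D.K.cinner_simps)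
qed (use t x in auto)

lemma cinner_cK:
  assumes x: "x \<in> Q.SK.L" and w: "w \<in> carrier K0" shows "cinner K0 x (cK w) = cinner K0 x w"
proof -
  have "cinner K0 x (pK w) = 0" using x pK_ker[OF w] unfolding Q.SK.L_def by blast
  then show ?thesis using x w by (simp add: cK_def D.K.cinner_simps)
qed

lemma T_L [simp]:
  assumes "t \<in> T" "x \<in> carrier H0" shows "t x \<in> Q.SK.L"
proof -
  have "cinner K0 (t x) y = 0" if "y \<in> kerK" for y using that assms kerK_iff by blast
  moreover have "t x \<in> carrier K0" using assms by simp
  ultimately show ?thesis unfolding Q.SK.L_def by blast
qed

lemma adj_T_L [simp]:
  assumes t: "t \<in> T" and y: "y \<in> carrier K0" shows "adj H0 K0 t y \<in> Q.SH.L"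
proof -
  have "cinner H0 (adj H0 K0 t y) x = 0" if x: "x \<in> kerH" for x
  proof -
    have "x \<in> carrier H0" "t x = \<zero>\<^bsub>K0\<^esub>" using x t kerH_iff by blast+
    then show ?thesis using t y by (simp add: D.cinner_adj_left)
  qed
  moreover have "adj H0 K0 t y \<in> carrier H0" using t y by simp
  ultimately show ?thesis unfolding Q.SH.L_def by blast
qed

definition \<sigma> :: "('a \<Rightarrow> 'b) \<Rightarrow> 'e \<Rightarrow> 'f" where "\<sigma> t = Q.block t (\<pi> t)"

lemma \<sigma>_closed [simp]: "t \<in> T \<Longrightarrow> \<sigma> t \<in> carrier (bop Q.SH.S Q.SK.S)"
  by (simp add: \<sigma>_def)

lemma \<sigma>_apply [simp]: "u \<in> carrier Q.SH.S \<Longrightarrow> \<sigma> t u = gK (t (Q.SH.P1 u), \<pi> t (Q.SH.P2 u))"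
  by (simp add: \<sigma>_def)

lemma adj_\<sigma>:
  assumes t: "t \<in> T" and w: "w \<in> carrier Q.SK.S"
  shows "adj Q.SH.S Q.SK.S (\<sigma> t) w = gH (adj H0 K0 t (Q.SK.P1 w), adj H K (\<pi> t) (Q.SK.P2 w))"
proof -
  \<comment> \<open>The same construction with domain and codomain exchanged, in which the candidate
    for the adjoint is again a block operator.\<close>
  interpret Fl: orth_sum_pair K0 K kerK gK H0 H kerH gH by unfold_locales
  have b: "Fl.block (adj H0 K0 t) (adj H K (\<pi> t)) \<in> carrier (bop Q.SK.S Q.SH.S)"
    using t by (intro Fl.block_closed) auto
  have "adj Q.SH.S Q.SK.S (\<sigma> t) = Fl.block (adj H0 K0 t) (adj H K (\<pi> t))"
  proof (rule Q.S.adj_eqI[OF \<sigma>_closed[OF t] b])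
    fix u w assume uw: "u \<in> carrier Q.SH.S" "w \<in> carrier Q.SK.S"
    show "cinner Q.SK.S (\<sigma> t u) w = cinner Q.SH.S u (Fl.block (adj H0 K0 t) (adj H K (\<pi> t)) w)"
      using uw t by (simp add: Q.SH.S_simps(5) Q.SK.S_simps(5) D.cinner_adj_right C.cinner_adj_right)
  qed
  then show ?thesis using w by simp
qed

lemma \<sigma>_representation: "representation H0 K0 T Q.SH.S Q.SK.S \<sigma>"
  unfolding representation_def triple_morphism_def clinear_on_def
proof (intro conjI ballI allI)
  show "\<sigma> \<in> T \<rightarrow> carrier (bop Q.SH.S Q.SK.S)" by simp
  fix x y assume x: "x \<in> T" and y: "y \<in> T"
  show "\<sigma> (x \<oplus>\<^bsub>bop H0 K0\<^esub> y) = \<sigma> x \<oplus>\<^bsub>bop Q.SH.S Q.SK.S\<^esub> \<sigma> y"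
  proof (rule Q.S.bop_ext)
    fix u assume u: "u \<in> carrier Q.SH.S"
    show "\<sigma> (x \<oplus>\<^bsub>bop H0 K0\<^esub> y) u = (\<sigma> x \<oplus>\<^bsub>bop Q.SH.S Q.SK.S\<^esub> \<sigma> y) u"
      using x y u by (intro Q.SK.S_eqI) (simp_all add: Q.SK.S_closed)
  qed (use x y in auto)
  fix z assume z: "z \<in> T"
  show "\<sigma> (tprod H0 K0 x y z) = tprod Q.SH.S Q.SK.S (\<sigma> x) (\<sigma> y) (\<sigma> z)"
  proof (rule Q.S.bop_ext)
    fix u assume u: "u \<in> carrier Q.SH.S"
    show "\<sigma> (tprod H0 K0 x y z) u = tprod Q.SH.S Q.SK.S (\<sigma> x) (\<sigma> y) (\<sigma> z) u"
      using x y z u by (simp add: adj_\<sigma>)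
  qed (use x y z in auto)
next
  fix c x assume x: "x \<in> T"
  show "\<sigma> (c \<odot>\<^bsub>bop H0 K0\<^esub> x) = c \<odot>\<^bsub>bop Q.SH.S Q.SK.S\<^esub> \<sigma> x"
  proof (rule Q.S.bop_ext)
    fix u assume u: "u \<in> carrier Q.SH.S"
    show "\<sigma> (c \<odot>\<^bsub>bop H0 K0\<^esub> x) u = (c \<odot>\<^bsub>bop Q.SH.S Q.SK.S\<^esub> \<sigma> x) u"
      using x u by (intro Q.SK.S_eqI) (simp_all add: Q.SK.S_closed)
  qed (use x in auto)
qed (rule Q.SH.complex_hilbert_space_S Q.SK.complex_hilbert_space_S)+

text \<open>The first summand is faithful on its own: \<open>L\<close> is the complement of the
  joint kernel of \<open>T\<close>, so \<open>t\<close> is recovered from its action there.\<close>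

lemma \<sigma>_inj: "inj_on \<sigma> T"
proof (rule inj_onI)
  fix s t assume st: "s \<in> T" "t \<in> T" "\<sigma> s = \<sigma> t"
  show "s = t"
  proof (rule D.bop_ext)
    fix x assume x: "x \<in> carrier H0"
    have "\<sigma> s (gH (cH x, \<zero>\<^bsub>H\<^esub>)) = \<sigma> t (gH (cH x, \<zero>\<^bsub>H\<^esub>))" using st by simp
    then have "Q.SK.P1 (gK (s x, \<pi> s \<zero>\<^bsub>H\<^esub>)) = Q.SK.P1 (gK (t x, \<pi> t \<zero>\<^bsub>H\<^esub>))" using x st(1,2) by simp
    then show "s x = t x" using x st(1,2) by simp
  qed (use st in auto)
qed

text \<open>A vector \<open>w\<close> in the range of \<open>p\<close> is killed by every
  \<open>\<sigma> t\<close>, and one in the range of \<open>q\<close> is orthogonal to all their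
  ranges. Its first component then lies both in the subspace that was cut off and in the complement
  of that subspace; its second component lies in the corresponding subspace for
  \<open>\<pi>\<close>, which is zero by irreducibility.\<close>

lemma \<sigma>_nondegenerate: "nondegenerate T Q.SH.S Q.SK.S \<sigma>"
proof (rule nondegenerateI[OF Q.SH.complex_hilbert_space_S Q.SK.complex_hilbert_space_S])
  fix p assume p: "p \<in> projections Q.SH.S"
    and zero: "\<And>t u. t \<in> T \<Longrightarrow> u \<in> carrier Q.SH.S \<Longrightarrow> \<sigma> t (p u) = \<zero>\<^bsub>Q.SK.S\<^esub>"
  interpret PP: hilbert_pair Q.SH.S Q.SH.S by (rule Q.S.H.hilbert_pair_self)
  define M where "M = {v \<in> carrier H. \<forall>z\<in>{adj H K (\<pi> t) y | t y. t \<in> T \<and> y \<in> carrier K}. cinner H v z = 0}"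
  have M: "C.H.closed_subspace M"
    unfolding M_def by (rule C.H.orthogonal_closed_subspace) auto
  have M_iff: "v \<in> M \<longleftrightarrow> v \<in> carrier H \<and> (\<forall>t\<in>T. \<forall>y\<in>carrier K. cinner H v (adj H K (\<pi> t) y) = 0)" for v
    unfolding M_def by blast
  obtain p' where p': "p' \<in> projections H" "\<And>x. x \<in> carrier H \<Longrightarrow> p' x \<in> M" "\<And>x. x \<in> M \<Longrightarrow> p' x = x"
    using C.H.closed_subspace_projection[OF M] by blast
  have "\<pi> x (p' v) = \<zero>\<^bsub>K\<^esub>" if x: "x \<in> X" and v: "v \<in> carrier H" for x v
  proof (rule C.K.cinner_eqI)
    note xT = X_sub_T[OF x]
    have pv: "p' v \<in> carrier H" by (rule C.H.projectionD(2)[OF p'(1) v])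
    fix y assume y: "y \<in> carrier K"
    have "cinner H (p' v) (adj H K (\<pi> x) y) = 0" using p'(2)[OF v] xT y unfolding M_iff by blast
    then show "Re (cinner K (\<pi> x (p' v)) y) = Re (cinner K \<zero>\<^bsub>K\<^esub> y)" using xT pv y by (simp add: C.cinner_adj_right)
  qed (use X_sub_T[OF x] C.H.projectionD(2)[OF p'(1) v] in auto)
  then have p'0: "p' = \<zero>\<^bsub>bop H H\<^esub>" by (rule nondegenerate_right[OF p'(1)])
  show "p = \<zero>\<^bsub>bop Q.SH.S Q.SH.S\<^esub>"
  proof (rule PP.bop_ext)
    fix u assume u: "u \<in> carrier Q.SH.S"
    define w where "w = p u"
    have w [simp]: "w \<in> carrier Q.SH.S" unfolding w_def by (rule Q.S.H.projectionD(2)[OF p u])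
    have tw: "t (Q.SH.P1 w) = \<zero>\<^bsub>K0\<^esub>" "\<pi> t (Q.SH.P2 w) = \<zero>\<^bsub>K\<^esub>" if t: "t \<in> T" for t
    proof -
      have "\<sigma> t w = \<zero>\<^bsub>Q.SK.S\<^esub>" using zero[OF t u] by (simp add: w_def)
      then have "Q.SK.P1 (gK (t (Q.SH.P1 w), \<pi> t (Q.SH.P2 w))) = \<zero>\<^bsub>K0\<^esub>" "Q.SK.P2 (gK (t (Q.SH.P1 w), \<pi> t (Q.SH.P2 w))) = \<zero>\<^bsub>K\<^esub>"
        by simp_all
      then show "t (Q.SH.P1 w) = \<zero>\<^bsub>K0\<^esub>" "\<pi> t (Q.SH.P2 w) = \<zero>\<^bsub>K\<^esub>" using t by simp_all
    qed
    have P1w: "Q.SH.P1 w \<in> carrier H0" by simp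
    have "Q.SH.P1 w \<in> kerH" using tw(1) P1w kerH_iff by blast
    moreover have "Q.SH.P1 w \<in> Q.SH.L" by simp
    ultimately have "cinner H0 (Q.SH.P1 w) (Q.SH.P1 w) = 0" unfolding Q.SH.L_def by blast
    then have "hnorm H0 (Q.SH.P1 w) = 0" by (simp add: hnorm_def)
    then have 1: "Q.SH.P1 w = \<zero>\<^bsub>H0\<^esub>" using D.H.hnorm_eq_0_iff[OF P1w] by blast
    have "cinner H (Q.SH.P2 w) (adj H K (\<pi> t) y) = 0" if "t \<in> T" "y \<in> carrier K" for t y
      using tw(2)[OF that(1)] that by (simp add: C.cinner_adj_right)
    then have "Q.SH.P2 w \<in> M" unfolding M_iff by simp
    then have "Q.SH.P2 w = p' (Q.SH.P2 w)" using p'(3) by simp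
    also have "\<dots> = \<zero>\<^bsub>H\<^esub>" unfolding p'0 by (rule hilbert_pair.zero_apply[OF C.H.hilbert_pair_self]) simp
    finally have "w = \<zero>\<^bsub>Q.SH.S\<^esub>" using 1 by (intro Q.SH.S_eqI) (simp_all add: Q.SH.S_closed)
    then show "p u = \<zero>\<^bsub>bop Q.SH.S Q.SH.S\<^esub> u" using u by (simp add: w_def)
  qed (use Q.S.H.projectionD(1)[OF p] in auto)
next
  fix q assume q: "q \<in> projections Q.SK.S"
    and zero: "\<And>t u. t \<in> T \<Longrightarrow> u \<in> carrier Q.SH.S \<Longrightarrow> q (\<sigma> t u) = \<zero>\<^bsub>Q.SK.S\<^esub>"
  interpret QQ: hilbert_pair Q.SK.S Q.SK.S by (rule Q.S.K.hilbert_pair_self)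
  define M where "M = {v \<in> carrier K. \<forall>z\<in>{\<pi> t y | t y. t \<in> T \<and> y \<in> carrier H}. cinner K v z = 0}"
  have M: "C.K.closed_subspace M"
    unfolding M_def by (rule C.K.orthogonal_closed_subspace) auto
  have M_iff: "v \<in> M \<longleftrightarrow> v \<in> carrier K \<and> (\<forall>t\<in>T. \<forall>y\<in>carrier H. cinner K v (\<pi> t y) = 0)" for v
    unfolding M_def by blast
  obtain q' where q': "q' \<in> projections K" "\<And>x. x \<in> carrier K \<Longrightarrow> q' x \<in> M" "\<And>x. x \<in> M \<Longrightarrow> q' x = x"
    using C.K.closed_subspace_projection[OF M] by blast
  have "q' (\<pi> x v) = \<zero>\<^bsub>K\<^esub>" if x: "x \<in> X" and v: "v \<in> carrier H" for x v
  proof (rule C.K.cinner_eqI)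
    note xT = X_sub_T[OF x]
    have xv: "\<pi> x v \<in> carrier K" using xT v by simp
    show "q' (\<pi> x v) \<in> carrier K" by (rule C.K.projectionD(2)[OF q'(1) xv])
    fix y assume y: "y \<in> carrier K"
    have "cinner K (q' y) (\<pi> x v) = 0" using q'(2)[OF y] xT v unfolding M_iff by blast
    then have "cinner K (\<pi> x v) (q' y) = 0"
      using C.K.cinner_commute[of "\<pi> x v" "q' y"] xv C.K.projectionD(2)[OF q'(1) y] by simp
    then show "Re (cinner K (q' (\<pi> x v)) y) = Re (cinner K \<zero>\<^bsub>K\<^esub> y)"
      using C.K.projectionD(4)[OF q'(1) xv y] y by simp
  qed simp
  then have q'0: "q' = \<zero>\<^bsub>bop K K\<^esub>" by (rule nondegenerate_left[OF q'(1)])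
  show "q = \<zero>\<^bsub>bop Q.SK.S Q.SK.S\<^esub>"
  proof (rule QQ.bop_ext)
    fix u assume u: "u \<in> carrier Q.SK.S"
    define w where "w = q u"
    have w [simp]: "w \<in> carrier Q.SK.S" unfolding w_def by (rule Q.S.K.projectionD(2)[OF q u])
    have orth: "cinner K0 (t (Q.SH.P1 v)) (Q.SK.P1 w) + cinner K (\<pi> t (Q.SH.P2 v)) (Q.SK.P2 w) = 0"
      if t: "t \<in> T" and v: "v \<in> carrier Q.SH.S" for t v
    proof -
      \<comment> \<open>Self-adjointness of \<open>q\<close> turns its vanishing on the ranges of
        \<open>\<sigma>\<close> into orthogonality of \<open>w = q u\<close> to these
        ranges.\<close>
      have "cinner Q.SK.S (\<sigma> t v) w = cinner Q.SK.S (q (\<sigma> t v)) u"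
        unfolding w_def using t v u by (intro Q.S.K.projectionD(4)[OF q, symmetric]) (auto simp del: \<sigma>_apply)
      also have "\<dots> = 0" using zero[OF t v] u by simp
      finally show ?thesis using t v by (simp add: Q.SK.S_simps(5))
    qed
    have "cinner K0 (t x) (Q.SK.P1 w) = 0" if "t \<in> T" "x \<in> carrier H0" for t x
      using orth[OF that(1), of "gH (cH x, \<zero>\<^bsub>H\<^esub>)"] that by simp
    moreover have P1w: "Q.SK.P1 w \<in> carrier K0" by simp
    ultimately have "Q.SK.P1 w \<in> kerK" using kerK_iff by blast
    moreover have "Q.SK.P1 w \<in> Q.SK.L" by simp
    ultimately have "cinner K0 (Q.SK.P1 w) (Q.SK.P1 w) = 0" unfolding Q.SK.L_def by blast
    then have "hnorm K0 (Q.SK.P1 w) = 0" by (simp add: hnorm_def)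
    then have 1: "Q.SK.P1 w = \<zero>\<^bsub>K0\<^esub>" using D.K.hnorm_eq_0_iff[OF P1w] by blast
    have "cinner K (Q.SK.P2 w) (\<pi> t v) = 0" if "t \<in> T" "v \<in> carrier H" for t v
      using orth[OF that(1), of "gH (\<zero>\<^bsub>H0\<^esub>, v)"] that C.K.cinner_commute[of "Q.SK.P2 w" "\<pi> t v"] by simp
    then have "Q.SK.P2 w \<in> M" unfolding M_iff by simp
    then have "Q.SK.P2 w = q' (Q.SK.P2 w)" using q'(3) by simp
    also have "\<dots> = \<zero>\<^bsub>K\<^esub>" unfolding q'0 by (rule hilbert_pair.zero_apply[OF C.K.hilbert_pair_self]) simp
    finally have "w = \<zero>\<^bsub>Q.SK.S\<^esub>" using 1 by (intro Q.SK.S_eqI) (simp_all add: Q.SK.S_closed)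
    then show "q u = \<zero>\<^bsub>bop Q.SK.S Q.SK.S\<^esub> u" using u by (simp add: w_def)
  qed (use Q.S.K.projectionD(1)[OF q] in auto)
qed simp

text \<open>The upper left corner of \<open>a\<close>, extended by zero from \<open>L\<close> to all
  of \<open>H0\<close>, because \<open>F\<close> expects operators in
  \<open>B(H0, K0)\<close>.\<close>

definition compress :: "('e \<Rightarrow> 'f) \<Rightarrow> 'a \<Rightarrow> 'b"
  where "compress a = (\<lambda>x\<in>carrier H0. Q.SK.P1 (a (gH (cH x, \<zero>\<^bsub>H\<^esub>))))"

lemma compress_apply: "x \<in> carrier H0 \<Longrightarrow> compress a x = Q.SK.P1 (a (gH (cH x, \<zero>\<^bsub>H\<^esub>)))"
  by (simp add: compress_def)

lemma g_cH_add: "x \<in> carrier H0 \<Longrightarrow> y \<in> carrier H0 \<Longrightarrow>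
    gH (cH (x \<oplus>\<^bsub>H0\<^esub> y), \<zero>\<^bsub>H\<^esub>) = gH (cH x, \<zero>\<^bsub>H\<^esub>) \<oplus>\<^bsub>Q.SH.S\<^esub> gH (cH y, \<zero>\<^bsub>H\<^esub>)"
  by (intro Q.SH.S_eqI Q.SH.S_closed) (simp_all add: cH_add)

lemma g_cH_smult: "x \<in> carrier H0 \<Longrightarrow>
    gH (cH (c \<odot>\<^bsub>H0\<^esub> x), \<zero>\<^bsub>H\<^esub>) = c \<odot>\<^bsub>Q.SH.S\<^esub> gH (cH x, \<zero>\<^bsub>H\<^esub>)"
  using C.H.smult_r_null[of c] by (intro Q.SH.S_eqI Q.SH.S_closed) (simp_all add: cH_smult)

lemma hnorm_g_cH: "x \<in> carrier H0 \<Longrightarrow> hnorm Q.SH.S (gH (cH x, \<zero>\<^bsub>H\<^esub>)) \<le> hnorm H0 x"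
  using D.H.hnorm_projection_complement_le[OF pH, of x] by (simp add: Q.SH.hnorm_S cH_def[symmetric])

lemma hnorm_g_cK: "x \<in> carrier K0 \<Longrightarrow> hnorm Q.SK.S (gK (cK x, \<zero>\<^bsub>K\<^esub>)) \<le> hnorm K0 x"
  using D.K.hnorm_projection_complement_le[OF pK, of x] by (simp add: Q.SK.hnorm_S cK_def[symmetric])

lemma compress_L [simp]: "a \<in> carrier (bop Q.SH.S Q.SK.S) \<Longrightarrow> x \<in> carrier H0 \<Longrightarrow> compress a x \<in> Q.SK.L"
  by (simp add: compress_apply)

lemma compress_closed [simp]:
  assumes a: "a \<in> carrier (bop Q.SH.S Q.SK.S)" shows "compress a \<in> carrier (bop H0 K0)"
proof (rule D.bopI[where C = "opnorm Q.SH.S Q.SK.S a"])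
  fix x assume x: "x \<in> carrier H0"
  have "hnorm K0 (compress a x) \<le> hnorm Q.SK.S (a (gH (cH x, \<zero>\<^bsub>H\<^esub>)))"
    using a x by (simp add: compress_apply Q.SK.hnorm_P_le)
  also have "\<dots> \<le> opnorm Q.SH.S Q.SK.S a * hnorm Q.SH.S (gH (cH x, \<zero>\<^bsub>H\<^esub>))"
    using a x by (intro Q.S.hnorm_le_opnorm) auto
  also have "\<dots> \<le> opnorm Q.SH.S Q.SK.S a * hnorm H0 x"
    using a x by (intro mult_left_mono hnorm_g_cH) auto
  finally show "hnorm K0 (compress a x) \<le> opnorm Q.SH.S Q.SK.S a * hnorm H0 x" .
  show "compress a (c \<odot>\<^bsub>H0\<^esub> x) = c \<odot>\<^bsub>K0\<^esub> compress a x" for c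
    using a x by (simp add: compress_apply g_cH_smult)
  show "compress a (x \<oplus>\<^bsub>H0\<^esub> y) = compress a x \<oplus>\<^bsub>K0\<^esub> compress a y" if "y \<in> carrier H0" for y
    using a x that by (simp add: compress_apply g_cH_add)
qed (use a in \<open>auto simp: compress_def\<close>)

lemma compress_add: "a \<in> carrier (bop Q.SH.S Q.SK.S) \<Longrightarrow> b \<in> carrier (bop Q.SH.S Q.SK.S) \<Longrightarrow>
    compress (a \<oplus>\<^bsub>bop Q.SH.S Q.SK.S\<^esub> b) = compress a \<oplus>\<^bsub>bop H0 K0\<^esub> compress b"
  by (rule D.bop_ext) (auto simp: compress_apply)

lemma compress_smult: "a \<in> carrier (bop Q.SH.S Q.SK.S) \<Longrightarrow>
    compress (c \<odot>\<^bsub>bop Q.SH.S Q.SK.S\<^esub> a) = c \<odot>\<^bsub>bop H0 K0\<^esub> compress a"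
  by (rule D.bop_ext) (auto simp: compress_apply)

lemma compress_\<sigma>: "t \<in> T \<Longrightarrow> compress (\<sigma> t) = t"
  by (rule D.bop_ext) (auto simp: compress_apply)

lemma cinner_compress:
  assumes "a \<in> carrier (bop Q.SH.S Q.SK.S)" "x \<in> carrier H0" "w \<in> carrier K0"
  shows "cinner K0 (compress a x) w = cinner Q.SK.S (a (gH (cH x, \<zero>\<^bsub>H\<^esub>))) (gK (cK w, \<zero>\<^bsub>K\<^esub>))"
  using assms cinner_cK[of "compress a x" w] by (simp add: Q.SK.S_simps(5) compress_apply)

text \<open>By \<open>cinner_compress\<close> the corner arises from \<open>a\<close> by inserting
  the maps \<open>x \<mapsto> gH (cH x, 0)\<close> and \<open>w \<mapsto> gK (cK w, 0)\<close> into
  its sesquilinear form, and these do not increase norms.\<close>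

lemma mbound_compress:
  assumes A: "\<forall>i<n. \<forall>j<n. A i j \<in> carrier (bop Q.SH.S Q.SK.S)" and m: "mbound Q.SH.S Q.SK.S 1 n A"
  shows "mbound H0 K0 1 n (\<lambda>i j. compress (A i j))"
  unfolding mbound_def
proof (intro allI impI)
  fix v w assume v: "\<forall>j<n. v j \<in> carrier H0" and w: "\<forall>i<n. w i \<in> carrier K0"
  let ?v = "\<lambda>j. gH (cH (v j), \<zero>\<^bsub>H\<^esub>)" and ?w = "\<lambda>i. gK (cK (w i), \<zero>\<^bsub>K\<^esub>)"
  have "(\<Sum>i<n. \<Sum>j<n. cinner K0 (compress (A i j) (v j)) (w i)) = (\<Sum>i<n. \<Sum>j<n. cinner Q.SK.S (A i j (?v j)) (?w i))"
    by (intro sum.cong refl cinner_compress) (use A v w in auto)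
  then have "Re (\<Sum>i<n. \<Sum>j<n. cinner K0 (compress (A i j) (v j)) (w i)) \<le>
      1 * ((\<Sum>j<n. (hnorm Q.SH.S (?v j))\<^sup>2) + (\<Sum>i<n. (hnorm Q.SK.S (?w i))\<^sup>2)) / 2"
    using m[unfolded mbound_def, rule_format, of ?v ?w] v w by simp
  moreover have "(\<Sum>j<n. (hnorm Q.SH.S (?v j))\<^sup>2) \<le> (\<Sum>j<n. (hnorm H0 (v j))\<^sup>2)"
    using v by (intro sum_mono power_mono hnorm_g_cH) (auto intro!: Q.S.H.hnorm_nonneg)
  moreover have "(\<Sum>j<n. (hnorm Q.SK.S (?w j))\<^sup>2) \<le> (\<Sum>j<n. (hnorm K0 (w j))\<^sup>2)"
    using w by (intro sum_mono power_mono hnorm_g_cK) (auto intro!: Q.S.K.hnorm_nonneg)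
  ultimately show "Re (\<Sum>i<n. \<Sum>j<n. cinner K0 (compress (A i j) (v j)) (w i)) \<le>
      1 * ((\<Sum>j<n. (hnorm H0 (v j))\<^sup>2) + (\<Sum>i<n. (hnorm K0 (w i))\<^sup>2)) / 2" by simp
qed

end

section \<open>The map to which hyperrigidity is applied\<close>

locale doubled_tro_extension = doubled_tro H0 K0 H K T \<pi> X gH gK pH pK
  for H0 :: "'a inner_space" and K0 :: "'b inner_space" and H :: "'c inner_space" and K :: "'d inner_space"
    and T :: "('a \<Rightarrow> 'b) set" and \<pi> :: "('a \<Rightarrow> 'b) \<Rightarrow> ('c \<Rightarrow> 'd)" and X :: "('a \<Rightarrow> 'b) set"
    and gH :: "'a \<times> 'c \<Rightarrow> 'e" and gK :: "'b \<times> 'd \<Rightarrow> 'f" and pH :: "'a \<Rightarrow> 'a" and pK :: "'b \<Rightarrow> 'b" +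
  fixes F :: "('a \<Rightarrow> 'b) \<Rightarrow> ('c \<Rightarrow> 'd)"
  assumes F: "clinear_on (carrier (bop H0 K0)) (bop H0 K0) (bop H K) F"
    and F_mbound: "\<And>n A. \<forall>i<n. \<forall>j<n. A i j \<in> carrier (bop H0 K0) \<Longrightarrow> mbound H0 K0 1 n A \<Longrightarrow>
      mbound H K 1 n (\<lambda>i j. F (A i j))"
    and F_X: "\<And>x. x \<in> X \<Longrightarrow> F x = \<pi> x"
begin

lemma F_closed [simp]: "a \<in> carrier (bop H0 K0) \<Longrightarrow> F a \<in> carrier (bop H K)"
  and F_add: "a \<in> carrier (bop H0 K0) \<Longrightarrow> b \<in> carrier (bop H0 K0) \<Longrightarrow>
    F (a \<oplus>\<^bsub>bop H0 K0\<^esub> b) = F a \<oplus>\<^bsub>bop H K\<^esub> F b"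
  and F_smult: "a \<in> carrier (bop H0 K0) \<Longrightarrow> F (c \<odot>\<^bsub>bop H0 K0\<^esub> a) = c \<odot>\<^bsub>bop H K\<^esub> F a"
  using F unfolding clinear_on_def by blast+

definition \<Phi> :: "('e \<Rightarrow> 'f) \<Rightarrow> 'e \<Rightarrow> 'f" where "\<Phi> a = Q.block (compress a) (F (compress a))"

lemma compress_L': "a \<in> carrier (bop Q.SH.S Q.SK.S) \<Longrightarrow> x \<in> Q.SH.L \<Longrightarrow> compress a x \<in> Q.SK.L"
  using Q.SH.L_carrier by simp

lemma \<Phi>_closed [simp]: "a \<in> carrier (bop Q.SH.S Q.SK.S) \<Longrightarrow> \<Phi> a \<in> carrier (bop Q.SH.S Q.SK.S)"
  unfolding \<Phi>_def by (rule Q.block_closed) (simp_all add: compress_L')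

lemma \<Phi>_apply: "u \<in> carrier Q.SH.S \<Longrightarrow> \<Phi> a u = gK (compress a (Q.SH.P1 u), F (compress a) (Q.SH.P2 u))"
  by (simp add: \<Phi>_def)

lemma \<Phi>_linear: "clinear_on (carrier (bop Q.SH.S Q.SK.S)) (bop Q.SH.S Q.SK.S) (bop Q.SH.S Q.SK.S) \<Phi>"
  unfolding clinear_on_def
proof (intro conjI ballI allI)
  show "\<Phi> \<in> carrier (bop Q.SH.S Q.SK.S) \<rightarrow> carrier (bop Q.SH.S Q.SK.S)" by simp
  fix a assume a: "a \<in> carrier (bop Q.SH.S Q.SK.S)"
  show "\<Phi> (c \<odot>\<^bsub>bop Q.SH.S Q.SK.S\<^esub> a) = c \<odot>\<^bsub>bop Q.SH.S Q.SK.S\<^esub> \<Phi> a" for c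
  proof (rule Q.S.bop_ext)
    fix u assume u: "u \<in> carrier Q.SH.S"
    note [simp] = compress_L'[OF a Q.SH.P_closed(1)[OF u]]
    show "\<Phi> (c \<odot>\<^bsub>bop Q.SH.S Q.SK.S\<^esub> a) u = (c \<odot>\<^bsub>bop Q.SH.S Q.SK.S\<^esub> \<Phi> a) u"
      using a u by (intro Q.SK.S_eqI) (simp_all add: \<Phi>_apply compress_smult F_smult Q.SK.S_closed)
  qed (use a in simp_all)
  fix b assume b: "b \<in> carrier (bop Q.SH.S Q.SK.S)"
  show "\<Phi> (a \<oplus>\<^bsub>bop Q.SH.S Q.SK.S\<^esub> b) = \<Phi> a \<oplus>\<^bsub>bop Q.SH.S Q.SK.S\<^esub> \<Phi> b"
  proof (rule Q.S.bop_ext)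
    fix u assume u: "u \<in> carrier Q.SH.S"
    note [simp] = compress_L'[OF a Q.SH.P_closed(1)[OF u]] compress_L'[OF b Q.SH.P_closed(1)[OF u]]
    show "\<Phi> (a \<oplus>\<^bsub>bop Q.SH.S Q.SK.S\<^esub> b) u = (\<Phi> a \<oplus>\<^bsub>bop Q.SH.S Q.SK.S\<^esub> \<Phi> b) u"
      using a b u by (intro Q.SK.S_eqI) (simp_all add: \<Phi>_apply compress_add F_add Q.SK.S_closed)
  qed (use a b in simp_all)
qed

text \<open>The bounds for the two diagonal blocks add up, and so do the squared norms of the
  components of \<open>v\<close> and \<open>w\<close>.\<close>

lemma \<Phi>_mbound:
  assumes A: "\<forall>i<n. \<forall>j<n. A i j \<in> carrier (bop Q.SH.S Q.SK.S)" and m: "mbound Q.SH.S Q.SK.S 1 n A"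
  shows "mbound Q.SH.S Q.SK.S 1 n (\<lambda>i j. \<Phi> (A i j))"
proof -
  have c: "mbound H0 K0 1 n (\<lambda>i j. compress (A i j))" by (rule mbound_compress[OF A m])
  have Fc: "mbound H K 1 n (\<lambda>i j. F (compress (A i j)))"
    by (rule F_mbound[OF _ c]) (use A in simp)
  show ?thesis
    unfolding mbound_def
  proof (intro allI impI)
    fix v w assume v: "\<forall>j<n. v j \<in> carrier Q.SH.S" and w: "\<forall>i<n. w i \<in> carrier Q.SK.S"
    have eq: "cinner Q.SK.S (\<Phi> (A i j) (v j)) (w i) =
        cinner K0 (compress (A i j) (Q.SH.P1 (v j))) (Q.SK.P1 (w i)) +
        cinner K (F (compress (A i j)) (Q.SH.P2 (v j))) (Q.SK.P2 (w i))" if "i < n" "j < n" for i j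
      unfolding \<Phi>_def by (rule Q.cinner_block) (use that A v w in \<open>simp_all add: compress_L'\<close>)
    have "(\<Sum>i<n. \<Sum>j<n. cinner Q.SK.S (\<Phi> (A i j) (v j)) (w i)) =
        (\<Sum>i<n. \<Sum>j<n. cinner K0 (compress (A i j) (Q.SH.P1 (v j))) (Q.SK.P1 (w i)) +
          cinner K (F (compress (A i j)) (Q.SH.P2 (v j))) (Q.SK.P2 (w i)))"
      by (rule sum.cong[OF refl], rule sum.cong[OF refl], rule eq) simp_all
    then have split: "Re (\<Sum>i<n. \<Sum>j<n. cinner Q.SK.S (\<Phi> (A i j) (v j)) (w i)) =
        Re (\<Sum>i<n. \<Sum>j<n. cinner K0 (compress (A i j) (Q.SH.P1 (v j))) (Q.SK.P1 (w i))) +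
        Re (\<Sum>i<n. \<Sum>j<n. cinner K (F (compress (A i j)) (Q.SH.P2 (v j))) (Q.SK.P2 (w i)))"
      by (simp only: sum.distrib plus_complex.simps)
    have 1: "Re (\<Sum>i<n. \<Sum>j<n. cinner K0 (compress (A i j) (Q.SH.P1 (v j))) (Q.SK.P1 (w i))) \<le>
        1 * ((\<Sum>j<n. (hnorm H0 (Q.SH.P1 (v j)))\<^sup>2) + (\<Sum>i<n. (hnorm K0 (Q.SK.P1 (w i)))\<^sup>2)) / 2"
      using c[unfolded mbound_def, rule_format, of "\<lambda>j. Q.SH.P1 (v j)" "\<lambda>i. Q.SK.P1 (w i)"] v w by simp
    have 2: "Re (\<Sum>i<n. \<Sum>j<n. cinner K (F (compress (A i j)) (Q.SH.P2 (v j))) (Q.SK.P2 (w i))) \<le>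
        1 * ((\<Sum>j<n. (hnorm H (Q.SH.P2 (v j)))\<^sup>2) + (\<Sum>i<n. (hnorm K (Q.SK.P2 (w i)))\<^sup>2)) / 2"
      using Fc[unfolded mbound_def, rule_format, of "\<lambda>j. Q.SH.P2 (v j)" "\<lambda>i. Q.SK.P2 (w i)"] v w by simp
    have "(\<Sum>j<n. (hnorm Q.SH.S (v j))\<^sup>2) = (\<Sum>j<n. (hnorm H0 (Q.SH.P1 (v j)))\<^sup>2 + (hnorm H (Q.SH.P2 (v j)))\<^sup>2)"
      by (rule sum.cong[OF refl], rule Q.SH.hnorm_S_square) (use v in simp)
    moreover have "(\<Sum>i<n. (hnorm Q.SK.S (w i))\<^sup>2) = (\<Sum>i<n. (hnorm K0 (Q.SK.P1 (w i)))\<^sup>2 + (hnorm K (Q.SK.P2 (w i)))\<^sup>2)"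
      by (rule sum.cong[OF refl], rule Q.SK.hnorm_S_square) (use w in simp)
    ultimately show "Re (\<Sum>i<n. \<Sum>j<n. cinner Q.SK.S (\<Phi> (A i j) (v j)) (w i)) \<le>
        1 * ((\<Sum>j<n. (hnorm Q.SH.S (v j))\<^sup>2) + (\<Sum>i<n. (hnorm Q.SK.S (w i))\<^sup>2)) / 2"
      using split 1 2 unfolding sum.distrib by argo
  qed
qed

lemma \<Phi>_\<sigma>: "x \<in> X \<Longrightarrow> \<Phi> (\<sigma> x) = \<sigma> x"
  by (simp add: \<Phi>_def compress_\<sigma> X_sub_T F_X \<sigma>_def[of x, symmetric])

lemma \<Phi>_contractive:
  "completely_contractive Q.SH.S Q.SK.S (carrier (bop Q.SH.S Q.SK.S)) Q.SH.S Q.SK.S \<Phi>"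
proof -
  have "cb_norm Q.SH.S Q.SK.S (carrier (bop Q.SH.S Q.SK.S)) Q.SH.S Q.SK.S \<Phi> \<le> ereal 1"
    using cb_norm_le_iff[OF Q.S.hilbert_pair_axioms Q.S.hilbert_pair_axioms order_refl, of \<Phi> 1] \<Phi>_mbound by simp
  then show ?thesis using \<Phi>_linear by (simp add: completely_contractive_def one_ereal_def)
qed

text \<open>Hyperrigidity asks for norm exactly 1. It is attained because \<open>\<Phi>\<close>
  fixes \<open>\<sigma> x\<close>, which is nonzero for some \<open>x\<close> in
  \<open>X\<close>.\<close>

lemma \<Phi>_cb_norm: "cb_norm Q.SH.S Q.SK.S (carrier (bop Q.SH.S Q.SK.S)) Q.SH.S Q.SK.S \<Phi> = 1"
proof (rule cb_norm_eq_1)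
  show "cb_norm Q.SH.S Q.SK.S (carrier (bop Q.SH.S Q.SK.S)) Q.SH.S Q.SK.S \<Phi> \<le> 1"
    using \<Phi>_contractive by (simp add: completely_contractive_def)
  fix r assume r: "0 \<le> r" "cb_norm Q.SH.S Q.SK.S (carrier (bop Q.SH.S Q.SK.S)) Q.SH.S Q.SK.S \<Phi> \<le> ereal r"
  obtain x v where x: "x \<in> X" and v: "v \<in> carrier H" "\<pi> x v \<noteq> \<zero>\<^bsub>K\<^esub>" using nonzero_on_X by blast
  note xT = X_sub_T[OF x]
  have "\<sigma> x \<noteq> \<zero>\<^bsub>bop Q.SH.S Q.SK.S\<^esub>"
  proof
    assume "\<sigma> x = \<zero>\<^bsub>bop Q.SH.S Q.SK.S\<^esub>"
    then have "Q.SK.P2 (\<sigma> x (gH (\<zero>\<^bsub>H0\<^esub>, v))) = \<zero>\<^bsub>K\<^esub>" using v(1) by (simp del: \<sigma>_apply)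
    then show False using v xT by simp
  qed
  then have "opnorm Q.SH.S Q.SK.S (\<sigma> x) > 0"
    using Q.S.opnorm_eq_0[OF \<sigma>_closed[OF xT]] Q.S.opnorm_nonneg[OF \<sigma>_closed[OF xT]] by linarith
  moreover have "opnorm Q.SH.S Q.SK.S (\<Phi> (\<sigma> x)) \<le> r * opnorm Q.SH.S Q.SK.S (\<sigma> x)"
    by (rule cb_norm_opnorm[OF Q.S.hilbert_pair_axioms Q.S.hilbert_pair_axioms _ \<Phi>_linear r \<sigma>_closed[OF xT]])
      (simp add: operator_space_def Q.S.B.carrier_is_submodule)
  ultimately show "1 \<le> r" unfolding \<Phi>_\<sigma>[OF x] by simp
qed

text \<open>\<open>compress\<close> returns \<open>t\<close> from \<open>\<sigma> t\<close>, so the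
  second components at \<open>(0, v)\<close> are \<open>F t v\<close> on one side and
  \<open>\<pi> t v\<close> on the other.\<close>

lemma F_eq:
  assumes t: "t \<in> T" and eq: "\<Phi> (\<sigma> t) = \<sigma> t"
  shows "F t = \<pi> t"
proof (rule C.bop_ext)
  fix v assume v: "v \<in> carrier H"
  have Ft: "F t \<in> carrier (bop H K)" using t by simp
  have "\<Phi> (\<sigma> t) (gH (\<zero>\<^bsub>H0\<^esub>, v)) = \<sigma> t (gH (\<zero>\<^bsub>H0\<^esub>, v))" by (simp only: eq)
  then have "gK (t \<zero>\<^bsub>H0\<^esub>, F t v) = gK (t \<zero>\<^bsub>H0\<^esub>, \<pi> t v)"
    using t v by (simp add: \<Phi>_apply compress_\<sigma> del: D.bop_zero)
  then have "Q.SK.P2 (gK (t \<zero>\<^bsub>H0\<^esub>, F t v)) = Q.SK.P2 (gK (t \<zero>\<^bsub>H0\<^esub>, \<pi> t v))" by simp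
  then show "F t v = \<pi> t v" using t v Ft by simp
qed (use t in simp_all)

end

section \<open>From rigidity to boundary representations\<close>

context irreducible_tro_morphism
begin

lemma rigidity:
  assumes hyp: "rect_hyperrigid H0 K0 T X" and sep: "norm_separable H0 K0 X"
    and F: "clinear_on (carrier (bop H0 K0)) (bop H0 K0) (bop H K) F"
    and F_mbound: "\<And>n A. \<forall>i<n. \<forall>j<n. A i j \<in> carrier (bop H0 K0) \<Longrightarrow> mbound H0 K0 1 n A \<Longrightarrow>
      mbound H K 1 n (\<lambda>i j. F (A i j))"
    and F_X: "\<And>x. x \<in> X \<Longrightarrow> F x = \<pi> x" and t: "t \<in> T"
  shows "F t = \<pi> t"
proof -
  \<comment> \<open>Separability enters here: the direct sums are carried by the types
    \<open>'a\<close> and \<open>'b\<close>, over which the hypothesis ranges.\<close>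
  obtain gH :: "'a \<times> 'c \<Rightarrow> 'a" where gH: "inj_on gH (carrier H0 \<times> carrier H)"
    using D.H.carrier_times_injection[OF separable(1)[OF sep]] by blast
  obtain gK :: "'b \<times> 'd \<Rightarrow> 'b" where gK: "inj_on gK (carrier K0 \<times> carrier K)"
    using D.K.carrier_times_injection[OF separable(2)[OF sep]] by blast
  obtain pH where pH: "pH \<in> projections H0" "\<And>x. x \<in> carrier H0 \<Longrightarrow> pH x \<in> kerH"
    "\<And>x y. x \<in> carrier H0 \<Longrightarrow> y \<in> kerH \<Longrightarrow> cinner H0 (pH x) y = cinner H0 x y"
    using D.H.closed_subspace_projection[OF kerH_closed] by blast
  obtain pK where pK: "pK \<in> projections K0" "\<And>x. x \<in> carrier K0 \<Longrightarrow> pK x \<in> kerK"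
    "\<And>x y. x \<in> carrier K0 \<Longrightarrow> y \<in> kerK \<Longrightarrow> cinner K0 (pK x) y = cinner K0 x y"
    using D.K.closed_subspace_projection[OF kerK_closed] by blast
  interpret W: doubled_tro_extension H0 K0 H K T \<pi> X gH gK pH pK F
    by unfold_locales (fact gH gK pH pK F F_mbound F_X)+
  let ?S = "W.Q.SH.S" and ?S' = "W.Q.SK.S"
  have lim: "(\<lambda>n::nat. opnorm ?S ?S' (W.\<Phi> (W.\<sigma> x) \<ominus>\<^bsub>bop ?S ?S'\<^esub> W.\<sigma> x)) \<longlonglongrightarrow> 0" if x: "x \<in> X" for x
    using W.\<sigma>_closed[OF X_sub_T[OF x]] by (simp add: W.\<Phi>_\<sigma>[OF x] W.Q.S.B.diff_eq_0_iff[THEN iffD2])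
  have "\<forall>t\<in>T. (\<lambda>n::nat. opnorm ?S ?S' (W.\<Phi> (W.\<sigma> t) \<ominus>\<^bsub>bop ?S ?S'\<^esub> W.\<sigma> t)) \<longlonglongrightarrow> 0"
    using hyp[unfolded rect_hyperrigid_def, THEN conjunct2, THEN conjunct2, rule_format,
        of ?S ?S' W.\<sigma> "\<lambda>_. W.\<Phi>"]
      W.\<sigma>_representation W.\<sigma>_inj W.\<sigma>_nondegenerate W.\<Phi>_contractive W.\<Phi>_cb_norm lim by blast
  then have lim_t: "(\<lambda>n::nat. opnorm ?S ?S' (W.\<Phi> (W.\<sigma> t) \<ominus>\<^bsub>bop ?S ?S'\<^esub> W.\<sigma> t)) \<longlonglongrightarrow> 0" using t by blast
  \<comment> \<open>The sequence is constant, so its limit is its value.\<close>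
  have 0: "opnorm ?S ?S' (W.\<Phi> (W.\<sigma> t) \<ominus>\<^bsub>bop ?S ?S'\<^esub> W.\<sigma> t) = 0"
    by (rule LIMSEQ_unique[OF tendsto_const lim_t])
  have cl: "W.\<sigma> t \<in> carrier (bop ?S ?S')" "W.\<Phi> (W.\<sigma> t) \<in> carrier (bop ?S ?S')" using t by simp_all
  have "W.\<Phi> (W.\<sigma> t) \<ominus>\<^bsub>bop ?S ?S'\<^esub> W.\<sigma> t = \<zero>\<^bsub>bop ?S ?S'\<^esub>"
    by (rule W.Q.S.opnorm_eq_0[OF _ 0]) (rule W.Q.S.B.minus_closed[OF cl(2,1)])
  then show ?thesis using W.F_eq[OF t] W.Q.S.B.diff_eq_0_iff[OF cl(2,1)] by blast
qed

end

lemma mbound_mono: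
  assumes "mbound H K r n A" "r \<le> s" shows "mbound H K s n A"
  unfolding mbound_def
proof (intro allI impI)
  fix v w assume "\<forall>j<n. v j \<in> carrier H" "\<forall>i<n. w i \<in> carrier K"
  then have "Re (\<Sum>i<n. \<Sum>j<n. cinner K (A i j (v j)) (w i)) \<le>
      r * ((\<Sum>j<n. (hnorm H (v j))\<^sup>2) + (\<Sum>i<n. (hnorm K (w i))\<^sup>2)) / 2"
    using assms(1) unfolding mbound_def by blast
  also have "\<dots> \<le> s * ((\<Sum>j<n. (hnorm H (v j))\<^sup>2) + (\<Sum>i<n. (hnorm K (w i))\<^sup>2)) / 2"
    using assms(2) by (intro divide_right_mono mult_right_mono add_nonneg_nonneg sum_nonneg) auto
  finally show "Re (\<Sum>i<n. \<Sum>j<n. cinner K (A i j (v j)) (w i)) \<le>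
      s * ((\<Sum>j<n. (hnorm H (v j))\<^sup>2) + (\<Sum>i<n. (hnorm K (w i))\<^sup>2)) / 2" .
qed

lemma (in contractive_map) extensionE:
  obtains F where "clinear_on (carrier (bop H0 K0)) (bop H0 K0) (bop H K) F" "\<And>x. x \<in> X \<Longrightarrow> F x = f x"
    "\<And>n A. \<forall>i<n. \<forall>j<n. A i j \<in> carrier (bop H0 K0) \<Longrightarrow> mbound H0 K0 1 n A \<Longrightarrow> mbound H K 1 n (\<lambda>i j. F (A i j))"
proof -
  obtain F where F: "clinear_on (carrier (bop H0 K0)) (bop H0 K0) (bop H K) F \<and> (\<forall>x\<in>X. F x = f x) \<and>
    (\<forall>n A. (\<forall>i<n. \<forall>j<n. A i j \<in> carrier (bop H0 K0)) \<longrightarrow> mbound H0 K0 1 n A \<longrightarrow> mbound H K 1 n (\<lambda>i j. F (A i j)))"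
    using extension by (elim exE)
  show thesis
    by (rule that[OF F[THEN conjunct1] F[THEN conjunct2, THEN conjunct1, THEN bspec]
          F[THEN conjunct2, THEN conjunct2, THEN spec, THEN spec, THEN mp, THEN mp]])
qed

context irreducible_tro_morphism
begin

lemma mbound_\<pi>:
  assumes "\<forall>i<n. \<forall>j<n. A i j \<in> T" "mbound H0 K0 1 n A"
  shows "mbound H K 1 n (\<lambda>i j. \<pi> (A i j))"
proof -
  have "T \<subseteq> carrier (bop H0 K0)" "\<pi> \<in> T \<rightarrow> carrier (bop H K)" by auto
  then show ?thesis
    using cb_norm_le_iff[OF D.hilbert_pair_axioms C.hilbert_pair_axioms, of T \<pi> 1] cb_norm_le_1 assms
    by (simp add: one_ereal_def)
qed

lemma bound_ge_1:
  assumes hyp: "rect_hyperrigid H0 K0 T X" and sep: "norm_separable H0 K0 X"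
    and r: "\<And>n A. \<forall>i<n. \<forall>j<n. A i j \<in> X \<Longrightarrow> mbound H0 K0 1 n A \<Longrightarrow> mbound H K r n (\<lambda>i j. \<pi> (A i j))"
  shows "1 \<le> r"
proof (rule ccontr)
  assume "\<not> 1 \<le> r"
  \<comment> \<open>\<open>r\<close> may be zero or negative, whereas \<open>\<pi>\<close> is going
    to be divided by \<open>s\<close>.\<close>
  then obtain s where s: "0 < s" "r \<le> s" "s < 1"
    by (metis dense linorder_not_le max.bounded_iff max_less_iff_conj order_less_imp_le zero_less_one)
  define f where "f x = complex_of_real (1 / s) \<odot>\<^bsub>bop H K\<^esub> \<pi> x" for x
  have "contractive_map H0 K0 H K X f"
  proof (unfold_locales)
    show "clinear_on X (bop H0 K0) (bop H K) f"
      unfolding clinear_on_def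
    proof (intro conjI ballI allI)
      show "f \<in> X \<rightarrow> carrier (bop H K)" using X_sub_T by (simp add: f_def)
      fix x assume x: "x \<in> X"
      note xT = X_sub_T[OF x]
      show "f (c \<odot>\<^bsub>bop H0 K0\<^esub> x) = c \<odot>\<^bsub>bop H K\<^esub> f x" for c
        using xT by (simp add: f_def C.B.csmult_assoc[symmetric] mult.commute)
      fix y assume y: "y \<in> X"
      show "f (x \<oplus>\<^bsub>bop H0 K0\<^esub> y) = f x \<oplus>\<^bsub>bop H K\<^esub> f y"
        using xT X_sub_T[OF y] by (simp add: f_def C.B.smult_r_distr)
    qed
    fix n A assume A: "\<forall>i<n. \<forall>j<n. A i j \<in> X" "mbound H0 K0 1 n A"
    have "mbound H K s n (\<lambda>i j. \<pi> (A i j))" by (rule mbound_mono[OF r[OF A] s(2)])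
    then have "mbound H K (1 / s * s) n (\<lambda>i j. complex_of_real (1 / s) \<odot>\<^bsub>bop H K\<^esub> \<pi> (A i j))"
      using A(1) X_sub_T s(1) by (intro C.mbound_scale) simp_all
    then show "mbound H K 1 n (\<lambda>i j. f (A i j))" using s(1) by (simp add: f_def)
  qed (rule X)
  then obtain F where F: "clinear_on (carrier (bop H0 K0)) (bop H0 K0) (bop H K) F" "\<And>x. x \<in> X \<Longrightarrow> F x = f x"
    "\<And>n A. \<forall>i<n. \<forall>j<n. A i j \<in> carrier (bop H0 K0) \<Longrightarrow> mbound H0 K0 1 n A \<Longrightarrow> mbound H K 1 n (\<lambda>i j. F (A i j))"
    by (rule contractive_map.extensionE) blast
  have F_closed [simp]: "F a \<in> carrier (bop H K)" if "a \<in> carrier (bop H0 K0)" for a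
    using F(1) that unfolding clinear_on_def by blast
  \<comment> \<open>Multiplied back by \<open>s < 1\<close>, the extension of
    \<open>\<pi> / s\<close> is still completely contractive and agrees with \<open>\<pi>\<close> on
    \<open>X\<close>, so rigidity identifies it with \<open>\<pi>\<close> on \<open>T\<close>. The
    factor \<open>s\<close> then passes into the norm of \<open>\<pi>\<close>.\<close>
  have "complex_of_real s \<odot>\<^bsub>bop H K\<^esub> F t = \<pi> t" if t: "t \<in> T" for t
  proof (rule rigidity[OF hyp sep _ _ _ t])
    show "clinear_on (carrier (bop H0 K0)) (bop H0 K0) (bop H K) (\<lambda>a. complex_of_real s \<odot>\<^bsub>bop H K\<^esub> F a)"
      unfolding clinear_on_def
    proof (intro conjI ballI allI)
      show "(\<lambda>a. complex_of_real s \<odot>\<^bsub>bop H K\<^esub> F a) \<in> carrier (bop H0 K0) \<rightarrow> carrier (bop H K)" by simp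
      fix x assume x: "x \<in> carrier (bop H0 K0)"
      have "F (c \<odot>\<^bsub>bop H0 K0\<^esub> x) = c \<odot>\<^bsub>bop H K\<^esub> F x" for c
        using F(1) x unfolding clinear_on_def by blast
      then show "complex_of_real s \<odot>\<^bsub>bop H K\<^esub> F (c \<odot>\<^bsub>bop H0 K0\<^esub> x) = c \<odot>\<^bsub>bop H K\<^esub> (complex_of_real s \<odot>\<^bsub>bop H K\<^esub> F x)" for c
        using x by (simp add: C.B.csmult_assoc[symmetric] mult.commute)
      fix y assume y: "y \<in> carrier (bop H0 K0)"
      have "F (x \<oplus>\<^bsub>bop H0 K0\<^esub> y) = F x \<oplus>\<^bsub>bop H K\<^esub> F y"
        using F(1) x y unfolding clinear_on_def by blast
      then show "complex_of_real s \<odot>\<^bsub>bop H K\<^esub> F (x \<oplus>\<^bsub>bop H0 K0\<^esub> y) =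
          complex_of_real s \<odot>\<^bsub>bop H K\<^esub> F x \<oplus>\<^bsub>bop H K\<^esub> complex_of_real s \<odot>\<^bsub>bop H K\<^esub> F y"
        using x y by (simp add: C.B.smult_r_distr)
    qed
    show "mbound H K 1 n (\<lambda>i j. complex_of_real s \<odot>\<^bsub>bop H K\<^esub> F (A i j))"
      if A: "\<forall>i<n. \<forall>j<n. A i j \<in> carrier (bop H0 K0)" "mbound H0 K0 1 n A" for n A
    proof (rule mbound_mono)
      show "mbound H K (s * 1) n (\<lambda>i j. complex_of_real s \<odot>\<^bsub>bop H K\<^esub> F (A i j))"
        using A(1) s(1) by (intro C.mbound_scale F(3)[OF A]) simp_all
    qed (use s in simp)
    show "complex_of_real s \<odot>\<^bsub>bop H K\<^esub> F x = \<pi> x" if x: "x \<in> X" for x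
      using s(1) X_sub_T[OF x] by (simp add: F(2)[OF x] f_def C.B.csmult_assoc[symmetric] flip: of_real_mult)
  qed
  note F_\<pi> = this
  have "opnorm H K (\<pi> t) \<le> s * opnorm H0 K0 t" if t: "t \<in> T" for t
  proof -
    have tc: "t \<in> carrier (bop H0 K0)" using t by simp
    have sp: "operator_space H0 K0 (carrier (bop H0 K0))"
      by (simp add: operator_space_def D.B.carrier_is_submodule)
    have "F \<in> carrier (bop H0 K0) \<rightarrow> carrier (bop H K)" by simp
    then have "cb_norm H0 K0 (carrier (bop H0 K0)) H K F \<le> ereal 1"
      using cb_norm_le_iff[OF D.hilbert_pair_axioms C.hilbert_pair_axioms order_refl, of F 1] F(3) by simp
    from cb_norm_opnorm[OF D.hilbert_pair_axioms C.hilbert_pair_axioms sp F(1) _ this tc]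
    have "opnorm H K (F t) \<le> opnorm H0 K0 t" by simp
    then have "s * opnorm H K (F t) \<le> s * opnorm H0 K0 t" using s(1) by simp
    moreover have "opnorm H K (complex_of_real s \<odot>\<^bsub>bop H K\<^esub> F t) = s * opnorm H K (F t)"
      using s(1) tc by (simp add: C.opnorm_smult)
    ultimately show ?thesis unfolding F_\<pi>[OF t] by simp
  qed
  moreover obtain x v where x: "x \<in> X" and v: "v \<in> carrier H" "\<pi> x v \<noteq> \<zero>\<^bsub>K\<^esub>" using nonzero_on_X by blast
  moreover have "\<pi> x \<noteq> \<zero>\<^bsub>bop H K\<^esub>" using v by auto
  ultimately have "1 \<le> s" using norm_ge_1[OF X_sub_T[OF x]] by blast
  then show False using s(3) by simp
qed

text \<open>Stated for every \<open>Y\<close> between \<open>X\<close> and \<open>T\<close> in order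
  to cover both the restriction of \<open>\<pi>\<close> to \<open>X\<close> and \<open>\<pi>\<close>
  itself. Nondegeneracy and the lower bound of the norm are already forced by the behaviour on
  \<open>X\<close>.\<close>

lemma rect_operator_state:
  assumes hyp: "rect_hyperrigid H0 K0 T X" and sep: "norm_separable H0 K0 X"
    and Y: "X \<subseteq> Y" "Y \<subseteq> T" "operator_space H0 K0 Y" and f: "\<And>y. y \<in> Y \<Longrightarrow> f y = \<pi> y"
  shows "rect_operator_state H0 K0 Y H K f"
proof -
  note YT = subsetD[OF Y(2)] and XY = subsetD[OF Y(1)] and Ysp = D.operator_spaceD[OF Y(3)]
  have nd: "nondegenerate Y H K f"
  proof (rule nondegenerateI[OF C.H.complex_hilbert_space_axioms C.K.complex_hilbert_space_axioms])
    show "f y \<in> carrier (bop H K)" if "y \<in> Y" for y using that YT by (simp add: f)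
    fix p assume p: "p \<in> projections H" and 0: "\<And>y v. y \<in> Y \<Longrightarrow> v \<in> carrier H \<Longrightarrow> f y (p v) = \<zero>\<^bsub>K\<^esub>"
    show "p = \<zero>\<^bsub>bop H H\<^esub>"
      by (rule nondegenerate_right[OF p]) (use 0 f XY in force)
  next
    fix q assume q: "q \<in> projections K" and 0: "\<And>y v. y \<in> Y \<Longrightarrow> v \<in> carrier H \<Longrightarrow> q (f y v) = \<zero>\<^bsub>K\<^esub>"
    show "q = \<zero>\<^bsub>bop K K\<^esub>"
      by (rule nondegenerate_left[OF q]) (use 0 f XY in force)
  qed
  have "Y \<subseteq> carrier (bop H0 K0)" "f \<in> Y \<rightarrow> carrier (bop H K)" using Ysp(1) YT f by auto
  note cb = cb_norm_le_iff[OF D.hilbert_pair_axioms C.hilbert_pair_axioms this]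
  have eq: "mbound H K r n (\<lambda>i j. f (A i j)) \<longleftrightarrow> mbound H K r n (\<lambda>i j. \<pi> (A i j))"
    if "\<forall>i<n. \<forall>j<n. A i j \<in> Y" for r n A
    using that f by (simp add: mbound_def)
  have "cb_norm H0 K0 Y H K f \<le> ereal 1"
    unfolding cb[OF zero_le_one]
  proof (intro allI impI)
    fix n A assume A: "\<forall>i<n. \<forall>j<n. A i j \<in> Y" "mbound H0 K0 1 n A"
    show "mbound H K 1 n (\<lambda>i j. f (A i j))"
      unfolding eq[OF A(1)] by (rule mbound_\<pi>) (use A YT in auto)
  qed
  then have le: "cb_norm H0 K0 Y H K f \<le> 1" by (simp add: one_ereal_def)
  have "cb_norm H0 K0 Y H K f = 1"
  proof (rule cb_norm_eq_1[OF le])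
    fix r assume r: "0 \<le> r" "cb_norm H0 K0 Y H K f \<le> ereal r"
    show "1 \<le> r"
    proof (rule bound_ge_1[OF hyp sep])
      fix n A assume A: "\<forall>i<n. \<forall>j<n. A i j \<in> X" "mbound H0 K0 1 n A"
      then have AY: "\<forall>i<n. \<forall>j<n. A i j \<in> Y" using XY by blast
      show "mbound H K r n (\<lambda>i j. \<pi> (A i j))"
        using r(2)[unfolded cb[OF r(1)]] AY A(2) eq[OF AY] by blast
    qed
  qed
  moreover have "clinear_on Y (bop H0 K0) (bop H K) f"
    unfolding clinear_on_def using Ysp YT by (auto simp: f)
  ultimately show ?thesis
    using nd le C.H.complex_hilbert_space_axioms C.K.complex_hilbert_space_axioms
    by (simp add: rect_operator_state_def completely_contractive_def)
qed

lemma extension_unique: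
  assumes hyp: "rect_hyperrigid H0 K0 T X" and sep: "norm_separable H0 K0 X"
    and g: "rect_operator_state H0 K0 T H K g" "\<And>x. x \<in> X \<Longrightarrow> g x = \<pi> x" and t: "t \<in> T"
  shows "g t = \<pi> t"
proof -
  have lin: "clinear_on T (bop H0 K0) (bop H K) g" and cb: "cb_norm H0 K0 T H K g \<le> 1"
    using g(1) by (simp_all add: rect_operator_state_def completely_contractive_def)
  have cl: "T \<subseteq> carrier (bop H0 K0)" "g \<in> T \<rightarrow> carrier (bop H K)" using lin by (auto simp: clinear_on_def)
  have "contractive_map H0 K0 H K T g"
  proof (unfold_locales)
    show "mbound H K 1 n (\<lambda>i j. g (A i j))" if "\<forall>i<n. \<forall>j<n. A i j \<in> T" "mbound H0 K0 1 n A" for n A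
      using cb_norm_le_iff[OF D.hilbert_pair_axioms C.hilbert_pair_axioms cl, of 1] cb that by (simp add: one_ereal_def)
  qed (fact operator_space_T lin)+
  then obtain F where F: "clinear_on (carrier (bop H0 K0)) (bop H0 K0) (bop H K) F" "\<And>x. x \<in> T \<Longrightarrow> F x = g x"
    "\<And>n A. \<forall>i<n. \<forall>j<n. A i j \<in> carrier (bop H0 K0) \<Longrightarrow> mbound H0 K0 1 n A \<Longrightarrow> mbound H K 1 n (\<lambda>i j. F (A i j))"
    by (rule contractive_map.extensionE) blast
  have "F t = \<pi> t"
    by (rule rigidity[OF hyp sep F(1,3) _ t]) (simp_all add: F(2) g(2) X_sub_T)
  then show ?thesis using F(2)[OF t] by simp
qed

lemma boundary_representation:
  assumes hyp: "rect_hyperrigid H0 K0 T X" and sep: "norm_separable H0 K0 X"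
  shows "boundary_representation H0 K0 T X H K \<pi>"
proof -
  have ext: "g t = \<pi> t" if "state_extension H0 K0 T X H K (restrict \<pi> X) g" "t \<in> T" for g t
    by (rule extension_unique[OF hyp sep _ _ that(2)]) (use that(1) in \<open>auto simp: state_extension_def\<close>)
  have "rect_operator_state H0 K0 X H K (restrict \<pi> X)"
    by (rule rect_operator_state[OF hyp sep _ _ X]) (use X_sub_T in auto)
  moreover have "triple_morphism H0 K0 T H K g" if "state_extension H0 K0 T X H K (restrict \<pi> X) g" for g
  proof -
    have tp: "tprod H0 K0 x y z \<in> T" if "x \<in> T" "y \<in> T" "z \<in> T" for x y z
      using tro that by (simp add: tro_def)
    show ?thesis
      using triple tp D.operator_spaceD(3,4)[OF operator_space_T] ext[OF that]
      by (auto simp: triple_morphism_def clinear_on_def)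
  qed
  \<comment> \<open>The extension asked for is \<open>\<pi>\<close> itself; its uniqueness is
    \<open>ext\<close>, and its irreducibility is the hypothesis.\<close>
  moreover have "state_extension H0 K0 T X H K (restrict \<pi> X) \<pi>"
    unfolding state_extension_def using X_sub_T
    by (auto intro!: rect_operator_state[OF hyp sep _ _ operator_space_T])
  ultimately show ?thesis
    using irreducible ext
    unfolding boundary_representation_def boundary_map_def unique_extension_property_def irreducible_representation_def
    by blast
qed

end

theorem corollary6p5:
  fixes H0 :: "'a inner_space" and K0 :: "'b inner_space"
    and X T :: "('a \<Rightarrow> 'b) set"
    and H :: "'c inner_space" and K :: "'d inner_space"
    and \<pi> :: "('a \<Rightarrow> 'b) \<Rightarrow> ('c \<Rightarrow> 'd)"
  assumes "complex_hilbert_space H0" and "complex_hilbert_space K0"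
    and "tro H0 K0 T"
    and "operator_space H0 K0 X" and "norm_separable H0 K0 X"
    and "generates H0 K0 X T"
    and "rect_hyperrigid H0 K0 T X"
    and "irreducible_representation H0 K0 T H K \<pi>"
  shows "boundary_representation H0 K0 T X H K \<pi>"
proof -
  have "representation H0 K0 T H K \<pi>" using assms(8) by (simp add: irreducible_representation_def)
  then have rep: "complex_hilbert_space H" "complex_hilbert_space K" "triple_morphism H0 K0 T H K \<pi>"
    by (simp_all add: representation_def)
  have "irreducible_tro_morphism H0 K0 H K T \<pi> X"
    by (intro irreducible_tro_morphism.intro tro_morphism.intro tro_morphism_axioms.intro
        irreducible_tro_morphism_axioms.intro hilbert_pairI assms rep)
  then show ?thesis by (rule irreducible_tro_morphism.boundary_representation[OF _ assms(7,5)])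
qed

end
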